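(* Suppose that: (1) $\{\eta_t\}$ are i.i.d. with $E|\eta_1|=1$ and $\kappa_\eta=E\eta_1^2<\infty$; (2) the density $f(x)$ of $\eta_1$ is symmetric and bounded continuous on $\mathbb{R}$ with $f(0)>0$; (3) $\Theta$ is compact and $\theta_0$ is an interior point of $\Theta$; (4) $f$ is positive and differentiable a.s. on $\mathbb{R}$ with $\sup_{x\in\mathbb{R}}f(x)<\infty$, and $\int(\log|\phi_0+x\sqrt{\alpha_0}|)\{f(x)+|xf'(x)|\}dx$ exists and is finite. Let $T_n=\sqrt n\,\hat\gamma_n/\hat\sigma_\gamma$, where $\hat\sigma_\gamma$ is computed with resampling size $B=B_n\to\infty$, $B=O(n)$, let $\Phi$ be the standard normal distribution function, and let $\underline{\alpha}\in(0,1)$. (i) For testing $H_0:\gamma_0<0$ versus $H_1:\gamma_0\ge0$, the test with critical region $\mathrm{C}^{\mathrm{ST}}=\{T_n>\Phi^{-1}(1-\underline{\alpha})\}$ has asymptotic significance level $\underline{\alpha}$ (i.e. $\limsup_{n\to\infty}P(\mathrm{C}^{\mathrm{ST}})\le\underline{\alpha}$ whenever $\gamma_0<0$) and is consistent for all $\gamma_0>0$ (i.e. $P(\mathrm{C}^{\mathrm{ST}})\to1$ whenever $\gamma_0>0$). (ii) For testing $H_0:\gamma_0>0$ versus $H_1:\gamma_0\le0$, the test with critical region $\mathrm{C}^{\mathrm{NS}}=\{T_n<\Phi^{-1}(\underline{\alpha})\}$ has asymptotic significance level $\underline{\alpha}$ (i.e. $\limsup_{n\to\infty}P(\mathrm{C}^{\mathrm{NS}})\le\underline{\alpha}$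 whenever $\gamma_0>0$) and is consistent for all $\gamma_0<0$ (i.e. $P(\mathrm{C}^{\mathrm{NS}})\to1$ whenever $\gamma_0<0$).
   Context: The DAR(1) model is $y_t=\phi_0y_{t-1}+\eta_t\sqrt{\omega_0+\alpha_0y_{t-1}^2}$, with $\phi_0\in\mathbb{R}$, $\omega_0>0$, $\alpha_0>0$, where $\{\eta_t\}$ is a sequence of i.i.d. random variables and $\eta_t$ is independent of $\{y_j,\,j<t\}$. The top Lyapunov exponent is $\gamma_0=E\log|\phi_0+\eta\sqrt{\alpha_0}|$, where $\eta$ has the same distribution as $\eta_t$. When $\gamma_0<0$, $\{y_t\}$ is the strictly stationary and ergodic solution; when $\gamma_0>0$ (explosive case) the process is generated by the recursion for $t\ge 1$ from the initial value $y_0$. One observes $y_0,y_1,\dots,y_n$. For $\theta=(\phi,\alpha,\omega)^T$ let $$L_n(\theta)=\sum_{t=1}^n\Big\{\tfrac12\log(\omega+\alpha y_{t-1}^2)+\frac{|y_t-\phi y_{t-1}|}{\sqrt{\omega+\alpha y_{t-1}^2}}\Big\},\qquad L_n^*(\theta)=\sum_{t=1}^n\varpi_t\Big\{\tfrac12\log(\omega+\alpha y_{t-1}^2)+\frac{|y_t-\phi y_{t-1}|}{\sqrt{\omega+\alpha y_{t-1}^2}}\Big\},$$ where $\varpi_1,\dots,\varpi_n$ are i.i.d. standard exponential random variables, independent of the data. Put $\hat\theta_n=(\hat\phi_n,\hat\alpha_n,\hat\omega_n)^T=\arg\min_{\theta\in\Theta}L_n(\theta)$ and $\hat\theta_n^*=(\hat\phi_n^*,\hat\alpha_n^*,\hat\omega_n^*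 )^T=\arg\min_{\theta\in\Theta}L_n^*(\theta)$, where $\Theta$ is a compact subset of $\mathbb{R}\times(0,\infty)^2$ containing the true value $\theta_0=(\phi_0,\alpha_0,\omega_0)^T$. Let $\eta_t(\theta)=(y_t-\phi y_{t-1})/\sqrt{\omega+\alpha y_{t-1}^2}$, $\hat\eta_t=\eta_t(\hat\theta_n)$, $\hat\eta_t^*=\eta_t(\hat\theta_n^* )$, $\mathcal{I}_n=[-n^2,-n^{-2}]\cup[n^{-2},n^2]$. Define $\mathcal{A}_1=\{1\le t\le n:\hat\phi_n+\hat\eta_t\sqrt{\hat\alpha_n}\in\mathcal{I}_n\}$, $\mathcal{A}_2=\{1\le t\le n:\hat\phi_n-\hat\eta_t\sqrt{\hat\alpha_n}\in\mathcal{I}_n\}$, $$\hat\gamma_n=\frac1{2n}\Big(\sum_{t\in\mathcal{A}_1}\log|\hat\phi_n+\hat\eta_t\sqrt{\hat\alpha_n}|+\sum_{t\in\mathcal{A}_2}\log|\hat\phi_n-\hat\eta_t\sqrt{\hat\alpha_n}|\Big),$$ and for $k=1,2$, $\mathcal{A}_k^*=\{1\le t\le n:\hat\eta_t^*\sqrt{\hat\alpha_n^*}-(-1)^k\hat\phi_n^*\in\mathcal{I}_n\}$, $$\hat\gamma_{nk}^*=\frac{1}{\sum_{t\in\mathcal{A}_k^*}\varpi_t}\sum_{t\in\mathcal{A}_k^*}\varpi_t\log|\hat\eta_t^*\sqrt{\hat\alpha_n^*}-(-1)^k\hat\phi_n^*|,\qquad \hat\gamma_n^*=(\hat\gamma_{n1}^*+\hat\gamma_{n2}^*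 )/2 .$$ Variance estimator: generate the weight vector $(\varpi_1,\dots,\varpi_n)$ independently $B$ times, giving $\hat\gamma_n^{*1},\dots,\hat\gamma_n^{*B}$, and set $$\hat\sigma_\gamma^2=\frac{n}{B-1}\sum_{b=1}^B\big(\hat\gamma_n^{*b}-\bar\gamma_n^*\big)^2,\qquad \bar\gamma_n^*=\frac1B\sum_{b=1}^B\hat\gamma_n^{*b}.$$ *)

theory Defs
  imports "HOL-Probability.Probability" "HOL-Library.Landau_Symbols"
begin

definition path_law :: "'a measure \<Rightarrow> (nat \<Rightarrow> 'a \<Rightarrow> real) \<Rightarrow> (nat \<Rightarrow> real) measure" where
  "path_law M y = distr M (Pi\<^sub>M UNIV (\<lambda>_. borel)) (\<lambda>x t. y t x)"

definition strictly_stationary :: "'a measure \<Rightarrow> (nat \<Rightarrow> 'a \<Rightarrow> real) \<Rightarrow> bool" where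
  "strictly_stationary M y \<longleftrightarrow> (\<forall>k. path_law M (\<lambda>t. y (t + k)) = path_law M y)"

definition ergodic :: "'a measure \<Rightarrow> (nat \<Rightarrow> 'a \<Rightarrow> real) \<Rightarrow> bool" where
  "ergodic M y \<longleftrightarrow>
     (\<forall>A \<in> sets (Pi\<^sub>M UNIV (\<lambda>_. borel)).
        (\<lambda>z t. z (Suc t)) -` A = A \<longrightarrow> measure (path_law M y) A \<in> {0, 1})"

text \<open>The library's \<open>indep_var\<close> requires both variables to take values in the same type;
  the following is what it amounts to, without that restriction (cf. \<open>indep_var_eq\<close>).\<close>

definition indep_rv ::
  "'a measure \<Rightarrow> 'b measure \<Rightarrow> ('a \<Rightarrow> 'b) \<Rightarrow> 'c measure \<Rightarrow> ('a \<Rightarrow> 'c) \<Rightarrow> bool" where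
  "indep_rv M N X N' X' \<longleftrightarrow>
     X \<in> measurable M N \<and> X' \<in> measurable M N' \<and>
     prob_space.indep_set M
       {X -` A \<inter> space M |A. A \<in> sets N} {X' -` A \<inter> space M |A. A \<in> sets N'}"

text \<open>Parameters are ordered as \<open>(\<phi>, \<alpha>, \<omega>)\<close>. \<open>E\<close> below is the innovation sequence.
  The recursion is only imposed for \<open>t \<ge> 1\<close>; the initial value \<open>y 0\<close> is random.
  That the innovations are i.i.d. is not part of this predicate.\<close>

fun dar1_process ::
  "'a measure \<Rightarrow> real \<times> real \<times> real \<Rightarrow> (nat \<Rightarrow> 'a \<Rightarrow> real) \<Rightarrow> (nat \<Rightarrow> 'a \<Rightarrow> real) \<Rightarrow> bool" where
  "dar1_process M (\<phi>, \<alpha>, \<omega>) E y \<longleftrightarrow>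
     (\<forall>t. y t \<in> borel_measurable M) \<and>
     (\<forall>t\<ge>1. AE x in M. y t x = \<phi> * y (t - 1) x + E t x * sqrt (\<omega> + \<alpha> * (y (t - 1) x)\<^sup>2)) \<and>
     (\<forall>t\<ge>1. indep_rv M borel (E t)
               (Pi\<^sub>M {..<t} (\<lambda>_. borel)) (\<lambda>x. \<lambda>j\<in>{..<t}. y j x))"

text \<open>Top Lyapunov exponent, for an innovation variable \<open>e\<close>.\<close>

definition lyapunov :: "'a measure \<Rightarrow> real \<Rightarrow> real \<Rightarrow> ('a \<Rightarrow> real) \<Rightarrow> real" where
  "lyapunov M \<phi> \<alpha> e = (LINT x|M. ln \<bar>\<phi> + e x * sqrt \<alpha>\<bar>)"

text \<open>In the remaining definitions \<open>Y\<close> is an observed path, of which only \<open>Y 0, \<dots>, Y n\<close> are used,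
  and \<open>w\<close> is a weight vector, of which only \<open>w 1, \<dots>, w n\<close> are used.\<close>

fun resid :: "real \<times> real \<times> real \<Rightarrow> (nat \<Rightarrow> real) \<Rightarrow> nat \<Rightarrow> real" where
  "resid (\<phi>, \<alpha>, \<omega>) Y t = (Y t - \<phi> * Y (t - 1)) / sqrt (\<omega> + \<alpha> * (Y (t - 1))\<^sup>2)"

fun qml_loss :: "(nat \<Rightarrow> real) \<Rightarrow> nat \<Rightarrow> real \<times> real \<times> real \<Rightarrow> real" where
  "qml_loss Y t (\<phi>, \<alpha>, \<omega>) =
     ln (\<omega> + \<alpha> * (Y (t - 1))\<^sup>2) / 2 + \<bar>Y t - \<phi> * Y (t - 1)\<bar> / sqrt (\<omega> + \<alpha> * (Y (t - 1))\<^sup>2)"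

definition L :: "nat \<Rightarrow> (nat \<Rightarrow> real) \<Rightarrow> real \<times> real \<times> real \<Rightarrow> real" where
  "L n Y \<theta> = (\<Sum>t=1..n. qml_loss Y t \<theta>)"

definition L_star :: "nat \<Rightarrow> (nat \<Rightarrow> real) \<Rightarrow> (nat \<Rightarrow> real) \<Rightarrow> real \<times> real \<times> real \<Rightarrow> real" where
  "L_star n w Y \<theta> = (\<Sum>t=1..n. w t * qml_loss Y t \<theta>)"

text \<open>The minimizers need not be unique. An estimator is any measurable function of the sample
  (and, for the bootstrap version, of the weights) that selects a minimizer.\<close>

definition qml_estimator ::
  "(real \<times> real \<times> real) set \<Rightarrow> nat \<Rightarrow> ((nat \<Rightarrow> real) \<Rightarrow> real \<times> real \<times> real) \<Rightarrow> bool" where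
  "qml_estimator \<Theta> n est \<longleftrightarrow>
     est \<in> borel_measurable (Pi\<^sub>M {0..n} (\<lambda>_. borel)) \<and>
     (\<forall>Y \<in> space (Pi\<^sub>M {0..n} (\<lambda>_. borel)). is_arg_min (L n Y) (\<lambda>\<theta>. \<theta> \<in> \<Theta>) (est Y))"

definition bootstrap_estimator ::
  "(real \<times> real \<times> real) set \<Rightarrow> nat \<Rightarrow> ((nat \<Rightarrow> real) \<Rightarrow> (nat \<Rightarrow> real) \<Rightarrow> real \<times> real \<times> real) \<Rightarrow> bool" where
  "bootstrap_estimator \<Theta> n est \<longleftrightarrow>
     case_prod est \<in> borel_measurable (Pi\<^sub>M {1..n} (\<lambda>_. borel) \<Otimes>\<^sub>M Pi\<^sub>M {0..n} (\<lambda>_. borel)) \<and>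
     (\<forall>w \<in> space (Pi\<^sub>M {1..n} (\<lambda>_. borel)). \<forall>Y \<in> space (Pi\<^sub>M {0..n} (\<lambda>_. borel)).
        is_arg_min (L_star n w Y) (\<lambda>\<theta>. \<theta> \<in> \<Theta>) (est w Y))"

definition sample :: "(nat \<Rightarrow> 'a \<Rightarrow> real) \<Rightarrow> nat \<Rightarrow> 'a \<Rightarrow> nat \<Rightarrow> real" where
  "sample y n x = (\<lambda>t\<in>{0..n}. y t x)"

definition trunc :: "nat \<Rightarrow> real set" where
  "trunc n = {- (real n)\<^sup>2 .. - (1 / (real n)\<^sup>2)} \<union> {1 / (real n)\<^sup>2 .. (real n)\<^sup>2}"

fun gamma_hat :: "nat \<Rightarrow> (nat \<Rightarrow> real) \<Rightarrow> real \<times> real \<times> real \<Rightarrow> real" where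
  "gamma_hat n Y (\<phi>, \<alpha>, \<omega>) =
     (let \<eta> = resid (\<phi>, \<alpha>, \<omega>) Y;
          A1 = {t \<in> {1..n}. \<phi> + \<eta> t * sqrt \<alpha> \<in> trunc n};
          A2 = {t \<in> {1..n}. \<phi> - \<eta> t * sqrt \<alpha> \<in> trunc n}
      in ((\<Sum>t\<in>A1. ln \<bar>\<phi> + \<eta> t * sqrt \<alpha>\<bar>) + (\<Sum>t\<in>A2. ln \<bar>\<phi> - \<eta> t * sqrt \<alpha>\<bar>)) / (2 * real n))"

fun gamma_star_part ::
  "nat \<Rightarrow> nat \<Rightarrow> (nat \<Rightarrow> real) \<Rightarrow> (nat \<Rightarrow> real) \<Rightarrow> real \<times> real \<times> real \<Rightarrow> real" where
  "gamma_star_part k n w Y (\<phi>, \<alpha>, \<omega>) =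
     (let \<eta> = resid (\<phi>, \<alpha>, \<omega>) Y;
          A = {t \<in> {1..n}. \<eta> t * sqrt \<alpha> - (- 1) ^ k * \<phi> \<in> trunc n}
      in (\<Sum>t\<in>A. w t * ln \<bar>\<eta> t * sqrt \<alpha> - (- 1) ^ k * \<phi>\<bar>) / (\<Sum>t\<in>A. w t))"

definition gamma_star ::
  "nat \<Rightarrow> (nat \<Rightarrow> real) \<Rightarrow> (nat \<Rightarrow> real) \<Rightarrow> real \<times> real \<times> real \<Rightarrow> real" where
  "gamma_star n w Y \<theta> = (gamma_star_part 1 n w Y \<theta> + gamma_star_part 2 n w Y \<theta>) / 2"

text \<open>\<open>g b\<close> is the value of the estimate in replicate \<open>b\<close>.\<close>

definition sigma2_hat :: "nat \<Rightarrow> nat \<Rightarrow> (nat \<Rightarrow> real) \<Rightarrow> real" where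
  "sigma2_hat n B g =
     (let m = (\<Sum>b=1..B. g b) / real B
      in real n / (real B - 1) * (\<Sum>b=1..B. (g b - m)\<^sup>2))"

text \<open>\<open>W b\<close> is the weight vector of replicate \<open>b\<close>.\<close>

definition T_stat ::
  "((nat \<Rightarrow> real) \<Rightarrow> real \<times> real \<times> real) \<Rightarrow> ((nat \<Rightarrow> real) \<Rightarrow> (nat \<Rightarrow> real) \<Rightarrow> real \<times> real \<times> real) \<Rightarrow>
   nat \<Rightarrow> nat \<Rightarrow> (nat \<Rightarrow> real) \<Rightarrow> (nat \<Rightarrow> nat \<Rightarrow> real) \<Rightarrow> real" where
  "T_stat est est_star n B Y W =
     sqrt (real n) * gamma_hat n Y (est Y) /
     sqrt (sigma2_hat n B (\<lambda>b. gamma_star n (W b) Y (est_star (W b) Y)))"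

definition std_normal_quantile :: "real \<Rightarrow> real" where
  "std_normal_quantile = inv (cdf std_normal_distribution)"

text \<open>For fixed \<open>n\<close>: \<open>W b t\<close> is the weight of observation \<open>t \<in> {1..n}\<close> in replicate \<open>b \<in> {1..B}\<close>.\<close>

definition weight_vec :: "(nat \<Rightarrow> nat \<Rightarrow> 'a \<Rightarrow> real) \<Rightarrow> nat \<Rightarrow> 'a \<Rightarrow> nat \<Rightarrow> nat \<Rightarrow> real" where
  "weight_vec W n x b = (\<lambda>t\<in>{1..n}. W b t x)"

definition bootstrap_weights ::
  "'a measure \<Rightarrow> nat \<Rightarrow> nat \<Rightarrow> (nat \<Rightarrow> 'a \<Rightarrow> real) \<Rightarrow> (nat \<Rightarrow> nat \<Rightarrow> 'a \<Rightarrow> real) \<Rightarrow> bool" where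
  "bootstrap_weights M n B y W \<longleftrightarrow>
     (\<forall>b\<in>{1..B}. \<forall>t\<in>{1..n}. distributed M lborel (W b t) (exponential_density 1)) \<and>
     prob_space.indep_vars M (\<lambda>_. borel) (\<lambda>(b, t). W b t) ({1..B} \<times> {1..n}) \<and>
     indep_rv M
       (Pi\<^sub>M {0..n} (\<lambda>_. borel)) (sample y n)
       (Pi\<^sub>M ({1..B} \<times> {1..n}) (\<lambda>_. borel)) (\<lambda>x. \<lambda>(b, t)\<in>{1..B} \<times> {1..n}. W b t x)"

end

theory Submission
  imports Defs "HOL-Real_Asymp.Real_Asymp"
begin

text \<open>The factor \<open>\<surd>n\<close> cancels in the test statistic, which is \<open>\<gamma>\<close>-hat divided by the empirical standard deviation
  \<open>s\<close> of the bootstrap replicates. It suffices that \<open>\<gamma>\<close>-hat tends to \<open>\<gamma>\<^sub>0\<close>, that \<open>s\<close> tends to \<open>0\<close>, and that the probability of \<open>s = 0\<close> (where the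
  statistic takes the junk value \<open>0\<close>) tends to \<open>0\<close>; then the statistic tends to \<open>-\<infinity>\<close> or to \<open>\<infinity>\<close> in probability, according to
  the sign of \<open>\<gamma>\<^sub>0\<close>, and every quantile is eventually exceeded on the correct side.

  The first two facts are uniform weak laws of large numbers. With weights of mean one that are independent of the data, the
  residual at \<open>\<theta>\<close> is an affine function of the innovation whose coefficients depend on the previous observation only,
  so the centred terms are orthogonal whatever the behaviour of the path, and Chebyshev's inequality on a finite grid
  suffices. Identification of \<open>\<phi>\<close> and \<open>\<alpha>\<close> comes from the large observations, of which there is always a positive
  fraction. The replicates are at most \<open>2 ln n\<close> in modulus, and each is close to \<open>\<gamma>\<^sub>0\<close> outside an event of probability
  \<open>n powr (-1/2)\<close>, which bounds the second moment of \<open>s\<close>.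

  For the third fact, condition on the data and on one of two replicates. The minimal weighted loss is a concave function
  of the weights, whose supergradients are the losses at the minimizers. At almost every weight vector this supergradient
  is pointwise Lipschitz, which turns a level set of positive measure into a linear dependence between the derivatives of
  loss and logarithm in six observations; for suitable observations, present with probability close to one, they
  are independent.\<close>

section \<open>Null level sets of the bootstrap estimate\<close>

text \<open>The minimizer need be neither unique nor continuous in the weights, so no implicit
  function theorem applies to it. What survives is convex analysis: the loss of each observation at
  the minimizer is monotone in its own weight, hence pointwise Lipschitz almost everywhere, and this
  is strong enough to carry first-order expansions. The truncation sets vary with the parameter as
  well; this is met by cutting the weight space into finitely many pieces.

  Explosive paths shape the choice of the six observations. Five of them follow large values, which
  recur in every regime. The sixth must follow a bounded value, which an explosive path may have
  only near its start. It is therefore taken from a fixed initial stretch, and its bound is fixed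
  before the threshold for the large values.

  The residual conditions on these observations are imposed for the whole parameter box, because the
  minimizer moves with the weights.\<close>

definition pointwise_lipschitz :: "(real => real) => real => bool" where
 "pointwise_lipschitz d x \<longleftrightarrow>
   (\<exists>m>0. \<exists>h>0. \<forall>s. \<bar>s\<bar> < h --> \<bar>d (x + s) - d x\<bar> <= m * \<bar>s\<bar>)"

lemma not_pointwise_lipschitzD:
 assumes "\<not> pointwise_lipschitz d x" "m > 0" "h > 0"
 obtains s where "\<bar>s\<bar> < h" "\<bar>d (x + s) - d x\<bar> > m * \<bar>s\<bar>"
 using assms unfolding pointwise_lipschitz_def by (meson not_le)

text \<open>A weak form of Lebesgue's theorem on the differentiability of monotone functions. Adding
  the identity gives a strictly increasing \<open>h\<close> whose inverse is 1-Lipschitz. The Vitali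
  covering is made on the image side, where disjoint intervals have bounded total length; on the
  side of \<open>x\<close> the corresponding intervals are shorter by the factor \<open>m\<close>,
  which may be as large as desired.\<close>

lemma mono_negligible_not_pointwise_lipschitz:
 fixes d :: "real => real"
 assumes "mono d"
 shows "negligible {x. \<not> pointwise_lipschitz d x}"
proof -
 define h where "h x = x + d x" for x
 have h_mono: "h x < h y" if "x < y" for x y
  using monoD[OF assms, of x y] that by (auto simp: h_def)
 have h_le: "h x <= h y \<longleftrightarrow> x <= y" for x y
  using h_mono[of x y] h_mono[of y x] by (cases x y rule: linorder_cases) auto
 have expand: "\<bar>h x - h y\<bar> = \<bar>x - y\<bar> + \<bar>d x - d y\<bar>" for x y
 proof (cases "x <= y")
  case True then show ?thesis using monoD[OF assms, of x y] by (auto simp: h_def)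
 next
  case False then show ?thesis using monoD[OF assms, of y x] by (auto simp: h_def)
 qed
 have inj: "inj h" by (metis h_mono injI less_irrefl linorder_neqE)
 define j where "j = inv h"
 have jh: "j (h x) = x" for x by (simp add: j_def inj)
 \<comment> \<open>Continuity points only, so that the covering intervals below can be taken
   arbitrarily short; the discontinuities are countable. The bound \<open>k\<close> keeps the images
   in a bounded interval.\<close>
 define N where "N k = {x. isCont d x \<and> \<not> pointwise_lipschitz d x \<and> \<bar>x\<bar> < k}" for k :: real
 have negl: "negligible (N k)" if "k > 0" for k
  unfolding negligible_outer
 proof (intro allI impI)
  fix e :: real assume "e > 0"
  define c where "c = h k - h (- k) + 1"
  have "c > 0" using h_mono[of "-k" k] that by (auto simp: c_def)
  \<comment> \<open>With this slope the preimages have total length at most \<open>c / m\<close>,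
    which is \<open>e / 2\<close>.\<close>
  define m where "m = 2 * c / e"
  have "m > 0" using \<open>c > 0\<close> \<open>e > 0\<close> by (simp add: m_def)
  define K where "K = {(x, x'). x \<noteq> x' \<and> \<bar>x\<bar> < k \<and> \<bar>x'\<bar> < k \<and> \<bar>h x' - h x\<bar> >= m * \<bar>x' - x\<bar>}"
  define a where "a = (\<lambda>(x, x'). (h x + h x') / 2)"
  define r where "r = (\<lambda>(x, x'). \<bar>h x' - h x\<bar> / 2)"
  have cb: "cball (a (x, x')) (r (x, x')) = {h (min x x')..h (max x x')}" for x x'
   using h_le[of x x'] h_le[of x' x]
   by (auto simp: a_def r_def cball_eq_atLeastAtMost min_def max_def field_simps abs_if)
  have rpos: "0 < r i" if "i \<in> K" for i
   using that inj by (auto simp: K_def r_def inj_eq)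
  have fine: "\<exists>i. i \<in> K \<and> p \<in> cball (a i) (r i) \<and> r i < dd" if "p \<in> h ` N k" "0 < dd" for p dd
  proof -
   obtain x where x: "p = h x" "x \<in> N k" using \<open>p \<in> h ` N k\<close> by blast
   have "isCont d x" using x by (simp add: N_def)
   then obtain \<delta> where \<delta>: "\<delta> > 0" "\<And>x'. \<bar>x' - x\<bar> < \<delta> ==> \<bar>d x' - d x\<bar> < dd"
    using \<open>0 < dd\<close> unfolding continuous_at_eps_delta dist_real_def by blast
   obtain s where s: "\<bar>s\<bar> < min (min \<delta> dd) (k - \<bar>x\<bar>)" "\<bar>d (x + s) - d x\<bar> > m * \<bar>s\<bar>"
    by (rule not_pointwise_lipschitzD[of d x m "min (min \<delta> dd) (k - \<bar>x\<bar>)"])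
      (use x \<open>m > 0\<close> \<delta> \<open>0 < dd\<close> in \<open>auto simp: N_def\<close>)
   have "s \<noteq> 0" using s(2) by auto
   have "\<bar>h (x + s) - h x\<bar> = \<bar>s\<bar> + \<bar>d (x + s) - d x\<bar>" using expand[of "x + s" x] by simp
   then have "(x, x + s) \<in> K" "r (x, x + s) < dd"
    using s x \<open>s \<noteq> 0\<close> \<delta>(2)[of "x + s"] unfolding K_def r_def N_def by auto linarith+
   moreover have "p \<in> cball (a (x, x + s)) (r (x, x + s))"
    unfolding cb x by (auto simp: h_le)
   ultimately show ?thesis by blast
  qed
  obtain C where C: "countable C" "C \<subseteq> K"
    "pairwise (\<lambda>i j. disjnt (cball (a i) (r i)) (cball (a j) (r j))) C"
    "negligible (h ` N k - (\<Union>i\<in>C. cball (a i) (r i)))"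
   by (rule Vitali_covering_theorem_cballs[of K r "h ` N k" a]) (use rpos fine in blast)+
  \<comment> \<open>\<open>T1\<close> comes from what the Vitali family misses and is null because
    \<open>j\<close> is Lipschitz; \<open>T2\<close> consists of the preimages of the balls.\<close>
  define T1 where "T1 = j ` (h ` N k - (\<Union>i\<in>C. cball (a i) (r i)))"
  define I where "I = (\<lambda>(x, x'). {min x x'..max x (x'::real)})"
  define T2 where "T2 = (\<Union>i\<in>C. I i)"
  have "negligible T1" unfolding T1_def
  proof (rule negligible_locally_Lipschitz_image[OF _ C(4)])
   fix p assume "p \<in> h ` N k - (\<Union>i\<in>C. cball (a i) (r i))"
   have "norm (j q - j p) <= 1 * norm (q - p)" if "q \<in> range h" "p \<in> range h" for p q
    using that expand by (auto simp: jh)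
   then show "\<exists>T B. open T \<and> p \<in> T \<and>
      (\<forall>y\<in>(h ` N k - (\<Union>i\<in>C. cball (a i) (r i))) \<inter> T. norm (j y - j p) <= B * norm (y - p))"
    using \<open>p \<in> _\<close> by (intro exI[of _ UNIV] exI[of _ 1]) auto
  qed simp
  \<comment> \<open>Finite subfamilies first: on them disjointness turns the sum of the ball
    measures into the measure of a union inside \<open>{h (-k)..h k}\<close>.\<close>
  have fin: "measure lebesgue (\<Union>i\<in>C'. I i) <= e / 2" if "C' \<subseteq> C" "finite C'" for C'
  proof -
   have I_le: "measure lebesgue (I i) <= measure lebesgue (cball (a i) (r i)) / m" if "i \<in> K" for i
   proof -
    obtain x x' where i: "i = (x, x')" by force
    show ?thesis using that \<open>m > 0\<close> h_le[of x x'] h_le[of x' x] unfolding i cb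
     by (auto simp: I_def K_def min_def max_def field_simps abs_if split: if_splits)
   qed
   have "measure lebesgue (\<Union>i\<in>C'. I i) <= (\<Sum>i\<in>C'. measure lebesgue (I i))"
    using that by (intro measure_UNION_le) (auto simp: I_def)
   also have "\<dots> <= (\<Sum>i\<in>C'. measure lebesgue (cball (a i) (r i)) / m)"
    using that C by (intro sum_mono I_le) auto
   also have "\<dots> = (\<Sum>i\<in>C'. measure lebesgue (cball (a i) (r i))) / m"
    by (simp add: sum_divide_distrib)
   also have "(\<Sum>i\<in>C'. measure lebesgue (cball (a i) (r i))) = measure lebesgue (\<Union>i\<in>C'. cball (a i) (r i))"
    using that C(3) by (intro measure_UNION'[symmetric] pairwise_subset[OF C(3)]) auto
   also have "\<dots> <= measure lebesgue {h (-k)..h k}"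
   proof (rule measure_mono_fmeasurable)
    show "(\<Union>i\<in>C'. cball (a i) (r i)) \<subseteq> {h (- k)..h k}"
    proof safe
     fix x x' z assume "(x, x') \<in> C'" and z: "z \<in> cball (a (x, x')) (r (x, x'))"
     then have "\<bar>x\<bar> < k" "\<bar>x'\<bar> < k" using that C by (auto simp: K_def)
     then have "h (- k) <= h (min x x')" "h (max x x') <= h k" by (auto simp: h_le)
     then show "z \<in> {h (- k)..h k}" using z unfolding cb by auto
    qed
    show "(\<Union>i\<in>C'. cball (a i) (r i)) \<in> sets lebesgue" using \<open>finite C'\<close> by auto
   qed auto
   also have "\<dots> <= c" using h_le[of "-k" k] that \<open>k > 0\<close> by (simp add: c_def)
   finally have "measure lebesgue (\<Union>i\<in>C'. I i) <= c / m" using \<open>m > 0\<close> by (simp add: divide_right_mono)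
   then show ?thesis using \<open>c > 0\<close> \<open>e > 0\<close> by (simp add: m_def)
  qed
  have Im: "I i \<in> lmeasurable" for i by (cases i) (auto simp: I_def)
  have T2: "T2 \<in> lmeasurable" "measure lebesgue T2 <= e / 2" unfolding T2_def
   by (rule fmeasurable_UN_bound[OF C(1) Im fin] measure_UN_bound[OF C(1) Im fin]; assumption?)+
  have "T1 \<union> T2 \<in> lmeasurable" "measure lebesgue (T1 \<union> T2) <= e / 2"
   using T2 \<open>negligible T1\<close> measure_Un_le[of T1 lebesgue T2]
   by (auto simp: negligible_iff_measure fmeasurable.Un)
  moreover have "N k \<subseteq> T1 \<union> T2"
  proof
   fix x assume x: "x \<in> N k"
   show "x \<in> T1 \<union> T2"
   proof (cases "h x \<in> (\<Union>i\<in>C. cball (a i) (r i))")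
    case True
    then obtain y y' where y: "(y, y') \<in> C" "h x \<in> cball (a (y, y')) (r (y, y'))" by force
    then have "x \<in> I (y, y')" unfolding cb by (auto simp: h_le I_def)
    then show ?thesis using y by (auto simp: T2_def)
   next
    case False
    then have "x = j (h x)" "h x \<in> h ` N k - (\<Union>i\<in>C. cball (a i) (r i))" using x by (auto simp: jh)
    then show ?thesis unfolding T1_def by blast
   qed
  qed
  ultimately show "\<exists>T. N k \<subseteq> T \<and> T \<in> lmeasurable \<and> measure lebesgue T < e"
   using \<open>e > 0\<close> by (intro exI[of _ "T1 \<union> T2"]) auto
 qed
 have "negligible {x. \<not> isCont d x}"
  using countable_imp_null_set_lborel[OF mono_ctble_discont[OF assms]]
  by (simp add: negligible_iff_null_sets null_sets_completionI)
 then have "negligible ({x. \<not> isCont d x} \<union> (\<Union>k\<in>{0<..}. N (real k)))"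
  by (intro negligible_Un negligible_countable_Union negl) 
    (auto intro!: negl negligible_countable_Union)
 moreover have "{x. \<not> pointwise_lipschitz d x} \<subseteq> {x. \<not> isCont d x} \<union> (\<Union>k\<in>{0<..}. N (real k))"
 proof safe
  fix x assume x: "\<not> pointwise_lipschitz d x" "x \<notin> (\<Union>k\<in>{0<..}. N (real k))" "isCont d x"
  obtain k where "\<bar>x\<bar> < real k" using reals_Archimedean2 by blast
  then show False using x by (auto simp: N_def)
 qed
 ultimately show ?thesis by (rule negligible_subset)
qed

section \<open>Translations of product Lebesgue measure and supergradients\<close>

text \<open>The restriction to \<open>I\<close> keeps the result in the extensional function space
  that carries \<open>PiM\<close>.\<close>

definition shift :: "'i set => ('i => real) => ('i => real) => 'i => real" where
 "shift I v w = (\<lambda>i\<in>I. w i + v i)"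

lemma shift_in_PiE [simp]: "shift I v w \<in> PiE I (\<lambda>_. UNIV)"
 by (auto simp: shift_def)

lemma measurable_shift [measurable]: "shift I v \<in> measurable (PiM I (\<lambda>_. borel)) (PiM I (\<lambda>_. borel))"
 unfolding shift_def by measurable

lemma sets_PiM_lborel [simp, measurable_cong]: "sets (PiM I (\<lambda>_. lborel)) = sets (PiM I (\<lambda>_. borel))"
 by (rule sets_PiM_cong) auto

lemma distr_shift_PiM_lborel:
 assumes "finite I"
 shows "distr (PiM I (\<lambda>_. lborel)) (PiM I (\<lambda>_. lborel)) (shift I v) = PiM I (\<lambda>_. lborel :: real measure)"
proof -
 interpret product_sigma_finite "\<lambda>_. lborel :: real measure" ..
 show ?thesis
 proof (rule PiM_eqI)
  fix A assume A: "\<And>i. i \<in> I ==> A i \<in> sets (lborel :: real measure)"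
  have "emeasure (distr (PiM I (\<lambda>_. lborel)) (PiM I (\<lambda>_. lborel)) (shift I v)) (PiE I A)
    = emeasure (PiM I (\<lambda>_. lborel)) (shift I v -` PiE I A \<inter> space (PiM I (\<lambda>_. lborel)))"
   using assms A by (intro emeasure_distr sets_PiM_I_finite) auto
  also have "shift I v -` PiE I A \<inter> space (PiM I (\<lambda>_. lborel)) = PiE I (\<lambda>i. (\<lambda>x. x + v i) -` A i)"
   by (auto simp: shift_def space_PiM PiE_iff)
  also have "emeasure (PiM I (\<lambda>_. lborel)) \<dots> = (\<Prod>i\<in>I. emeasure lborel ((\<lambda>x. x + v i) -` A i))"
   using A assms by (intro emeasure_PiM) (auto intro!: measurable_sets_borel[of _ borel])
  also have "\<dots> = (\<Prod>i\<in>I. emeasure lborel (A i))"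
  proof (intro prod.cong refl)
   fix i assume "i \<in> I"
   have "emeasure lborel (A i) = emeasure (distr lborel borel ((+) (v i))) (A i)"
    by (simp add: lborel_distr_plus)
   also have "\<dots> = emeasure lborel ((\<lambda>x. x + v i) -` A i)"
    using A[OF \<open>i \<in> I\<close>] by (subst emeasure_distr) (auto simp: vimage_def add.commute)
   finally show "emeasure lborel ((\<lambda>x. x + v i) -` A i) = emeasure lborel (A i)" by simp
  qed
  finally show "emeasure (distr (PiM I (\<lambda>_. lborel)) (PiM I (\<lambda>_. lborel)) (shift I v)) (PiE I A) =
    (\<Prod>i\<in>I. emeasure lborel (A i))" .
 qed (use assms in auto)
qed

text \<open>For every \<open>K\<close>, the translates of \<open>S\<close> by
  \<open>k * h / K\<close> along \<open>v\<close>, for \<open>k < K\<close>, are pairwise disjoint,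
  have the measure of \<open>S\<close>, and lie in one cube. So \<open>K\<close> times the measure
  of \<open>S\<close> stays bounded.\<close>

lemma disjoint_translates_null:
 assumes "finite I" and S: "S \<in> sets (PiM I (\<lambda>_. borel))" and "h > 0"
  and bdd: "\<And>w i. w \<in> S ==> i \<in> I ==> \<bar>w i\<bar> <= c"
  and disj: "\<And>w s. w \<in> S ==> 0 < s ==> s < h ==> shift I (\<lambda>i. s * v i) w \<notin> S"
 shows "S \<in> null_sets (PiM I (\<lambda>_. lborel))"
proof -
 let ?L = "PiM I (\<lambda>_. lborel :: real measure)"
 interpret product_sigma_finite "\<lambda>_. lborel :: real measure" ..
 have SP: "w \<in> PiE I (\<lambda>_. UNIV)" if "w \<in> S" for w
  using sets.sets_into_space[OF S] that by (auto simp: space_PiM)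
 define c' where "c' i = \<bar>c\<bar> + h * \<bar>v i\<bar>" for i
 define Q where "Q = PiE I (\<lambda>i. {- c' i..c' i})"
 define q where "q = (\<Prod>i\<in>I. 2 * c' i)"
 have Q: "emeasure ?L Q = ennreal q"
  unfolding Q_def q_def using \<open>finite I\<close> \<open>h > 0\<close>
  by (subst emeasure_PiM) (auto simp: c'_def simp flip: prod_ennreal intro!: prod.cong)
 have bound: "of_nat K * emeasure ?L S <= ennreal q" for K :: nat
 proof (cases "K = 0")
  case False
  define S' where "S' k = shift I (\<lambda>i. - (real k * h / K) * v i) -` S \<inter> space ?L" for k :: nat
  have S'_sets: "S' k \<in> sets ?L" for k
   unfolding S'_def using measurable_sets[OF measurable_shift S] by (simp add: space_PiM)
  have mem: "w \<in> S' k \<longleftrightarrow> w \<in> PiE I (\<lambda>_. UNIV) \<and> shift I (\<lambda>i. - (real k * h / K) * v i) w \<in> S" for w k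
   by (auto simp: S'_def space_PiM)
  have "emeasure ?L (S' k) = emeasure ?L S" for k
  proof -
   have "emeasure ?L S = emeasure (distr ?L ?L (shift I (\<lambda>i. - (real k * h / K) * v i))) S"
    by (subst distr_shift_PiM_lborel[OF \<open>finite I\<close>]) simp
   also have "\<dots> = emeasure ?L (S' k)" unfolding S'_def using S by (intro emeasure_distr) auto
   finally show ?thesis ..
  qed
  then have "of_nat K * emeasure ?L S = (\<Sum>k<K. emeasure ?L (S' k))" by simp
  also have "\<dots> = emeasure ?L (\<Union>k<K. S' k)"
  proof (rule sum_emeasure)
   have *: "S' k \<inter> S' l = {}" if "l < k" "k < K" for k l
   proof (rule equals0I)
    fix w assume "w \<in> S' k \<inter> S' l"
    then have w: "shift I (\<lambda>i. - (real k * h / K) * v i) w \<in> S" "shift I (\<lambda>i. - (real l * h / K) * v i) w \<in> S"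
     by (auto simp: mem)
    define s where "s = (real k - real l) * h / K"
    have "0 < s" using that \<open>h > 0\<close> by (auto simp: s_def)
    have "(real k - real l) * h < real K * h" using that \<open>h > 0\<close> by (intro mult_strict_right_mono) auto
    then have "s < h" using False by (auto simp: s_def field_simps)
    have "shift I (\<lambda>i. - (real l * h / K) * v i) w = shift I (\<lambda>i. s * v i) (shift I (\<lambda>i. - (real k * h / K) * v i) w)"
     by (auto simp: shift_def s_def fun_eq_iff algebra_simps diff_divide_distrib)
    then show False using disj[OF w(1) \<open>0 < s\<close> \<open>s < h\<close>] w(2) by simp
   qed
   show "disjoint_family_on S' {..<K}" unfolding disjoint_family_on_def
    using * by (metis Int_commute lessThan_iff linorder_neqE_nat)
  qed (use S'_sets in auto)
  also have "\<dots> <= emeasure ?L Q"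
  proof (rule emeasure_mono)
   show "(\<Union>k<K. S' k) \<subseteq> Q"
   proof safe
    fix k w assume "k < K" "w \<in> S' k"
    then have w: "w \<in> PiE I (\<lambda>_. UNIV)" "shift I (\<lambda>i. - (real k * h / K) * v i) w \<in> S" by (auto simp: mem)
    have "\<bar>w i\<bar> <= c' i" if "i \<in> I" for i
    proof -
     have 1: "\<bar>w i - (real k * h / K) * v i\<bar> <= c" using bdd[OF w(2) that] that by (simp add: shift_def)
     have "real k * h / K <= h" using \<open>k < K\<close> \<open>h > 0\<close> by (simp add: field_simps)
     then have "\<bar>(real k * h / K) * v i\<bar> <= h * \<bar>v i\<bar>"
      using \<open>h > 0\<close> unfolding abs_mult by (intro mult_right_mono) auto
     moreover have "\<bar>x\<bar> <= \<bar>c\<bar> + b" if "\<bar>x - y\<bar> <= c" "\<bar>y\<bar> <= b" for x y b :: real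
      using that by arith
     ultimately show ?thesis using 1 unfolding c'_def by blast
    qed
    then show "w \<in> Q" using w(1) by (auto simp: Q_def PiE_iff abs_le_iff minus_le_iff)
   qed
   show "Q \<in> sets ?L" unfolding Q_def using \<open>finite I\<close> by (intro sets_PiM_I_finite) auto
  qed
  finally show ?thesis using Q by simp
 qed simp
 have "emeasure ?L S <= ennreal q" using bound[of 1] by simp
 then have fin: "emeasure ?L S = ennreal (measure ?L S)"
  by (intro emeasure_eq_ennreal_measure) (auto simp: top_unique)
 have "real K * measure ?L S <= q" if "q >= 0" for K
  using bound[of K] that unfolding fin
  by (simp add: ennreal_of_nat_eq_real_of_nat flip: ennreal_mult)
 moreover have "q >= 0" unfolding q_def using \<open>h > 0\<close> by (intro prod_nonneg) (auto simp: c'_def)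
 ultimately have "measure ?L S <= 0"
  by (metis ex_less_of_nat_mult linorder_not_le)
 then have "emeasure ?L S = 0" using fin by (simp add: ennreal_neg)
 then show ?thesis using S by (auto simp: null_sets_def)
qed

text \<open>The hypothesis \<open>sup\<close> says that \<open>u w\<close> is a supergradient at \<open>w\<close> of the concave
 function \<open>V w = (\<Sum>i\<in>I. w i * u w i)\<close>. A quadratic lower bound of \<open>V\<close> along the axes
 extends to all directions by concavity.\<close>

lemma supergradient_lipschitz:
 fixes u :: "('i => real) => 'i => real" and r m h :: real
 assumes I: "finite I" "I \<noteq> {}"
  and sup: "\<And>w w'. w \<in> PiE I (\<lambda>_. UNIV) ==> w' \<in> PiE I (\<lambda>_. UNIV) ==>
        (\<Sum>i\<in>I. w' i * u w' i) <= (\<Sum>i\<in>I. w' i * u w i)"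
  and lip: "\<And>i s. i \<in> I ==> \<bar>s\<bar> < h ==> \<bar>u (w(i := w i + s)) i - u w i\<bar> <= m * \<bar>s\<bar>"
  and w: "w \<in> PiE I (\<lambda>_. UNIV)" and w': "w' \<in> PiE I (\<lambda>_. UNIV)"
  and close: "\<And>i. i \<in> I ==> \<bar>w' i - w i\<bar> <= r"
  and r: "r > 0" "2 * card I * r < h" and "m > 0" and k: "k \<in> I"
 shows "\<bar>u w' k - u w k\<bar> <= 4 * m * (card I)\<^sup>2 * r"
proof -
 define N where "N = real (card I)"
 have "N >= 1" using I by (simp add: N_def Suc_le_eq card_gt_0_iff)
 define V where "V w = (\<Sum>i\<in>I. w i * u w i)" for w
 have V_le: "V w' <= V w + (\<Sum>i\<in>I. (w' i - w i) * u w i)"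
  if "w \<in> PiE I (\<lambda>_. UNIV)" "w' \<in> PiE I (\<lambda>_. UNIV)" for w w'
  using sup[OF that] by (simp add: V_def algebra_simps sum_subtractf sum.distrib)
 have upd: "w(i := x) \<in> PiE I (\<lambda>_. UNIV)" if "w \<in> PiE I (\<lambda>_. UNIV)" "i \<in> I" for w i and x :: real
  using that by (auto simp: PiE_iff extensional_def)
 \<comment> \<open>The displacement \<open>z - w\<close> is the average of the axis displacements
   \<open>wi i - w\<close>, each of them \<open>card I\<close> times one component. The
   supergradient at \<open>z\<close> turns this average into concavity of \<open>V\<close>; the
   bounds along the axes come from \<open>lip\<close>.\<close>
 have lower: "V z >= V w + (\<Sum>i\<in>I. (z i - w i) * u w i) - 4 * m * N\<^sup>2 * r\<^sup>2"
  if z: "z \<in> PiE I (\<lambda>_. UNIV)" "\<And>i. i \<in> I ==> \<bar>z i - w i\<bar> <= 2 * r" for z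
 proof -
  define d where "d i = z i - w i" for i
  define wi where "wi i = w(i := w i + N * d i)" for i
  have wi: "wi i \<in> PiE I (\<lambda>_. UNIV)" if "i \<in> I" for i using upd[OF w that] by (simp add: wi_def)
  have 1: "V (wi i) >= V w + N * (d i * u w i) - m * N\<^sup>2 * (2 * r)\<^sup>2" if i: "i \<in> I" for i
  proof -
   have di: "\<bar>d i\<bar> <= 2 * r" using z(2)[OF i] by (simp add: d_def)
   have "N * \<bar>d i\<bar> <= N * (2 * r)" using di \<open>N >= 1\<close> by (intro mult_left_mono) auto
   moreover have "N * (2 * r) < h" using r by (simp add: N_def algebra_simps)
   ultimately have Nd: "\<bar>N * d i\<bar> <= N * (2 * r)" "\<bar>N * d i\<bar> < h"
    using \<open>N >= 1\<close> abs_mult[of N "d i"] by linarith+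
   have "V w <= V (wi i) + (\<Sum>j\<in>I. (w j - wi i j) * u (wi i) j)" by (rule V_le[OF wi[OF i] w])
   also have "(\<Sum>j\<in>I. (w j - wi i j) * u (wi i) j) = (\<Sum>j\<in>I. if j = i then - (N * d i) * u (wi i) i else 0)"
    by (intro sum.cong) (auto simp: wi_def)
   also have "\<dots> = - (N * d i) * u (wi i) i" using I i by (simp add: sum.delta)
   finally have "V (wi i) >= V w + N * d i * u w i + (N * d i) * (u (wi i) i - u w i)"
    by (simp add: algebra_simps)
   moreover have "\<bar>(N * d i) * (u (wi i) i - u w i)\<bar> <= \<bar>N * d i\<bar> * (m * \<bar>N * d i\<bar>)"
    unfolding abs_mult[of "N * d i" "u (wi i) i - u w i"] using lip[OF i Nd(2)] by (intro mult_left_mono) (auto simp: wi_def)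
   moreover have "\<bar>N * d i\<bar> * (m * \<bar>N * d i\<bar>) <= (N * (2 * r)) * (m * (N * (2 * r)))"
    using Nd \<open>m > 0\<close> r \<open>N >= 1\<close> by (intro mult_mono) auto
   ultimately show ?thesis by (simp add: power2_eq_square algebra_simps abs_le_iff)
  qed
  have 2: "V (wi i) <= V z + (\<Sum>j\<in>I. (wi i j - z j) * u z j)" if "i \<in> I" for i
   by (rule V_le[OF z(1) wi[OF that]])
  have "(\<Sum>i\<in>I. \<Sum>j\<in>I. (wi i j - z j) * u z j) = (\<Sum>j\<in>I. (\<Sum>i\<in>I. wi i j - z j) * u z j)"
   by (subst sum.swap) (simp add: sum_distrib_right)
  also have "\<dots> = 0"
  proof (intro sum.neutral ballI)
   fix j assume j: "j \<in> I"
   have "(\<Sum>i\<in>I. wi i j - z j) = (\<Sum>i\<in>I. - d j + (if i = j then N * d j else 0))"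
    by (intro sum.cong) (auto simp: wi_def d_def)
   also have "\<dots> = 0" using I j by (simp add: sum.distrib sum_subtractf sum.delta N_def)
   finally show "(\<Sum>i\<in>I. wi i j - z j) * u z j = 0" by simp
  qed
  finally have 3: "(\<Sum>i\<in>I. \<Sum>j\<in>I. (wi i j - z j) * u z j) = 0" .
  have "(\<Sum>i\<in>I. V w + N * (d i * u w i) - m * N\<^sup>2 * (2 * r)\<^sup>2) <= (\<Sum>i\<in>I. V z + (\<Sum>j\<in>I. (wi i j - z j) * u z j))"
   using 1 2 by (intro sum_mono) (rule order.trans)
  then have "N * (V w + (\<Sum>i\<in>I. d i * u w i) - m * N\<^sup>2 * (2 * r)\<^sup>2) <= N * V z"
   using 3 by (simp add: sum.distrib sum_subtractf sum_distrib_left N_def algebra_simps)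
  then have "V w + (\<Sum>i\<in>I. d i * u w i) - m * N\<^sup>2 * (2 * r)\<^sup>2 <= V z" using \<open>N >= 1\<close> by simp
  then show ?thesis by (simp add: d_def power2_eq_square)
 qed
 \<comment> \<open>Push \<open>w'\<close> by \<open>r\<close> along the axis \<open>k\<close>,
   upwards and downwards. The upper bounds of \<open>V\<close> by supergradients against the lower
   bound \<open>lower\<close> leave only the difference of the two slopes. The extra push is the
   reason why \<open>lower\<close> admits distance \<open>2 * r\<close>.\<close>
 have main: "\<sigma> * r * (u w' k - u w k) >= - (4 * m * N\<^sup>2 * r\<^sup>2)" if "\<bar>\<sigma>\<bar> = 1" for \<sigma>
 proof -
  define z where "z = w'(k := w' k + \<sigma> * r)"
  have z: "z \<in> PiE I (\<lambda>_. UNIV)" using upd[OF w' k] by (simp add: z_def)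
  have "\<bar>\<sigma> * r\<bar> = r" using that r by (simp add: abs_mult)
  then have "\<bar>z i - w i\<bar> <= 2 * r" if "i \<in> I" for i using close[OF that] r by (auto simp: z_def)
  then have "V z >= V w + (\<Sum>i\<in>I. (z i - w i) * u w i) - 4 * m * N\<^sup>2 * r\<^sup>2" by (rule lower[OF z])
  moreover have "(\<Sum>i\<in>I. (z i - w i) * u w i) = (\<Sum>i\<in>I. (w' i - w i) * u w i + (if i = k then \<sigma> * r * u w k else 0))"
   by (intro sum.cong) (auto simp: z_def algebra_simps)
  then have "(\<Sum>i\<in>I. (z i - w i) * u w i) = (\<Sum>i\<in>I. (w' i - w i) * u w i) + \<sigma> * r * u w k"
   using I k by (simp add: sum.distrib sum.delta)
  moreover have "V z <= V w' + (\<Sum>i\<in>I. (z i - w' i) * u w' i)" by (rule V_le[OF w' z])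
  moreover have "(\<Sum>i\<in>I. (z i - w' i) * u w' i) = (\<Sum>i\<in>I. if i = k then \<sigma> * r * u w' k else 0)"
   by (intro sum.cong) (auto simp: z_def algebra_simps)
  then have "(\<Sum>i\<in>I. (z i - w' i) * u w' i) = \<sigma> * r * u w' k" using I k by (simp add: sum.delta)
  moreover have "V w' <= V w + (\<Sum>i\<in>I. (w' i - w i) * u w i)" by (rule V_le[OF w w'])
  ultimately show ?thesis by (simp add: algebra_simps)
 qed
 have "r * \<bar>u w' k - u w k\<bar> = \<bar>r * (u w' k - u w k)\<bar>" using r(1) by (simp add: abs_mult)
 also have "\<dots> <= r * (4 * m * N\<^sup>2 * r)"
  using main[of 1] main[of "-1"] by (simp only: abs_le_iff) (simp add: power2_eq_square algebra_simps)
 finally have "r * \<bar>u w' k - u w k\<bar> <= r * (4 * m * N\<^sup>2 * r)" .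
 then show ?thesis using r(1) by (simp add: N_def)
qed

text \<open>Monotonicity along the axes makes rational increments sufficient, so that the following
 condition is measurable in \<open>w\<close>.\<close>

definition axis_lipschitz ::
 "(('i => real) => 'i => real) => 'i => nat => nat => ('i => real) => bool" where
 "axis_lipschitz u k m j w \<longleftrightarrow>
   (\<forall>s\<in>\<rat>. \<bar>s\<bar> < 1 / Suc j --> \<bar>u (w(k := w k + s)) k - u w k\<bar> <= real m * \<bar>s\<bar>)"

context
 fixes I :: "'i set" and u :: "('i => real) => 'i => real" and k :: 'i
 assumes I: "finite I" and k: "k \<in> I"
  and meas: "(\<lambda>w. u w k) \<in> borel_measurable (PiM I (\<lambda>_. borel))"
  and sup: "\<And>w w'. w \<in> PiE I (\<lambda>_. UNIV) ==> w' \<in> PiE I (\<lambda>_. UNIV) ==>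
        (\<Sum>i\<in>I. w' i * u w' i) <= (\<Sum>i\<in>I. w' i * u w i)"
begin

text \<open>Adding the supergradient inequalities at the two points, each tested against the other,
  gives monotonicity; along one axis only the term of \<open>k\<close> remains.\<close>

lemma supergradient_antimono:
 assumes "x <= y" "w \<in> PiE I (\<lambda>_. UNIV)"
 shows "u (w(k := y)) k <= u (w(k := x)) k"
proof -
 have upd: "w(k := x) \<in> PiE I (\<lambda>_. UNIV)" if "w \<in> PiE I (\<lambda>_. UNIV)" for w and x :: real
  using that k by (auto simp: PiE_iff extensional_def)
 have "u (w(k := y)) k <= u (w(k := x)) k"
 proof (cases "x = y")
  case False
  have "(\<Sum>i\<in>I. (w(k := y)) i * u (w(k := y)) i) + (\<Sum>i\<in>I. (w(k := x)) i * u (w(k := x)) i)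
    <= (\<Sum>i\<in>I. (w(k := y)) i * u (w(k := x)) i) + (\<Sum>i\<in>I. (w(k := x)) i * u (w(k := y)) i)"
   using assms by (intro add_mono sup upd)
  then have "0 <= (\<Sum>i\<in>I. ((w(k := y)) i - (w(k := x)) i) * (u (w(k := x)) i - u (w(k := y)) i))"
   by (simp add: algebra_simps sum.distrib sum_subtractf)
  also have "\<dots> = (\<Sum>i\<in>I. if i = k then (y - x) * (u (w(k := x)) k - u (w(k := y)) k) else 0)"
   by (intro sum.cong) auto
  also have "\<dots> = (y - x) * (u (w(k := x)) k - u (w(k := y)) k)" using I k by (simp add: sum.delta)
  finally show ?thesis using assms False by (simp add: zero_le_mult_iff)
 qed simp
 then show ?thesis .
qed

text \<open>By monotonicity the increment at \<open>s\<close> is dominated by that at a rational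
  between \<open>s\<close> and \<open>2 * s\<close>. This costs a factor 2 in constant and range;
  the added 1 keeps the constant positive.\<close>

lemma axis_lipschitz_real:
 assumes "axis_lipschitz u k m j w" and w: "w \<in> PiE I (\<lambda>_. UNIV)" and s: "\<bar>s\<bar> < 1 / (2 * Suc j)"
 shows "\<bar>u (w(k := w k + s)) k - u w k\<bar> <= (2 * real m + 1) * \<bar>s\<bar>"
proof -
 note anti = supergradient_antimono
 have mj: "\<And>s. s \<in> \<rat> ==> \<bar>s\<bar> < 1 / Suc j ==>
   \<bar>u (w(k := w k + s)) k - u w k\<bar> <= real m * \<bar>s\<bar>" using assms(1) by (auto simp: axis_lipschitz_def)
  have "\<bar>u (w(k := w k + s)) k - u w k\<bar> <= (2 * real m + 1) * \<bar>s\<bar>"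
  proof (cases "s = 0")
   case False
   have s2: "2 * \<bar>s\<bar> < 1 / Suc j" using s by (simp add: field_simps)
   show ?thesis
   proof (cases "s > 0")
    case True
    obtain q where q: "q \<in> \<rat>" "s < q" "q < 2 * s" using Rats_dense_in_real[of s "2 * s"] True by auto
    have "u (w(k := w k + q)) k <= u (w(k := w k + s)) k" "u (w(k := w k + s)) k <= u (w(k := w k)) k"
     using q True anti[OF _ w, of "w k + s" "w k + q"] anti[OF _ w, of "w k" "w k + s"] by auto
    moreover have "\<bar>u (w(k := w k + q)) k - u w k\<bar> <= real m * \<bar>q\<bar>" using mj[OF q(1)] q s2 True by auto
    moreover have "real m * \<bar>q\<bar> <= real m * (2 * s)" using q True by (intro mult_left_mono) auto
    ultimately show ?thesis using True by (simp add: algebra_simps)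
   next
    case neg: False
    obtain q where q: "q \<in> \<rat>" "2 * s < q" "q < s" using Rats_dense_in_real[of "2 * s" s] neg False by auto
    have "u (w(k := w k)) k <= u (w(k := w k + s)) k" "u (w(k := w k + s)) k <= u (w(k := w k + q)) k"
     using q neg anti[OF _ w, of "w k + q" "w k + s"] anti[OF _ w, of "w k + s" "w k"] by auto
    moreover have "\<bar>u (w(k := w k + q)) k - u w k\<bar> <= real m * \<bar>q\<bar>" using mj[OF q(1)] q s2 neg by auto
    moreover have "real m * \<bar>q\<bar> <= real m * (2 * - s)" using q neg by (intro mult_left_mono) auto
    ultimately show ?thesis using neg by (simp add: algebra_simps)
   qed
  qed simp
  then show ?thesis .
qed

text \<open>Translates the countable condition into \<open>pointwise_lipschitz\<close> of the
  section along the axis, to which the one-dimensional theorem applies.\<close>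

lemma axis_lipschitz_iff:
 assumes w: "w \<in> PiE I (\<lambda>_. UNIV)"
 shows "(\<exists>m j. axis_lipschitz u k m j w) \<longleftrightarrow> pointwise_lipschitz (\<lambda>x. u (w(k := x)) k) (w k)"
proof
 assume "pointwise_lipschitz (\<lambda>x. u (w(k := x)) k) (w k)"
 then obtain m h where mh: "m > 0" "h > 0" "\<And>s. \<bar>s\<bar> < h ==> \<bar>u (w(k := w k + s)) k - u w k\<bar> <= m * \<bar>s\<bar>"
  by (auto simp: pointwise_lipschitz_def)
 obtain m' :: nat where m': "m <= m'" using real_arch_simple by blast
 obtain j :: nat where j: "1 / Suc j < h" using nat_approx_posE[OF mh(2)] by blast
 have "\<bar>u (w(k := w k + s)) k - u w k\<bar> <= real m' * \<bar>s\<bar>" if "\<bar>s\<bar> < 1 / Suc j" for s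
  using mh(3)[of s] that j m' by (meson abs_ge_zero less_trans mult_right_mono order_trans)
 then show "\<exists>m j. axis_lipschitz u k m j w" unfolding axis_lipschitz_def by blast
next
 assume "\<exists>m j. axis_lipschitz u k m j w"
 then obtain m j where "axis_lipschitz u k m j w" by blast
 from axis_lipschitz_real[OF this w] show "pointwise_lipschitz (\<lambda>x. u (w(k := x)) k) (w k)"
  unfolding pointwise_lipschitz_def
  by (intro exI[of _ "2 * real m + 1"] conjI exI[of _ "1 / (2 * Suc j)"]) auto
qed

lemma measurable_axis_lipschitz:
 "Measurable.pred (PiM I (\<lambda>_. borel)) (axis_lipschitz u k m j)"
proof -
 have updm: "(\<lambda>w. w(k := w k + s)) \<in> measurable (PiM I (\<lambda>_. borel)) (PiM I (\<lambda>_. borel))" for s :: real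
 proof -
  have "insert k I = I" using k by auto
  then show ?thesis using measurable_fun_upd[of I I k "\<lambda>w. w" "PiM I (\<lambda>_. borel)" "\<lambda>_. borel" "\<lambda>w. w k + s"] k
   by (simp add: insert_absorb)
 qed
 note [measurable] = measurable_compose[OF updm meas] meas
 have "countable (\<rat> :: real set)" by (rule countable_rat)
 then show ?thesis unfolding axis_lipschitz_def[abs_def] by measurable
qed

text \<open>Fubini in the coordinate \<open>k\<close>: on every line parallel to that axis the
  supergradient is monotone, so the exceptional set meets the line in a null set.\<close>

lemma AE_axis_lipschitz: "AE w in PiM I (\<lambda>_. lborel). \<exists>m j. axis_lipschitz u k m j w"
proof -
 interpret product_sigma_finite "\<lambda>_. lborel :: real measure" ..
 let ?L = "PiM I (\<lambda>_. lborel :: real measure)"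
 note anti = supergradient_antimono
 define R where "R w \<longleftrightarrow> (\<exists>m j. axis_lipschitz u k m j w)" for w
 note R_iff = axis_lipschitz_iff[folded R_def]
 note [measurable] = measurable_axis_lipschitz
 have "Measurable.pred (PiM I (\<lambda>_. borel)) (\<lambda>w. \<not> R w)" unfolding R_def by measurable
 then have R_sets: "{w \<in> space ?L. \<not> R w} \<in> sets ?L" by (simp add: space_PiM pred_def)
 have "emeasure ?L {w \<in> space ?L. \<not> R w} = (\<integral>\<^sup>+ w. indicator {w \<in> space ?L. \<not> R w} w \<partial>?L)"
  using R_sets by simp
 also have "\<dots> = (\<integral>\<^sup>+ w. (\<integral>\<^sup>+ x. indicator {w \<in> space ?L. \<not> R w} (w(k := x)) \<partial>lborel) \<partial>PiM (I - {k}) (\<lambda>_. lborel))"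
 proof -
  have "insert k (I - {k}) = I" using k by auto
  then show ?thesis
   using product_nn_integral_insert[of "I - {k}" k "indicator {w \<in> space ?L. \<not> R w}"] I R_sets
   by simp
 qed
 also have "\<dots> = (\<integral>\<^sup>+ w. 0 \<partial>PiM (I - {k}) (\<lambda>_. lborel :: real measure))"
 proof (rule nn_integral_cong)
  fix w assume "w \<in> space (PiM (I - {k}) (\<lambda>_. lborel :: real measure))"
  then have w: "w(k := x) \<in> PiE I (\<lambda>_. UNIV)" for x using k
   by (auto simp: space_PiM PiE_iff extensional_def)
  have "mono (\<lambda>x. - u (w(k := x)) k)" using anti[OF _ w] by (intro monoI) simp
  from mono_negligible_not_pointwise_lipschitz[OF this]
  have neg: "negligible {x. \<not> pointwise_lipschitz (\<lambda>x. u (w(k := x)) k) x}"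
   by (simp add: pointwise_lipschitz_def abs_minus_commute)
  have *: "(\<lambda>x. w(k := x)) -` {w \<in> space ?L. \<not> R w} = {x. \<not> pointwise_lipschitz (\<lambda>x. u (w(k := x)) k) x}"
   using R_iff[OF w] w by (auto simp: space_PiM)
  have "(\<lambda>x. w(k := x)) \<in> measurable borel ?L"
  proof -
   have "(\<lambda>x. w(k := x)) \<in> measurable borel (PiM I (\<lambda>_. borel))"
    using k \<open>w \<in> space _\<close> 
    by (intro measurable_fun_upd[where J = "I - {k}"]) (auto simp: space_PiM)
   then show ?thesis by (simp cong: measurable_cong_sets)
  qed
  then have "{x. \<not> pointwise_lipschitz (\<lambda>x. u (w(k := x)) k) x} \<in> sets borel"
   using measurable_sets[OF _ R_sets] * by fastforce
  then have "emeasure lborel {x. \<not> pointwise_lipschitz (\<lambda>x. u (w(k := x)) k) x} = 0"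
   using neg unfolding negligible_iff_null_sets by (simp add: null_sets_completion_iff null_sets_def)
  moreover have "(\<integral>\<^sup>+ x. indicator {w \<in> space ?L. \<not> R w} (w(k := x)) \<partial>lborel) =
    (\<integral>\<^sup>+ x. indicator {x. \<not> pointwise_lipschitz (\<lambda>x. u (w(k := x)) k) x} x \<partial>lborel)"
   by (intro nn_integral_cong) (simp add: indicator_def flip: *)
  ultimately show "(\<integral>\<^sup>+ x. indicator {w \<in> space ?L. \<not> R w} (w(k := x)) \<partial>lborel) = 0"
   using \<open>_ \<in> sets borel\<close> by simp
 qed
 finally have "{w \<in> space ?L. \<not> R w} \<in> null_sets ?L" using R_sets by (auto simp: null_sets_def)
 then have "AE w in ?L. R w" by (intro AE_I'[where N = "{w \<in> space ?L. \<not> R w}"]) auto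
 then show ?thesis by (simp add: R_def)
qed

end

text \<open>Almost every point of \<open>S\<close> lies in a piece with uniform Lipschitz constants,
  where \<open>u\<close> moves by at most a constant times \<open>s\<close> along \<open>v\<close>.
  The hypothesis, with \<open>K\<close> equal to this constant, says that \<open>u\<close> moves by
  more; so no two points of a small piece differ by \<open>s * v\<close>, and
  \<open>disjoint_translates_null\<close> applies. The direction \<open>v\<close> is chosen before
  \<open>K\<close> because the constant depends on the size of \<open>v\<close>. Neighbourhoods are
  taken in the graph of \<open>\<tau>\<close>, which may be discontinuous.\<close>

lemma supergradient_locally_injective_null:
 fixes u :: "(nat => real) => nat => real" and \<tau> :: "(nat => real) => 'p :: second_countable_topology"
 assumes I: "finite I" "I \<noteq> {}"
  and u: "\<And>k. k \<in> I ==> (\<lambda>w. u w k) \<in> borel_measurable (PiM I (\<lambda>_. borel))"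
  and \<tau>: "\<tau> \<in> borel_measurable (PiM I (\<lambda>_. borel))"
  and sup: "\<And>w w'. w \<in> PiE I (\<lambda>_. UNIV) ==> w' \<in> PiE I (\<lambda>_. UNIV) ==>
        (\<Sum>i\<in>I. w' i * u w' i) <= (\<Sum>i\<in>I. w' i * u w i)"
  and S: "S \<in> sets (PiM I (\<lambda>_. borel))"
  and loc: "\<And>w. w \<in> S ==> \<exists>v. \<forall>K>0. \<exists>U \<delta>. open U \<and> (w, \<tau> w) \<in> U \<and> \<delta> > 0 \<and>
    (\<forall>w' s. w' \<in> S --> 0 < s --> s < \<delta> --> shift I (\<lambda>i. s * v i) w' \<in> S --> (w', \<tau> w') \<in> U -->
     (shift I (\<lambda>i. s * v i) w', \<tau> (shift I (\<lambda>i. s * v i) w')) \<in> U -->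
     (\<exists>k\<in>I. \<bar>u (shift I (\<lambda>i. s * v i) w') k - u w' k\<bar> > K * s))"
 shows "S \<in> null_sets (PiM I (\<lambda>_. lborel))"
proof -
 let ?L = "PiM I (\<lambda>_. lborel :: real measure)"
 have SP: "w \<in> PiE I (\<lambda>_. UNIV)" if "w \<in> S" for w
  using sets.sets_into_space[OF S] that by (auto simp: space_PiM)
 obtain \<B> :: "((nat => real) \<times> 'p) set set" where \<B>: "countable \<B>" "topological_basis \<B>"
  using ex_countable_basis by blast
 \<comment> \<open>Outside \<open>I\<close> the coordinates are constantly \<open>undefined\<close>,
   so the inclusion into the space of all sequences is measurable. That space has a countable base,
   which makes the pieces below countable in number.\<close>
 have emb: "(\<lambda>w. (w, \<tau> w)) \<in> borel_measurable (PiM I (\<lambda>_. borel))"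
 proof -
  have "(\<lambda>w. w) \<in> measurable (PiM I (\<lambda>_. borel)) (PiM UNIV (\<lambda>_. borel :: real measure))"
  proof (rule measurable_PiM_single')
   fix i show "(\<lambda>w. w i) \<in> borel_measurable (PiM I (\<lambda>_. borel :: real measure))"
   proof (cases "i \<in> I")
    case False
    have "(\<lambda>w. undefined) \<in> borel_measurable (PiM I (\<lambda>_. borel :: real measure))" by simp
    then show ?thesis using False
     by (subst measurable_cong[where g = "\<lambda>_. undefined"]) (auto simp: space_PiM PiE_iff extensional_def)
   next
    case True
    then show ?thesis by (rule measurable_component_singleton)
   qed
   show "(\<lambda>w. w) \<in> space (PiM I (\<lambda>_. borel)) \<rightarrow> (\<Pi>\<^sub>E i\<in>UNIV. space (borel :: real measure))"
    by (simp add: PiE_def)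
  qed
  then have "(\<lambda>w. w) \<in> borel_measurable (PiM I (\<lambda>_. borel :: real measure))"
   by (subst (asm) measurable_cong_sets[OF refl sets_PiM_equal_borel])
  then show ?thesis using \<tau> by (rule borel_measurable_Pair)
 qed
 \<comment> \<open>The pieces, indexed by the Lipschitz constant, the range of the increments, the
   size of the weights and a basic open set of the graph.\<close>
 define Z where "Z = (\<lambda>(m, j, c, b). {w \<in> S. (\<forall>k\<in>I. axis_lipschitz u k m j w \<and> \<bar>w k\<bar> <= real c) \<and> (w, \<tau> w) \<in> b})"
 have Z_sets: "Z (m, j, c, b) \<in> sets (PiM I (\<lambda>_. borel))" if "b \<in> \<B>" for m j c b
 proof -
  have b: "(\<lambda>w. (w, \<tau> w)) -` b \<inter> space (PiM I (\<lambda>_. borel)) \<in> sets (PiM I (\<lambda>_. borel))"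
   using borel_open[OF topological_basis_open[OF \<B>(2) that]] by (rule measurable_sets[OF emb])
  have "Measurable.pred (PiM I (\<lambda>_. borel)) (\<lambda>w. axis_lipschitz u k m j w \<and> \<bar>w k\<bar> <= real c)" if k: "k \<in> I" for k
  proof -
   have [measurable]: "Measurable.pred (PiM I (\<lambda>_. borel)) (axis_lipschitz u k m j)"
    by (rule measurable_axis_lipschitz[OF I(1) k u[OF k] sup])
   have [measurable]: "(\<lambda>w. w k) \<in> borel_measurable (PiM I (\<lambda>_. borel :: real measure))"
    using k by (rule measurable_component_singleton)
   show ?thesis by measurable
  qed
  then have "{w \<in> space (PiM I (\<lambda>_. borel)). \<forall>k\<in>I. axis_lipschitz u k m j w \<and> \<bar>w k\<bar> <= real c} \<in> sets (PiM I (\<lambda>_. borel))"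
   unfolding pred_def by (rule sets.sets_Collect_finite_All'[OF _ I])
  moreover have "Z (m, j, c, b) = S \<inter> {w \<in> space (PiM I (\<lambda>_. borel)). \<forall>k\<in>I. axis_lipschitz u k m j w \<and> \<bar>w k\<bar> <= real c}
    \<inter> ((\<lambda>w. (w, \<tau> w)) -` b \<inter> space (PiM I (\<lambda>_. borel)))"
   using SP by (auto simp: Z_def space_PiM)
  ultimately show ?thesis using S b by auto
 qed
 define good where "good z \<longleftrightarrow> (\<exists>v \<delta>. \<delta> > 0 \<and> (\<forall>w s. w \<in> Z z --> 0 < s --> s < \<delta> --> shift I (\<lambda>i. s * v i) w \<notin> Z z))" for z
 define G where "G = {z \<in> UNIV \<times> UNIV \<times> UNIV \<times> \<B>. good z}"
 have "countable (UNIV \<times> UNIV \<times> UNIV \<times> \<B> :: (nat \<times> nat \<times> nat \<times> _) set)"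
  by (intro countable_SIGMA countableI_type \<B>(1))
 then have "countable G" unfolding G_def by (rule countable_subset[OF Collect_restrict])
 have Z_null: "Z z \<in> null_sets ?L" if "z \<in> G" for z
 proof -
  obtain m j c b where z: "z = (m, j, c, b)" "b \<in> \<B>" using \<open>z \<in> G\<close> by (auto simp: G_def)
  obtain v \<delta> where "\<delta> > 0" "\<And>w s. w \<in> Z z ==> 0 < s ==> s < \<delta> ==> shift I (\<lambda>i. s * v i) w \<notin> Z z"
   using \<open>z \<in> G\<close> unfolding G_def good_def by blast
  then show ?thesis using Z_sets[OF z(2)] I(1)
   by (intro disjoint_translates_null[of I "Z z" \<delta> "real c" v]) (auto simp: z Z_def)
 qed
 have cover: "w \<in> (\<Union>z\<in>G. Z z)" if w: "w \<in> S" and lip: "\<forall>k\<in>I. \<exists>m j. axis_lipschitz u k m j w" for w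
 proof -
  obtain m j where mj: "\<And>k. k \<in> I ==> axis_lipschitz u k (m k) (j k) w" using lip by metis
  define m' j' where "m' = Max (m ` I)" and "j' = Max (j ` I)"
  have lip': "axis_lipschitz u k m' j' w" if k: "k \<in> I" for k
   unfolding axis_lipschitz_def
  proof (intro ballI impI)
   fix s :: real assume s: "s \<in> \<rat>" "\<bar>s\<bar> < 1 / Suc j'"
   have "m k <= m'" "j k <= j'" using k I by (auto simp: m'_def j'_def)
   then have le: "1 / Suc j' <= 1 / Suc (j k)" "real (m k) * \<bar>s\<bar> <= real m' * \<bar>s\<bar>"
    by (auto intro!: divide_left_mono mult_right_mono)
   have "\<bar>s\<bar> < 1 / Suc (j k)" using s(2) le(1) by (rule less_le_trans)
   then have "\<bar>u (w(k := w k + s)) k - u w k\<bar> <= real (m k) * \<bar>s\<bar>"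
    using mj[OF k] s(1) unfolding axis_lipschitz_def by blast
   then show "\<bar>u (w(k := w k + s)) k - u w k\<bar> <= real m' * \<bar>s\<bar>" using le(2) by (rule order.trans)
  qed
  obtain c :: nat where c: "Max ((\<lambda>k. \<bar>w k\<bar>) ` I) <= c" using real_arch_simple by blast
  have c: "\<bar>w k\<bar> <= c" if "k \<in> I" for k using c that I by (auto intro: order.trans[OF Max_ge])
  obtain v where v: "\<forall>K>0. \<exists>U \<delta>. open U \<and> (w, \<tau> w) \<in> U \<and> \<delta> > 0 \<and>
    (\<forall>w' s. w' \<in> S --> 0 < s --> s < \<delta> --> shift I (\<lambda>i. s * v i) w' \<in> S --> (w', \<tau> w') \<in> U -->
     (shift I (\<lambda>i. s * v i) w', \<tau> (shift I (\<lambda>i. s * v i) w')) \<in> U -->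
     (\<exists>k\<in>I. \<bar>u (shift I (\<lambda>i. s * v i) w') k - u w' k\<bar> > K * s))"
   using loc[OF w] by blast
  define vm where "vm = (\<Sum>k\<in>I. \<bar>v k\<bar>) + 1"
  have "vm > 0" unfolding vm_def by (intro add_nonneg_pos sum_nonneg) auto
  have vm: "\<bar>v k\<bar> <= vm" if "k \<in> I" for k
   using member_le_sum[OF that, of "\<lambda>k. \<bar>v k\<bar>"] I by (simp add: vm_def)
  define M where "M = 2 * real m' + 1"
  \<comment> \<open>The constant that \<open>supergradient_lipschitz\<close> gives for points at
    distance \<open>s * vm\<close>; the choice of \<open>\<delta>'\<close> below keeps this distance
    within its range.\<close>
  define K where "K = 4 * M * (card I)\<^sup>2 * vm"
  have "K > 0" unfolding K_def M_def using I \<open>vm > 0\<close> by (auto intro!: mult_pos_pos simp: card_gt_0_iff)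
  then have "\<exists>U \<delta>. open U \<and> (w, \<tau> w) \<in> U \<and> \<delta> > 0 \<and>
    (\<forall>w' s. w' \<in> S --> 0 < s --> s < \<delta> --> shift I (\<lambda>i. s * v i) w' \<in> S --> (w', \<tau> w') \<in> U -->
     (shift I (\<lambda>i. s * v i) w', \<tau> (shift I (\<lambda>i. s * v i) w')) \<in> U -->
     (\<exists>k\<in>I. \<bar>u (shift I (\<lambda>i. s * v i) w') k - u w' k\<bar> > K * s))"
   by (rule v[THEN spec, THEN mp])
  then obtain U \<delta> where U: "open U" "(w, \<tau> w) \<in> U" "\<delta> > 0"
    and sep: "\<forall>w' s. w' \<in> S --> 0 < s --> s < \<delta> --> shift I (\<lambda>i. s * v i) w' \<in> S --> (w', \<tau> w') \<in> U -->
     (shift I (\<lambda>i. s * v i) w', \<tau> (shift I (\<lambda>i. s * v i) w')) \<in> U -->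
     (\<exists>k\<in>I. \<bar>u (shift I (\<lambda>i. s * v i) w') k - u w' k\<bar> > K * s)"
   by (elim exE conjE) (rule that)
  obtain b where b: "b \<in> \<B>" "(w, \<tau> w) \<in> b" "b \<subseteq> U"
   using topological_basisE[OF \<B>(2) U(1,2)] by blast
  define h where "h = 1 / (2 * Suc j')"
  define \<delta>' where "\<delta>' = min \<delta> (h / (2 * card I * vm))"
  have "h > 0" by (simp add: h_def)
  have card: "real (card I) > 0" using I by (simp add: card_gt_0_iff)
  have "\<delta>' > 0" using U(3) \<open>vm > 0\<close> card \<open>h > 0\<close> by (simp add: \<delta>'_def)
  have "good (m', j', c, b)"
   unfolding good_def
  proof (rule exI[of _ v], rule exI[of _ "\<delta>'"], intro conjI allI impI notI)
   show "\<delta>' > 0" by fact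
   fix w' s assume w': "w' \<in> Z (m', j', c, b)" and s: "0 < s" "s < \<delta>'"
    and sh: "shift I (\<lambda>i. s * v i) w' \<in> Z (m', j', c, b)"
   have wP: "w' \<in> PiE I (\<lambda>_. UNIV)" using w' SP by (auto simp: Z_def)
   have ax: "axis_lipschitz u k m' j' w'" if "k \<in> I" for k using w' that by (auto simp: Z_def)
   have "s * (2 * card I * vm) < h" using s card \<open>vm > 0\<close> by (simp add: \<delta>'_def field_simps)
   then have small: "2 * card I * (s * vm) < h" by (simp add: algebra_simps)
   have "\<bar>u (shift I (\<lambda>i. s * v i) w') k - u w' k\<bar> <= 4 * M * (card I)\<^sup>2 * (s * vm)" if "k \<in> I" for k
   proof (rule supergradient_lipschitz[where h = h, OF I sup])
    show "\<bar>u (w'(i := w' i + s)) i - u w' i\<bar> <= M * \<bar>s\<bar>" if "i \<in> I" "\<bar>s\<bar> < h" for i s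
     unfolding M_def using that(2)
     by (intro axis_lipschitz_real[OF I(1) that(1) u[OF that(1)] sup ax[OF that(1)] wP]) (auto simp: h_def)
    show "\<bar>shift I (\<lambda>i. s * v i) w' i - w' i\<bar> <= s * vm" if "i \<in> I" for i
     using that vm[OF that] s by (simp add: shift_def abs_mult)
    show "w' \<in> PiE I (\<lambda>_. UNIV)" by (fact wP)
    show "shift I (\<lambda>i. s * v i) w' \<in> PiE I (\<lambda>_. UNIV)" by simp
    show "0 < s * vm" using s \<open>vm > 0\<close> by simp
    show "real (2 * card I) * (s * vm) < h" using small by simp
    show "0 < M" by (simp add: M_def)
    show "k \<in> I" by (fact that)
   qed
   then have "\<bar>u (shift I (\<lambda>i. s * v i) w') k - u w' k\<bar> <= K * s" if "k \<in> I" for k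
    using that by (simp add: K_def algebra_simps)
   moreover obtain k where "k \<in> I" "\<bar>u (shift I (\<lambda>i. s * v i) w') k - u w' k\<bar> > K * s"
    using w' sh s b sep[rule_format, of w' s] by (auto simp: Z_def \<delta>'_def)
   ultimately show False by (meson not_le)
  qed
  then have "(m', j', c, b) \<in> G" using b by (simp add: G_def)
  moreover have "w \<in> Z (m', j', c, b)" using w lip' c b by (auto simp: Z_def)
  ultimately show ?thesis by blast
 qed
 have "AE w in ?L. \<forall>k\<in>I. \<exists>m j. axis_lipschitz u k m j w"
  using I(1) by (intro AE_finite_allI AE_axis_lipschitz u sup)
 then have "AE w in ?L. w \<in> S --> w \<in> (\<Union>z\<in>G. Z z)"
  by (rule AE_mp) (rule AE_I2, intro impI cover)
 moreover have "AE w in ?L. w \<notin> (\<Union>z\<in>G. Z z)"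
  using null_sets_UN'[OF \<open>countable G\<close> Z_null] by (rule AE_not_in)
 ultimately have "AE w in ?L. w \<notin> S" by (rule eventually_elim2) blast
 then show ?thesis using S by (simp add: AE_iff_null_sets)
qed

section \<open>Strict differentiability\<close>

text \<open>Both arguments vary: the minimizers at two nearby weight vectors are compared with each
  other, and neither need be the point of expansion.\<close>

definition strict_gradient :: "('a::euclidean_space => real) => 'a => 'a => bool" where
 "strict_gradient f g x \<longleftrightarrow>
   (\<lambda>(a, b). f a - f b - g \<bullet> (a - b)) \<in> o[nhds x \<times>\<^sub>F nhds x](\<lambda>(a, b). norm (a - b))"

lemma smallo_one_mult:
 fixes f h :: "'z => real"
 assumes "(f \<longlongrightarrow> 0) F" "h \<in> O[F](d)"
 shows "(\<lambda>z. f z * h z) \<in> o[F](d)"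
proof -
 have "f \<in> o[F](\<lambda>_. 1)" using assms(1) by (simp add: smalloI_tendsto)
 from landau_o.small_big_mult[OF this assms(2)] show ?thesis by simp
qed

lemma bigo_one_mult:
 fixes f h :: "'z => real"
 assumes "(f \<longlongrightarrow> c) F" "h \<in> o[F](d)"
 shows "(\<lambda>z. f z * h z) \<in> o[F](d)"
proof -
 have "f \<in> O[F](\<lambda>_. 1)" using assms(1) by (intro bigoI_tendsto[where c = c]) auto
 from landau_o.big_small_mult[OF this assms(2)] show ?thesis by simp
qed

lemma strict_gradient_continuous:
 assumes "strict_gradient f g x"
 shows "(f \<longlongrightarrow> f x) (nhds x)"
proof -
 have "eventually (\<lambda>(a, b). norm (f a - f b - g \<bullet> (a - b)) <= 1 * norm (norm (a - b))) (nhds x \<times>\<^sub>F nhds x)"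
  using landau_o.smallD[OF assms[unfolded strict_gradient_def], of 1] by (simp add: case_prod_unfold)
 then have "eventually (\<lambda>a. norm (f a - f x - g \<bullet> (a - x)) <= norm (a - x)) (nhds x)"
  unfolding eventually_prod_filter
  by (auto elim!: eventually_mono dest: eventually_nhds_x_imp_x)
 then have "eventually (\<lambda>a. norm (f a - f x) <= norm (a - x) * (1 + norm g)) (nhds x)"
 proof eventually_elim
  case (elim a)
  have "\<bar>g \<bullet> (a - x)\<bar> <= norm g * norm (a - x)" by (rule Cauchy_Schwarz_ineq2)
  then show ?case using elim by (simp add: algebra_simps abs_le_iff)
 qed
 moreover have "((\<lambda>a. norm (a - x) * (1 + norm g)) \<longlongrightarrow> norm (x - x) * (1 + norm g)) (nhds x)"
  by (intro tendsto_intros filterlim_ident)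
 ultimately have "((\<lambda>a. f a - f x) \<longlongrightarrow> 0) (nhds x)"
  by (intro Lim_null_comparison[of "\<lambda>a. f a - f x"]) auto
 then show ?thesis by (simp add: LIM_zero_iff)
qed

lemma bigo_inner_diff: "(\<lambda>(a, b). g \<bullet> (a - b)) \<in> O[F](\<lambda>(a, b). norm (a - b))"
 by (rule bigoI[of _ "norm g"]) (auto simp: case_prod_unfold Cauchy_Schwarz_ineq2)

lemma strict_gradient_const: "strict_gradient (\<lambda>_. c) 0 x"
 by (simp add: strict_gradient_def case_prod_unfold)

lemma strict_gradient_inner: "strict_gradient (\<lambda>a. g \<bullet> a) g x"
 by (simp add: strict_gradient_def case_prod_unfold inner_diff_right)

lemma strict_gradient_add:
 assumes "strict_gradient f g x" "strict_gradient f' g' x"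
 shows "strict_gradient (\<lambda>a. f a + f' a) (g + g') x"
 using sum_in_smallo(1)[OF assms[unfolded strict_gradient_def]]
 by (simp add: strict_gradient_def case_prod_unfold algebra_simps)

lemma tendsto_prod_filter_fst:
 assumes "(f \<longlongrightarrow> c) F"
 shows "((\<lambda>z. f (fst z)) \<longlongrightarrow> c) (F \<times>\<^sub>F G)"
 using filterlim_compose[OF assms filterlim_fst] .

lemma tendsto_prod_filter_snd:
 assumes "(f \<longlongrightarrow> c) G"
 shows "((\<lambda>z. f (snd z)) \<longlongrightarrow> c) (F \<times>\<^sub>F G)"
 using filterlim_compose[OF assms filterlim_snd] .

lemma strict_gradient_mult:
 assumes f: "strict_gradient f g x" and f': "strict_gradient f' g' x"
 shows "strict_gradient (\<lambda>a. f a * f' a) (f x *\<^sub>R g' + f' x *\<^sub>R g) x"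
proof -
 let ?F = "nhds x \<times>\<^sub>F nhds x" and ?d = "\<lambda>z::'a \<times> 'a. norm (fst z - snd z)"
 note c = strict_gradient_continuous[OF f] and c' = strict_gradient_continuous[OF f']
 \<comment> \<open>The increment of the product is split into four terms: \<open>1\<close> and
   \<open>3\<close> carry the errors of the factors, \<open>2\<close> and \<open>4\<close> replace
   the values at the moving points by those at \<open>x\<close>.\<close>
 have 1: "(\<lambda>z. f (fst z) * (f' (fst z) - f' (snd z) - g' \<bullet> (fst z - snd z))) \<in> o[?F](?d)"
  by (rule bigo_one_mult[OF tendsto_prod_filter_fst[OF c]])
    (use f' in \<open>simp add: strict_gradient_def case_prod_unfold\<close>)
 have 2: "(\<lambda>z. (f (fst z) - f x) * (g' \<bullet> (fst z - snd z))) \<in> o[?F](?d)"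
  using tendsto_prod_filter_fst[OF c] bigo_inner_diff[of g' ?F]
  by (intro smallo_one_mult) (auto simp: LIM_zero_iff case_prod_unfold)
 have 3: "(\<lambda>z. f' (snd z) * (f (fst z) - f (snd z) - g \<bullet> (fst z - snd z))) \<in> o[?F](?d)"
  by (rule bigo_one_mult[OF tendsto_prod_filter_snd[OF c']])
    (use f in \<open>simp add: strict_gradient_def case_prod_unfold\<close>)
 have 4: "(\<lambda>z. (f' (snd z) - f' x) * (g \<bullet> (fst z - snd z))) \<in> o[?F](?d)"
  using tendsto_prod_filter_snd[OF c'] bigo_inner_diff[of g ?F]
  by (intro smallo_one_mult) (auto simp: LIM_zero_iff case_prod_unfold)
 show ?thesis
  using sum_in_smallo(1)[OF sum_in_smallo(1)[OF 1 2] sum_in_smallo(1)[OF 3 4]]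
  by (simp add: strict_gradient_def case_prod_unfold inner_add_left algebra_simps)
qed

lemma strict_gradient_scale:
 assumes "strict_gradient f g x"
 shows "strict_gradient (\<lambda>a. c * f a) (c *\<^sub>R g) x"
 using strict_gradient_mult[OF strict_gradient_const assms, of c] by simp

lemma strict_gradient_diff:
 assumes "strict_gradient f g x" "strict_gradient f' g' x"
 shows "strict_gradient (\<lambda>a. f a - f' a) (g - g') x"
 using strict_gradient_add[OF assms(1) strict_gradient_scale[OF assms(2), of "-1"]] by simp

lemma strict_gradient_compose:
 fixes \<phi> :: "real => real"
 assumes f: "strict_gradient f g x" and \<phi>: "strict_gradient \<phi> c (f x)"
 shows "strict_gradient (\<lambda>a. \<phi> (f a)) (c *\<^sub>R g) x"
proof -
 let ?F = "nhds x \<times>\<^sub>F nhds x" and ?d = "\<lambda>z::'a \<times> 'a. norm (fst z - snd z)"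
 note ct = strict_gradient_continuous[OF f]
 have lim: "filterlim (\<lambda>z. (f (fst z), f (snd z))) (nhds (f x) \<times>\<^sub>F nhds (f x)) ?F"
  by (intro filterlim_Pair tendsto_prod_filter_fst[OF ct] tendsto_prod_filter_snd[OF ct])
 have fo: "(\<lambda>z. f (fst z) - f (snd z) - g \<bullet> (fst z - snd z)) \<in> o[?F](?d)"
  using f by (simp add: strict_gradient_def case_prod_unfold)
 have "(\<lambda>z. g \<bullet> (fst z - snd z)) \<in> O[?F](?d)"
  using bigo_inner_diff[of g ?F] by (simp add: case_prod_unfold)
 from sum_in_bigo(1)[OF landau_o.small_imp_big[OF fo] this]
 have fO: "(\<lambda>z. f (fst z) - f (snd z)) \<in> O[?F](?d)" by simp
 have "(\<lambda>z. \<phi> (f (fst z)) - \<phi> (f (snd z)) - c * (f (fst z) - f (snd z))) \<in> o[?F](\<lambda>z. norm (f (fst z) - f (snd z)))"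
  using landau_o.small.compose[OF \<phi>[unfolded strict_gradient_def] lim] by simp
 then have "(\<lambda>z. \<phi> (f (fst z)) - \<phi> (f (snd z)) - c * (f (fst z) - f (snd z))) \<in> o[?F](?d)"
  by (rule landau_o.small_big_trans) (use fO in simp)
 from sum_in_smallo(1)[OF this bigo_one_mult[OF tendsto_const fo, of c]]
 show ?thesis by (simp add: strict_gradient_def case_prod_unfold algebra_simps)
qed

text \<open>A derivative that is continuous at \<open>x\<close> makes the function strictly
  differentiable there, by the mean value theorem between the two moving points.\<close>

lemma strict_gradient_real:
 fixes \<phi> :: "real => real"
 assumes S: "open S" "x \<in> S" and d: "\<And>y. y \<in> S ==> (\<phi> has_real_derivative \<phi>' y) (at y)"
  and c: "isCont \<phi>' x"
 shows "strict_gradient \<phi> (\<phi>' x) x"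
 unfolding strict_gradient_def
proof (rule landau_o.smallI)
 fix e :: real assume "e > 0"
 obtain r1 where r1: "r1 > 0" "ball x r1 \<subseteq> S" using S open_contains_ball by blast
 obtain r2 where r2: "r2 > 0" "\<And>y. \<bar>y - x\<bar> < r2 ==> \<bar>\<phi>' y - \<phi>' x\<bar> < e"
  using c \<open>e > 0\<close> unfolding continuous_at_eps_delta dist_real_def by blast
 define r where "r = min r1 r2"
 have "\<bar>\<phi> a - \<phi> b - \<phi>' x * (a - b)\<bar> <= e * \<bar>a - b\<bar>" if ab: "\<bar>a - x\<bar> < r" "\<bar>b - x\<bar> < r" "b < a" for a b
 proof -
  have in_S: "y \<in> S" "\<bar>\<phi>' y - \<phi>' x\<bar> < e" if "b <= y" "y <= a" for y
  proof -
   have "\<bar>y - x\<bar> < r" using ab that by linarith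
   then show "y \<in> S" "\<bar>\<phi>' y - \<phi>' x\<bar> < e" using r1(2) r2(2) by (auto simp: r_def dist_real_def subset_iff)
  qed
  obtain z where z: "b < z" "z < a" "\<phi> a - \<phi> b = (a - b) * \<phi>' z"
   using MVT2[OF ab(3), of \<phi> \<phi>'] d in_S by auto
  have "\<phi> a - \<phi> b - \<phi>' x * (a - b) = (\<phi>' z - \<phi>' x) * (a - b)" using z(3) by (simp add: algebra_simps)
  then show ?thesis using in_S(2)[of z] z by (auto simp: abs_mult intro!: mult_right_mono)
 qed
 then have *: "\<bar>\<phi> a - \<phi> b - \<phi>' x * (a - b)\<bar> <= e * \<bar>a - b\<bar>" if "\<bar>a - x\<bar> < r" "\<bar>b - x\<bar> < r" for a b
  using that
  by (cases a b rule: linorder_cases) (fastforce simp: abs_minus_commute algebra_simps)+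
 have "eventually (\<lambda>a. \<bar>a - x\<bar> < r) (nhds x)"
  using r1(1) r2(1) unfolding eventually_nhds_metric by (intro exI[of _ r]) (auto simp: r_def dist_real_def)
 from eventually_prodI[OF this this]
 show "\<forall>\<^sub>F z in nhds x \<times>\<^sub>F nhds x. norm (case z of (a, b) => \<phi> a - \<phi> b - \<phi>' x \<bullet> (a - b)) <= e * norm (case z of (a, b) => norm (a - b))"
  by eventually_elim (auto simp: * case_prod_unfold)
qed

section \<open>First-order expansion of weighted means and their level sets\<close>

definition weighted_mean :: "nat set => (nat => 'p => real) => (nat => real) => 'p => real" where
 "weighted_mean A l w \<theta> = (\<Sum>t\<in>A. w t * l t \<theta>) / (\<Sum>t\<in>A. w t)"

text \<open>The expansion is joint in the weight increment \<open>s * v\<close> and the parameter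
  increment \<open>a - b\<close>, with an error that is uniform as the base weights and both
  parameters converge. This uniformity allows it to be applied at all nearby pairs of points of a
  level set.\<close>

lemma weighted_mean_expansion:
 fixes l :: "nat => 'p::euclidean_space => real" and w :: "nat => real"
 assumes A: "finite A" "A \<subseteq> I" and l: "\<And>t. t \<in> A ==> strict_gradient (l t) (g t) \<theta>"
  and W: "(\<Sum>t\<in>A. w t) > 0"
 shows "(\<lambda>(w', s, a, b). weighted_mean A l (shift I (\<lambda>t. s * v t) w') a - weighted_mean A l w' b -
      (s * (\<Sum>t\<in>A. v t * (l t \<theta> - weighted_mean A l w \<theta>)) + (\<Sum>t\<in>A. w t *\<^sub>R g t) \<bullet> (a - b)) / (\<Sum>t\<in>A. w t))
     \<in> o[nhds w \<times>\<^sub>F at_right 0 \<times>\<^sub>F nhds \<theta> \<times>\<^sub>F nhds \<theta>](\<lambda>(w', s, a, b). s + norm (a - b))"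
proof -
 define F where "F = nhds w \<times>\<^sub>F at_right (0::real) \<times>\<^sub>F nhds \<theta> \<times>\<^sub>F nhds \<theta>"
 define w' where "w' = (fst :: (nat => real) \<times> real \<times> 'p \<times> 'p => _)"
 define s where "s = (\<lambda>z :: (nat => real) \<times> real \<times> 'p \<times> 'p. fst (snd z))"
 define a where "a = (\<lambda>z :: (nat => real) \<times> real \<times> 'p \<times> 'p. fst (snd (snd z)))"
 define b where "b = (\<lambda>z :: (nat => real) \<times> real \<times> 'p \<times> 'p. snd (snd (snd z)))"
 define d where "d z = s z + norm (a z - b z)" for z
 have lim_w': "filterlim w' (nhds w) F" unfolding w'_def F_def by (rule filterlim_fst)
 have lim_s: "filterlim s (at_right 0) F" unfolding s_def F_def
  by (rule filterlim_compose[OF filterlim_fst filterlim_snd])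
 have lim_a: "filterlim a (nhds \<theta>) F" unfolding a_def F_def
  by (rule filterlim_compose[OF filterlim_compose[OF filterlim_fst filterlim_snd] filterlim_snd])
 have lim_b: "filterlim b (nhds \<theta>) F" unfolding b_def F_def
  by (rule filterlim_compose[OF filterlim_compose[OF filterlim_snd filterlim_snd] filterlim_snd])
 have lim_ab: "filterlim (\<lambda>z. (a z, b z)) (nhds \<theta> \<times>\<^sub>F nhds \<theta>) F"
  by (intro filterlim_Pair lim_a lim_b)
 have lim_s0: "(s \<longlongrightarrow> 0) F" using lim_s filterlim_at by blast
 have s_pos: "eventually (\<lambda>z. s z > 0) F"
  using lim_s by (auto simp: filterlim_at elim!: eventually_mono)
 have lim_wt: "((\<lambda>z. w' z t) \<longlongrightarrow> w t) F" for t
 proof -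
  have "continuous_on UNIV (\<lambda>x::nat => real. x t)" by (rule continuous_on_product_coordinates)
  then have "isCont (\<lambda>x::nat => real. x t) w" using continuous_on_eq_continuous_at[OF open_UNIV] by blast
  then show ?thesis using isCont_tendsto_compose[OF _ lim_w'] by fastforce
 qed
 have ab_O: "(\<lambda>z. norm (a z - b z)) \<in> O[F](d)"
  using s_pos by (intro bigoI[of _ 1]) (auto simp: d_def elim!: eventually_mono)
 have s_O: "s \<in> O[F](d)"
  using s_pos by (intro bigoI[of _ 1]) (auto simp: d_def elim!: eventually_mono)
 have l_o: "(\<lambda>z. l t (a z) - l t (b z) - g t \<bullet> (a z - b z)) \<in> o[F](d)" if "t \<in> A" for t
  using landau_o.small_big_trans[OF landau_o.small.compose[OF l[OF that, unfolded strict_gradient_def] lim_ab]] ab_O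
  by simp
 have g_O: "(\<lambda>z. g t \<bullet> (a z - b z)) \<in> O[F](d)" for t
  by (rule landau_o.big_trans[OF _ ab_O]) (auto intro!: bigoI[of _ "norm (g t)"] simp: Cauchy_Schwarz_ineq2)
 have lim_la: "((\<lambda>z. l t (a z)) \<longlongrightarrow> l t \<theta>) F" "((\<lambda>z. l t (b z)) \<longlongrightarrow> l t \<theta>) F" if "t \<in> A" for t
  using filterlim_compose[OF strict_gradient_continuous[OF l[OF that]]] lim_a lim_b by auto
 define W'' where "W'' z = (\<Sum>t\<in>A. w' z t + s z * v t)" for z
 define W' where "W' z = (\<Sum>t\<in>A. w' z t)" for z
 define W0 where "W0 = (\<Sum>t\<in>A. w t)"
 define \<gamma> where "\<gamma> = weighted_mean A l w \<theta>"
 define \<gamma>' where "\<gamma>' z = weighted_mean A l (w' z) (b z)" for z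
 have lim_W'': "(W'' \<longlongrightarrow> W0) F"
 proof -
  have "((\<lambda>z. w' z t + s z * v t) \<longlongrightarrow> w t + 0) F" for t
   by (intro tendsto_add lim_wt tendsto_mult_left_zero lim_s0)
  then show ?thesis unfolding W''_def[abs_def] W0_def by (intro tendsto_sum) simp
 qed
 have lim_W': "(W' \<longlongrightarrow> W0) F" unfolding W'_def[abs_def] W0_def by (intro tendsto_intros lim_wt)
 have lim_\<gamma>': "(\<gamma>' \<longlongrightarrow> \<gamma>) F"
  using lim_W' W unfolding \<gamma>'_def[abs_def] \<gamma>_def weighted_mean_def W'_def[symmetric] W0_def[symmetric]
  by (intro tendsto_intros lim_wt lim_la) auto
 have ne: "eventually (\<lambda>z. W'' z > 0 \<and> W' z > 0) F"
  using order_tendstoD(1)[OF lim_W'', of 0] order_tendstoD(1)[OF lim_W', of 0] W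
  by (simp add: W0_def eventually_conj)
 define X where "X z = (\<Sum>t\<in>A. w' z t * (l t (a z) - l t (b z)))" for z
 define Y where "Y z = (\<Sum>t\<in>A. v t * (l t (a z) - \<gamma>' z))" for z
 define G where "G = (\<Sum>t\<in>A. w t *\<^sub>R g t)"
 define Y0 where "Y0 = (\<Sum>t\<in>A. v t * (l t \<theta> - \<gamma>))"
 \<comment> \<open>An exact identity: \<open>X\<close> is the effect of the parameter at the old
   weights, \<open>s * Y\<close> that of the weights at the new parameter, and the old mean
   \<open>\<gamma>'\<close> cancels.\<close>
 have eq: "eventually (\<lambda>z. weighted_mean A l (shift I (\<lambda>t. s z * v t) (w' z)) (a z) - \<gamma>' z = (X z + s z * Y z) / W'' z) F"
  using ne
 proof eventually_elim
  case (elim z)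
  have sh: "shift I (\<lambda>t. s z * v t) (w' z) t = w' z t + s z * v t" if "t \<in> A" for t
   using A that by (auto simp: shift_def)
  have "weighted_mean A l (shift I (\<lambda>t. s z * v t) (w' z)) (a z) = (\<Sum>t\<in>A. (w' z t + s z * v t) * l t (a z)) / W'' z"
   unfolding weighted_mean_def W''_def using sh by simp
  moreover have "(\<Sum>t\<in>A. (w' z t + s z * v t) * l t (a z)) - \<gamma>' z * W'' z
    = X z + s z * Y z + ((\<Sum>t\<in>A. w' z t * l t (b z)) - \<gamma>' z * W' z)"
   by (simp add: X_def Y_def W''_def W'_def algebra_simps sum.distrib sum_subtractf sum_distrib_left)
  moreover have "(\<Sum>t\<in>A. w' z t * l t (b z)) - \<gamma>' z * W' z = 0"
   using elim by (simp add: \<gamma>'_def weighted_mean_def W'_def)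
  ultimately show ?case using elim by (simp add: field_simps)
 qed
 have X_o: "(\<lambda>z. X z - G \<bullet> (a z - b z)) \<in> o[F](d)"
 proof -
  have "(\<lambda>z. w' z t * (l t (a z) - l t (b z) - g t \<bullet> (a z - b z)) + (w' z t - w t) * (g t \<bullet> (a z - b z))) \<in> o[F](d)"
   if "t \<in> A" for t
   using lim_wt[of t] by (intro sum_in_smallo bigo_one_mult[OF lim_wt l_o[OF that]] smallo_one_mult[OF _ g_O])
    (simp add: LIM_zero_iff)
  then have "(\<lambda>z. \<Sum>t\<in>A. w' z t * (l t (a z) - l t (b z) - g t \<bullet> (a z - b z)) + (w' z t - w t) * (g t \<bullet> (a z - b z))) \<in> o[F](d)"
   by (rule big_sum_in_smallo)
  then show ?thesis
   by (simp add: X_def G_def inner_sum_left algebra_simps sum.distrib sum_subtractf)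
 qed
 have Y_o: "(\<lambda>z. s z * Y z - s z * Y0) \<in> o[F](d)"
 proof -
  have "(Y \<longlongrightarrow> Y0) F" unfolding Y_def[abs_def] Y0_def by (intro tendsto_intros lim_la lim_\<gamma>')
  then have "(\<lambda>z. (Y z - Y0) * s z) \<in> o[F](d)" by (intro smallo_one_mult s_O) (simp add: LIM_zero_iff)
  then show ?thesis by (simp add: algebra_simps)
 qed
 have G_O: "(\<lambda>z. G \<bullet> (a z - b z) + s z * Y0) \<in> O[F](d)"
 proof (rule sum_in_bigo(1))
  show "(\<lambda>z. G \<bullet> (a z - b z)) \<in> O[F](d)"
   by (rule landau_o.big_trans[OF _ ab_O]) (auto intro!: bigoI[of _ "norm G"] simp: Cauchy_Schwarz_ineq2)
  show "(\<lambda>z. s z * Y0) \<in> O[F](d)"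
   by (rule landau_o.big_trans[OF _ s_O]) (auto intro!: bigoI[of _ "\<bar>Y0\<bar>"] simp: abs_mult)
 qed
 have inv: "((\<lambda>z. inverse (W'' z)) \<longlongrightarrow> inverse W0) F"
  using lim_W'' W by (intro tendsto_inverse) (auto simp: W0_def)
 have 1: "(\<lambda>z. inverse (W'' z) * ((X z - G \<bullet> (a z - b z)) + (s z * Y z - s z * Y0))) \<in> o[F](d)"
  by (rule bigo_one_mult[OF inv sum_in_smallo(1)[OF X_o Y_o]])
 have 2: "(\<lambda>z. (inverse (W'' z) - inverse W0) * (G \<bullet> (a z - b z) + s z * Y0)) \<in> o[F](d)"
  using inv by (intro smallo_one_mult[OF _ G_O]) (simp add: LIM_zero_iff)
 have A: "(\<lambda>z. (X z + s z * Y z) / W'' z - (s z * Y0 + G \<bullet> (a z - b z)) / W0) \<in> o[F](d)"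
  using sum_in_smallo(1)[OF 1 2] by (simp add: divide_inverse algebra_simps)
 have B: "eventually (\<lambda>z. (X z + s z * Y z) / W'' z - (s z * Y0 + G \<bullet> (a z - b z)) / W0 =
   weighted_mean A l (shift I (\<lambda>t. s z * v t) (w' z)) (a z) - \<gamma>' z - (s z * Y0 + G \<bullet> (a z - b z)) / W0) F"
  using eq by eventually_elim simp
 have "(\<lambda>z. weighted_mean A l (shift I (\<lambda>t. s z * v t) (w' z)) (a z) - \<gamma>' z - (s z * Y0 + G \<bullet> (a z - b z)) / W0) \<in> o[F](d)"
  by (rule landau_o.small.in_cong[OF B, THEN iffD1, OF A])
 then show ?thesis
  by (simp add: \<gamma>'_def[abs_def] Y0_def G_def \<gamma>_def W0_def d_def[abs_def] s_def a_def b_def w'_def F_def case_prod_unfold)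
qed

text \<open>Duality: a proper subspace has a nonzero orthogonal vector. Independence is available
  below as a trivial annihilator, while the proof needs solutions \<open>v\<close>.\<close>

lemma spanning_family:
 fixes x :: "nat => 'p::euclidean_space"
 assumes "finite J" "\<And>z. (\<And>t. t \<in> J ==> z \<bullet> x t = 0) ==> z = 0"
 obtains v where "(\<Sum>t\<in>J. v t *\<^sub>R x t) = p"
proof -
 have "span (x ` J) = UNIV"
 proof (rule ccontr)
  assume "span (x ` J) \<noteq> UNIV"
  then have "span (x ` J) \<subset> span UNIV" by (simp add: psubset_eq)
  then obtain z where z: "z \<noteq> 0" "\<And>y. y \<in> span (x ` J) ==> orthogonal z y"
   by (rule orthogonal_to_subspace_exists_gen) blast
  have "z = 0"
  proof (rule assms(2))
   fix t assume "t \<in> J"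
   then have "x t \<in> span (x ` J)" by (intro span_base imageI)
   then show "z \<bullet> x t = 0" using z(2) unfolding orthogonal_def by blast
  qed
  with z(1) show False by simp
 qed
 moreover have "span (x ` J) \<subseteq> range (\<lambda>v. \<Sum>t\<in>J. v t *\<^sub>R x t)"
 proof (rule span_minimal)
  show "x ` J \<subseteq> range (\<lambda>v. \<Sum>t\<in>J. v t *\<^sub>R x t)"
  proof
   fix y assume "y \<in> x ` J"
   then obtain k where k: "k \<in> J" "y = x k" by blast
   have "(\<Sum>t\<in>J. (if t = k then 1 else 0) *\<^sub>R x t) = (\<Sum>t\<in>J. if t = k then x t else 0)"
    by (rule sum.cong) auto
   also have "\<dots> = y" using k assms(1) by (simp add: sum.delta)
   finally show "y \<in> range (\<lambda>v. \<Sum>t\<in>J. v t *\<^sub>R x t)" 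
    by (intro range_eqI[of _ _ "\<lambda>t. if t = k then 1 else 0"]) simp
  qed
  show "subspace (range (\<lambda>v. \<Sum>t\<in>J. v t *\<^sub>R x t))"
  proof (rule subspaceI)
   show "0 \<in> range (\<lambda>v. \<Sum>t\<in>J. v t *\<^sub>R x t)" by (rule range_eqI[of _ _ "\<lambda>_. 0"]) simp
  next
   fix y z assume "y \<in> range (\<lambda>v. \<Sum>t\<in>J. v t *\<^sub>R x t)" "z \<in> range (\<lambda>v. \<Sum>t\<in>J. v t *\<^sub>R x t)"
   then obtain v v' where "y = (\<Sum>t\<in>J. v t *\<^sub>R x t)" "z = (\<Sum>t\<in>J. v' t *\<^sub>R x t)" by blast
   then show "y + z \<in> range (\<lambda>v. \<Sum>t\<in>J. v t *\<^sub>R x t)"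
    by (intro range_eqI[of _ _ "\<lambda>t. v t + v' t"]) (simp add: scaleR_add_left sum.distrib)
  next
   fix c y assume "y \<in> range (\<lambda>v. \<Sum>t\<in>J. v t *\<^sub>R x t)"
   then obtain v where "y = (\<Sum>t\<in>J. v t *\<^sub>R x t)" by blast
   then show "c *\<^sub>R y \<in> range (\<lambda>v. \<Sum>t\<in>J. v t *\<^sub>R x t)"
    by (intro range_eqI[of _ _ "\<lambda>t. c * v t"]) (simp add: scaleR_sum_right)
  qed
 qed
 ultimately have "p \<in> range (\<lambda>v. \<Sum>t\<in>J. v t *\<^sub>R x t)" by blast
 then obtain v where "p = (\<Sum>t\<in>J. v t *\<^sub>R x t)" by blast
 then show ?thesis using that by simp
qed

text \<open>Let \<open>D\<close> be the gradient of the estimate in the parameter and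
  \<open>r\<close> its derivative in the weights. Independence provides a weight direction
  \<open>v0\<close> along which \<open>r\<close> has total effect 1 while the loss gradients sum to
  \<open>- D\<close>. If two points of the level set differ by \<open>s\<close> times this
  direction, the expansion forces the sum of \<open>v0\<close> times the loss increments to be close
  to \<open>s\<close>, hence positive; monotonicity of the supergradient makes it nonpositive. The
  only way out is a parameter increment too large for the expansion, and this means that some loss
  moves by more than \<open>K * s\<close>.\<close>

lemma weighted_level_null:
 fixes loss l1 l2 :: "nat => 'p::euclidean_space => real" and \<tau> :: "(nat => real) => 'p"
 assumes I: "finite I" "I \<noteq> {}"
  and u: "\<And>k. k \<in> I ==> (\<lambda>w. loss k (\<tau> w)) \<in> borel_measurable (PiM I (\<lambda>_. borel))"
  and \<tau>: "\<tau> \<in> borel_measurable (PiM I (\<lambda>_. borel))"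
  and min: "\<And>w w'. w \<in> PiE I (\<lambda>_. UNIV) ==> w' \<in> PiE I (\<lambda>_. UNIV) ==>
        (\<Sum>i\<in>I. w' i * loss i (\<tau> w')) <= (\<Sum>i\<in>I. w' i * loss i (\<tau> w))"
  and S: "S \<in> sets (PiM I (\<lambda>_. borel))"
  and A: "A1 \<subseteq> I" "A2 \<subseteq> I"
  and pos: "\<And>w t. w \<in> S ==> t \<in> I ==> w t > 0"
  and lev: "\<And>w. w \<in> S ==> weighted_mean A1 l1 w (\<tau> w) + weighted_mean A2 l2 w (\<tau> w) = c"
  and l1: "\<And>w t. w \<in> S ==> t \<in> A1 ==> \<exists>g. strict_gradient (l1 t) g (\<tau> w)"
  and l2: "\<And>w t. w \<in> S ==> t \<in> A2 ==> \<exists>g. strict_gradient (l2 t) g (\<tau> w)"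
  and nondeg: "\<And>w. w \<in> S ==> \<exists>J g. J \<noteq> {} \<and> J \<subseteq> A1 \<inter> A2 \<and> (\<forall>t\<in>J. strict_gradient (loss t) (g t) (\<tau> w)) \<and>
    (\<forall>b1>0. \<forall>b2>0. \<forall>b0 z1 z2. (\<forall>t\<in>J. z1 \<bullet> g t + z2 * (b1 * l1 t (\<tau> w) + b2 * l2 t (\<tau> w) - b0) = 0) -->
     z1 = 0 \<and> z2 = 0)"
 shows "S \<in> null_sets (PiM I (\<lambda>_. lborel))"
proof (rule supergradient_locally_injective_null[OF I, where \<tau> = \<tau> and u = "\<lambda>w k. loss k (\<tau> w)"])
 fix w assume w: "w \<in> S"
 define \<theta> where "\<theta> = \<tau> w"
 obtain J g where J: "J \<noteq> {}" "J \<subseteq> A1 \<inter> A2" "\<And>t. t \<in> J ==> strict_gradient (loss t) (g t) \<theta>"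
  and nd: "\<And>b1 b2 b0 z1 z2. b1 > 0 ==> b2 > 0 ==>
     (\<And>t. t \<in> J ==> z1 \<bullet> g t + z2 * (b1 * l1 t \<theta> + b2 * l2 t \<theta> - b0) = 0) ==> z1 = 0 \<and> z2 = 0"
  using nondeg[OF w] unfolding \<theta>_def by metis
 obtain g1 where g1: "\<And>t. t \<in> A1 ==> strict_gradient (l1 t) (g1 t) \<theta>" using l1[OF w] unfolding \<theta>_def by metis
 obtain g2 where g2: "\<And>t. t \<in> A2 ==> strict_gradient (l2 t) (g2 t) \<theta>" using l2[OF w] unfolding \<theta>_def by metis
 have fin: "finite A1" "finite A2" "finite J"
  using finite_subset[OF A(1) I(1)] finite_subset[OF A(2) I(1)] finite_subset[OF J(2)] by auto
 define W1 W2 where "W1 = (\<Sum>t\<in>A1. w t)" and "W2 = (\<Sum>t\<in>A2. w t)"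
 have "A1 \<noteq> {}" "A2 \<noteq> {}" using J by auto
 then have W: "W1 > 0" "W2 > 0" unfolding W1_def W2_def
  using A fin pos[OF w] by (auto intro!: sum_pos)
 define \<gamma>1 \<gamma>2 where "\<gamma>1 = weighted_mean A1 l1 w \<theta>" and "\<gamma>2 = weighted_mean A2 l2 w \<theta>"
 define r where "r t = (l1 t \<theta> - \<gamma>1) / W1 + (l2 t \<theta> - \<gamma>2) / W2" for t
 have r_eq: "r t = (1 / W1) * l1 t \<theta> + (1 / W2) * l2 t \<theta> - (\<gamma>1 / W1 + \<gamma>2 / W2)" for t
  by (simp add: r_def diff_divide_distrib)
 have span: "\<exists>v. (\<Sum>t\<in>J. v t *\<^sub>R g t) = p \<and> (\<Sum>t\<in>J. v t * r t) = q" for p q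
 proof -
  have "z = 0" if z: "\<And>t. t \<in> J ==> z \<bullet> (g t, r t) = 0" for z
  proof -
   have "fst z = 0 \<and> snd z = 0"
    by (rule nd[of "1 / W1" "1 / W2" "fst z" "snd z" "\<gamma>1 / W1 + \<gamma>2 / W2"])
      (use W z in \<open>auto simp: inner_prod_def r_eq\<close>)
   then show "z = 0" by (simp add: prod_eq_iff)
  qed
  then obtain v where v: "(\<Sum>t\<in>J. v t *\<^sub>R (g t, r t)) = (p, q)"
   by (rule spanning_family[OF fin(3), of "\<lambda>t. (g t, r t)"])
  have "(\<Sum>t\<in>J. v t *\<^sub>R g t) = p \<and> (\<Sum>t\<in>J. v t * r t) = q"
   using arg_cong[OF v, of fst] arg_cong[OF v, of snd] by (simp add: fst_sum snd_sum)
  then show ?thesis by blast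
 qed
 define D where "D = (\<Sum>t\<in>A1. w t *\<^sub>R g1 t) /\<^sub>R W1 + (\<Sum>t\<in>A2. w t *\<^sub>R g2 t) /\<^sub>R W2"
 obtain v0 where v0: "(\<Sum>t\<in>J. v0 t *\<^sub>R g t) = - D" "(\<Sum>t\<in>J. v0 t * r t) = 1"
  using span[of "- D" 1] by blast
 \<comment> \<open>Expressing each vector \<open>b\<close> by loss gradients lets small loss
   increments bound every coordinate of the parameter increment.\<close>
 have "\<forall>b. \<exists>v. (\<Sum>t\<in>J. v t *\<^sub>R g t) = b" using span[of _ 0] by blast
 from choice[OF this] obtain vb where vb: "\<And>b. (\<Sum>t\<in>J. vb b t *\<^sub>R g t) = b" by blast
 \<comment> \<open>Observations outside \<open>J\<close> keep their weights. As \<open>J\<close>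
   lies in both index sets, the derivatives of both means involve all of \<open>v0\<close>.\<close>
 define v where "v t = (if t \<in> J then v0 t else 0)" for t
 have JI: "J \<subseteq> A1" "J \<subseteq> A2" "J \<subseteq> I" using J A by auto
 have v_sum: "(\<Sum>t\<in>A. v t * x t) = (\<Sum>t\<in>J. v0 t * x t)" if "J \<subseteq> A" "finite A" for A x
  unfolding v_def using that by (intro sum.mono_neutral_cong_right) auto
 have v_r: "(\<Sum>t\<in>A1. v t * (l1 t \<theta> - \<gamma>1)) / W1 + (\<Sum>t\<in>A2. v t * (l2 t \<theta> - \<gamma>2)) / W2 = 1"
  unfolding v_sum[OF JI(1) fin(1)] v_sum[OF JI(2) fin(2)] v0(2)[symmetric] r_def
  by (simp add: sum_divide_distrib distrib_left sum.distrib)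
 define F where "F = nhds w \<times>\<^sub>F at_right (0::real) \<times>\<^sub>F nhds \<theta> \<times>\<^sub>F nhds \<theta>"
 define d where "d = (\<lambda>(w' :: nat => real, s, a, b :: 'p). s + norm (a - b))"
 have lim_ab: "filterlim (\<lambda>(w', s, a, b). (a, b)) (nhds \<theta> \<times>\<^sub>F nhds \<theta>) F"
  unfolding F_def case_prod_unfold prod.collapse
  by (rule filterlim_compose[OF filterlim_snd filterlim_snd])
 have s_pos: "eventually (\<lambda>(w', s, a, b). s > 0) F"
 proof -
  have "filterlim (\<lambda>z. fst (snd z)) (at_right 0) F"
   unfolding F_def by (rule filterlim_compose[OF filterlim_fst filterlim_snd])
  then show ?thesis unfolding case_prod_unfold filterlim_at by (auto elim!: eventually_mono)
 qed
 have loss_o: "(\<lambda>(w', s, a, b). loss t a - loss t b - g t \<bullet> (a - b)) \<in> o[F](d)" if "t \<in> J" for t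
 proof -
  have "(\<lambda>(w' :: nat => real, s, a, b). norm (a - b)) \<in> O[F](d)"
   using s_pos by (intro bigoI[of _ 1]) (auto simp: d_def elim!: eventually_mono)
  from landau_o.small_big_trans[OF landau_o.small.compose[OF J(3)[OF that, unfolded strict_gradient_def] lim_ab]] this
  show ?thesis by (simp add: case_prod_unfold)
 qed
 \<comment> \<open>On the level set the four means cancel in \<open>RX\<close>, which leaves the
   weighted loss increments minus \<open>s\<close>.\<close>
 define RX where "RX = (\<lambda>(w', s, a, b).
   weighted_mean A1 l1 (shift I (\<lambda>t. s * v t) w') a + weighted_mean A2 l2 (shift I (\<lambda>t. s * v t) w') a
   - (weighted_mean A1 l1 w' b + weighted_mean A2 l2 w' b)
   + (\<Sum>t\<in>J. v0 t * (loss t a - loss t b)) - s)"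
 have RX: "RX \<in> o[F](d)"
 proof -
  have X1: "(\<lambda>(w', s, a, b). weighted_mean A1 l1 (shift I (\<lambda>t. s * v t) w') a - weighted_mean A1 l1 w' b -
      (s * (\<Sum>t\<in>A1. v t * (l1 t \<theta> - \<gamma>1)) + (\<Sum>t\<in>A1. w t *\<^sub>R g1 t) \<bullet> (a - b)) / W1) \<in> o[F](d)"
   unfolding F_def d_def \<gamma>1_def W1_def
   by (rule weighted_mean_expansion[OF fin(1) A(1) g1]) (use W in \<open>simp_all add: W1_def\<close>)
  have X2: "(\<lambda>(w', s, a, b). weighted_mean A2 l2 (shift I (\<lambda>t. s * v t) w') a - weighted_mean A2 l2 w' b -
      (s * (\<Sum>t\<in>A2. v t * (l2 t \<theta> - \<gamma>2)) + (\<Sum>t\<in>A2. w t *\<^sub>R g2 t) \<bullet> (a - b)) / W2) \<in> o[F](d)"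
   unfolding F_def d_def \<gamma>2_def W2_def
   by (rule weighted_mean_expansion[OF fin(2) A(2) g2]) (use W in \<open>simp_all add: W2_def\<close>)
  have X3: "(\<lambda>z. \<Sum>t\<in>J. v0 t * (case z of (w', s, a, b) => loss t a - loss t b - g t \<bullet> (a - b))) \<in> o[F](d)"
   by (intro big_sum_in_smallo landau_o.small.cmult_in_iff'[THEN iffD2] bigo_one_mult[OF tendsto_const] loss_o)
  have eq: "(\<Sum>t\<in>J. v0 t * (g t \<bullet> x)) = - (D \<bullet> x)" for x
   using arg_cong[OF v0(1), of "\<lambda>y. y \<bullet> x"] by (simp add: inner_sum_left)
  have "RX z = (case z of (w', s, a, b) => weighted_mean A1 l1 (shift I (\<lambda>t. s * v t) w') a - weighted_mean A1 l1 w' b -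
      (s * (\<Sum>t\<in>A1. v t * (l1 t \<theta> - \<gamma>1)) + (\<Sum>t\<in>A1. w t *\<^sub>R g1 t) \<bullet> (a - b)) / W1)
    + (case z of (w', s, a, b) => weighted_mean A2 l2 (shift I (\<lambda>t. s * v t) w') a - weighted_mean A2 l2 w' b -
      (s * (\<Sum>t\<in>A2. v t * (l2 t \<theta> - \<gamma>2)) + (\<Sum>t\<in>A2. w t *\<^sub>R g2 t) \<bullet> (a - b)) / W2)
    + (\<Sum>t\<in>J. v0 t * (case z of (w', s, a, b) => loss t a - loss t b - g t \<bullet> (a - b)))" for z
  proof -
   obtain w' s a b where z: "z = (w', s, a, b)" by (cases z) auto
   define T1 T2 where "T1 = (\<Sum>t\<in>A1. v t * (l1 t \<theta> - \<gamma>1))" and "T2 = (\<Sum>t\<in>A2. v t * (l2 t \<theta> - \<gamma>2))"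
   have "s * (T1 / W1 + T2 / W2) = s"
    unfolding v_r[folded T1_def T2_def] by simp
   then have "s * T1 / W1 + s * T2 / W2 = s" by (simp add: distrib_left)
   moreover have "(\<Sum>t\<in>J. v0 t * (loss t a - loss t b - g t \<bullet> (a - b))) = (\<Sum>t\<in>J. v0 t * (loss t a - loss t b)) + D \<bullet> (a - b)"
    using eq[of "a - b"] by (simp add: right_diff_distrib sum_subtractf)
   moreover have "D \<bullet> (a - b) = (\<Sum>t\<in>A1. w t *\<^sub>R g1 t) \<bullet> (a - b) / W1 + (\<Sum>t\<in>A2. w t *\<^sub>R g2 t) \<bullet> (a - b) / W2"
    by (simp add: D_def inner_add_left divide_inverse)
   ultimately show ?thesis unfolding RX_def z T1_def[symmetric] T2_def[symmetric] prod.case add_divide_distrib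
    by linarith
  qed
  then have "RX = (\<lambda>z. (case z of (w', s, a, b) => weighted_mean A1 l1 (shift I (\<lambda>t. s * v t) w') a - weighted_mean A1 l1 w' b -
      (s * (\<Sum>t\<in>A1. v t * (l1 t \<theta> - \<gamma>1)) + (\<Sum>t\<in>A1. w t *\<^sub>R g1 t) \<bullet> (a - b)) / W1)
    + (case z of (w', s, a, b) => weighted_mean A2 l2 (shift I (\<lambda>t. s * v t) w') a - weighted_mean A2 l2 w' b -
      (s * (\<Sum>t\<in>A2. v t * (l2 t \<theta> - \<gamma>2)) + (\<Sum>t\<in>A2. w t *\<^sub>R g2 t) \<bullet> (a - b)) / W2)
    + (\<Sum>t\<in>J. v0 t * (case z of (w', s, a, b) => loss t a - loss t b - g t \<bullet> (a - b))))" by (rule ext)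
  then show ?thesis using sum_in_smallo(1)[OF sum_in_smallo(1)[OF X1 X2] X3] by simp
 qed
 define RB where "RB b' = (\<lambda>(w' :: nat => real, s :: real, a, b). (\<Sum>t\<in>J. vb b' t * (loss t a - loss t b)) - b' \<bullet> (a - b))" for b'
 have RB: "RB b' \<in> o[F](d)" for b'
 proof -
  have "(\<lambda>z. \<Sum>t\<in>J. vb b' t * (case z of (w', s, a, b) => loss t a - loss t b - g t \<bullet> (a - b))) \<in> o[F](d)"
   by (intro big_sum_in_smallo bigo_one_mult[OF tendsto_const] loss_o)
  moreover have "(\<Sum>t\<in>J. vb b' t * (g t \<bullet> x)) = b' \<bullet> x" for x
   using arg_cong[OF vb[of b'], of "\<lambda>y. y \<bullet> x"] by (simp add: inner_sum_left)
  ultimately show ?thesis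
   by (simp add: RB_def case_prod_unfold right_diff_distrib sum_subtractf)
 qed
 show "\<exists>v. \<forall>K>0. \<exists>U \<delta>. open U \<and> (w, \<tau> w) \<in> U \<and> \<delta> > 0 \<and>
    (\<forall>w' s. w' \<in> S --> 0 < s --> s < \<delta> --> shift I (\<lambda>i. s * v i) w' \<in> S --> (w', \<tau> w') \<in> U -->
     (shift I (\<lambda>i. s * v i) w', \<tau> (shift I (\<lambda>i. s * v i) w')) \<in> U -->
     (\<exists>k\<in>I. \<bar>loss k (\<tau> (shift I (\<lambda>i. s * v i) w')) - loss k (\<tau> w')\<bar> > K * s))"
 proof (intro exI[of _ v] allI impI)
  fix K :: real assume "K > 0"
  define n where "n = real DIM('p)"
  have "n >= 1" by (simp add: n_def Suc_le_eq)
  define C where "C = (\<Sum>b\<in>Basis. \<Sum>t\<in>J. \<bar>vb b t\<bar>)"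
  have "C >= 0" unfolding C_def by (intro sum_nonneg) auto
  \<comment> \<open>\<open>K'\<close> bounds the parameter increment relative to \<open>s\<close>
    once all loss increments are at most \<open>K * s\<close>; \<open>e\<close> then makes the error
    of the expansion at most \<open>s / 2\<close>.\<close>
  define K' where "K' = 2 * (C * K + 1)"
  have "K' > 0" using \<open>C >= 0\<close> \<open>K > 0\<close> by (simp add: K'_def add_nonneg_pos)
  define e where "e = 1 / (2 * (1 + K'))"
  have "e > 0" using \<open>K' > 0\<close> by (simp add: e_def)
  have "eventually (\<lambda>z. norm (RX z) <= e * norm (d z)) F" by (rule landau_o.smallD[OF RX \<open>e > 0\<close>])
  moreover have "eventually (\<lambda>z. \<forall>b\<in>Basis. norm (RB b z) <= (1 / (2 * n)) * norm (d z)) F"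
   using \<open>n >= 1\<close> by (intro eventually_ball_finite ballI landau_o.smallD[OF RB]) auto
  ultimately have "eventually (\<lambda>z. norm (RX z) <= e * norm (d z) \<and> (\<forall>b\<in>Basis. norm (RB b z) <= (1 / (2 * n)) * norm (d z))) F"
   by (rule eventually_conj)
  then obtain P Q1 Q2 Q3 where ev: "eventually P (nhds w)" "eventually Q1 (at_right (0::real))" "eventually Q2 (nhds \<theta>)" "eventually Q3 (nhds \<theta>)"
   and PQ: "\<And>w' s a b. P w' ==> Q1 s ==> Q2 a ==> Q3 b ==> norm (RX (w', s, a, b)) <= e * norm (d (w', s, a, b)) \<and>
     (\<forall>b'\<in>Basis. norm (RB b' (w', s, a, b)) <= (1 / (2 * n)) * norm (d (w', s, a, b)))"
   unfolding F_def eventually_prod_filter by metis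
  obtain U1 where U1: "open U1" "w \<in> U1" "\<And>x. x \<in> U1 ==> P x" using ev(1) unfolding eventually_nhds by blast
  obtain \<delta> where \<delta>: "\<delta> > 0" "\<And>x. 0 < x ==> x < \<delta> ==> Q1 x" using ev(2) unfolding eventually_at_right_field by auto
  obtain U2 where U2: "open U2" "\<theta> \<in> U2" "\<And>x. x \<in> U2 ==> Q2 x" using ev(3) unfolding eventually_nhds by blast
  obtain U3 where U3: "open U3" "\<theta> \<in> U3" "\<And>x. x \<in> U3 ==> Q3 x" using ev(4) unfolding eventually_nhds by blast
  have "\<exists>k\<in>I. \<bar>loss k (\<tau> (shift I (\<lambda>i. s * v i) w')) - loss k (\<tau> w')\<bar> > K * s"
   if w': "w' \<in> S" "0 < s" "s < \<delta>" and w'': "shift I (\<lambda>i. s * v i) w' \<in> S"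
    and U: "(w', \<tau> w') \<in> U1 \<times> (U2 \<inter> U3)" "(shift I (\<lambda>i. s * v i) w', \<tau> (shift I (\<lambda>i. s * v i) w')) \<in> U1 \<times> (U2 \<inter> U3)"
   for w' s
  proof (rule ccontr)
   assume "\<not> (\<exists>k\<in>I. \<bar>loss k (\<tau> (shift I (\<lambda>i. s * v i) w')) - loss k (\<tau> w')\<bar> > K * s)"
   then have lip: "\<bar>loss k (\<tau> (shift I (\<lambda>i. s * v i) w')) - loss k (\<tau> w')\<bar> <= K * s" if "k \<in> I" for k
    using that by force
   define ws where "ws = shift I (\<lambda>i. s * v i) w'"
   define a where "a = \<tau> ws"
   define b where "b = \<tau> w'"
   note lip = lip[folded ws_def, folded a_def b_def]
   have P': "P w'" "Q1 s" "Q2 a" "Q3 b" using U U1 U2 U3 w' \<delta> by (auto simp: a_def b_def ws_def)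
   have d: "d (w', s, a, b) = s + norm (a - b)" by (simp add: d_def)
   have d0: "\<bar>d (w', s, a, b)\<bar> = s + norm (a - b)" using w' by (simp add: d)
   have bas: "\<bar>b' \<bullet> (a - b)\<bar> <= (\<Sum>t\<in>J. \<bar>vb b' t\<bar>) * (K * s) + (1 / (2 * n)) * (s + norm (a - b))"
    if b': "b' \<in> Basis" for b'
   proof -
    have "\<bar>(\<Sum>t\<in>J. vb b' t * (loss t a - loss t b)) - b' \<bullet> (a - b)\<bar> <= (1 / (2 * n)) * (s + norm (a - b))"
     using PQ[OF P'] b' by (simp add: RB_def d0)
    moreover have "\<bar>\<Sum>t\<in>J. vb b' t * (loss t a - loss t b)\<bar> <= (\<Sum>t\<in>J. \<bar>vb b' t\<bar> * (K * s))"
     using lip JI by (intro order.trans[OF sum_abs] sum_mono) (auto simp: abs_mult intro!: mult_left_mono)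
    ultimately show ?thesis unfolding sum_distrib_right by linarith
   qed
   \<comment> \<open>The error shares of the basis vectors add up to half of
     \<open>s + norm (a - b)\<close>, and the part with \<open>norm (a - b)\<close> is absorbed on
     the left.\<close>
   have "norm (a - b) <= (\<Sum>b'\<in>Basis. \<bar>(a - b) \<bullet> b'\<bar>)" by (rule norm_le_l1)
   also have "\<dots> <= (\<Sum>b'\<in>Basis. (\<Sum>t\<in>J. \<bar>vb b' t\<bar>) * (K * s) + (1 / (2 * n)) * (s + norm (a - b)))"
    using bas by (intro sum_mono) (simp add: inner_commute)
   also have "\<dots> = C * (K * s) + n * ((1 / (2 * n)) * (s + norm (a - b)))"
    by (simp add: sum.distrib C_def sum_distrib_right n_def)
   also have "\<dots> = C * (K * s) + (s + norm (a - b)) / 2" using \<open>n >= 1\<close> by simp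
   finally have "norm (a - b) <= 2 * (C * (K * s)) + s" by (simp add: field_simps)
   then have ab: "norm (a - b) <= K' * s" using w'(2) by (simp add: K'_def algebra_simps)
   have "\<bar>RX (w', s, a, b)\<bar> <= e * (s + norm (a - b))" using PQ[OF P'] by (simp add: d0)
   also have "\<dots> <= e * (s + K' * s)" using ab \<open>e > 0\<close> by (intro mult_left_mono) auto
   also have "\<dots> = s / 2" using \<open>K' > 0\<close> by (simp add: e_def field_simps)
   finally have "RX (w', s, a, b) >= - (s / 2)" by simp
   moreover have "weighted_mean A1 l1 ws a + weighted_mean A2 l2 ws a = c"
    unfolding a_def using lev w'' by (simp add: ws_def)
   moreover have "weighted_mean A1 l1 w' b + weighted_mean A2 l2 w' b = c"
    unfolding b_def using lev w' by simp
   ultimately have "(\<Sum>t\<in>J. v0 t * (loss t a - loss t b)) > 0"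
    using w'(2) by (simp add: RX_def ws_def)
   \<comment> \<open>Each of \<open>a\<close> and \<open>b\<close> is minimal for its own weights;
     adding both inequalities leaves the increments of the weights, which are supported on
     \<open>J\<close>.\<close>
   moreover have "s * (\<Sum>t\<in>J. v0 t * (loss t a - loss t b)) <= 0"
   proof -
    have P1: "w' \<in> PiE I (\<lambda>_. UNIV)" "ws \<in> PiE I (\<lambda>_. UNIV)"
     using sets.sets_into_space[OF S] w' by (auto simp: space_PiM ws_def)
    have "(\<Sum>i\<in>I. ws i * loss i a) + (\<Sum>i\<in>I. w' i * loss i b) <= (\<Sum>i\<in>I. ws i * loss i b) + (\<Sum>i\<in>I. w' i * loss i a)"
     unfolding a_def b_def using P1 by (intro add_mono min)
    then have "(\<Sum>i\<in>I. (ws i - w' i) * (loss i a - loss i b)) <= 0"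
     by (simp add: algebra_simps sum.distrib sum_subtractf)
    also have "(\<Sum>i\<in>I. (ws i - w' i) * (loss i a - loss i b)) = (\<Sum>i\<in>I. s * (v i * (loss i a - loss i b)))"
     by (intro sum.cong) (auto simp: ws_def shift_def)
    also have "\<dots> = s * (\<Sum>t\<in>J. v0 t * (loss t a - loss t b))"
     unfolding sum_distrib_left[symmetric] v_sum[OF JI(3) I(1)] ..
    finally show ?thesis .
   qed
   ultimately show False using w'(2) by (simp add: mult_le_0_iff)
  qed
  then show "\<exists>U \<delta>. open U \<and> (w, \<tau> w) \<in> U \<and> \<delta> > 0 \<and>
    (\<forall>w' s. w' \<in> S --> 0 < s --> s < \<delta> --> shift I (\<lambda>i. s * v i) w' \<in> S --> (w', \<tau> w') \<in> U -->
     (shift I (\<lambda>i. s * v i) w', \<tau> (shift I (\<lambda>i. s * v i) w')) \<in> U -->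
     (\<exists>k\<in>I. \<bar>loss k (\<tau> (shift I (\<lambda>i. s * v i) w')) - loss k (\<tau> w')\<bar> > K * s))"
   using U1 U2 U3 \<delta>
   by (intro exI[of _ "U1 \<times> (U2 \<inter> U3)"] exI[of _ \<delta>]) (simp add: open_Times open_Int \<theta>_def[symmetric])
 qed
qed (use u \<tau> min S in auto)

section \<open>Gradients of the loss and of the logarithms\<close>

lemma strict_gradient_eq:
 assumes "strict_gradient f g x" "g = g'"
 shows "strict_gradient f g' x"
 using assms by simp

lemma strict_gradient_ln: "x > 0 ==> strict_gradient ln (1 / x) (x :: real)"
 by (rule strict_gradient_real[of "{0<..}"])
   (auto intro!: derivative_eq_intros continuous_intros simp: inverse_eq_divide)

lemma strict_gradient_abs: "x \<noteq> 0 ==> strict_gradient abs (sgn x) (x :: real)"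
proof (cases "x > 0")
 case True
 have "(abs has_real_derivative 1) (at y)" if "y \<in> {0<..}" for y :: real
  by (rule has_field_derivative_transform_within_open[of "\<lambda>x. x" _ _ "{0<..}"]) (use that in auto)
 from strict_gradient_real[of "{0<..}" x, OF _ _ this] show ?thesis using True by simp
next
 assume "x \<noteq> 0"
 case False
 have "(abs has_real_derivative -1) (at y)" if "y \<in> {..<0}" for y :: real
  by (rule has_field_derivative_transform_within_open[of "\<lambda>x. - x" _ _ "{..<0}"])
    (use that in \<open>auto intro!: derivative_eq_intros\<close>)
 from strict_gradient_real[of "{..<0}" x, OF _ _ this] show ?thesis using False \<open>x \<noteq> 0\<close> by simp
qed

lemma strict_gradient_sqrt: "x > 0 ==> strict_gradient sqrt (inverse (sqrt x) / 2) (x :: real)"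
 by (rule strict_gradient_real[of "{0<..}"])
   (auto intro!: derivative_eq_intros continuous_intros)

lemma strict_gradient_inverse: "x \<noteq> 0 ==> strict_gradient inverse (- (inverse x * inverse x)) (x :: real)"
 by (rule strict_gradient_real[of "- {0}"])
   (auto intro!: derivative_eq_intros continuous_intros)

lemma strict_gradient_fst: "strict_gradient (\<lambda>\<theta> :: real \<times> real \<times> real. fst \<theta>) (1, 0, 0) \<theta>0"
 using strict_gradient_inner[of "(1, 0, 0) :: real \<times> real \<times> real"] by (simp add: inner_prod_def)

lemma strict_gradient_fst_snd: "strict_gradient (\<lambda>\<theta> :: real \<times> real \<times> real. fst (snd \<theta>)) (0, 1, 0) \<theta>0"
 using strict_gradient_inner[of "(0, 1, 0) :: real \<times> real \<times> real"] by (simp add: inner_prod_def)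

lemma strict_gradient_snd_snd: "strict_gradient (\<lambda>\<theta> :: real \<times> real \<times> real. snd (snd \<theta>)) (0, 0, 1) \<theta>0"
 using strict_gradient_inner[of "(0, 0, 1) :: real \<times> real \<times> real"] by (simp add: inner_prod_def)

text \<open>Projections and \<open>inverse\<close> in place of patterns and division: in this form
  the rules for gradients and for measurability apply term by term.\<close>

lemma qml_loss_unfold:
 "qml_loss Y t \<theta> = ln (snd (snd \<theta>) + (Y (t - 1))\<^sup>2 * fst (snd \<theta>)) / 2
   + \<bar>Y t - Y (t - 1) * fst \<theta>\<bar> * inverse (sqrt (snd (snd \<theta>) + (Y (t - 1))\<^sup>2 * fst (snd \<theta>)))"
 by (cases \<theta>) (simp only: qml_loss.simps resid.simps fst_conv snd_conv divide_inverse mult.commute)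

lemma resid_unfold:
 "resid \<theta> Y t = (Y t - Y (t - 1) * fst \<theta>) * inverse (sqrt (snd (snd \<theta>) + (Y (t - 1))\<^sup>2 * fst (snd \<theta>)))"
 by (cases \<theta>) (simp only: qml_loss.simps resid.simps fst_conv snd_conv divide_inverse mult.commute)

context
 fixes \<phi> \<alpha> \<omega> y x q :: real
 assumes pos: "\<alpha> > 0" "\<omega> > 0"
 defines "q \<equiv> \<omega> + y\<^sup>2 * \<alpha>"
begin

lemma q_pos: "q > 0"
 unfolding q_def using pos by (intro add_pos_nonneg) auto

lemma strict_gradient_scale_sq:
 "strict_gradient (\<lambda>\<theta>. snd (snd \<theta>) + y\<^sup>2 * fst (snd \<theta>)) (0, y\<^sup>2, 1) (\<phi>, \<alpha>, \<omega>)"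
 by (rule strict_gradient_eq[OF strict_gradient_add[OF strict_gradient_snd_snd
    strict_gradient_scale[OF strict_gradient_fst_snd]]]) simp

lemma strict_gradient_inverse_scale:
 "strict_gradient (\<lambda>\<theta>. inverse (sqrt (snd (snd \<theta>) + y\<^sup>2 * fst (snd \<theta>))))
   (- (1 / (2 * q * sqrt q)) *\<^sub>R (0, y\<^sup>2, 1)) (\<phi>, \<alpha>, \<omega>)"
proof -
 have 1: "strict_gradient (\<lambda>\<theta>. sqrt (snd (snd \<theta>) + y\<^sup>2 * fst (snd \<theta>)))
   ((inverse (sqrt q) / 2) *\<^sub>R (0, y\<^sup>2, 1)) (\<phi>, \<alpha>, \<omega>)"
  by (rule strict_gradient_compose[OF strict_gradient_scale_sq])
    (use strict_gradient_sqrt[OF q_pos] in \<open>simp add: q_def\<close>)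
 have 2: "strict_gradient (\<lambda>\<theta>. inverse (sqrt (snd (snd \<theta>) + y\<^sup>2 * fst (snd \<theta>))))
   ((- (inverse (sqrt q) * inverse (sqrt q))) *\<^sub>R (inverse (sqrt q) / 2) *\<^sub>R (0, y\<^sup>2, 1)) (\<phi>, \<alpha>, \<omega>)"
  by (rule strict_gradient_compose[OF 1])
    (use strict_gradient_inverse[of "sqrt q"] q_pos in \<open>simp add: q_def\<close>)
 have "- (inverse (sqrt q) * inverse (sqrt q)) * (inverse (sqrt q) / 2) = - (1 / (2 * q * sqrt q))"
  using q_pos by (simp add: field_simps)
 with 2 show ?thesis by (simp only: scaleR_scaleR)
qed

lemma strict_gradient_numerator:
 "strict_gradient (\<lambda>\<theta>. x - y * fst \<theta>) (- y, 0, 0) (\<phi>, \<alpha>, \<omega>)"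
 by (rule strict_gradient_eq[OF strict_gradient_diff[OF strict_gradient_const
    strict_gradient_scale[OF strict_gradient_fst]]]) simp

text \<open>The modulus is differentiable off its kink, whence \<open>e \<noteq> 0\<close>. In the
  components of \<open>\<alpha>\<close> and \<open>\<omega>\<close> the derivatives of the logarithm
  and of the scale combine to the factor \<open>1 - \<bar>e\<bar>\<close>.\<close>

lemma strict_gradient_loss:
 fixes e defines "e \<equiv> (x - \<phi> * y) / sqrt q"
 assumes "e \<noteq> 0"
 shows "strict_gradient (\<lambda>\<theta>. ln (snd (snd \<theta>) + y\<^sup>2 * fst (snd \<theta>)) / 2
   + \<bar>x - y * fst \<theta>\<bar> * inverse (sqrt (snd (snd \<theta>) + y\<^sup>2 * fst (snd \<theta>))))
   (- (sgn e * y / sqrt q), y\<^sup>2 * (1 - \<bar>e\<bar>) / (2 * q), (1 - \<bar>e\<bar>) / (2 * q)) (\<phi>, \<alpha>, \<omega>)"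
proof -
 have sq: "sqrt q > 0" using q_pos by simp
 have ne: "x - y * \<phi> \<noteq> 0" using assms(2) by (auto simp: e_def mult.commute)
 have sgn_e: "sgn (x - y * \<phi>) = sgn e" using sq by (simp add: e_def sgn_divide mult.commute)
 have abs_e: "\<bar>x - y * \<phi>\<bar> = \<bar>e\<bar> * sqrt q" using sq by (simp add: e_def abs_divide mult.commute)
 have 1: "strict_gradient (\<lambda>\<theta>. ln (snd (snd \<theta>) + y\<^sup>2 * fst (snd \<theta>))) ((1 / q) *\<^sub>R (0, y\<^sup>2, 1)) (\<phi>, \<alpha>, \<omega>)"
  by (rule strict_gradient_compose[OF strict_gradient_scale_sq])
    (use strict_gradient_ln[OF q_pos] in \<open>simp add: q_def\<close>)
 have 2: "strict_gradient (\<lambda>\<theta>. \<bar>x - y * fst \<theta>\<bar>) (sgn e *\<^sub>R (- y, 0, 0)) (\<phi>, \<alpha>, \<omega>)"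
  by (rule strict_gradient_compose[OF strict_gradient_numerator])
    (use strict_gradient_abs[OF ne] sgn_e in simp)
 note 3 = strict_gradient_add[OF strict_gradient_scale[OF 1, of "1/2"]
   strict_gradient_mult[OF 2 strict_gradient_inverse_scale]]
 show ?thesis
 proof (rule strict_gradient_eq)
  show "strict_gradient (\<lambda>\<theta>. ln (snd (snd \<theta>) + y\<^sup>2 * fst (snd \<theta>)) / 2
   + \<bar>x - y * fst \<theta>\<bar> * inverse (sqrt (snd (snd \<theta>) + y\<^sup>2 * fst (snd \<theta>))))
   ((1/2) *\<^sub>R (1 / q) *\<^sub>R (0, y\<^sup>2, 1) +
    (\<bar>x - y * \<phi>\<bar> *\<^sub>R - (1 / (2 * q * sqrt q)) *\<^sub>R (0, y\<^sup>2, 1) + inverse (sqrt q) *\<^sub>R sgn e *\<^sub>R (- y, 0, 0))) (\<phi>, \<alpha>, \<omega>)"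
   using 3 by (simp add: q_def)
  show "(1/2) *\<^sub>R (1 / q) *\<^sub>R (0, y\<^sup>2, 1) +
    (\<bar>x - y * \<phi>\<bar> *\<^sub>R - (1 / (2 * q * sqrt q)) *\<^sub>R (0, y\<^sup>2, 1) + inverse (sqrt q) *\<^sub>R sgn e *\<^sub>R (- y, 0, 0)) =
    (- (sgn e * y / sqrt q), y\<^sup>2 * (1 - \<bar>e\<bar>) / (2 * q), (1 - \<bar>e\<bar>) / (2 * q))"
  proof -
   have "\<bar>e\<bar> * sqrt q * (- (1 / (2 * q * sqrt q))) = - (\<bar>e\<bar> / (2 * q))" using sq by simp
   then have c: "(1/2) * ((1 / q) * z) + \<bar>e\<bar> * sqrt q * (- (1 / (2 * q * sqrt q)) * z) = z * (1 - \<bar>e\<bar>) / (2 * q)" for z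
    unfolding mult.assoc[symmetric] by (simp add: algebra_simps diff_divide_distrib)
   have d: "inverse (sqrt q) * (sgn e * - y) = - (sgn e * y / sqrt q)"
    by (simp only: divide_inverse mult_minus_right mult.commute)
   show ?thesis
    by (simp only: abs_e scaleR_Pair real_scaleR_def add_Pair mult_zero_right add_0_right add_0_left mult_1_left c d)
  qed
 qed
qed

text \<open>In the application \<open>\<sigma>\<close> is \<open>- ((- 1) ^ k)\<close>, the sign of
  \<open>\<phi>\<close> in the two halves of the estimate.\<close>

lemma strict_gradient_log_abs:
 assumes "(x - y * \<phi>) * inverse (sqrt q) * sqrt \<alpha> + \<sigma> * \<phi> \<noteq> 0"
 shows "\<exists>g. strict_gradient (\<lambda>\<theta>. ln \<bar>(x - y * fst \<theta>) * inverse (sqrt (snd (snd \<theta>) + y\<^sup>2 * fst (snd \<theta>))) * sqrt (fst (snd \<theta>)) + \<sigma> * fst \<theta>\<bar>)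
   g (\<phi>, \<alpha>, \<omega>)"
proof -
 let ?X = "(x - y * \<phi>) * inverse (sqrt q) * sqrt \<alpha> + \<sigma> * \<phi>"
 have 1: "strict_gradient (\<lambda>\<theta>. sqrt (fst (snd \<theta>))) ((inverse (sqrt \<alpha>) / 2) *\<^sub>R (0, 1, 0)) (\<phi>, \<alpha>, \<omega>)"
  by (rule strict_gradient_compose[OF strict_gradient_fst_snd])
    (use strict_gradient_sqrt[OF pos(1)] in simp)
 note 2 = strict_gradient_add[OF strict_gradient_mult[OF strict_gradient_mult[OF strict_gradient_numerator
    strict_gradient_inverse_scale] 1] strict_gradient_scale[OF strict_gradient_fst, of \<sigma>]]
 have "strict_gradient abs (sgn ?X) ?X" using strict_gradient_abs[OF assms] .
 note 3 = strict_gradient_compose[OF 2, of abs "sgn ?X"]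
 note 4 = strict_gradient_compose[OF 3, of ln "1 / \<bar>?X\<bar>"]
 show ?thesis
  by (rule exI, rule 4) (use strict_gradient_abs[OF assms] strict_gradient_ln[of "\<bar>?X\<bar>"] assms in \<open>simp_all add: q_def\<close>)
qed

end

section \<open>Linear independence at six observations\<close>

text \<open>A quantitative form of strict concavity: by the mean value theorem the two chord slopes
  are derivatives at points that are at least 1 apart.\<close>

lemma log_slope_gap:
 fixes r \<tau> :: real
 assumes r: "r > 0" "r <= r2" "r1 <= r" "0 < r1" and e: "e1 < e2" "e2 + 1 <= e3" "e3 < e4"
  and low: "r * e1 + \<tau> > 0" and up: "\<And>e. e <= e4 ==> r * e + \<tau> <= M"
 shows "(ln (r * e2 + \<tau>) - ln (r * e1 + \<tau>)) / (e2 - e1) - (ln (r * e4 + \<tau>) - ln (r * e3 + \<tau>)) / (e4 - e3) >= r1\<^sup>2 / M\<^sup>2"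
proof -
 have pos: "r * e + \<tau> > 0" if "e >= e1" for e
  using low mult_left_mono[OF that less_imp_le[OF r(1)]] by linarith
 have d: "((\<lambda>e. ln (r * e + \<tau>)) has_real_derivative r / (r * e + \<tau>)) (at e)" if "e >= e1" for e
  using pos[OF that] by (auto intro!: derivative_eq_intros)
 obtain z1 where z1: "e1 < z1" "z1 < e2" "ln (r * e2 + \<tau>) - ln (r * e1 + \<tau>) = (e2 - e1) * (r / (r * z1 + \<tau>))"
  using MVT2[OF e(1), of "\<lambda>e. ln (r * e + \<tau>)" "\<lambda>e. r / (r * e + \<tau>)"] d by auto
 obtain z2 where z2: "e3 < z2" "z2 < e4" "ln (r * e4 + \<tau>) - ln (r * e3 + \<tau>) = (e4 - e3) * (r / (r * z2 + \<tau>))"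
  using MVT2[OF e(3), of "\<lambda>e. ln (r * e + \<tau>)" "\<lambda>e. r / (r * e + \<tau>)"] d e by auto
 define p1 p2 where "p1 = r * z1 + \<tau>" and "p2 = r * z2 + \<tau>"
 have p: "0 < p1" "0 < p2" "p1 <= M" "p2 <= M"
  using pos[of z1] pos[of z2] up[of z1] up[of z2] z1 z2 e by (auto simp: p1_def p2_def)
 have "p2 - p1 = r * (z2 - z1)" by (simp add: p1_def p2_def algebra_simps)
 moreover have "z2 - z1 >= 1" using z1 z2 e by linarith
 ultimately have gap: "p2 - p1 >= r" using r(1) by simp
 have "r1\<^sup>2 / M\<^sup>2 <= r * r / (p1 * p2)"
  unfolding power2_eq_square using p r by (intro frac_le mult_mono mult_pos_pos) auto
 also have "\<dots> <= r * (p2 - p1) / (p1 * p2)"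
  using p r gap by (intro divide_right_mono mult_left_mono) auto
 also have "\<dots> = r / p1 - r / p2" using p by (simp add: field_simps)
 finally show ?thesis using z1 z2 e by (simp add: p1_def p2_def)
qed

text \<open>With \<open>\<beta> = b1 + b2\<close>, the terms in \<open>1 / q\<close> are small for the observations 1 to 5 but not for
 observation 6, so that the first five equations force all other coefficients to be small
 compared with the coefficient of \<open>1 / q\<close>, which the sixth one then forces to vanish. In the
 first step, strict concavity of the logarithm excludes an affine relation.\<close>

lemma qml_gradients_independent:
 fixes c C E0 E1 R6 :: real
 assumes c: "0 < c" "c <= C" and E0: "2 <= E0" "C + 1 <= sqrt c * E0" and E1: "E0 <= E1"
 obtains R where "R > 0"
  "\<And>\<phi> \<alpha> \<omega> y e a1 a2 a3 z b0 b1 b2.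
    c <= \<alpha> ==> \<alpha> <= C ==> c <= \<omega> ==> \<omega> <= C ==> \<bar>\<phi>\<bar> <= C ==>
    (\<And>i. i \<in> {1..5::nat} ==> y i >= R) ==> \<bar>y 6\<bar> <= R6 ==>
    E0 <= e 1 ==> e 1 + 1 <= e 2 ==> e 2 + 1 <= e 3 ==> e 3 + 1 <= e 4 ==> e 4 <= E1 ==>
    - E1 <= e 5 ==> e 5 <= - E0 ==> E0 <= e 6 ==> e 6 <= E1 ==> b1 > 0 ==> b2 > 0 ==>
    (\<And>i. i \<in> {1..6} ==>
     a1 * (- (sgn (e i) * y i / sqrt (\<omega> + (y i)\<^sup>2 * \<alpha>)))
     + a2 * ((y i)\<^sup>2 * (1 - \<bar>e i\<bar>) / (2 * (\<omega> + (y i)\<^sup>2 * \<alpha>)))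
     + a3 * ((1 - \<bar>e i\<bar>) / (2 * (\<omega> + (y i)\<^sup>2 * \<alpha>)))
     + z * (b1 * ln \<bar>e i * sqrt \<alpha> + \<phi>\<bar> + b2 * ln \<bar>e i * sqrt \<alpha> - \<phi>\<bar> - b0) = 0) ==>
    a1 = 0 \<and> a2 = 0 \<and> a3 = 0 \<and> z = 0"
proof -
 \<comment> \<open>\<open>M\<close> bounds the arguments of the logarithms, \<open>Lm\<close> the
   logarithms, and \<open>\<kappa>\<close> bounds their curvature from below. The constants
   \<open>k1\<close> to \<open>k5\<close> bound the unknowns, in the order in which they are
   eliminated below, by multiples of the error \<open>h\<close>. \<open>T\<close> is the resulting
   total, and \<open>R\<close> makes the scale \<open>q\<close> at least \<open>T + 1\<close>, so
   that in the end \<open>h\<close> is at most \<open>T / (T + 1)\<close> times itself.\<close>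
 define M where "M = sqrt C * E1 + C"
 define Lm where "Lm = ln M"
 define \<kappa> where "\<kappa> = c / M\<^sup>2"
 define K1 where "K1 = C + E1 + 1"
 define k1 where "k1 = 4 / \<kappa>"
 define k2 where "k2 = k1 * Lm + 2"
 define k3 where "k3 = k2 * E1 + k1 * Lm + 2"
 define k4 where "k4 = k3 + k2 * (E1 + 1) + k1 * Lm + 1"
 define k5 where "k5 = k3 + k2 * (E1 + 1) + k1 * Lm + k4"
 define p' where "p' = 1 / (C + C * R6\<^sup>2)"
 define T where "T = K1 * (k3 + k5 / p')"
 define R where "R = sqrt ((T + 1) / c)"
 have C: "C > 0" and E1': "E1 >= 2" using c E0 E1 by auto
 have "sqrt C * E1 >= 0" using C E1' by simp
 have "sqrt c * E0 <= sqrt C * E1" using c E0 E1 by (intro mult_mono) auto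
 then have M: "M > 1" using E0 C by (simp add: M_def)
 have Lm: "Lm >= 0" using M by (simp add: Lm_def)
 have \<kappa>: "\<kappa> > 0" using c M by (simp add: \<kappa>_def)
 have k1: "k1 > 0" using \<kappa> by (simp add: k1_def)
 have k2: "k2 > 0" using k1 Lm by (simp add: k2_def add_nonneg_pos)
 have k3: "k3 > 0" using k1 k2 Lm E1' by (simp add: k3_def add_nonneg_pos)
 have k4: "k4 > 0" using k1 k2 k3 Lm E1' by (simp add: k4_def add_nonneg_pos)
 have k5: "k5 > 0" using k1 k2 k3 k4 Lm E1' by (simp add: k5_def add_nonneg_pos)
 have p': "p' > 0" using C by (simp add: p'_def add_pos_nonneg)
 have K1: "K1 > 0" using C E1' by (simp add: K1_def)
 have T: "T > 0" using K1 k3 k5 p' by (simp add: T_def add_pos_pos)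
 have R: "R > 0" using T c by (simp add: R_def)
 have R2: "c * R\<^sup>2 = T + 1" using T c by (simp add: R_def)
 show ?thesis
 proof (rule that[OF R])
  fix \<phi> \<alpha> \<omega> a1 a2 a3 z b0 b1 b2 :: real and y e :: "nat => real"
  assume \<alpha>: "c <= \<alpha>" "\<alpha> <= C" and \<omega>: "c <= \<omega>" "\<omega> <= C" and \<phi>: "\<bar>\<phi>\<bar> <= C"
   and y: "\<And>i. i \<in> {1..5::nat} ==> y i >= R" and y6: "\<bar>y 6\<bar> <= R6"
   and e: "E0 <= e 1" "e 1 + 1 <= e 2" "e 2 + 1 <= e 3" "e 3 + 1 <= e 4" "e 4 <= E1"
     "- E1 <= e 5" "e 5 <= - E0" "E0 <= e 6" "e 6 <= E1" and b: "b1 > 0" "b2 > 0"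
   and eq: "\<And>i. i \<in> {1..6} ==>
     a1 * (- (sgn (e i) * y i / sqrt (\<omega> + (y i)\<^sup>2 * \<alpha>)))
     + a2 * ((y i)\<^sup>2 * (1 - \<bar>e i\<bar>) / (2 * (\<omega> + (y i)\<^sup>2 * \<alpha>)))
     + a3 * ((1 - \<bar>e i\<bar>) / (2 * (\<omega> + (y i)\<^sup>2 * \<alpha>)))
     + z * (b1 * ln \<bar>e i * sqrt \<alpha> + \<phi>\<bar> + b2 * ln \<bar>e i * sqrt \<alpha> - \<phi>\<bar> - b0) = 0"
  define r where "r = sqrt \<alpha>"
  have r: "r > 0" "sqrt c <= r" "r <= sqrt C" using \<alpha> c by (auto simp: r_def)
  have rr: "r * r = \<alpha>" using \<alpha> c by (simp add: r_def)
  have arg: "1 <= r * x + \<tau>" "r * x + \<tau> <= M" if "E0 <= x" "x <= E1" "\<bar>\<tau>\<bar> <= C" for x \<tau>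
  proof -
   have "sqrt c * E0 <= r * x" using r c E0 that by (intro mult_mono) auto
   then show "1 <= r * x + \<tau>" using E0 that by linarith
   have "r * x <= sqrt C * E1" using r C E0 that by (intro mult_mono) auto
   then show "r * x + \<tau> <= M" using that by (simp add: M_def)
  qed
  have lnb: "0 <= ln (r * x + \<tau>)" "ln (r * x + \<tau>) <= Lm" if "E0 <= x" "x <= E1" "\<bar>\<tau>\<bar> <= C" for x \<tau>
   using arg[OF that] by (auto simp: Lm_def)
  define l where "l i = b1 * ln \<bar>e i * sqrt \<alpha> + \<phi>\<bar> + b2 * ln \<bar>e i * sqrt \<alpha> - \<phi>\<bar>" for i
  define \<beta> where "\<beta> = b1 + b2"
  have \<beta>: "\<beta> > 0" using b by (simp add: \<beta>_def)
  have l_pos: "l i = b1 * ln (r * e i + \<phi>) + b2 * ln (r * e i + - \<phi>)" if "E0 <= e i" "e i <= E1" for i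
   using arg[OF that, of \<phi>] arg[OF that, of "- \<phi>"] \<phi> by (simp add: l_def r_def mult.commute)
  have l_bound_aux: "0 <= b1 * u + b2 * v \<and> b1 * u + b2 * v <= \<beta> * Lm"
   if "0 <= u" "u <= Lm" "0 <= v" "v <= Lm" for u v
   unfolding \<beta>_def distrib_right using that b
   by (intro conjI add_nonneg_nonneg add_mono mult_nonneg_nonneg mult_left_mono) auto
  have l_bound: "0 <= l i" "l i <= \<beta> * Lm" if "E0 <= e i" "e i <= E1" for i
   using l_bound_aux[OF lnb[OF that, of \<phi>] lnb[OF that, of "- \<phi>"]] \<phi> unfolding l_pos[OF that] by auto
  have l5: "l 5 = b1 * ln (r * - e 5 + - \<phi>) + b2 * ln (r * - e 5 + \<phi>)"
  proof -
   have "1 <= r * - e 5 + - \<phi>" "1 <= r * - e 5 + \<phi>"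
    using arg(1)[of "- e 5" "- \<phi>"] arg(1)[of "- e 5" \<phi>] e \<phi> by auto
   moreover have "\<bar>e 5 * sqrt \<alpha> + \<phi>\<bar> = \<bar>r * - e 5 + - \<phi>\<bar>" "\<bar>e 5 * sqrt \<alpha> - \<phi>\<bar> = \<bar>r * - e 5 + \<phi>\<bar>"
    by (auto simp: r_def mult.commute abs_minus_commute)
   ultimately show ?thesis by (simp add: l_def)
  qed
  have l5_bound: "0 <= l 5" "l 5 <= \<beta> * Lm"
   using l_bound_aux[OF lnb[of "- e 5" "- \<phi>"] lnb[of "- e 5" \<phi>]] e \<phi> unfolding l5 by auto
  define q where "q i = \<omega> + (y i)\<^sup>2 * \<alpha>" for i
  have q: "q i > 0" for i using \<omega> \<alpha> c by (auto simp: q_def intro!: add_pos_nonneg)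
  \<comment> \<open>\<open>m i\<close> is at most 1 in modulus and close to 1 for large positive
    \<open>y i\<close>: there \<open>(m i)\<^sup>2 <= m i\<close>, so that
    \<open>1 - m i <= \<omega> / q i\<close>.\<close>
  define m where "m i = r * (y i / sqrt (q i))" for i
  have m2: "(m i)\<^sup>2 = 1 - \<omega> / q i" for i
  proof -
   have "(m i)\<^sup>2 = \<alpha> * (y i)\<^sup>2 / q i"
    using q[of i] rr by (simp add: m_def power_mult_distrib power_divide power2_eq_square[of r])
   also have "\<alpha> * (y i)\<^sup>2 = q i - \<omega>" by (simp add: q_def)
   finally show ?thesis using q[of i] by (simp add: diff_divide_distrib)
  qed
  have m1: "\<bar>m i\<bar> <= 1" for i
  proof -
   have "(m i)\<^sup>2 <= 1\<^sup>2" unfolding m2 using \<omega> c q[of i] by simp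
   then show ?thesis using abs_le_square_iff[of "m i" 1] by simp
  qed
  \<comment> \<open>Substituting
    \<open>(y i)\<^sup>2 / q i = (1 - \<omega> / q i) / \<alpha>\<close> separates the part of the
    gradient that survives for large \<open>y i\<close> from a multiple of
    \<open>1 / q i\<close>.\<close>
  define A where "A = a2 / (2 * \<alpha>)"
  define B where "B = (a3 - a2 * \<omega> / \<alpha>) / 2"
  define s where "s = a1 / r"
  have eq': "- (sgn (e i) * s * m i) + (A + B / q i) * (1 - \<bar>e i\<bar>) + z * (l i - b0) = 0"
   if "i \<in> {1..6}" for i
  proof -
   have "a1 * (- (sgn (e i) * y i / sqrt (q i))) = - (sgn (e i) * s * m i)"
    using r by (simp add: s_def m_def)
   moreover have "a2 * ((y i)\<^sup>2 * (1 - \<bar>e i\<bar>) / (2 * q i)) + a3 * ((1 - \<bar>e i\<bar>) / (2 * q i)) = (A + B / q i) * (1 - \<bar>e i\<bar>)"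
   proof -
    have "(a2 * (y i)\<^sup>2 + a3) / (2 * q i) = A + B / q i"
     using \<alpha> c q[of i] by (simp add: A_def B_def field_simps) (simp add: q_def algebra_simps)
    moreover have "a2 * ((y i)\<^sup>2 * (1 - \<bar>e i\<bar>) / (2 * q i)) + a3 * ((1 - \<bar>e i\<bar>) / (2 * q i))
      = (a2 * (y i)\<^sup>2 + a3) / (2 * q i) * (1 - \<bar>e i\<bar>)"
     by (simp add: add_divide_distrib distrib_right)
    ultimately show ?thesis by simp
   qed
   ultimately show ?thesis using eq[OF that] by (simp add: q_def l_def add.assoc)
  qed
  define \<epsilon> where "\<epsilon> = 1 / (T + 1)"
  \<comment> \<open>Bounds the error made in the first five equations by putting 1 for
    \<open>m i\<close> and 0 for \<open>1 / q i\<close>.\<close>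
  define h where "h = \<epsilon> * K1 * (\<bar>s\<bar> + \<bar>B\<bar>)"
  have \<epsilon>: "\<epsilon> > 0" using T by (simp add: \<epsilon>_def)
  have h: "h >= 0" using \<epsilon> K1 by (simp add: h_def)
  have err: "\<bar>s * (1 - m i)\<bar> + \<bar>B / q i * (1 - \<bar>e i\<bar>)\<bar> <= h"
   if i: "i \<in> {1..5}" and ei: "2 <= \<bar>e i\<bar>" "\<bar>e i\<bar> <= E1" for i
  proof -
   have yi: "y i >= R" "y i > 0" using y[OF i] R by auto
   have "T + 1 <= \<alpha> * (y i)\<^sup>2" unfolding R2[symmetric] using \<alpha> c yi R by (intro mult_mono power_mono) auto
   also have "\<dots> <= q i" using \<omega> c by (simp add: q_def)
   finally have qi: "1 / q i <= \<epsilon>" using T by (simp add: \<epsilon>_def frac_le)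
   have "m i >= 0" using r yi q[of i] by (simp add: m_def)
   then have "(m i)\<^sup>2 <= m i" using m1[of i] by (simp add: power2_eq_square mult_left_le)
   then have "1 - m i <= \<omega> / q i" unfolding m2 by simp
   also have "\<dots> <= C * \<epsilon>" using mult_mono[of \<omega> C "1 / q i" \<epsilon>] qi \<omega> C q[of i] by simp
   finally have "\<bar>1 - m i\<bar> <= C * \<epsilon>" using m1[of i] by simp
   then have 1: "\<bar>s * (1 - m i)\<bar> <= \<bar>s\<bar> * (C * \<epsilon>)" unfolding abs_mult by (intro mult_left_mono) auto
   have "\<bar>B / q i * (1 - \<bar>e i\<bar>)\<bar> = \<bar>B\<bar> * (1 / q i * \<bar>1 - \<bar>e i\<bar>\<bar>)" using q[of i] by (simp add: abs_mult)
   also have "\<dots> <= \<bar>B\<bar> * (\<epsilon> * (E1 + 1))" using qi ei \<epsilon> q[of i] by (intro mult_left_mono mult_mono) auto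
   finally have 2: "\<bar>B / q i * (1 - \<bar>e i\<bar>)\<bar> <= \<bar>B\<bar> * (\<epsilon> * (E1 + 1))" .
   have "\<bar>s\<bar> * (C * \<epsilon>) <= \<bar>s\<bar> * (K1 * \<epsilon>)" "\<bar>B\<bar> * (\<epsilon> * (E1 + 1)) <= \<bar>B\<bar> * (K1 * \<epsilon>)"
    using \<epsilon> C E1' by (auto intro!: mult_left_mono simp: K1_def)
   then show ?thesis using 1 2 unfolding h_def by (simp add: algebra_simps)
  qed
  have pos_eq: "\<bar>- s + A * (1 - e i) + z * (l i - b0)\<bar> <= h" if "i \<in> {1..4}" "E0 <= e i" "e i <= E1" for i
  proof -
   have "sgn (e i) = 1" "\<bar>e i\<bar> = e i" using that E0 by auto
   then have "- s + A * (1 - e i) + z * (l i - b0) = - (s * (1 - m i)) - B / q i * (1 - \<bar>e i\<bar>)"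
    using eq'[of i] that by (simp add: algebra_simps)
   moreover have "\<bar>s * (1 - m i)\<bar> + \<bar>B / q i * (1 - \<bar>e i\<bar>)\<bar> <= h" using err[of i] that E0 by auto
   ultimately show ?thesis by linarith
  qed
  have eq5: "\<bar>s + A * (1 + e 5) + z * (l 5 - b0)\<bar> <= h"
  proof -
   have "sgn (e 5) = - 1" "\<bar>e 5\<bar> = - e 5" using e E0 by auto
   then have "s + A * (1 + e 5) + z * (l 5 - b0) = s * (1 - m 5) - B / q 5 * (1 - \<bar>e 5\<bar>)"
    using eq'[of 5] by (simp add: algebra_simps)
   moreover have "\<bar>s * (1 - m 5)\<bar> + \<bar>B / q 5 * (1 - \<bar>e 5\<bar>)\<bar> <= h" using err[of 5] e E0 by auto
   ultimately show ?thesis by linarith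
  qed
  have eb: "E0 <= e 1" "e 1 <= E1" "E0 <= e 2" "e 2 <= E1" "E0 <= e 3" "e 3 <= E1" "E0 <= e 4" "e 4 <= E1"
   using e by auto
  have q1: "\<bar>- s + A * (1 - e 1) + z * (l 1 - b0)\<bar> <= h" and q2: "\<bar>- s + A * (1 - e 2) + z * (l 2 - b0)\<bar> <= h"
   and q3: "\<bar>- s + A * (1 - e 3) + z * (l 3 - b0)\<bar> <= h" and q4: "\<bar>- s + A * (1 - e 4) + z * (l 4 - b0)\<bar> <= h"
   using pos_eq[of 1] pos_eq[of 2] pos_eq[of 3] pos_eq[of 4] eb by auto
  define D1 where "D1 = (l 2 - l 1) / (e 2 - e 1)"
  define D2 where "D2 = (l 4 - l 3) / (e 4 - e 3)"
  \<comment> \<open>The difference of two equations with positive residuals cancels \<open>s\<close>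
    and \<open>b0\<close> and leaves \<open>A\<close> as \<open>z\<close> times a chord
    slope.\<close>
  have slope: "\<bar>A - z * ((l j - l i) / (e j - e i))\<bar> <= 2 * h"
   if "e i + 1 <= e j" "\<bar>- s + A * (1 - e i) + z * (l i - b0)\<bar> <= h" "\<bar>- s + A * (1 - e j) + z * (l j - b0)\<bar> <= h" for i j
  proof -
   have "\<bar>A * (e j - e i) - z * (l j - l i)\<bar> <= 2 * h" using that(2,3) by (simp add: algebra_simps abs_le_iff)
   moreover have "A * (e j - e i) - z * (l j - l i) = (A - z * ((l j - l i) / (e j - e i))) * (e j - e i)"
    using that(1) by (simp add: field_simps)
   ultimately have "\<bar>A - z * ((l j - l i) / (e j - e i))\<bar> * (e j - e i) <= 2 * h" using that(1) by (simp add: abs_mult)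
   moreover have "\<bar>A - z * ((l j - l i) / (e j - e i))\<bar> * 1 <= \<bar>A - z * ((l j - l i) / (e j - e i))\<bar> * (e j - e i)"
    using that(1) by (intro mult_left_mono) auto
   ultimately show ?thesis unfolding mult_1_right by (rule order.trans[rotated])
  qed
  have s1: "\<bar>A - z * D1\<bar> <= 2 * h" unfolding D1_def by (rule slope) (use e q1 q2 in auto)
  have s2: "\<bar>A - z * D2\<bar> <= 2 * h" unfolding D2_def by (rule slope) (use e q3 q4 in auto)
  have gap: "D1 - D2 >= \<kappa> * \<beta>"
  proof -
   define f where "f \<tau> = (ln (r * e 2 + \<tau>) - ln (r * e 1 + \<tau>)) / (e 2 - e 1) - (ln (r * e 4 + \<tau>) - ln (r * e 3 + \<tau>)) / (e 4 - e 3)" for \<tau>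
   have f: "f \<tau> >= \<kappa>" if "\<bar>\<tau>\<bar> <= C" for \<tau>
   proof -
    have "f \<tau> >= (sqrt c)\<^sup>2 / M\<^sup>2" unfolding f_def
    proof (rule log_slope_gap[where r = r and ?r2.0 = "sqrt C"])
     show "r * e 1 + \<tau> > 0" using arg(1)[of "e 1" \<tau>] eb that by auto
     show "r * x + \<tau> <= M" if "x <= e 4" for x
      using arg(2)[of "e 4" \<tau>] eb \<open>\<bar>\<tau>\<bar> <= C\<close> mult_left_mono[OF that less_imp_le[OF r(1)]] by auto
    qed (use r c e in auto)
    then show ?thesis using c by (simp add: \<kappa>_def)
   qed
   have "D1 - D2 = b1 * f \<phi> + b2 * f (- \<phi>)"
    unfolding D1_def D2_def f_def l_pos[OF eb(1,2)] l_pos[OF eb(3,4)] l_pos[OF eb(5,6)] l_pos[OF eb(7,8)]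
    by (simp add: diff_divide_distrib add_divide_distrib algebra_simps)
   also have "\<dots> >= b1 * \<kappa> + b2 * \<kappa>" using b f[of \<phi>] f[of "- \<phi>"] \<phi> by (intro add_mono mult_left_mono) auto
   finally show ?thesis by (simp add: \<beta>_def algebra_simps)
  qed
  \<comment> \<open>Two chords give two approximations of \<open>A\<close>, so the gap between their
    slopes bounds \<open>z\<close>. The factor \<open>\<beta>\<close> makes the bound independent of
    the sizes of \<open>b1\<close> and \<open>b2\<close>.\<close>
  define \<zeta> where "\<zeta> = \<bar>z\<bar> * \<beta>"
  have "\<bar>z\<bar> * (\<kappa> * \<beta>) <= \<bar>z\<bar> * (D1 - D2)" using gap by (intro mult_left_mono) auto
  also have "\<dots> = \<bar>z * (D1 - D2)\<bar>" using gap \<kappa> \<beta> by (simp add: abs_mult) (smt (verit) mult_pos_pos)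
  also have "\<dots> <= 4 * h" using s1 s2 by (simp add: algebra_simps)
  finally have z1: "\<zeta> <= k1 * h" using \<kappa> by (simp add: \<zeta>_def k1_def field_simps)
  have zl: "\<bar>z * x\<bar> <= \<zeta> * Lm" if "\<bar>x\<bar> <= \<beta> * Lm" for x
   using mult_left_mono[OF that, of "\<bar>z\<bar>"] by (simp add: \<zeta>_def abs_mult mult.assoc)
  have zlk: "\<zeta> * Lm <= k1 * Lm * h" using mult_right_mono[OF z1 Lm] by (simp add: algebra_simps)
  have "\<bar>D1\<bar> <= \<beta> * Lm"
  proof -
   have "\<bar>l 2 - l 1\<bar> <= \<beta> * Lm" using l_bound[OF eb(1,2)] l_bound[OF eb(3,4)] by auto
   then have "\<bar>l 2 - l 1\<bar> / (e 2 - e 1) <= (\<beta> * Lm) / 1" using e by (intro frac_le) auto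
   then show ?thesis using e by (simp add: D1_def)
  qed
  from zl[OF this] have A: "\<bar>A\<bar> <= k2 * h" using s1 zlk unfolding k2_def by (simp add: algebra_simps)
  have AE: "\<bar>A * x\<bar> <= k2 * h * X" if "\<bar>x\<bar> <= X" for x X
   unfolding abs_mult using A that k2 h by (intro mult_mono) auto
  \<comment> \<open>The fifth residual is negative, so subtracting its equation from the first
    doubles \<open>s\<close> instead of cancelling it.\<close>
  have s: "\<bar>s\<bar> <= k3 * h"
  proof -
   have "\<bar>A * (- e 5 - e 1)\<bar> <= k2 * h * E1" using e E0 by (intro AE) auto
   moreover have "\<bar>z * (l 1 - l 5)\<bar> <= \<zeta> * Lm" using l_bound[OF eb(1,2)] l5_bound by (intro zl) auto
   moreover have "\<bar>- 2 * s + A * (- e 5 - e 1) + z * (l 1 - l 5)\<bar> <= 2 * h"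
    using q1 eq5 by (simp add: algebra_simps abs_le_iff)
   ultimately have "2 * \<bar>s\<bar> <= k3 * h" using zlk unfolding k3_def by (simp add: algebra_simps)
   then show ?thesis by linarith
  qed
  have zb: "\<bar>z * b0\<bar> <= k4 * h"
  proof -
   have "\<bar>A * (1 - e 1)\<bar> <= k2 * h * (E1 + 1)" using eb E0 by (intro AE) auto
   moreover have "\<bar>z * l 1\<bar> <= \<zeta> * Lm" using l_bound[OF eb(1,2)] by (intro zl) auto
   moreover have "z * (l 1 - b0) = z * l 1 - z * b0" by (simp add: algebra_simps)
   ultimately have "\<bar>z * b0\<bar> <= k3 * h + k2 * h * (E1 + 1) + k1 * Lm * h + h" using q1 s zlk by linarith
   then show ?thesis by (simp add: k4_def algebra_simps)
  qed
  \<comment> \<open>The bounded value \<open>y 6\<close> keeps \<open>1 / q 6\<close> above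
    \<open>p'\<close>, so the sixth equation can be solved for \<open>B\<close>.\<close>
  have B: "\<bar>B\<bar> <= k5 / p' * h"
  proof -
   have "sgn (e 6) = 1" "\<bar>e 6\<bar> = e 6" using e E0 by auto
   then have "B / q 6 * (1 - e 6) = s * m 6 - A * (1 - e 6) - z * l 6 + z * b0"
    using eq'[of 6] by (simp add: algebra_simps)
   moreover have "\<bar>s * m 6\<bar> <= \<bar>s\<bar>" using m1[of 6] by (simp add: abs_mult mult_left_le)
   moreover have "\<bar>A * (1 - e 6)\<bar> <= k2 * h * (E1 + 1)" using e E0 by (intro AE) auto
   moreover have "\<bar>z * l 6\<bar> <= \<zeta> * Lm" using l_bound[of 6] e by (intro zl) auto
   ultimately have "\<bar>B / q 6 * (1 - e 6)\<bar> <= k3 * h + k2 * h * (E1 + 1) + k1 * Lm * h + k4 * h"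
    using s zb zlk by linarith
   then have 1: "\<bar>B / q 6 * (1 - e 6)\<bar> <= k5 * h" by (simp add: k5_def algebra_simps)
   have "q 6 <= C + C * R6\<^sup>2"
    using \<omega> \<alpha> c y6 mult_mono[of \<alpha> C "(y 6)\<^sup>2" "R6\<^sup>2"] power_mono[of "\<bar>y 6\<bar>" R6 2] by (simp add: q_def mult.commute)
   then have "p' <= 1 / q 6" using q[of 6] by (simp add: p'_def frac_le)
   then have "\<bar>B\<bar> * p' <= \<bar>B\<bar> * (1 / q 6 * \<bar>1 - e 6\<bar>)"
    using e E0 p' q[of 6] mult_mono[of p' "1 / q 6" 1 "\<bar>1 - e 6\<bar>"] by (intro mult_left_mono) auto
   also have "\<dots> = \<bar>B / q 6 * (1 - e 6)\<bar>" using q[of 6] by (simp add: abs_mult)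
   finally show ?thesis using 1 p' by (simp add: field_simps)
  qed
  have "h <= \<epsilon> * K1 * (k3 * h + k5 / p' * h)"
   unfolding h_def[of] using s B \<epsilon> K1 by (intro mult_left_mono) (auto simp: h_def)
  also have "\<dots> = T / (T + 1) * h" by (simp add: \<epsilon>_def T_def algebra_simps)
  finally have "(1 - T / (T + 1)) * h <= 0" by (simp add: algebra_simps)
  moreover have "1 - T / (T + 1) > 0" using T by simp
  ultimately have "h <= 0" by (simp add: mult_le_0_iff)
  then have "h = 0" using h by simp
  then have "s = 0" "B = 0" "A = 0" "\<zeta> <= 0" using s B A z1 by auto
  then show "a1 = 0 \<and> a2 = 0 \<and> a3 = 0 \<and> z = 0"
   using r \<alpha> c \<beta> by (auto simp: s_def A_def B_def \<zeta>_def mult_le_0_iff)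
 qed
qed

section \<open>The bootstrap estimate as a function of the weights\<close>

text \<open>For \<open>k = 2\<close> this is the negative of the argument in
  \<open>gamma_hat\<close>; modulus and truncation set are symmetric, so one function serves both
  estimates.\<close>

definition root_arg :: "nat => (nat => real) => nat => real \<times> real \<times> real => real" where
 "root_arg k Y t \<theta> = resid \<theta> Y t * sqrt (fst (snd \<theta>)) - (- 1) ^ k * fst \<theta>"

definition kept :: "nat => nat => (nat => real) => real \<times> real \<times> real => nat set" where
 "kept k n Y \<theta> = {t \<in> {1..n}. root_arg k Y t \<theta> \<in> trunc n}"

lemma kept_subset: "kept k n Y \<theta> \<subseteq> {1..n}" and finite_kept [simp]: "finite (kept k n Y \<theta>)"
 by (auto simp: kept_def)

lemma gamma_star_part_eq:
 "gamma_star_part k n w Y \<theta> = weighted_mean (kept k n Y \<theta>) (\<lambda>t \<theta>. ln \<bar>root_arg k Y t \<theta>\<bar>) w \<theta>"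
 by (cases \<theta>) (simp only: gamma_star_part.simps Let_def weighted_mean_def kept_def root_arg_def fst_conv snd_conv)

lemma sets_trunc [measurable]: "trunc n \<in> sets borel"
 by (simp add: trunc_def)

lemma sum_kept: "(\<Sum>t\<in>kept k n Y \<theta>. f t) = (\<Sum>t\<in>{1..n}. if root_arg k Y t \<theta> \<in> trunc n then f t else 0)"
 unfolding kept_def by (simp add: sum.If_cases Int_def)

lemma measurable_fst_real3 [measurable]: "(fst :: real \<times> real \<times> real => real) \<in> borel_measurable borel"
 by (intro borel_measurable_continuous_onI continuous_intros)

lemma measurable_snd_real3 [measurable]: "(snd :: real \<times> real \<times> real => real \<times> real) \<in> borel_measurable borel"
 by (intro borel_measurable_continuous_onI continuous_intros)

lemma measurable_fst_real2 [measurable]: "(fst :: real \<times> real => real) \<in> borel_measurable borel"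
 by (intro borel_measurable_continuous_onI continuous_intros)

lemma measurable_snd_real2 [measurable]: "(snd :: real \<times> real => real) \<in> borel_measurable borel"
 by (intro borel_measurable_continuous_onI continuous_intros)

context
 fixes n :: nat and N :: "'b measure" and f h :: "'b => nat => real" and g :: "'b => real \<times> real \<times> real"
 assumes f: "f \<in> measurable N (PiM {0..n} (\<lambda>_. borel))"
  and g: "g \<in> borel_measurable N"
begin

lemma measurable_path_component:
 assumes "t \<in> {0..n}"
 shows "(\<lambda>x. f x t) \<in> borel_measurable N"
 using measurable_compose[OF f measurable_component_singleton[OF assms]] .

lemma measurable_resid:
 assumes "t \<in> {1..n}"
 shows "(\<lambda>x. resid (g x) (f x) t) \<in> borel_measurable N"
proof -
 have [measurable]: "(\<lambda>x. f x t) \<in> borel_measurable N" "(\<lambda>x. f x (t - 1)) \<in> borel_measurable N"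
  using assms by (auto intro!: measurable_path_component)
 note [measurable] = g
 show ?thesis unfolding resid_unfold by measurable
qed

lemma measurable_qml_loss:
 assumes "t \<in> {1..n}"
 shows "(\<lambda>x. qml_loss (f x) t (g x)) \<in> borel_measurable N"
proof -
 have [measurable]: "(\<lambda>x. f x t) \<in> borel_measurable N" "(\<lambda>x. f x (t - 1)) \<in> borel_measurable N"
  using assms by (auto intro!: measurable_path_component)
 note [measurable] = g
 show ?thesis unfolding qml_loss_unfold by measurable
qed

lemma measurable_root_arg:
 assumes "t \<in> {1..n}"
 shows "(\<lambda>x. root_arg k (f x) t (g x)) \<in> borel_measurable N"
proof -
 note [measurable] = measurable_resid[OF assms] g
 show ?thesis unfolding root_arg_def by measurable
qed

lemma measurable_gamma_star:
 assumes h: "h \<in> measurable N (PiM {1..n} (\<lambda>_. borel))"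
 shows "(\<lambda>x. gamma_star n (h x) (f x) (g x)) \<in> borel_measurable N"
proof -
 have "(\<lambda>x. \<Sum>t\<in>kept k n (f x) (g x). h x t * ln \<bar>root_arg k (f x) t (g x)\<bar>) \<in> borel_measurable N"
  "(\<lambda>x. \<Sum>t\<in>kept k n (f x) (g x). h x t) \<in> borel_measurable N" for k
 proof -
  have m: "(\<lambda>x. h x t) \<in> borel_measurable N" if "t \<in> {1..n}" for t
   using measurable_compose[OF h measurable_component_singleton[OF that]] .
  have p: "Measurable.pred N (\<lambda>x. root_arg k (f x) t (g x) \<in> trunc n)" if "t \<in> {1..n}" for t
   using pred_sets2[OF sets_trunc measurable_root_arg[OF that]] .
  show "(\<lambda>x. \<Sum>t\<in>kept k n (f x) (g x). h x t * ln \<bar>root_arg k (f x) t (g x)\<bar>) \<in> borel_measurable N"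
   unfolding sum_kept
   by (intro borel_measurable_sum measurable_If borel_measurable_times borel_measurable_ln borel_measurable_abs
     m measurable_root_arg borel_measurable_const p[unfolded pred_def])
  show "(\<lambda>x. \<Sum>t\<in>kept k n (f x) (g x). h x t) \<in> borel_measurable N"
   unfolding sum_kept
   by (intro borel_measurable_sum measurable_If m borel_measurable_const p[unfolded pred_def])
 qed
 then show ?thesis unfolding gamma_star_def gamma_star_part_eq weighted_mean_def
  by (intro borel_measurable_divide borel_measurable_add borel_measurable_const)
qed

end

text \<open>\<open>qml_gradients_independent\<close> at the six observations supplies the
  nondegeneracy that \<open>weighted_level_null\<close> requires. The threshold \<open>R\<close> is
  fixed after \<open>R6\<close> but before sample size, data and estimator.\<close>

lemma gamma_star_level_null:
 fixes c C E0 E1 R6 :: real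
 assumes c: "0 < c" "c <= C" and E0: "2 <= E0" "C + 1 <= sqrt c * E0" and E1: "E0 <= E1"
 obtains R where "R > 0"
  "\<And>\<Theta> n Y est t \<gamma>.
   (\<And>\<phi> \<alpha> \<omega>. (\<phi>, \<alpha>, \<omega>) \<in> \<Theta> ==> \<bar>\<phi>\<bar> <= C \<and> c <= \<alpha> \<and> \<alpha> <= C \<and> c <= \<omega> \<and> \<omega> <= C) ==>
   n >= 1 ==> sqrt C * E1 + C <= (real n)\<^sup>2 ==>
   bootstrap_estimator \<Theta> n est ==> Y \<in> space (PiM {0..n} (\<lambda>_. borel)) ==>
   (\<And>i. i \<in> {1..6::nat} ==> t i \<in> {1..n}) ==>
   (\<And>i. i \<in> {1..5} ==> Y (t i - 1) >= R) ==> \<bar>Y (t 6 - 1)\<bar> <= R6 ==>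
   (\<And>\<theta>. \<theta> \<in> \<Theta> ==> E0 <= resid \<theta> Y (t 1) \<and> resid \<theta> Y (t 1) + 1 <= resid \<theta> Y (t 2) \<and>
     resid \<theta> Y (t 2) + 1 <= resid \<theta> Y (t 3) \<and> resid \<theta> Y (t 3) + 1 <= resid \<theta> Y (t 4) \<and> resid \<theta> Y (t 4) <= E1 \<and>
     - E1 <= resid \<theta> Y (t 5) \<and> resid \<theta> Y (t 5) <= - E0 \<and> E0 <= resid \<theta> Y (t 6) \<and> resid \<theta> Y (t 6) <= E1) ==>
   {w \<in> space (PiM {1..n} (\<lambda>_. borel)). (\<forall>t\<in>{1..n}. w t > 0) \<and> gamma_star n w Y (est w Y) = \<gamma>}
    \<in> null_sets (PiM {1..n} (\<lambda>_. lborel))"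
proof -
 obtain R where R: "R > 0" and indep: "\<And>\<phi> \<alpha> \<omega> y e a1 a2 a3 z b0 b1 b2.
    c <= \<alpha> ==> \<alpha> <= C ==> c <= \<omega> ==> \<omega> <= C ==> \<bar>\<phi>\<bar> <= C ==>
    (\<And>i. i \<in> {1..5::nat} ==> y i >= R) ==> \<bar>y 6\<bar> <= R6 ==>
    E0 <= e 1 ==> e 1 + 1 <= e 2 ==> e 2 + 1 <= e 3 ==> e 3 + 1 <= e 4 ==> e 4 <= E1 ==>
    - E1 <= e 5 ==> e 5 <= - E0 ==> E0 <= e 6 ==> e 6 <= E1 ==> b1 > 0 ==> b2 > 0 ==>
    (\<And>i. i \<in> {1..6} ==>
     a1 * (- (sgn (e i) * y i / sqrt (\<omega> + (y i)\<^sup>2 * \<alpha>)))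
     + a2 * ((y i)\<^sup>2 * (1 - \<bar>e i\<bar>) / (2 * (\<omega> + (y i)\<^sup>2 * \<alpha>)))
     + a3 * ((1 - \<bar>e i\<bar>) / (2 * (\<omega> + (y i)\<^sup>2 * \<alpha>)))
     + z * (b1 * ln \<bar>e i * sqrt \<alpha> + \<phi>\<bar> + b2 * ln \<bar>e i * sqrt \<alpha> - \<phi>\<bar> - b0) = 0) ==>
    a1 = 0 \<and> a2 = 0 \<and> a3 = 0 \<and> z = 0"
  using qml_gradients_independent[OF c E0 E1, of R6] by blast
 show ?thesis
 proof (rule that[OF R])
  fix \<Theta> n Y est t \<gamma>
  assume box: "\<And>\<phi> \<alpha> \<omega>. (\<phi>, \<alpha>, \<omega>) \<in> \<Theta> ==> \<bar>\<phi>\<bar> <= C \<and> c <= \<alpha> \<and> \<alpha> <= C \<and> c <= \<omega> \<and> \<omega> <= C"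
   and n: "n >= 1" "sqrt C * E1 + C <= (real n)\<^sup>2"
   and est: "bootstrap_estimator \<Theta> n est" and Y: "Y \<in> space (PiM {0..n} (\<lambda>_. borel))"
   and t: "\<And>i. i \<in> {1..6::nat} ==> t i \<in> {1..n}"
   and y: "\<And>i. i \<in> {1..5} ==> Y (t i - 1) >= R" and y6: "\<bar>Y (t 6 - 1)\<bar> <= R6"
   and e: "\<And>\<theta>. \<theta> \<in> \<Theta> ==> E0 <= resid \<theta> Y (t 1) \<and> resid \<theta> Y (t 1) + 1 <= resid \<theta> Y (t 2) \<and>
     resid \<theta> Y (t 2) + 1 <= resid \<theta> Y (t 3) \<and> resid \<theta> Y (t 3) + 1 <= resid \<theta> Y (t 4) \<and> resid \<theta> Y (t 4) <= E1 \<and>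
     - E1 <= resid \<theta> Y (t 5) \<and> resid \<theta> Y (t 5) <= - E0 \<and> E0 <= resid \<theta> Y (t 6) \<and> resid \<theta> Y (t 6) <= E1"
  define P where "P = PiM {1..n} (\<lambda>_. borel :: real measure)"
  define \<tau> where "\<tau> w = est w Y" for w
  have \<tau>: "\<tau> \<in> borel_measurable P"
  proof -
   have "(\<lambda>w. (w, Y)) \<in> measurable P (P \<Otimes>\<^sub>M PiM {0..n} (\<lambda>_. borel))"
    by (rule measurable_Pair2'[OF Y])
   moreover have "case_prod est \<in> borel_measurable (P \<Otimes>\<^sub>M PiM {0..n} (\<lambda>_. borel))"
    using est by (simp add: bootstrap_estimator_def P_def)
   ultimately have "(\<lambda>w. case_prod est (w, Y)) \<in> borel_measurable P" by (rule measurable_compose)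
   then show ?thesis by (simp add: \<tau>_def[abs_def])
  qed
  have am: "is_arg_min (L_star n w Y) (\<lambda>\<theta>. \<theta> \<in> \<Theta>) (\<tau> w)" if "w \<in> space P" for w
   using est that Y by (simp add: bootstrap_estimator_def P_def \<tau>_def)
  have \<tau>_mem: "\<tau> w \<in> \<Theta>" if "w \<in> space P" for w
   using am[OF that] by (simp add: is_arg_min_def)
  have \<tau>_le: "(\<Sum>s\<in>{1..n}. w s * qml_loss Y s (\<tau> w)) <= (\<Sum>s\<in>{1..n}. w s * qml_loss Y s \<theta>)"
   if "w \<in> space P" "\<theta> \<in> \<Theta>" for w \<theta>
   using am[OF that(1)] that(2) unfolding is_arg_min_linorder L_star_def by blast
  have Yc: "(\<lambda>_. Y) \<in> measurable P (PiM {0..n} (\<lambda>_. borel))" using Y by simp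
  define S where "S = {w \<in> space P. (\<forall>s\<in>{1..n}. w s > 0) \<and> gamma_star n w Y (\<tau> w) = \<gamma>}"
  \<comment> \<open>The kept sets vary with the minimizer. On each of these finitely many pieces
    they are constant, and twice the estimate is a sum of two weighted means.\<close>
  define S' where "S' B1 B2 = {w \<in> S. kept 1 n Y (\<tau> w) = B1 \<and> kept 2 n Y (\<tau> w) = B2}" for B1 B2
  have comp: "(\<lambda>w. w s) \<in> borel_measurable P" if "s \<in> {1..n}" for s
   unfolding P_def using that by (rule measurable_component_singleton)
  have S_sets: "S \<in> sets P"
  proof -
   have "(\<lambda>w. w) \<in> measurable P (PiM {1..n} (\<lambda>_. borel))" by (simp add: P_def)
   note m = measurable_gamma_star[OF Yc \<tau> this]
   have p: "Measurable.pred P (\<lambda>w. \<forall>s\<in>{1..n}. 0 < w s)"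
   proof (rule pred_intros_finite(3))
    fix s assume "s \<in> {1..n}"
    note [measurable] = comp[OF this]
    show "Measurable.pred P (\<lambda>w. 0 < w s)" by measurable
   qed simp
   have "S = {w \<in> space P. \<forall>s\<in>{1..n}. 0 < w s} \<inter> ((\<lambda>w. gamma_star n w Y (\<tau> w)) -` {\<gamma>} \<inter> space P)"
    by (auto simp: S_def)
   then show ?thesis using p measurable_sets[OF m, of "{\<gamma>}"] by (simp add: pred_def)
  qed
  have kept_sets: "{w \<in> space P. kept k n Y (\<tau> w) = B} \<in> sets P" if "B \<subseteq> {1..n}" for k B
  proof -
   have "Measurable.pred P (\<lambda>w. root_arg k Y s (\<tau> w) \<in> trunc n \<longleftrightarrow> s \<in> B)" if "s \<in> {1..n}" for s
    using pred_sets2[OF sets_trunc measurable_root_arg[OF Yc \<tau> that]]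
    by (intro pred_intros_logic) auto
   then have "Measurable.pred P (\<lambda>w. \<forall>s\<in>{1..n}. root_arg k Y s (\<tau> w) \<in> trunc n \<longleftrightarrow> s \<in> B)"
    by (intro pred_intros_finite(3)) simp_all
   then have "{w \<in> space P. \<forall>s\<in>{1..n}. root_arg k Y s (\<tau> w) \<in> trunc n \<longleftrightarrow> s \<in> B} \<in> sets P" by (simp add: pred_def)
   also have "{w \<in> space P. \<forall>s\<in>{1..n}. root_arg k Y s (\<tau> w) \<in> trunc n \<longleftrightarrow> s \<in> B} = {w \<in> space P. kept k n Y (\<tau> w) = B}"
    using that by (auto simp: kept_def)
   finally show ?thesis .
  qed
  have "S' B1 B2 \<in> null_sets (PiM {1..n} (\<lambda>_. lborel))" if B: "B1 \<subseteq> {1..n}" "B2 \<subseteq> {1..n}" for B1 B2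
  proof (rule weighted_level_null[where I = "{1..n}" and loss = "qml_loss Y" and \<tau> = \<tau> and ?A1.0 = B1 and ?A2.0 = B2
     and ?l1.0 = "\<lambda>s \<theta>. ln \<bar>root_arg 1 Y s \<theta>\<bar>" and ?l2.0 = "\<lambda>s \<theta>. ln \<bar>root_arg 2 Y s \<theta>\<bar>" and c = "2 * \<gamma>"])
   show "{1..n} \<noteq> {}" using n by simp
   show "(\<lambda>w. qml_loss Y k (\<tau> w)) \<in> borel_measurable (PiM {1..n} (\<lambda>_. borel))" if "k \<in> {1..n}" for k
    using measurable_qml_loss[OF Yc \<tau> that] by (simp add: P_def)
   show "\<tau> \<in> borel_measurable (PiM {1..n} (\<lambda>_. borel))" using \<tau> by (simp add: P_def)
   show "(\<Sum>i\<in>{1..n}. w' i * qml_loss Y i (\<tau> w')) <= (\<Sum>i\<in>{1..n}. w' i * qml_loss Y i (\<tau> w))"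
    if "w \<in> PiE {1..n} (\<lambda>_. UNIV)" "w' \<in> PiE {1..n} (\<lambda>_. UNIV)" for w w'
    using that by (intro \<tau>_le \<tau>_mem) (simp_all add: P_def space_PiM)
   have "S' B1 B2 = S \<inter> {w \<in> space P. kept 1 n Y (\<tau> w) = B1} \<inter> {w \<in> space P. kept 2 n Y (\<tau> w) = B2}"
    by (auto simp: S'_def S_def)
   then have "S' B1 B2 \<in> sets P"
    using sets.Int[OF sets.Int[OF S_sets kept_sets[OF B(1), of 1]] kept_sets[OF B(2), of 2]] by simp
   then show "S' B1 B2 \<in> sets (PiM {1..n} (\<lambda>_. borel))" by (simp add: P_def)
   show "B1 \<subseteq> {1..n}" "B2 \<subseteq> {1..n}" by fact+
   show "0 < w s" if "w \<in> S' B1 B2" "s \<in> {1..n}" for w s using that by (simp add: S'_def S_def)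
   show "weighted_mean B1 (\<lambda>s \<theta>. ln \<bar>root_arg 1 Y s \<theta>\<bar>) w (\<tau> w) + weighted_mean B2 (\<lambda>s \<theta>. ln \<bar>root_arg 2 Y s \<theta>\<bar>) w (\<tau> w) = 2 * \<gamma>"
    if "w \<in> S' B1 B2" for w
    using that by (auto simp: S'_def S_def gamma_star_def gamma_star_part_eq)
   have grad: "\<exists>g. strict_gradient (\<lambda>\<theta>. ln \<bar>root_arg k Y s \<theta>\<bar>) g (\<tau> w)"
    if w: "w \<in> S" and s: "s \<in> kept k n Y (\<tau> w)" for w s k
   proof -
    obtain \<phi> \<alpha> \<omega> where \<theta>: "\<tau> w = (\<phi>, \<alpha>, \<omega>)" by (cases "\<tau> w") auto
    have "(\<phi>, \<alpha>, \<omega>) \<in> \<Theta>" using \<tau>_mem[of w] w unfolding \<theta>[symmetric] by (simp add: S_def)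
    then have \<alpha>\<omega>: "\<alpha> > 0" "\<omega> > 0" using box c by force+
    have "root_arg k Y s (\<tau> w) \<in> trunc n" using s by (simp add: kept_def)
    moreover have "1 / (real n)\<^sup>2 > 0" using n by simp
    ultimately have "root_arg k Y s (\<tau> w) \<noteq> 0" by (auto simp: trunc_def)
    then have ne: "(Y s - Y (s - 1) * \<phi>) * inverse (sqrt (\<omega> + (Y (s - 1))\<^sup>2 * \<alpha>)) * sqrt \<alpha> + - ((- 1) ^ k) * \<phi> \<noteq> 0"
     unfolding \<theta> root_arg_def resid_unfold by simp
    show ?thesis
     using strict_gradient_log_abs[OF \<alpha>\<omega> ne] unfolding \<theta> root_arg_def resid_unfold by simp
   qed
   show "\<exists>g. strict_gradient (\<lambda>\<theta>. ln \<bar>root_arg 1 Y s \<theta>\<bar>) g (\<tau> w)" if "w \<in> S' B1 B2" "s \<in> B1" for w s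
    using grad[of w s 1] that by (simp add: S'_def)
   show "\<exists>g. strict_gradient (\<lambda>\<theta>. ln \<bar>root_arg 2 Y s \<theta>\<bar>) g (\<tau> w)" if "w \<in> S' B1 B2" "s \<in> B2" for w s
    using grad[of w s 2] that by (simp add: S'_def)
   fix w assume w: "w \<in> S' B1 B2"
   then have wP: "w \<in> space P" by (simp add: S'_def S_def)
   obtain \<phi> \<alpha> \<omega> where \<theta>: "\<tau> w = (\<phi>, \<alpha>, \<omega>)" by (cases "\<tau> w") auto
   have mem: "(\<phi>, \<alpha>, \<omega>) \<in> \<Theta>" using \<tau>_mem[OF wP] unfolding \<theta> .
   note bx = box[OF mem]
   have \<alpha>\<omega>: "\<alpha> > 0" "\<omega> > 0" using bx c by auto
   define ee where "ee i = resid (\<phi>, \<alpha>, \<omega>) Y (t i)" for i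
   note e' = e[OF mem, folded ee_def]
   have i_cases: "i = 1 \<or> i = 2 \<or> i = 3 \<or> i = 4 \<or> i = 5 \<or> i = 6" if "i \<in> {1..6::nat}" for i
    using that by auto
   have ee_abs: "E0 <= \<bar>ee i\<bar> \<and> \<bar>ee i\<bar> <= E1" if "i \<in> {1..6}" for i
    using i_cases[OF that] e' E0 by (elim disjE) auto
   \<comment> \<open>Residuals of modulus at least \<open>E0\<close> make the argument at least 1 in
     modulus; \<open>E1\<close> and the lower bound on \<open>n\<close> keep it below the outer
     truncation. So the six indices belong to both kept sets at every minimizer.\<close>
   have in_kept: "t i \<in> kept k n Y (\<tau> w)" if i: "i \<in> {1..6}" for i k
   proof -
    define X where "X = root_arg k Y (t i) (\<tau> w)"
    have X: "X = ee i * sqrt \<alpha> - (- 1) ^ k * \<phi>" by (simp add: X_def root_arg_def \<theta> ee_def)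
    have ab: "\<bar>(- 1) ^ k * \<phi>\<bar> <= C" using bx by (simp add: abs_mult)
    have "sqrt c * E0 <= sqrt \<alpha> * \<bar>ee i\<bar>" using bx c E0 ee_abs[OF i] by (intro mult_mono) auto
    then have lo: "\<bar>ee i * sqrt \<alpha>\<bar> >= C + 1" using E0 \<alpha>\<omega> by (simp add: abs_mult mult.commute)
    have "sqrt \<alpha> * \<bar>ee i\<bar> <= sqrt C * E1" using bx c E0 ee_abs[OF i] by (intro mult_mono) auto
    then have hi: "\<bar>ee i * sqrt \<alpha>\<bar> <= sqrt C * E1" using \<alpha>\<omega> by (simp add: abs_mult mult.commute)
    have "1 <= \<bar>X\<bar>" "\<bar>X\<bar> <= (real n)\<^sup>2" using lo hi ab n(2) unfolding X by linarith+
    moreover have "1 / (real n)\<^sup>2 <= 1" using n(1) by simp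
    ultimately have "X \<in> trunc n" unfolding trunc_def by auto
    then show ?thesis using t[OF i] by (simp add: kept_def X_def)
   qed
   define gr where "gr s = (- (sgn (resid (\<phi>, \<alpha>, \<omega>) Y s) * Y (s - 1) / sqrt (\<omega> + (Y (s - 1))\<^sup>2 * \<alpha>)),
     (Y (s - 1))\<^sup>2 * (1 - \<bar>resid (\<phi>, \<alpha>, \<omega>) Y s\<bar>) / (2 * (\<omega> + (Y (s - 1))\<^sup>2 * \<alpha>)),
     (1 - \<bar>resid (\<phi>, \<alpha>, \<omega>) Y s\<bar>) / (2 * (\<omega> + (Y (s - 1))\<^sup>2 * \<alpha>)))" for s
   show "\<exists>J g. J \<noteq> {} \<and> J \<subseteq> B1 \<inter> B2 \<and> (\<forall>s\<in>J. strict_gradient (qml_loss Y s) (g s) (\<tau> w)) \<and>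
     (\<forall>b1>0. \<forall>b2>0. \<forall>b0 z1 z2. (\<forall>s\<in>J. z1 \<bullet> g s + z2 * (b1 * ln \<bar>root_arg 1 Y s (\<tau> w)\<bar> + b2 * ln \<bar>root_arg 2 Y s (\<tau> w)\<bar> - b0) = 0) -->
      z1 = 0 \<and> z2 = 0)"
   proof (rule exI[of _ "t ` {1..6}"], rule exI[of _ gr], intro conjI ballI allI impI)
    show "t ` {1..6} \<noteq> {}" by simp
    show "t ` {1..6} \<subseteq> B1 \<inter> B2" using in_kept w by (auto simp: S'_def)
    fix s assume "s \<in> t ` {1..6}"
    then obtain i where i: "i \<in> {1..6}" "s = t i" by blast
    have ne: "resid (\<phi>, \<alpha>, \<omega>) Y s \<noteq> 0" using ee_abs[OF i(1)] E0 by (auto simp: ee_def i)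
    have rs: "resid (\<phi>, \<alpha>, \<omega>) Y s = (Y s - \<phi> * Y (s - 1)) / sqrt (\<omega> + (Y (s - 1))\<^sup>2 * \<alpha>)"
     by (simp add: mult.commute)
    show "strict_gradient (qml_loss Y s) (gr s) (\<tau> w)"
     using strict_gradient_loss[OF \<alpha>\<omega> ne[unfolded rs]]
     unfolding \<theta> gr_def rs[symmetric] qml_loss_unfold[abs_def] .
   next
    fix b1 b2 b0 z2 :: real and z1 :: "real \<times> real \<times> real"
    assume b: "b1 > 0" "b2 > 0"
     and eq: "\<forall>s\<in>t ` {1..6}. z1 \<bullet> gr s + z2 * (b1 * ln \<bar>root_arg 1 Y s (\<tau> w)\<bar> + b2 * ln \<bar>root_arg 2 Y s (\<tau> w)\<bar> - b0) = 0"
    obtain a1 a2 a3 where z1: "z1 = (a1, a2, a3)" by (cases z1) auto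
    have "a1 = 0 \<and> a2 = 0 \<and> a3 = 0 \<and> z2 = 0"
    proof (rule indep[where y = "\<lambda>i. Y (t i - 1)" and e = ee and \<alpha> = \<alpha> and \<omega> = \<omega> and \<phi> = \<phi> and ?b1.0 = b1 and ?b2.0 = b2 and ?b0.0 = b0])
     fix i :: nat assume i: "i \<in> {1..6}"
     have "z1 \<bullet> gr (t i) + z2 * (b1 * ln \<bar>root_arg 1 Y (t i) (\<tau> w)\<bar> + b2 * ln \<bar>root_arg 2 Y (t i) (\<tau> w)\<bar> - b0) = 0"
      using eq i by blast
     moreover have "root_arg 1 Y (t i) (\<tau> w) = ee i * sqrt \<alpha> + \<phi>" "root_arg 2 Y (t i) (\<tau> w) = ee i * sqrt \<alpha> - \<phi>"
      by (simp_all add: root_arg_def \<theta> ee_def)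
     ultimately show "a1 * (- (sgn (ee i) * Y (t i - 1) / sqrt (\<omega> + (Y (t i - 1))\<^sup>2 * \<alpha>)))
     + a2 * ((Y (t i - 1))\<^sup>2 * (1 - \<bar>ee i\<bar>) / (2 * (\<omega> + (Y (t i - 1))\<^sup>2 * \<alpha>)))
     + a3 * ((1 - \<bar>ee i\<bar>) / (2 * (\<omega> + (Y (t i - 1))\<^sup>2 * \<alpha>)))
     + z2 * (b1 * ln \<bar>ee i * sqrt \<alpha> + \<phi>\<bar> + b2 * ln \<bar>ee i * sqrt \<alpha> - \<phi>\<bar> - b0) = 0"
      unfolding z1 gr_def ee_def[symmetric] by (simp only: inner_Pair inner_real_def add.assoc)
    qed (use bx e' b y y6 in simp_all)
    then show "z1 = 0" "z2 = 0" by (simp_all add: z1 zero_prod_def)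
   qed
  qed simp
  then have "(\<Union>B1\<in>Pow {1..n}. \<Union>B2\<in>Pow {1..n}. S' B1 B2) \<in> null_sets (PiM {1..n} (\<lambda>_. lborel))"
   by (intro null_sets_UN' countable_finite) auto
  moreover have "S = (\<Union>B1\<in>Pow {1..n}. \<Union>B2\<in>Pow {1..n}. S' B1 B2)"
  proof (intro equalityI subsetI)
   fix w assume "w \<in> S"
   then have "w \<in> S' (kept 1 n Y (\<tau> w)) (kept 2 n Y (\<tau> w))" by (simp only: S'_def mem_Collect_eq simp_thms)
   moreover have "kept k n Y (\<tau> w) \<in> Pow {1..n}" for k using kept_subset by (simp only: Pow_iff)
   ultimately show "w \<in> (\<Union>B1\<in>Pow {1..n}. \<Union>B2\<in>Pow {1..n}. S' B1 B2)" by blast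
  next
   fix w assume "w \<in> (\<Union>B1\<in>Pow {1..n}. \<Union>B2\<in>Pow {1..n}. S' B1 B2)"
   then obtain B1 B2 where "w \<in> S' B1 B2" by blast
   then show "w \<in> S" by (simp only: S'_def mem_Collect_eq)
  qed
  ultimately show "{w \<in> space (PiM {1..n} (\<lambda>_. borel)). (\<forall>t\<in>{1..n}. w t > 0) \<and> gamma_star n w Y (est w Y) = \<gamma>}
    \<in> null_sets (PiM {1..n} (\<lambda>_. lborel))"
   by (simp add: S_def P_def \<tau>_def)
 qed
qed

section \<open>Laws of large numbers along the path\<close>

lemma (in prob_space) distr_indep_rv:
 assumes "indep_rv M N X N' X'"
 shows "distr M (N \<Otimes>\<^sub>M N') (\<lambda>x. (X x, X' x)) = distr M N X \<Otimes>\<^sub>M distr M N' X'"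
proof -
 have X: "X \<in> measurable M N" and X': "X' \<in> measurable M N'"
  and ind: "indep_set {X -` A \<inter> space M |A. A \<in> sets N} {X' -` A \<inter> space M |A. A \<in> sets N'}"
  using assms by (auto simp: indep_rv_def)
 interpret D: prob_space "distr M N X" by (rule prob_space_distr[OF X])
 interpret D': prob_space "distr M N' X'" by (rule prob_space_distr[OF X'])
 show ?thesis
 proof (rule pair_measure_eqI[symmetric])
  fix A B assume A: "A \<in> sets (distr M N X)" and B: "B \<in> sets (distr M N' X')"
  have "prob ((X -` A \<inter> space M) \<inter> (X' -` B \<inter> space M)) = prob (X -` A \<inter> space M) * prob (X' -` B \<inter> space M)"
   by (rule indep_setD[OF ind]) (use A B in auto)
  moreover have "(\<lambda>x. (X x, X' x)) -` (A \<times> B) \<inter> space M = (X -` A \<inter> space M) \<inter> (X' -` B \<inter> space M)"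
   by auto
  ultimately show "emeasure (distr M N X) A * emeasure (distr M N' X') B =
    emeasure (distr M (N \<Otimes>\<^sub>M N') (\<lambda>x. (X x, X' x))) (A \<times> B)"
   using A B X X' by (simp add: emeasure_distr emeasure_eq_measure ennreal_mult')
 qed (use D.sigma_finite_measure_axioms D'.sigma_finite_measure_axioms in \<open>auto intro!: sets_pair_measure_cong\<close>)
qed

lemma integrable_mult_squares:
 fixes a b :: "'b => real"
 assumes [measurable]: "a \<in> borel_measurable M" "b \<in> borel_measurable M"
  and "integrable M (\<lambda>x. (a x)\<^sup>2)" "integrable M (\<lambda>x. (b x)\<^sup>2)"
 shows "integrable M (\<lambda>x. a x * b x)"
proof (rule Bochner_Integration.integrable_bound)
 show "integrable M (\<lambda>x. (a x)\<^sup>2 + (b x)\<^sup>2)" using assms by auto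
 have "\<bar>p * q\<bar> <= p\<^sup>2 + q\<^sup>2" for p q :: real
 proof -
  have "2 * \<bar>p * q\<bar> <= p\<^sup>2 + q\<^sup>2" using sum_squares_bound[of "\<bar>p\<bar>" "\<bar>q\<bar>"] by (simp add: abs_mult)
  then show ?thesis by (smt (verit) abs_ge_zero)
 qed
 then show "AE x in M. norm (a x * b x) <= norm ((a x)\<^sup>2 + (b x)\<^sup>2)" by (intro AE_I2) simp
qed simp

lemma (in prob_space) chebyshev_orthogonal:
 fixes D :: "nat => 'a => real" and \<epsilon> :: real
 assumes D: "\<And>t. t \<in> {1..n} ==> D t \<in> borel_measurable M"
  and sq: "\<And>t. t \<in> {1..n} ==> integrable M (\<lambda>x. (D t x)\<^sup>2)"
  and bd: "\<And>t. t \<in> {1..n} ==> expectation (\<lambda>x. (D t x)\<^sup>2) <= K"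
  and orth: "\<And>s t. s \<in> {1..n} ==> t \<in> {1..n} ==> s < t ==> expectation (\<lambda>x. D s x * D t x) = 0"
  and \<epsilon>: "\<epsilon> > 0" and n: "n >= 1"
 shows "prob {x \<in> space M. \<bar>\<Sum>t=1..n. D t x\<bar> >= \<epsilon> * n} <= K / (\<epsilon>\<^sup>2 * n)"
proof -
 have int: "integrable M (\<lambda>x. D s x * D t x)" if "s \<in> {1..n}" "t \<in> {1..n}" for s t
  using that by (intro integrable_mult_squares D sq)
 have orth': "expectation (\<lambda>x. D s x * D t x) = 0" if "s \<in> {1..n}" "t \<in> {1..n}" "s \<noteq> t" for s t
  using orth[of s t] orth[of t s] that by (cases s t rule: linorder_cases) (auto simp: mult.commute)
 have sq_sum: "(\<Sum>t=1..n. D t x)\<^sup>2 = (\<Sum>s=1..n. \<Sum>t=1..n. D s x * D t x)" for x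
  by (simp add: power2_eq_square sum_product)
 have "expectation (\<lambda>x. (\<Sum>t=1..n. D t x)\<^sup>2) = (\<Sum>s=1..n. expectation (\<lambda>x. \<Sum>t=1..n. D s x * D t x))"
  unfolding sq_sum by (rule Bochner_Integration.integral_sum) (intro Bochner_Integration.integrable_sum int)
 also have "\<dots> = (\<Sum>s=1..n. \<Sum>t=1..n. expectation (\<lambda>x. D s x * D t x))"
  by (intro sum.cong refl Bochner_Integration.integral_sum int)
 also have "\<dots> = (\<Sum>s=1..n. \<Sum>t=1..n. if s = t then expectation (\<lambda>x. (D s x)\<^sup>2) else 0)"
  using orth' by (intro sum.cong) (auto simp: power2_eq_square)
 also have "\<dots> = (\<Sum>s=1..n. expectation (\<lambda>x. (D s x)\<^sup>2))" by (intro sum.cong) (auto simp: sum.delta)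
 also have "\<dots> <= (\<Sum>s=1..n. K)" by (intro sum_mono bd)
 finally have E: "expectation (\<lambda>x. (\<Sum>t=1..n. D t x)\<^sup>2) <= n * K" by simp
 have meas: "(\<lambda>x. \<Sum>t=1..n. D t x) \<in> borel_measurable M" using D by (intro borel_measurable_sum) auto
 have "prob {x \<in> space M. (\<Sum>t=1..n. D t x)\<^sup>2 >= (\<epsilon> * n)\<^sup>2} <= expectation (\<lambda>x. (\<Sum>t=1..n. D t x)\<^sup>2) / (\<epsilon> * n)\<^sup>2"
 proof (rule integral_Markov_inequality_measure[where A = "{}"])
  show "integrable M (\<lambda>x. (\<Sum>t=1..n. D t x)\<^sup>2)"
   unfolding sq_sum using int by (intro Bochner_Integration.integrable_sum) auto
 qed (use \<epsilon> n in auto)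
 also have "\<dots> <= n * K / (\<epsilon> * n)\<^sup>2" using E by (intro divide_right_mono) auto
 also have "\<dots> = K / (\<epsilon>\<^sup>2 * n)" using n \<epsilon> by (simp add: power2_eq_square field_simps)
 finally have "prob {x \<in> space M. (\<epsilon> * n)\<^sup>2 <= (\<Sum>t=1..n. D t x)\<^sup>2} <= K / (\<epsilon>\<^sup>2 * n)" .
 moreover have "(\<epsilon> * n)\<^sup>2 <= z\<^sup>2 \<longleftrightarrow> \<epsilon> * n <= \<bar>z\<bar>" for z
  using \<epsilon> abs_le_square_iff[of "\<epsilon> * n" z] by simp
 ultimately show ?thesis by simp
qed

section \<open>The model and its innovations\<close>

locale dar_model = prob_space M for M :: "'a measure" +
 fixes \<eta> y :: "nat => 'a => real" and f :: "real => real" and \<phi>\<^sub>0 \<alpha>\<^sub>0 \<omega>\<^sub>0 :: real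
 assumes pos: "\<omega>\<^sub>0 > 0" "\<alpha>\<^sub>0 > 0"
  and law: "\<And>t. t >= 1 ==> distributed M lborel (\<eta> t) (\<lambda>u. ennreal (f u))"
  and model: "dar1_process M (\<phi>\<^sub>0, \<alpha>\<^sub>0, \<omega>\<^sub>0) \<eta> y"
  and moment1: "(LINT x|M. \<bar>\<eta> 1 x\<bar>) = 1"
  and moment2: "integrable M (\<lambda>x. (\<eta> 1 x)\<^sup>2)"
  and f_nonneg: "\<And>u. f u >= 0"
  and f_sym: "\<And>u. f (- u) = f u"
  and f_bdd: "bounded (range f)"
  and f_pos: "AE u in lborel. f u > 0"
begin

definition \<mu> :: "real measure" where "\<mu> = density lborel (\<lambda>u. ennreal (f u))"

text \<open>The innovation read off the path. It agrees with \<open>\<eta> t\<close> almost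
  everywhere, but it satisfies the recursion at every point, and being a function of the sample it
  is covered by the independence of sample and weights.\<close>

definition U :: "nat => 'a => real" where "U t x = resid (\<phi>\<^sub>0, \<alpha>\<^sub>0, \<omega>\<^sub>0) (\<lambda>j. y j x) t"

abbreviation \<theta>\<^sub>0 :: "real \<times> real \<times> real" where "\<theta>\<^sub>0 \<equiv> (\<phi>\<^sub>0, \<alpha>\<^sub>0, \<omega>\<^sub>0)"

text \<open>The only consequence of minimality that enters the consistency proofs, which therefore
  hold for every choice of the minimizer.\<close>

abbreviation no_worse :: "nat => (nat => 'a => real) => 'a => real \<times> real \<times> real => bool" where
 "no_worse n W x \<theta> \<equiv> (\<Sum>t=1..n. W t x * qml_loss (sample y n x) t \<theta>) <= (\<Sum>t=1..n. W t x * qml_loss (sample y n x) t \<theta>\<^sub>0)"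

text \<open>A bound for the second moment of \<open>1 + \<bar>u\<bar>\<close>, the growth function
  of all summands in the laws of large numbers.\<close>

definition K0 :: real where "K0 = 2 + 2 * (\<integral>u. u\<^sup>2 \<partial>\<mu>)"

lemma f_measurable [measurable]: "f \<in> borel_measurable borel"
proof -
 have "(\<lambda>u. ennreal (f u)) \<in> borel_measurable borel"
  using distributed_borel_measurable[OF law[of 1]] by simp
 then have "(\<lambda>u. enn2real (ennreal (f u))) \<in> borel_measurable borel" by measurable
 then show ?thesis using f_nonneg by simp
qed

lemma sets_\<mu> [simp, measurable_cong]: "sets \<mu> = sets borel" and space_\<mu> [simp]: "space \<mu> = UNIV"
 by (simp_all add: \<mu>_def)

lemma \<eta>_measurable [measurable]: "t >= 1 ==> \<eta> t \<in> borel_measurable M"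
 using distributed_measurable[OF law] by simp

lemma y_measurable [measurable]: "y t \<in> borel_measurable M"
 using model by simp

lemma U_measurable [measurable]: "U t \<in> borel_measurable M"
 unfolding U_def[abs_def] resid.simps by measurable

lemma distr_\<eta>: "t >= 1 ==> distr M borel (\<eta> t) = \<mu>"
 using distributed_distr_eq_density[OF law] by (simp add: \<mu>_def cong: distr_cong)

lemma prob_space_\<mu>: "prob_space \<mu>"
 using prob_space_distr[OF \<eta>_measurable[of 1]] by (simp add: distr_\<eta>)

sublocale \<mu>: prob_space \<mu> by (rule prob_space_\<mu>)

lemma integrable_\<mu>_sq: "integrable \<mu> (\<lambda>u. u\<^sup>2)"
 using moment2 integrable_distr_eq[of "\<eta> 1" M borel "\<lambda>u. u\<^sup>2"] by (simp add: distr_\<eta>)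

lemma integrable_\<mu>_abs [simp]: "integrable \<mu> (\<lambda>u. \<bar>u\<bar>)"
proof (rule Bochner_Integration.integrable_bound)
 show "integrable \<mu> (\<lambda>u. 1 + u\<^sup>2)" using integrable_\<mu>_sq by simp
 have "\<bar>u\<bar> <= 1 + u\<^sup>2" for u :: real
  using sum_squares_bound[of 1 "\<bar>u\<bar>"] by (simp add: power2_eq_square)
 then show "AE u in \<mu>. norm \<bar>u\<bar> <= norm (1 + u\<^sup>2)" by (intro AE_I2) simp
qed simp

lemma integrable_\<mu>_id [simp]: "integrable \<mu> (\<lambda>u. u)"
 using integrable_\<mu>_abs integrable_abs_cancel[of \<mu> "\<lambda>u. u"] by simp

lemma integral_\<mu>_abs: "(\<integral>u. \<bar>u\<bar> \<partial>\<mu>) = 1"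
 using moment1 integral_distr[of "\<eta> 1" M borel "\<lambda>u. \<bar>u\<bar>"] by (simp add: distr_\<eta>)

lemma K0_bound: "integrable \<mu> (\<lambda>u. (1 + \<bar>u\<bar>)\<^sup>2)" "(\<integral>u. (1 + \<bar>u\<bar>)\<^sup>2 \<partial>\<mu>) <= K0" "K0 >= 2"
proof -
 have le: "(1 + \<bar>u\<bar>)\<^sup>2 <= 2 + 2 * u\<^sup>2" for u :: real
  using sum_squares_bound[of 1 "\<bar>u\<bar>"] by (simp add: power2_eq_square algebra_simps)
 have "integrable \<mu> (\<lambda>u. 2 + 2 * u\<^sup>2)" using integrable_\<mu>_sq by simp
 then show int: "integrable \<mu> (\<lambda>u. (1 + \<bar>u\<bar>)\<^sup>2)"
  by (rule Bochner_Integration.integrable_bound) (auto intro!: AE_I2 simp: le)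
 have "(\<integral>u. (1 + \<bar>u\<bar>)\<^sup>2 \<partial>\<mu>) <= (\<integral>u. 2 + 2 * u\<^sup>2 \<partial>\<mu>)"
  using int integrable_\<mu>_sq by (intro integral_mono le) auto
 then show "(\<integral>u. (1 + \<bar>u\<bar>)\<^sup>2 \<partial>\<mu>) <= K0"
  using integrable_\<mu>_sq \<mu>.prob_space by (simp add: K0_def)
 show "K0 >= 2" by (simp add: K0_def)
qed

lemma AE_U: "AE x in M. \<forall>t\<ge>1. U t x = \<eta> t x"
proof -
 have "AE x in M. U t x = \<eta> t x" if "t >= 1" for t
 proof -
  have "AE x in M. y t x = \<phi>\<^sub>0 * y (t - 1) x + \<eta> t x * sqrt (\<omega>\<^sub>0 + \<alpha>\<^sub>0 * (y (t - 1) x)\<^sup>2)"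
   using model that by simp
  then show ?thesis
  proof eventually_elim
   case (elim x)
   have "sqrt (\<omega>\<^sub>0 + \<alpha>\<^sub>0 * (y (t - 1) x)\<^sup>2) > 0" using pos by (simp add: add_pos_nonneg)
   then show ?case unfolding U_def resid.simps elim by simp
  qed
 qed
 then have "AE x in M. \<forall>t. t >= 1 --> U t x = \<eta> t x" by (simp add: AE_all_countable)
 then show ?thesis by simp
qed

lemma y_rec: "y t x = \<phi>\<^sub>0 * y (t - 1) x + U t x * sqrt (\<omega>\<^sub>0 + \<alpha>\<^sub>0 * (y (t - 1) x)\<^sup>2)"
proof -
 have "sqrt (\<omega>\<^sub>0 + \<alpha>\<^sub>0 * (y (t - 1) x)\<^sup>2) > 0" using pos by (simp add: add_pos_nonneg)
 then show ?thesis unfolding U_def resid.simps by simp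
qed

text \<open>With a product as joint law, conditional expectations given the past become integrals
  over \<open>\<mu>\<close>.\<close>

lemma past_innovation_law:
 assumes "t >= 1"
 shows "distr M (borel \<Otimes>\<^sub>M PiM {..<t} (\<lambda>_. borel)) (\<lambda>x. (U t x, \<lambda>j\<in>{..<t}. y j x))
   = \<mu> \<Otimes>\<^sub>M distr M (PiM {..<t} (\<lambda>_. borel)) (\<lambda>x. \<lambda>j\<in>{..<t}. y j x)"
proof -
 have past: "(\<lambda>x. \<lambda>j\<in>{..<t}. y j x) \<in> measurable M (PiM {..<t} (\<lambda>_. borel))" by measurable
 have ind: "indep_rv M borel (\<eta> t) (PiM {..<t} (\<lambda>_. borel)) (\<lambda>x. \<lambda>j\<in>{..<t}. y j x)"
  using model assms by simp
 from distr_indep_rv[OF this]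
 have "distr M (borel \<Otimes>\<^sub>M PiM {..<t} (\<lambda>_. borel)) (\<lambda>x. (\<eta> t x, \<lambda>j\<in>{..<t}. y j x))
   = \<mu> \<Otimes>\<^sub>M distr M (PiM {..<t} (\<lambda>_. borel)) (\<lambda>x. \<lambda>j\<in>{..<t}. y j x)"
  by (simp add: distr_\<eta>[OF assms])
 moreover have "distr M (borel \<Otimes>\<^sub>M PiM {..<t} (\<lambda>_. borel)) (\<lambda>x. (\<eta> t x, \<lambda>j\<in>{..<t}. y j x))
   = distr M (borel \<Otimes>\<^sub>M PiM {..<t} (\<lambda>_. borel)) (\<lambda>x. (U t x, \<lambda>j\<in>{..<t}. y j x))"
 proof (rule distr_cong_AE)
  show "AE x in M. (\<eta> t x, \<lambda>j\<in>{..<t}. y j x) = (U t x, \<lambda>j\<in>{..<t}. y j x)"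
   using AE_U by eventually_elim (use assms in simp)
  show "(\<lambda>x. (\<eta> t x, \<lambda>j\<in>{..<t}. y j x)) \<in> measurable M (borel \<Otimes>\<^sub>M PiM {..<t} (\<lambda>_. borel))"
   by (rule measurable_Pair[OF \<eta>_measurable[OF assms] past])
  show "(\<lambda>x. (U t x, \<lambda>j\<in>{..<t}. y j x)) \<in> measurable M (borel \<Otimes>\<^sub>M PiM {..<t} (\<lambda>_. borel))"
   by (rule measurable_Pair[OF U_measurable past])
 qed simp_all
 ultimately show ?thesis by simp
qed

end

section \<open>Weighted laws of large numbers\<close>

text \<open>Just enough about the weights for a weak law. Constant weights 1 and standard
  exponential weights both qualify, so one proof covers \<open>gamma_hat\<close> and every bootstrap
  replicate.\<close>

locale weights = dar_model +
 fixes n :: nat and W :: "nat => 'a => real"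
 assumes n_pos: "n >= 1"
  and W_measurable [measurable]: "t \<in> {1..n} ==> W t \<in> borel_measurable M"
  and W_indep: "indep_rv M (PiM {0..n} (\<lambda>_. borel)) (sample y n) (PiM {1..n} (\<lambda>_. borel)) (\<lambda>x. \<lambda>t\<in>{1..n}. W t x)"
  and W_nonneg: "AE x in M. \<forall>t\<in>{1..n}. W t x >= 0"
  and W_sq: "t \<in> {1..n} ==> integrable M (\<lambda>x. (W t x)\<^sup>2)"
  and W_mean: "t \<in> {1..n} ==> expectation (W t) = 1"
  and W_var: "t \<in> {1..n} ==> expectation (\<lambda>x. (W t x)\<^sup>2) <= 2"
  and W_uncor: "s \<in> {1..n} ==> t \<in> {1..n} ==> s < t ==> expectation (\<lambda>x. W s x * W t x) = 1"

text \<open>Reduction to \<open>indep_var\<close> of real functions, for which expectations of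
  products factor.\<close>

lemma (in prob_space) indep_rv_compose:
 fixes a :: "'b => real" and b :: "'c => real"
 assumes "indep_rv M N X N' X'" and a: "a \<in> borel_measurable N" and b: "b \<in> borel_measurable N'"
 shows "indep_var borel (\<lambda>x. a (X x)) borel (\<lambda>x. b (X' x))"
proof -
 have X: "X \<in> measurable M N" and X': "X' \<in> measurable M N'"
  and ind: "indep_set {X -` A \<inter> space M |A. A \<in> sets N} {X' -` A \<inter> space M |A. A \<in> sets N'}"
  using assms(1) by (auto simp: indep_rv_def)
 have aX: "(\<lambda>x. a (X x)) \<in> borel_measurable M" by (rule measurable_compose[OF X a])
 have bX: "(\<lambda>x. b (X' x)) \<in> borel_measurable M" by (rule measurable_compose[OF X' b])
 have stable: "Int_stable {g -` A \<inter> space M |A. A \<in> sets borel}" for g :: "'a => real"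
 proof (rule Int_stableI)
  fix S T assume "S \<in> {g -` A \<inter> space M |A. A \<in> sets borel}" "T \<in> {g -` A \<inter> space M |A. A \<in> sets borel}"
  then obtain A B where "S = g -` A \<inter> space M" "T = g -` B \<inter> space M" "A \<in> sets borel" "B \<in> sets borel" by blast
  then have "S \<inter> T = g -` (A \<inter> B) \<inter> space M" "A \<inter> B \<in> sets borel" by auto
  then show "S \<inter> T \<in> {g -` A \<inter> space M |A. A \<in> sets borel}" by blast
 qed
 have "indep_set {(\<lambda>x. a (X x)) -` A \<inter> space M |A. A \<in> sets borel} {(\<lambda>x. b (X' x)) -` A \<inter> space M |A. A \<in> sets borel}"
 proof (rule indep_setI)
  show "{(\<lambda>x. a (X x)) -` A \<inter> space M |A. A \<in> sets borel} \<subseteq> events" using measurable_sets[OF aX] by blast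
  show "{(\<lambda>x. b (X' x)) -` A \<inter> space M |A. A \<in> sets borel} \<subseteq> events" using measurable_sets[OF bX] by blast
  fix S T assume "S \<in> {(\<lambda>x. a (X x)) -` A \<inter> space M |A. A \<in> sets borel}" "T \<in> {(\<lambda>x. b (X' x)) -` A \<inter> space M |A. A \<in> sets borel}"
  then obtain A B where AB: "S = (\<lambda>x. a (X x)) -` A \<inter> space M" "T = (\<lambda>x. b (X' x)) -` B \<inter> space M"
   "A \<in> sets borel" "B \<in> sets borel" by blast
  have "S = X -` (a -` A \<inter> space N) \<inter> space M" "T = X' -` (b -` B \<inter> space N') \<inter> space M"
   using AB measurable_space[OF X] measurable_space[OF X'] by auto
  moreover have "a -` A \<inter> space N \<in> sets N" "b -` B \<inter> space N' \<in> sets N'"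
   using AB a b by auto
  ultimately show "prob (S \<inter> T) = prob S * prob T" by (intro indep_setD[OF ind]) blast+
 qed
 from indep_set_sigma_sets[OF this stable stable] show ?thesis
  unfolding indep_var_eq using aX bX by blast
qed

context dar_model
begin

text \<open>The conditional expectation of \<open>\<psi> (U t) (y (t - 1))\<close> given
  \<open>y (t - 1) = v\<close>, for \<open>t >= 1\<close>.\<close>

definition cmean :: "(real => real => real) => real => real" where
 "cmean \<psi> v = (\<integral>u. \<psi> u v \<partial>\<mu>)"

lemma distr_U: "t >= 1 ==> distr M borel (U t) = \<mu>"
 unfolding distr_\<eta>[symmetric] using AE_U
 by (intro distr_cong_AE) (auto elim!: eventually_mono)

lemma U_sq: 
 assumes "t >= 1"
 shows "integrable M (\<lambda>x. (1 + \<bar>U t x\<bar>)\<^sup>2)" "expectation (\<lambda>x. (1 + \<bar>U t x\<bar>)\<^sup>2) <= K0"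
 using K0_bound(1,2) integrable_distr_eq[of "U t" M borel "\<lambda>u. (1 + \<bar>u\<bar>)\<^sup>2"]
  integral_distr[of "U t" M borel "\<lambda>u. (1 + \<bar>u\<bar>)\<^sup>2"] by (simp_all add: distr_U[OF assms])

context
 fixes \<psi> :: "real => real => real" and C :: real
 assumes \<psi> [measurable]: "case_prod \<psi> \<in> borel_measurable (borel \<Otimes>\<^sub>M borel)"
  and C: "C >= 0" "\<And>u v. \<bar>\<psi> u v\<bar> <= C * (1 + \<bar>u\<bar>)"
begin

lemma \<psi>_u: "(\<lambda>u. \<psi> u v) \<in> borel_measurable borel"
 by measurable

lemma \<psi>_sq: "(\<psi> u v)\<^sup>2 <= C\<^sup>2 * (1 + \<bar>u\<bar>)\<^sup>2"
 using power_mono[OF C(2)[of u v], of 2] by (simp add: power_mult_distrib)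

lemma \<psi>_integrable: "integrable \<mu> (\<lambda>u. \<psi> u v)" "integrable \<mu> (\<lambda>u. (\<psi> u v)\<^sup>2)"
 "(\<integral>u. (\<psi> u v)\<^sup>2 \<partial>\<mu>) <= C\<^sup>2 * K0"
proof -
 show "integrable \<mu> (\<lambda>u. \<psi> u v)"
  by (rule Bochner_Integration.integrable_bound[of _ "\<lambda>u. C * (1 + \<bar>u\<bar>)"])
    (use C \<psi>_u in \<open>auto intro!: AE_I2 order.trans[OF C(2)]\<close>)
 show sq: "integrable \<mu> (\<lambda>u. (\<psi> u v)\<^sup>2)"
  by (rule Bochner_Integration.integrable_bound[of _ "\<lambda>u. C\<^sup>2 * (1 + \<bar>u\<bar>)\<^sup>2"])
    (use K0_bound \<psi>_sq \<psi>_u in auto)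
 have "(\<integral>u. (\<psi> u v)\<^sup>2 \<partial>\<mu>) <= (\<integral>u. C\<^sup>2 * (1 + \<bar>u\<bar>)\<^sup>2 \<partial>\<mu>)"
  using K0_bound by (intro integral_mono sq \<psi>_sq) auto
 also have "\<dots> <= C\<^sup>2 * K0" using K0_bound by (simp add: mult_left_mono)
 finally show "(\<integral>u. (\<psi> u v)\<^sup>2 \<partial>\<mu>) <= C\<^sup>2 * K0" .
qed

lemma cmean_measurable: "cmean \<psi> \<in> borel_measurable borel"
proof -
 have "(\<lambda>p. \<psi> (snd p) (fst p)) \<in> borel_measurable (borel \<Otimes>\<^sub>M \<mu>)" by measurable
 then have "(\<lambda>v. \<integral>u. \<psi> u v \<partial>\<mu>) \<in> borel_measurable borel"
  by (intro \<mu>.borel_measurable_lebesgue_integral) (simp add: case_prod_unfold)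
 then show ?thesis by (simp add: cmean_def[abs_def])
qed

text \<open>Jensen's inequality, in the form that a variance is nonnegative.\<close>

lemma cmean_sq: "(cmean \<psi> v)\<^sup>2 <= C\<^sup>2 * K0"
 using \<mu>.variance_positive[of "\<lambda>u. \<psi> u v"] \<mu>.variance_eq[of "\<lambda>u. \<psi> u v"] \<psi>_integrable[of v]
 unfolding cmean_def by simp

text \<open>A martingale difference. The linear growth of \<open>\<psi>\<close> in \<open>u\<close>,
  uniform in \<open>v\<close>, bounds its variance whatever the path does.\<close>

definition centred :: "nat => 'a => real" where
 "centred t x = \<psi> (U t x) (y (t - 1) x) - cmean \<psi> (y (t - 1) x)"

lemma \<psi>_path_measurable: "(\<lambda>x. \<psi> (U t x) (y (t - 1) x)) \<in> borel_measurable M"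
 by measurable

lemma centred_measurable: "centred t \<in> borel_measurable M"
 unfolding centred_def[abs_def]
 by (intro borel_measurable_diff \<psi>_path_measurable measurable_compose[OF _ cmean_measurable] y_measurable)

lemma \<psi>_path_sq:
 assumes "t >= 1"
 shows "integrable M (\<lambda>x. (\<psi> (U t x) (y (t - 1) x))\<^sup>2)" "expectation (\<lambda>x. (\<psi> (U t x) (y (t - 1) x))\<^sup>2) <= C\<^sup>2 * K0"
proof -
 have int: "integrable M (\<lambda>x. C\<^sup>2 * (1 + \<bar>U t x\<bar>)\<^sup>2)" using U_sq[OF assms] by simp
 show sq: "integrable M (\<lambda>x. (\<psi> (U t x) (y (t - 1) x))\<^sup>2)"
  by (rule Bochner_Integration.integrable_bound[OF int])
    (use \<psi>_sq \<psi>_path_measurable in auto)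
 have "expectation (\<lambda>x. (\<psi> (U t x) (y (t - 1) x))\<^sup>2) <= expectation (\<lambda>x. C\<^sup>2 * (1 + \<bar>U t x\<bar>)\<^sup>2)"
  by (intro integral_mono sq int \<psi>_sq)
 also have "\<dots> <= C\<^sup>2 * K0" using U_sq[OF assms] by (simp add: mult_left_mono)
 finally show "expectation (\<lambda>x. (\<psi> (U t x) (y (t - 1) x))\<^sup>2) <= C\<^sup>2 * K0" .
qed

lemma centred_sq:
 assumes "t >= 1"
 shows "integrable M (\<lambda>x. (centred t x)\<^sup>2)" "expectation (\<lambda>x. (centred t x)\<^sup>2) <= 4 * C\<^sup>2 * K0"
proof -
 define B where "B x = 2 * (\<psi> (U t x) (y (t - 1) x))\<^sup>2 + 2 * (C\<^sup>2 * K0)" for x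
 have int: "integrable M B" unfolding B_def[abs_def] using \<psi>_path_sq[OF assms] by simp
 have le: "(centred t x)\<^sup>2 <= B x" for x
 proof -
  have "(p - q)\<^sup>2 <= 2 * p\<^sup>2 + 2 * q\<^sup>2" for p q :: real
   using zero_le_power2[of "p + q"] by (simp add: power2_eq_square algebra_simps)
  then have "(centred t x)\<^sup>2 <= 2 * (\<psi> (U t x) (y (t - 1) x))\<^sup>2 + 2 * (cmean \<psi> (y (t - 1) x))\<^sup>2"
   unfolding centred_def by blast
  then show ?thesis unfolding B_def using cmean_sq[of "y (t - 1) x"] by linarith
 qed
 show sq: "integrable M (\<lambda>x. (centred t x)\<^sup>2)"
  by (rule Bochner_Integration.integrable_bound[OF int])
    (use centred_measurable in \<open>auto intro!: AE_I2 order.trans[OF le abs_ge_self]\<close>)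
 have "expectation (\<lambda>x. (centred t x)\<^sup>2) <= expectation B" by (intro integral_mono sq int le)
 also have "\<dots> = 2 * expectation (\<lambda>x. (\<psi> (U t x) (y (t - 1) x))\<^sup>2) + 2 * (C\<^sup>2 * K0)"
  unfolding B_def[abs_def] using \<psi>_path_sq[OF assms] by (simp add: prob_space)
 also have "\<dots> <= 4 * C\<^sup>2 * K0" using \<psi>_path_sq(2)[OF assms] by linarith
 finally show "expectation (\<lambda>x. (centred t x)\<^sup>2) <= 4 * C\<^sup>2 * K0" .
qed

text \<open>Under the product law the inner integral over the innovation vanishes for every fixed
  past.\<close>

lemma centred_orthogonal_past:
 fixes a :: "(nat => real) => real"
 assumes t: "t >= 1" and a: "a \<in> borel_measurable (PiM {..<t} (\<lambda>_. borel))"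
  and sq: "integrable M (\<lambda>x. (a (\<lambda>j\<in>{..<t}. y j x))\<^sup>2)"
 shows "expectation (\<lambda>x. a (\<lambda>j\<in>{..<t}. y j x) * centred t x) = 0"
proof -
 define N where "N = PiM {..<t} (\<lambda>_. borel :: real measure)"
 define past where "past x = (\<lambda>j\<in>{..<t}. y j x)" for x
 have past: "past \<in> measurable M N" unfolding past_def[abs_def] N_def by measurable
 define F where "F p = a (snd p) * (\<psi> (fst p) (snd p (t - 1)) - cmean \<psi> (snd p (t - 1)))" for p
 have comp: "(\<lambda>z. z (t - 1)) \<in> borel_measurable N"
  unfolding N_def using t by (intro measurable_component_singleton) auto
 have a': "a \<in> borel_measurable N" using a by (simp add: N_def)
 have F: "F \<in> borel_measurable (borel \<Otimes>\<^sub>M N)"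
 proof -
  note [measurable] = comp a' cmean_measurable
  show ?thesis unfolding F_def[abs_def] by measurable
 qed
 interpret Q: prob_space "distr M N past" by (rule prob_space_distr[OF past])
 interpret P: pair_sigma_finite \<mu> "distr M N past" ..
 have pair: "(\<lambda>x. (U t x, past x)) \<in> measurable M (borel \<Otimes>\<^sub>M N)"
  by (intro measurable_Pair U_measurable past)
 have law': "distr M (borel \<Otimes>\<^sub>M N) (\<lambda>x. (U t x, past x)) = \<mu> \<Otimes>\<^sub>M distr M N past"
  using past_innovation_law[OF t] by (simp add: N_def past_def[abs_def])
 have FX: "F (U t x, past x) = a (past x) * centred t x" for x
  using t by (simp add: F_def centred_def past_def)
 have "integrable M (\<lambda>x. a (past x) * centred t x)"
  using sq by (intro integrable_mult_squares measurable_compose[OF past a'] centred_measurable centred_sq t) (simp_all add: past_def)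
 then have int: "integrable (\<mu> \<Otimes>\<^sub>M distr M N past) F"
  using integrable_distr_eq[OF pair F] by (simp add: law' FX)
 have "expectation (\<lambda>x. a (past x) * centred t x) = integral\<^sup>L (\<mu> \<Otimes>\<^sub>M distr M N past) F"
  using integral_distr[OF pair F] by (simp add: law' FX)
 also have "\<dots> = (\<integral>z. (\<integral>u. F (u, z) \<partial>\<mu>) \<partial>distr M N past)"
  using P.integral_snd[of "\<lambda>u z. F (u, z)"] int by simp
 also have "(\<lambda>z. \<integral>u. F (u, z) \<partial>\<mu>) = (\<lambda>z. 0)"
 proof
  fix z
  have "(\<integral>u. F (u, z) \<partial>\<mu>) = a z * (\<integral>u. \<psi> u (z (t - 1)) - cmean \<psi> (z (t - 1)) \<partial>\<mu>)"
   by (simp add: F_def)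
  also have "(\<integral>u. \<psi> u (z (t - 1)) - cmean \<psi> (z (t - 1)) \<partial>\<mu>) = 0"
   using \<psi>_integrable(1)[of "z (t - 1)"] \<mu>.prob_space by (simp add: cmean_def)
  finally show "(\<integral>u. F (u, z) \<partial>\<mu>) = 0" by simp
 qed
 finally have "expectation (\<lambda>x. a (past x) * centred t x) = 0" by simp
 then show ?thesis unfolding past_def .
qed

lemma centred_orthogonal:
 assumes "1 <= s" "s < t"
 shows "expectation (\<lambda>x. centred s x * centred t x) = 0"
proof -
 \<comment> \<open>\<open>centred s\<close> as a function of the values before time
   \<open>t\<close>, among which are \<open>y s\<close> and \<open>y (s - 1)\<close>.\<close>
 define a where "a z = \<psi> (resid \<theta>\<^sub>0 z s) (z (s - 1)) - cmean \<psi> (z (s - 1))" for z :: "nat => real"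
 have eq: "a (\<lambda>j\<in>{..<t}. y j x) = centred s x" for x
 proof -
  have "s - Suc 0 < t" using assms by linarith
  then show ?thesis using assms by (simp add: a_def centred_def U_def)
 qed
 have "(\<lambda>z. z s) \<in> borel_measurable (PiM {..<t} (\<lambda>_. borel :: real measure))"
  "(\<lambda>z. z (s - 1)) \<in> borel_measurable (PiM {..<t} (\<lambda>_. borel :: real measure))"
  using assms by (auto intro!: measurable_component_singleton)
 note [measurable] = this cmean_measurable
 have "a \<in> borel_measurable (PiM {..<t} (\<lambda>_. borel))"
  unfolding a_def[abs_def] resid.simps by measurable
 from centred_orthogonal_past[OF _ this] centred_sq(1)[of s] assms show ?thesis by (simp add: eq)
qed

lemma lln_centred:
 fixes \<epsilon> :: real
 assumes "n >= 1" "\<epsilon> > 0"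
 shows "prob {x \<in> space M. \<bar>\<Sum>t=1..n. centred t x\<bar> >= \<epsilon> * n} <= 4 * C\<^sup>2 * K0 / (\<epsilon>\<^sup>2 * n)"
 by (rule chebyshev_orthogonal) (use assms in \<open>auto intro!: centred_measurable centred_sq centred_orthogonal\<close>)

end

end

text \<open>The factors \<open>W t - 1\<close> are centred, uncorrelated and independent of the
  data, so the summands are orthogonal whatever the dependence within the data.\<close>

lemma (in weights) lln_weights:
 fixes \<epsilon> :: real
 assumes \<psi> [measurable]: "case_prod \<psi> \<in> borel_measurable (borel \<Otimes>\<^sub>M borel)"
  and C: "C >= 0" "\<And>u v. \<bar>\<psi> u v\<bar> <= C * (1 + \<bar>u\<bar>)" and "\<epsilon> > 0"
 shows "prob {x \<in> space M. \<bar>\<Sum>t=1..n. (W t x - 1) * \<psi> (U t x) (y (t - 1) x)\<bar> >= \<epsilon> * n} <= C\<^sup>2 * K0 / (\<epsilon>\<^sup>2 * n)"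
proof -
 define P where "P t x = \<psi> (U t x) (y (t - 1) x)" for t x
 have P_meas: "P t \<in> borel_measurable M" for t
  unfolding P_def by (rule \<psi>_path_measurable[OF \<psi> C])
 have P_sq: "integrable M (\<lambda>x. (P t x)\<^sup>2)" "expectation (\<lambda>x. (P t x)\<^sup>2) <= C\<^sup>2 * K0" if "t \<in> {1..n}" for t
  using \<psi>_path_sq[OF \<psi> C, of t] that by (auto simp: P_def)
 define p where "p t z = \<psi> (resid \<theta>\<^sub>0 z t) (z (t - 1))" for t and z :: "nat => real"
 have p_eq: "p t (sample y n x) = P t x" if "t \<in> {1..n}" for t x
 proof -
  have "t - Suc 0 <= n" using that by auto
  then show ?thesis using that by (simp add: p_def P_def U_def sample_def)
 qed
 have p_meas: "p t \<in> borel_measurable (PiM {0..n} (\<lambda>_. borel))" if "t \<in> {1..n}" for t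
 proof -
  have "(\<lambda>z. z t) \<in> borel_measurable (PiM {0..n} (\<lambda>_. borel :: real measure))"
   "(\<lambda>z. z (t - 1)) \<in> borel_measurable (PiM {0..n} (\<lambda>_. borel :: real measure))"
   using that by (auto intro!: measurable_component_singleton)
  note [measurable] = this
  show ?thesis unfolding p_def[abs_def] resid.simps by measurable
 qed
 have W_int: "integrable M (W t)" if "t \<in> {1..n}" for t
  using integrable_mult_squares[of "W t" M "\<lambda>_. 1"] W_sq[OF that] W_measurable[OF that] by simp
 have prod: "integrable M (\<lambda>x. ((W s x - 1) * (W t x - 1)) * (P s x * P t x)) \<and>
   expectation (\<lambda>x. ((W s x - 1) * (W t x - 1)) * (P s x * P t x)) = expectation (\<lambda>x. (W s x - 1) * (W t x - 1)) * expectation (\<lambda>x. P s x * P t x)"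
  if st: "s \<in> {1..n}" "t \<in> {1..n}" for s t
 proof -
  have c: "(\<lambda>w. w k) \<in> borel_measurable (PiM {1..n} (\<lambda>_. borel :: real measure))" if "k \<in> {1..n}" for k
   using that by (rule measurable_component_singleton)
  have b: "(\<lambda>w. (w s - 1) * (w t - 1)) \<in> borel_measurable (PiM {1..n} (\<lambda>_. borel :: real measure))"
   using c[OF st(1)] c[OF st(2)] by (intro borel_measurable_times borel_measurable_diff borel_measurable_const)
  have a: "(\<lambda>z. p s z * p t z) \<in> borel_measurable (PiM {0..n} (\<lambda>_. borel))"
   by (intro borel_measurable_times p_meas st)
  have ind: "indep_var borel (\<lambda>x. P s x * P t x) borel (\<lambda>x. (W s x - 1) * (W t x - 1))"
   using indep_rv_compose[OF W_indep a b] st by (simp add: p_eq)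
  have i1: "integrable M (\<lambda>x. P s x * P t x)" by (intro integrable_mult_squares P_meas P_sq st)
  have sq1: "integrable M (\<lambda>x. (W k x - 1)\<^sup>2)" if "k \<in> {1..n}" for k
   using W_sq[OF that] W_int[OF that] by (simp add: power2_diff)
  have i2: "integrable M (\<lambda>x. (W s x - 1) * (W t x - 1))"
   using W_measurable[OF st(1)] W_measurable[OF st(2)] by (intro integrable_mult_squares sq1 st) auto
  show ?thesis
   using indep_var_integrable[OF ind i1 i2] indep_var_lebesgue_integral[OF ind i1 i2] by (simp add: mult.commute)
 qed
 have WW: "expectation (\<lambda>x. (W s x - 1) * (W t x - 1)) = expectation (\<lambda>x. W s x * W t x) - 1" if "s \<in> {1..n}" "t \<in> {1..n}" for s t
 proof -
  have "integrable M (\<lambda>x. W s x * W t x)" by (intro integrable_mult_squares W_measurable W_sq that)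
  then have "expectation (\<lambda>x. W s x * W t x - W s x - W t x + 1) = expectation (\<lambda>x. W s x * W t x) - 1 - 1 + 1"
   using W_int[OF that(1)] W_int[OF that(2)] W_mean[OF that(1)] W_mean[OF that(2)] by (simp add: prob_space)
  then show ?thesis by (simp add: algebra_simps)
 qed
 have "prob {x \<in> space M. \<bar>\<Sum>t=1..n. (W t x - 1) * P t x\<bar> >= \<epsilon> * n} <= (C\<^sup>2 * K0) / (\<epsilon>\<^sup>2 * n)"
 proof (rule chebyshev_orthogonal)
  fix t assume t: "t \<in> {1..n}"
  show "(\<lambda>x. (W t x - 1) * P t x) \<in> borel_measurable M"
   using W_measurable[OF t] P_meas[of t] by measurable
  have eq: "((W t x - 1) * P t x)\<^sup>2 = ((W t x - 1) * (W t x - 1)) * (P t x * P t x)" for x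
   by (simp add: power2_eq_square algebra_simps)
  show "integrable M (\<lambda>x. ((W t x - 1) * P t x)\<^sup>2)" using prod[OF t t] by (simp only: eq)
  have "expectation (\<lambda>x. W t x * W t x) - 1 <= 1" using W_var[OF t] by (simp add: power2_eq_square)
  then have "expectation (\<lambda>x. ((W t x - 1) * P t x)\<^sup>2) <= 1 * expectation (\<lambda>x. P t x * P t x)"
   unfolding eq using prod[OF t t] WW[OF t t] by (simp only:) (intro mult_right_mono integral_nonneg, auto)
  then show "expectation (\<lambda>x. ((W t x - 1) * P t x)\<^sup>2) <= C\<^sup>2 * K0"
   using P_sq(2)[OF t] by (simp add: power2_eq_square)
 next
  fix s t assume st: "s \<in> {1..n}" "t \<in> {1..n}" "s < t"
  have "expectation (\<lambda>x. (W s x - 1) * P s x * ((W t x - 1) * P t x)) = expectation (\<lambda>x. ((W s x - 1) * (W t x - 1)) * (P s x * P t x))"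
   by (simp add: ac_simps)
  then show "expectation (\<lambda>x. (W s x - 1) * P s x * ((W t x - 1) * P t x)) = 0"
   using prod[OF st(1,2)] WW[OF st(1,2)] W_uncor[OF st] by simp
 qed (use \<open>\<epsilon> > 0\<close> n_pos in auto)
 then show ?thesis by (simp add: P_def)
qed

lemma (in weights) lln_single:
 fixes \<epsilon> :: real
 assumes \<psi> [measurable]: "case_prod \<psi> \<in> borel_measurable (borel \<Otimes>\<^sub>M borel)"
  and C: "C >= 0" "\<And>u v. \<bar>\<psi> u v\<bar> <= C * (1 + \<bar>u\<bar>)" and \<epsilon>: "\<epsilon> > 0"
 obtains N where "N \<in> events" "prob N <= 20 * K0 * C\<^sup>2 / (\<epsilon>\<^sup>2 * n)"
  "\<And>x. x \<in> space M - N ==> \<bar>\<Sum>t=1..n. W t x * \<psi> (U t x) (y (t - 1) x) - cmean \<psi> (y (t - 1) x)\<bar> <= \<epsilon> * n"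
proof -
 define A where "A = {x \<in> space M. \<bar>\<Sum>t=1..n. (W t x - 1) * \<psi> (U t x) (y (t - 1) x)\<bar> >= (\<epsilon>/2) * n}"
 define B where "B = {x \<in> space M. \<bar>\<Sum>t=1..n. centred \<psi> t x\<bar> >= (\<epsilon>/2) * n}"
 have m1: "(\<lambda>x. \<Sum>t=1..n. (W t x - 1) * \<psi> (U t x) (y (t - 1) x)) \<in> borel_measurable M"
  by (intro borel_measurable_sum borel_measurable_times borel_measurable_diff W_measurable borel_measurable_const \<psi>_path_measurable[OF \<psi> C])
 have m2: "(\<lambda>x. \<Sum>t=1..n. centred \<psi> t x) \<in> borel_measurable M"
  by (intro borel_measurable_sum centred_measurable[OF \<psi> C])
 have A: "A \<in> events" unfolding A_def using m1 by measurable
 have B: "B \<in> events" unfolding B_def using m2 by measurable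
 have "prob (A \<union> B) <= prob A + prob B" by (rule measure_Un_le[OF A B])
 also have "\<dots> <= C\<^sup>2 * K0 / ((\<epsilon>/2)\<^sup>2 * n) + 4 * C\<^sup>2 * K0 / ((\<epsilon>/2)\<^sup>2 * n)"
  unfolding A_def B_def using \<epsilon> n_pos by (intro add_mono lln_weights[OF \<psi> C] lln_centred[OF \<psi> C]) auto
 \<comment> \<open>Halving the accuracy multiplies both bounds by 4, and 4 + 16 = 20.\<close>
 also have "\<dots> = 20 * K0 * C\<^sup>2 / (\<epsilon>\<^sup>2 * n)" using \<epsilon> n_pos by (simp add: field_simps power2_eq_square)
 finally have "prob (A \<union> B) <= 20 * K0 * C\<^sup>2 / (\<epsilon>\<^sup>2 * n)" .
 moreover have "\<bar>\<Sum>t=1..n. W t x * \<psi> (U t x) (y (t - 1) x) - cmean \<psi> (y (t - 1) x)\<bar> <= \<epsilon> * n" if "x \<in> space M - (A \<union> B)" for x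
 proof -
  have "(\<Sum>t=1..n. W t x * \<psi> (U t x) (y (t - 1) x) - cmean \<psi> (y (t - 1) x))
    = (\<Sum>t=1..n. (W t x - 1) * \<psi> (U t x) (y (t - 1) x)) + (\<Sum>t=1..n. centred \<psi> t x)"
   unfolding sum.distrib[symmetric] by (intro sum.cong) (auto simp: centred_def[OF \<psi> C] algebra_simps)
  moreover have "\<bar>\<Sum>t=1..n. (W t x - 1) * \<psi> (U t x) (y (t - 1) x)\<bar> < (\<epsilon>/2) * n" "\<bar>\<Sum>t=1..n. centred \<psi> t x\<bar> < (\<epsilon>/2) * n"
   using that by (auto simp: A_def B_def not_le)
  ultimately show ?thesis by linarith
 qed
 ultimately show ?thesis using that[of "A \<union> B"] A B by blast
qed

section \<open>Uniformity over a parameter box\<close>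

definition param_box :: "real => real => (real \<times> real \<times> real) set" where
 "param_box c C = {(\<phi>, \<alpha>, \<omega>). \<bar>\<phi>\<bar> <= C \<and> c <= \<alpha> \<and> \<alpha> <= C \<and> c <= \<omega> \<and> \<omega> <= C}"

definition dist1 :: "real \<times> real \<times> real => real \<times> real \<times> real => real" where
 "dist1 \<theta> \<theta>' = \<bar>fst \<theta> - fst \<theta>'\<bar> + \<bar>fst (snd \<theta>) - fst (snd \<theta>')\<bar> + \<bar>snd (snd \<theta>) - snd (snd \<theta>')\<bar>"

lemma dist1_nonneg [simp]: "dist1 \<theta> \<theta>' >= 0"
 by (simp add: dist1_def)

lemma grid_point:
 fixes a b x :: real
 assumes "a <= x" "x <= b" "m >= 1"
 obtains i :: nat where "i <= m" "\<bar>x - (a + (b - a) * i / m)\<bar> <= (b - a) / m"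
proof (cases "a = b")
 case True
 then show ?thesis using assms that[of 0] by simp
next
 case False
 then have ab: "b - a > 0" using assms by simp
 define s where "s = (x - a) * m / (b - a)"
 define i where "i = nat \<lfloor>s\<rfloor>"
 have s: "0 <= s" "s <= m" using assms ab by (auto simp: s_def field_simps mult_right_mono)
 have i: "real i <= s" "s < real i + 1" using s by (auto simp: i_def)
 have "i <= m" using i s by linarith
 have x: "x = a + (b - a) * s / m" using ab assms by (simp add: s_def)
 have "x - (a + (b - a) * i / m) = (b - a) * (s - i) / m" unfolding x by (simp add: diff_divide_distrib right_diff_distrib)
 also have "\<bar>\<dots>\<bar> <= (b - a) * 1 / m" unfolding abs_divide abs_mult
  using i ab assms by (intro divide_mono mult_mono) auto
 finally show ?thesis using that[OF \<open>i <= m\<close>] by simp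
qed

lemma param_grid:
 assumes "0 < c" "c <= C" "m >= 1"
 obtains G where "finite G" "card G <= (m + 1) ^ 3" "G \<subseteq> param_box c C"
  "\<And>\<theta>. \<theta> \<in> param_box c C ==> \<exists>g\<in>G. dist1 \<theta> g <= 4 * C / m"
proof -
 define p where "p = (\<lambda>(i::nat, j::nat, k::nat). (- C + (C - - C) * i / m, c + (C - c) * j / m, c + (C - c) * k / m))"
 define G where "G = p ` ({..m} \<times> {..m} \<times> {..m})"
 have "finite G" by (simp add: G_def)
 moreover have "card G <= (m + 1) ^ 3"
 proof -
  have "card G <= card ({..m} \<times> {..m} \<times> {..m})" unfolding G_def by (rule card_image_le) simp
  then show ?thesis by (simp add: card_cartesian_product power3_eq_cube algebra_simps)
 qed
 moreover have "G \<subseteq> param_box c C"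
 proof -
  have le: "(b - a) * real i / m <= b - a" "0 <= (b - a) * real i / m" if "i <= m" "a <= b" for i and a b :: real
   using that mult_left_mono[of "real i / m" 1 "b - a"] assms(3) by auto
  show ?thesis using assms le[of _ "- C" C] le[of _ c C]
   by (fastforce simp: G_def p_def param_box_def abs_le_iff)
 qed
 moreover have "\<exists>g\<in>G. dist1 \<theta> g <= 4 * C / m" if "\<theta> \<in> param_box c C" for \<theta>
 proof -
  obtain \<phi> \<alpha> \<omega> where \<theta>: "\<theta> = (\<phi>, \<alpha>, \<omega>)" by (cases \<theta>) auto
  have b: "- C <= \<phi>" "\<phi> <= C" "c <= \<alpha>" "\<alpha> <= C" "c <= \<omega>" "\<omega> <= C"
   using that by (auto simp: \<theta> param_box_def)
  obtain i where i: "i <= m" "\<bar>\<phi> - (- C + (C - - C) * i / m)\<bar> <= (C - - C) / m" by (rule grid_point[OF b(1,2) assms(3)])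
  obtain j where j: "j <= m" "\<bar>\<alpha> - (c + (C - c) * j / m)\<bar> <= (C - c) / m" by (rule grid_point[OF b(3,4) assms(3)])
  obtain k where k: "k <= m" "\<bar>\<omega> - (c + (C - c) * k / m)\<bar> <= (C - c) / m" by (rule grid_point[OF b(5,6) assms(3)])
  have "p (i, j, k) \<in> G" using i j k by (auto simp: G_def)
  moreover have "dist1 \<theta> (p (i, j, k)) <= (C - - C) / m + (C - c) / m + (C - c) / m"
   unfolding dist1_def \<theta> p_def prod.case fst_conv snd_conv by (intro add_mono i j k)
  moreover have "(C - - C) / m + (C - c) / m + (C - c) / m <= 4 * C / m"
   using assms by (simp add: field_simps)
  ultimately show ?thesis by (meson order.trans)
 qed
 ultimately show ?thesis using that by blast
qed

lemma (in dar_model) cmean_one_plus_abs: "cmean (\<lambda>u v. 1 + \<bar>u\<bar>) v = 2"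
 using integral_\<mu>_abs \<mu>.prob_space by (simp add: cmean_def)

text \<open>Chebyshev's inequality on the grid; off the grid the Lipschitz bound multiplies
  \<open>1 + \<bar>u\<bar>\<close>, whose weighted sum is controlled by one more law of large
  numbers. Grid fineness \<open>m\<close>, growth constant \<open>K\<close> and Lipschitz constant
  stay explicit, because the functions will vary with \<open>n\<close>.\<close>

lemma (in weights) uniform_lln:
 fixes \<psi> :: "real \<times> real \<times> real => real => real => real" and \<epsilon> :: real
 assumes c: "0 < c" "c <= C"
  and meas: "\<And>\<theta>. \<theta> \<in> param_box c C ==> case_prod (\<psi> \<theta>) \<in> borel_measurable (borel \<Otimes>\<^sub>M borel)"
  and bd: "K >= 0" "\<And>\<theta> u v. \<theta> \<in> param_box c C ==> \<bar>\<psi> \<theta> u v\<bar> <= K * (1 + \<bar>u\<bar>)"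
  and lip: "\<Lambda> >= 0" "\<And>\<theta> \<theta>' u v. \<theta> \<in> param_box c C ==> \<theta>' \<in> param_box c C ==>
    \<bar>\<psi> \<theta> u v - \<psi> \<theta>' u v\<bar> <= \<Lambda> * dist1 \<theta> \<theta>' * (1 + \<bar>u\<bar>)"
  and \<epsilon>: "\<epsilon> > 0" and m: "m >= 1" "20 * C * \<Lambda> <= \<epsilon> * m"
 obtains N where "N \<in> events" "prob N <= ((real m + 1) ^ 3 * K\<^sup>2 / \<epsilon>\<^sup>2 + 1) * (20 * K0) / n"
  "\<And>x \<theta>. x \<in> space M - N ==> \<theta> \<in> param_box c C ==>
   \<bar>\<Sum>t=1..n. W t x * \<psi> \<theta> (U t x) (y (t - 1) x) - cmean (\<psi> \<theta>) (y (t - 1) x)\<bar> <= 2 * \<epsilon> * n"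
proof -
 obtain G where G: "finite G" "card G <= (m + 1) ^ 3" "G \<subseteq> param_box c C"
  "\<And>\<theta>. \<theta> \<in> param_box c C ==> \<exists>g\<in>G. dist1 \<theta> g <= 4 * C / m"
  using param_grid[OF c m(1)] by blast
 have "\<exists>N. N \<in> events \<and> prob N <= 20 * K0 * K\<^sup>2 / (\<epsilon>\<^sup>2 * n) \<and>
   (\<forall>x\<in>space M - N. \<bar>\<Sum>t=1..n. W t x * \<psi> g (U t x) (y (t - 1) x) - cmean (\<psi> g) (y (t - 1) x)\<bar> <= \<epsilon> * n)"
  if g: "g \<in> G" for g
 proof -
  have g': "g \<in> param_box c C" using g G by blast
  show ?thesis by (rule lln_single[OF meas[OF g'] bd(1) bd(2)[OF g'] \<epsilon>]) blast
 qed
 then have "\<forall>g\<in>G. \<exists>N. N \<in> events \<and> prob N <= 20 * K0 * K\<^sup>2 / (\<epsilon>\<^sup>2 * n) \<and>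
   (\<forall>x\<in>space M - N. \<bar>\<Sum>t=1..n. W t x * \<psi> g (U t x) (y (t - 1) x) - cmean (\<psi> g) (y (t - 1) x)\<bar> <= \<epsilon> * n)"
  by blast
 from bchoice[OF this] obtain N where N: "\<And>g. g \<in> G ==> N g \<in> events" "\<And>g. g \<in> G ==> prob (N g) <= 20 * K0 * K\<^sup>2 / (\<epsilon>\<^sup>2 * n)"
   "\<And>g x. g \<in> G ==> x \<in> space M - N g ==> \<bar>\<Sum>t=1..n. W t x * \<psi> g (U t x) (y (t - 1) x) - cmean (\<psi> g) (y (t - 1) x)\<bar> <= \<epsilon> * n"
  by blast
 obtain N1 where N1: "N1 \<in> events" "prob N1 <= 20 * K0 * 1\<^sup>2 / (1\<^sup>2 * n)"
   "\<And>x. x \<in> space M - N1 ==> \<bar>\<Sum>t=1..n. W t x * (1 + \<bar>U t x\<bar>) - cmean (\<lambda>u v. 1 + \<bar>u\<bar>) (y (t - 1) x)\<bar> <= 1 * n"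
  by (rule lln_single[of "\<lambda>u v. 1 + \<bar>u\<bar>" 1 1]) auto
 \<comment> \<open>The weights are nonnegative only almost everywhere; the null set joins the
   exceptional event.\<close>
 obtain N0 where N0: "{x \<in> space M. \<not> (\<forall>t\<in>{1..n}. W t x >= 0)} \<subseteq> N0" "emeasure M N0 = 0" "N0 \<in> events"
  by (rule AE_E[OF W_nonneg])
 have N0': "prob N0 = 0" using N0(2) by (simp add: measure_def)
 define NN where "NN = (\<Union>g\<in>G. N g) \<union> (N1 \<union> N0)"
 have "prob NN <= prob (\<Union>g\<in>G. N g) + (prob N1 + prob N0)"
  unfolding NN_def using N(1) N1(1) N0(3) G(1)
  by (intro order.trans[OF measure_Un_le] add_mono measure_Un_le sets.finite_UN sets.Un) auto
 also have "prob (\<Union>g\<in>G. N g) <= (\<Sum>g\<in>G. prob (N g))" using G(1) N(1) by (intro finite_measure_subadditive_finite) auto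
 also have "\<dots> <= (\<Sum>g\<in>G. 20 * K0 * K\<^sup>2 / (\<epsilon>\<^sup>2 * n))" using N(2) by (intro sum_mono)
 also have "\<dots> = card G * (20 * K0 * K\<^sup>2 / (\<epsilon>\<^sup>2 * n))" by simp
 also have "\<dots> <= (real m + 1) ^ 3 * (20 * K0 * K\<^sup>2 / (\<epsilon>\<^sup>2 * n))"
 proof (rule mult_right_mono)
  have "real (card G) <= real ((m + 1) ^ 3)" using G(2) by (rule of_nat_mono)
  then show "real (card G) <= (real m + 1) ^ 3" by (simp add: add.commute)
 qed (use K0_bound(3) in simp)
 finally have "prob NN <= (real m + 1) ^ 3 * (20 * K0 * K\<^sup>2 / (\<epsilon>\<^sup>2 * n)) + 20 * K0 / n" using N1(2) N0' by simp
 also have "\<dots> = ((real m + 1) ^ 3 * K\<^sup>2 / \<epsilon>\<^sup>2 + 1) * (20 * K0) / n"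
 proof -
  have "(a * K\<^sup>2 / \<epsilon>\<^sup>2 + 1) * (20 * K0) / n = a * (20 * K0 * K\<^sup>2 / (\<epsilon>\<^sup>2 * n)) + 20 * K0 / n" for a
  proof -
   have "a * K\<^sup>2 / \<epsilon>\<^sup>2 * (20 * K0) / n = a * (20 * K0 * K\<^sup>2 / (\<epsilon>\<^sup>2 * n))" by (simp add: mult_ac)
   then show ?thesis by (simp only: distrib_right add_divide_distrib mult_1_left)
  qed
  then show ?thesis by (simp only:)
 qed
 finally have 1: "prob NN <= ((real m + 1) ^ 3 * K\<^sup>2 / \<epsilon>\<^sup>2 + 1) * (20 * K0) / n" .
 have 2: "NN \<in> events" unfolding NN_def using N(1) N1(1) N0(3) G(1) by (intro sets.Un sets.finite_UN) auto
 have 3: "\<bar>\<Sum>t=1..n. W t x * \<psi> \<theta> (U t x) (y (t - 1) x) - cmean (\<psi> \<theta>) (y (t - 1) x)\<bar> <= 2 * \<epsilon> * n"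
  if x: "x \<in> space M - NN" and \<theta>: "\<theta> \<in> param_box c C" for x \<theta>
 proof -
  obtain g where g: "g \<in> G" "dist1 \<theta> g <= 4 * C / m" using G(4)[OF \<theta>] by blast
  have g': "g \<in> param_box c C" using g G by blast
  have Wn: "W t x >= 0" if "t \<in> {1..n}" for t using x N0(1) that unfolding NN_def by blast
  define d where "d = \<Lambda> * dist1 \<theta> g"
  have d0: "d >= 0" using lip(1) by (simp add: d_def)
  \<comment> \<open>The Lipschitz term occurs five times: twice through the mean 2 of
    \<open>1 + \<bar>u\<bar>\<close> in the weighted sum, twice through \<open>cmean\<close>, and
    once through the deviation of the weighted sum.\<close>
  have d5: "5 * d <= \<epsilon>"
  proof -
   have "d <= \<Lambda> * (4 * C / m)" unfolding d_def using g lip(1) by (intro mult_left_mono)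
   also have "5 * (\<Lambda> * (4 * C / m)) = 20 * C * \<Lambda> / m" by simp
   also have "\<dots> <= \<epsilon>" using m by (simp add: field_simps)
   finally show ?thesis by simp
  qed
  have cm: "\<bar>cmean (\<psi> \<theta>) v - cmean (\<psi> g) v\<bar> <= 2 * d" for v
  proof -
   have i1: "integrable \<mu> (\<lambda>u. \<psi> \<theta> u v)" by (rule \<psi>_integrable(1)[OF meas[OF \<theta>] bd(1) bd(2)[OF \<theta>]])
   have i2: "integrable \<mu> (\<lambda>u. \<psi> g u v)" by (rule \<psi>_integrable(1)[OF meas[OF g'] bd(1) bd(2)[OF g']])
   have "\<bar>cmean (\<psi> \<theta>) v - cmean (\<psi> g) v\<bar> = \<bar>\<integral>u. \<psi> \<theta> u v - \<psi> g u v \<partial>\<mu>\<bar>"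
    unfolding cmean_def using i1 i2 by simp
   also have "\<dots> <= (\<integral>u. d * (1 + \<bar>u\<bar>) \<partial>\<mu>)"
    using i1 i2 lip(2)[OF \<theta> g'] by (intro order.trans[OF integral_abs_bound] integral_mono) (auto simp: d_def)
   also have "\<dots> = 2 * d" using cmean_one_plus_abs by (simp add: cmean_def)
   finally show ?thesis .
  qed
  have "\<bar>(\<Sum>t=1..n. W t x * \<psi> \<theta> (U t x) (y (t - 1) x) - cmean (\<psi> \<theta>) (y (t - 1) x))
    - (\<Sum>t=1..n. W t x * \<psi> g (U t x) (y (t - 1) x) - cmean (\<psi> g) (y (t - 1) x))\<bar>
    <= (\<Sum>t=1..n. W t x * (d * (1 + \<bar>U t x\<bar>)) + 2 * d)"
   unfolding sum_subtractf[symmetric]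
  proof (rule order.trans[OF sum_abs], rule sum_mono)
   fix t assume t: "t \<in> {1..n}"
   have "\<bar>W t x * (\<psi> \<theta> (U t x) (y (t - 1) x) - \<psi> g (U t x) (y (t - 1) x))\<bar> <= W t x * (d * (1 + \<bar>U t x\<bar>))"
    unfolding abs_mult using Wn[OF t] lip(2)[OF \<theta> g'] by (simp add: d_def mult_left_mono)
   then show "\<bar>W t x * \<psi> \<theta> (U t x) (y (t - 1) x) - cmean (\<psi> \<theta>) (y (t - 1) x) -
     (W t x * \<psi> g (U t x) (y (t - 1) x) - cmean (\<psi> g) (y (t - 1) x))\<bar> <= W t x * (d * (1 + \<bar>U t x\<bar>)) + 2 * d"
    using cm[of "y (t - 1) x"] by (simp add: right_diff_distrib abs_le_iff)
  qed
  also have "\<dots> = d * (\<Sum>t=1..n. W t x * (1 + \<bar>U t x\<bar>) - 2) + 4 * d * n"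
   by (simp add: sum.distrib sum_subtractf sum_distrib_left algebra_simps)
  also have "\<dots> <= d * n + 4 * d * n"
   using N1(3)[of x] x d0 unfolding cmean_one_plus_abs NN_def by (intro add_mono mult_left_mono) auto
  also have "\<dots> <= \<epsilon> * n" using mult_right_mono[OF d5, of "real n"] by (simp add: algebra_simps)
  finally show ?thesis using N(3)[OF g(1), of x] x g(1) unfolding NN_def by (simp add: abs_le_iff)
 qed
 show ?thesis by (rule that[OF 2 1 3])
qed

section \<open>Residuals at a general parameter\<close>

context dar_model
begin

text \<open>The ratio of true to assumed volatility after the value \<open>v\<close>: the slope of
  the residual as a function of the innovation, with intercept \<open>loc\<close>.\<close>

definition rho :: "real \<times> real \<times> real => real => real" where
 "rho \<theta> v = sqrt (\<omega>\<^sub>0 + \<alpha>\<^sub>0 * v\<^sup>2) / sqrt (snd (snd \<theta>) + fst (snd \<theta>) * v\<^sup>2)"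

definition loc :: "real \<times> real \<times> real => real => real" where
 "loc \<theta> v = (\<phi>\<^sub>0 - fst \<theta>) * v / sqrt (snd (snd \<theta>) + fst (snd \<theta>) * v\<^sup>2)"

lemma resid_path:
 assumes "t >= 1" "t <= n"
 shows "resid \<theta> (sample y n x) t = loc \<theta> (y (t - 1) x) + rho \<theta> (y (t - 1) x) * U t x"
proof -
 obtain \<phi> \<alpha> \<omega> where \<theta>: "\<theta> = (\<phi>, \<alpha>, \<omega>)" by (cases \<theta>) auto
 have s: "sample y n x t = y t x" "sample y n x (t - 1) = y (t - 1) x" using assms by (auto simp: sample_def)
 have "resid \<theta> (sample y n x) t = (y t x - \<phi> * y (t - 1) x) / sqrt (\<omega> + \<alpha> * (y (t - 1) x)\<^sup>2)"
  unfolding \<theta> resid.simps s ..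
 also have "y t x - \<phi> * y (t - 1) x = (\<phi>\<^sub>0 - \<phi>) * y (t - 1) x + sqrt (\<omega>\<^sub>0 + \<alpha>\<^sub>0 * (y (t - 1) x)\<^sup>2) * U t x"
  using y_rec[of t x] by (simp add: algebra_simps)
 finally show ?thesis by (simp add: \<theta> loc_def rho_def add_divide_distrib)
qed

lemma rho_measurable [measurable]: "rho \<theta> \<in> borel_measurable borel"
 and loc_measurable [measurable]: "loc \<theta> \<in> borel_measurable borel"
 unfolding rho_def[abs_def] loc_def[abs_def] by measurable

lemma box_scale:
 assumes "\<theta> \<in> param_box c C" "0 < c"
 shows "c * (1 + v\<^sup>2) <= snd (snd \<theta>) + fst (snd \<theta>) * v\<^sup>2" "snd (snd \<theta>) + fst (snd \<theta>) * v\<^sup>2 <= C * (1 + v\<^sup>2)"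
 using assms mult_right_mono[of c "fst (snd \<theta>)" "v\<^sup>2"] mult_right_mono[of "fst (snd \<theta>)" C "v\<^sup>2"]
 by (auto simp: param_box_def distrib_left)

lemma inverse_sqrt_diff:
 fixes p q k d :: real
 assumes "p > 0" "q > 0" "\<bar>p - q\<bar> <= k * p"
 shows "\<bar>1 / sqrt p - 1 / sqrt q\<bar> <= k / sqrt q"
proof -
 have sp: "sqrt p > 0" "sqrt q > 0" using assms by auto
 have "1 / sqrt p - 1 / sqrt q = (sqrt q - sqrt p) / (sqrt p * sqrt q)" using sp by (simp add: field_simps)
 also have "\<dots> = (q - p) / (sqrt p * sqrt q * (sqrt q + sqrt p))"
 proof -
  have "(sqrt q - sqrt p) * (sqrt q + sqrt p) = q - p" using assms by (simp add: algebra_simps)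
  moreover have "(sqrt q - sqrt p) / (sqrt p * sqrt q) = ((sqrt q - sqrt p) * (sqrt q + sqrt p)) / (sqrt p * sqrt q * (sqrt q + sqrt p))"
  proof -
   have "sqrt q + sqrt p \<noteq> 0" using sp by linarith
   then show ?thesis by simp
  qed
  ultimately show ?thesis by simp
 qed
 finally have "\<bar>1 / sqrt p - 1 / sqrt q\<bar> = \<bar>p - q\<bar> / (sqrt p * sqrt q * (sqrt q + sqrt p))"
  using sp by (simp add: abs_divide abs_mult abs_minus_commute)
 also have "\<dots> <= (k * p) / (sqrt p * sqrt q * sqrt p)"
  using sp assms by (intro frac_le mult_left_mono mult_pos_pos) auto
 also have "sqrt p * sqrt q * sqrt p = p * sqrt q"
  using assms(1) by (metis mult.assoc mult.commute real_sqrt_mult_self abs_of_pos)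
 also have "k * p / (p * sqrt q) = k / sqrt q" using assms(1) by simp
 finally show ?thesis .
qed

text \<open>All squared scales lie between \<open>c * (1 + v\<^sup>2)\<close> and
  \<open>C * (1 + v\<^sup>2)\<close>, so quotients of scales, and \<open>v\<close> divided by a
  scale, are bounded and Lipschitz in the parameter uniformly in \<open>v\<close>. One constant
  \<open>H\<close> serves for everything, since every bound is monotone in it.\<close>

lemma param_box_bounds:
 assumes c: "0 < c" "c <= C" and \<theta>0: "\<theta>\<^sub>0 \<in> param_box c C"
 obtains H where "H >= 1"
  "\<And>\<theta> v. \<theta> \<in> param_box c C ==> 1 / H <= rho \<theta> v \<and> rho \<theta> v <= H \<and> \<bar>loc \<theta> v\<bar> <= H"
  "\<And>\<theta>. \<theta> \<in> param_box c C ==> 1 / H <= sqrt (fst (snd \<theta>)) \<and> sqrt (fst (snd \<theta>)) <= H \<and> \<bar>fst \<theta>\<bar> <= H"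
  "\<And>\<theta> \<theta>' v. \<theta> \<in> param_box c C ==> \<theta>' \<in> param_box c C ==>
    \<bar>rho \<theta> v - rho \<theta>' v\<bar> <= H * dist1 \<theta> \<theta>' \<and> \<bar>loc \<theta> v - loc \<theta>' v\<bar> <= H * dist1 \<theta> \<theta>'"
  "\<And>\<theta> \<theta>'. \<theta> \<in> param_box c C ==> \<theta>' \<in> param_box c C ==>
    \<bar>sqrt (fst (snd \<theta>)) - sqrt (fst (snd \<theta>'))\<bar> <= H * dist1 \<theta> \<theta>'"
proof -
 define r where "r = sqrt (C / c)"
 define H where "H = 1 + C + r + sqrt C + 1 / sqrt c + 2 * C / sqrt c + r / c + 1 / sqrt c + 2 * C / (c * sqrt c)"
 have C: "C > 0" using c by simp
 have r: "r >= 1" using c by (simp add: r_def)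
 have sc: "sqrt c > 0" "sqrt C > 0" using c C by auto
 have parts: "0 <= C" "0 <= r" "0 <= sqrt C" "0 <= 1 / sqrt c" "0 <= 2 * C / sqrt c" "0 <= r / c" "0 <= 2 * C / (c * sqrt c)"
  using c C r sc by auto
 have H1: "H >= 1" "r <= H" "sqrt C <= H" "1 / sqrt c <= H" "2 * C / sqrt c <= H" "r / c <= H" "C <= H"
  "1 / sqrt c + 2 * C / (c * sqrt c) <= H"
  using parts unfolding H_def by linarith+
 define q where "q \<theta> v = snd (snd \<theta>) + fst (snd \<theta>) * v\<^sup>2" for \<theta> :: "real \<times> real \<times> real" and v
 define q0 where "q0 v = \<omega>\<^sub>0 + \<alpha>\<^sub>0 * v\<^sup>2" for v
 have q: "c * (1 + v\<^sup>2) <= q \<theta> v" "q \<theta> v <= C * (1 + v\<^sup>2)" "q \<theta> v > 0" if "\<theta> \<in> param_box c C" for \<theta> v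
 proof -
  show "c * (1 + v\<^sup>2) <= q \<theta> v" "q \<theta> v <= C * (1 + v\<^sup>2)" using box_scale[OF that c(1)] by (auto simp: q_def)
  moreover have "c * (1 + v\<^sup>2) > 0" using c by (simp add: add_pos_nonneg)
  ultimately show "q \<theta> v > 0" by linarith
 qed
 have q0: "c * (1 + v\<^sup>2) <= q0 v" "q0 v <= C * (1 + v\<^sup>2)" "q0 v > 0" for v
  using q[OF \<theta>0, of v] by (auto simp: q_def q0_def)
 have ratio: "x / y' <= C / c" if "x <= C * (1 + v\<^sup>2)" "c * (1 + v\<^sup>2) <= y'" "0 < x" for x y' v
 proof -
  have p: "0 < 1 + v\<^sup>2" by (simp add: add_pos_nonneg)
  have "x / y' <= (C * (1 + v\<^sup>2)) / (c * (1 + v\<^sup>2))" using that p c by (intro frac_le) auto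
  then show ?thesis using p by simp
 qed
 have rho_eq: "rho \<theta> v = sqrt (q0 v / q \<theta> v)" for \<theta> v
  by (simp add: rho_def q_def q0_def real_sqrt_divide)
 have rho_le: "rho \<theta> v <= r" "sqrt (q \<theta> v / q0 v) <= r" if "\<theta> \<in> param_box c C" for \<theta> v
  unfolding rho_eq r_def using q[OF that, of v] q0[of v] by (auto intro!: real_sqrt_le_mono ratio)
 have rho_ge: "1 / r <= rho \<theta> v" if "\<theta> \<in> param_box c C" for \<theta> v
 proof -
  have pos': "0 < q0 v / q \<theta> v" using q[OF that, of v] q0[of v] by simp
  have "1 / rho \<theta> v = sqrt (q \<theta> v / q0 v)" unfolding rho_eq by (simp add: real_sqrt_divide)
  then have "1 / rho \<theta> v <= r" using rho_le(2)[OF that, of v] by simp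
  moreover have "rho \<theta> v > 0" unfolding rho_eq using pos' by simp
  ultimately show ?thesis using r by (simp add: field_simps)
 qed
 have vq: "\<bar>v\<bar> / sqrt (q \<theta> v) <= 1 / sqrt c" if "\<theta> \<in> param_box c C" for \<theta> v
 proof -
  have "sqrt (c * v\<^sup>2) <= sqrt (q \<theta> v)" using q(1)[OF that, of v] c by (intro real_sqrt_le_mono) (simp add: distrib_left)
  then have "sqrt c * \<bar>v\<bar> <= sqrt (q \<theta> v)" by (simp add: real_sqrt_mult)
  moreover have "sqrt (q \<theta> v) > 0" using q(3)[OF that] by simp
  ultimately show ?thesis using sc by (simp add: field_simps)
 qed
 have phi: "\<bar>\<phi>\<^sub>0 - fst \<theta>\<bar> <= 2 * C" "\<bar>fst \<theta>\<bar> <= C" if "\<theta> \<in> param_box c C" for \<theta>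
  using that \<theta>0 by (auto simp: param_box_def)
 have loc_le: "\<bar>loc \<theta> v\<bar> <= 2 * C / sqrt c" if "\<theta> \<in> param_box c C" for \<theta> v
 proof -
  have "\<bar>loc \<theta> v\<bar> = \<bar>\<phi>\<^sub>0 - fst \<theta>\<bar> * (\<bar>v\<bar> / sqrt (q \<theta> v))"
   using q(3)[OF that, of v] by (simp add: loc_def q_def abs_mult abs_divide)
  also have "\<dots> <= (2 * C) * (1 / sqrt c)" using phi[OF that] vq[OF that, of v] C q(3)[OF that, of v] by (intro mult_mono) auto
  finally show ?thesis by simp
 qed
 have dq: "\<bar>q \<theta> v - q \<theta>' v\<bar> <= dist1 \<theta> \<theta>' / c * q \<theta> v" if "\<theta> \<in> param_box c C" for \<theta> \<theta>' v
 proof -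
  have "q \<theta> v - q \<theta>' v = (snd (snd \<theta>) - snd (snd \<theta>')) + (fst (snd \<theta>) - fst (snd \<theta>')) * v\<^sup>2"
   by (simp add: q_def algebra_simps)
  then have "\<bar>q \<theta> v - q \<theta>' v\<bar> <= \<bar>snd (snd \<theta>) - snd (snd \<theta>')\<bar> + \<bar>fst (snd \<theta>) - fst (snd \<theta>')\<bar> * v\<^sup>2"
   using abs_triangle_ineq[of "snd (snd \<theta>) - snd (snd \<theta>')" "(fst (snd \<theta>) - fst (snd \<theta>')) * v\<^sup>2"] by (simp add: abs_mult)
  also have "\<dots> <= dist1 \<theta> \<theta>' * 1 + dist1 \<theta> \<theta>' * v\<^sup>2"
   by (intro add_mono mult_right_mono) (auto simp: dist1_def)
  also have "\<dots> = dist1 \<theta> \<theta>' / c * (c * (1 + v\<^sup>2))" using c by (simp add: distrib_left)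
  also have "\<dots> <= dist1 \<theta> \<theta>' / c * q \<theta> v" using q(1)[OF that, of v] c by (intro mult_left_mono) auto
  finally show ?thesis .
 qed
 have inv: "\<bar>1 / sqrt (q \<theta> v) - 1 / sqrt (q \<theta>' v)\<bar> <= dist1 \<theta> \<theta>' / c / sqrt (q \<theta>' v)"
  if "\<theta> \<in> param_box c C" "\<theta>' \<in> param_box c C" for \<theta> \<theta>' v
  by (rule inverse_sqrt_diff[OF q(3)[OF that(1)] q(3)[OF that(2)] dq[OF that(1)]])
 have rho_lip: "\<bar>rho \<theta> v - rho \<theta>' v\<bar> <= r / c * dist1 \<theta> \<theta>'" if "\<theta> \<in> param_box c C" "\<theta>' \<in> param_box c C" for \<theta> \<theta>' v
 proof -
  have "rho \<theta> v - rho \<theta>' v = sqrt (q0 v) * (1 / sqrt (q \<theta> v) - 1 / sqrt (q \<theta>' v))"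
   by (simp add: rho_def q_def q0_def right_diff_distrib)
  then have "\<bar>rho \<theta> v - rho \<theta>' v\<bar> = sqrt (q0 v) * \<bar>1 / sqrt (q \<theta> v) - 1 / sqrt (q \<theta>' v)\<bar>"
   using q0(3)[of v] by (simp add: abs_mult)
  also have "\<dots> <= sqrt (q0 v) * (dist1 \<theta> \<theta>' / c / sqrt (q \<theta>' v))" using inv[OF that] q0(3)[of v] by (intro mult_left_mono) auto
  also have "\<dots> = rho \<theta>' v * (dist1 \<theta> \<theta>' / c)" by (simp add: rho_def q_def q0_def)
  also have "\<dots> <= r * (dist1 \<theta> \<theta>' / c)" using rho_le(1)[OF that(2)] c by (intro mult_right_mono) auto
  finally show ?thesis by simp
 qed
 have loc_lip: "\<bar>loc \<theta> v - loc \<theta>' v\<bar> <= (1 / sqrt c + 2 * C / (c * sqrt c)) * dist1 \<theta> \<theta>'"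
  if "\<theta> \<in> param_box c C" "\<theta>' \<in> param_box c C" for \<theta> \<theta>' v
 proof -
  have "loc \<theta> v - loc \<theta>' v = - (fst \<theta> - fst \<theta>') * (v / sqrt (q \<theta> v)) + (\<phi>\<^sub>0 - fst \<theta>') * (v * (1 / sqrt (q \<theta> v) - 1 / sqrt (q \<theta>' v)))"
   by (simp add: loc_def q_def algebra_simps diff_divide_distrib)
  then have "\<bar>loc \<theta> v - loc \<theta>' v\<bar> <= \<bar>fst \<theta> - fst \<theta>'\<bar> * (\<bar>v\<bar> / sqrt (q \<theta> v)) + \<bar>\<phi>\<^sub>0 - fst \<theta>'\<bar> * (\<bar>v\<bar> * \<bar>1 / sqrt (q \<theta> v) - 1 / sqrt (q \<theta>' v)\<bar>)"
   using q(3)[OF that(1), of v] abs_triangle_ineq[of "- (fst \<theta> - fst \<theta>') * (v / sqrt (q \<theta> v))" "(\<phi>\<^sub>0 - fst \<theta>') * (v * (1 / sqrt (q \<theta> v) - 1 / sqrt (q \<theta>' v)))"]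
   by (simp add: abs_mult abs_divide abs_minus_commute)
  also have "\<dots> <= dist1 \<theta> \<theta>' * (1 / sqrt c) + (2 * C) * (dist1 \<theta> \<theta>' / c * (1 / sqrt c))"
  proof (rule add_mono)
   show "\<bar>fst \<theta> - fst \<theta>'\<bar> * (\<bar>v\<bar> / sqrt (q \<theta> v)) <= dist1 \<theta> \<theta>' * (1 / sqrt c)"
    using vq[OF that(1), of v] q(3)[OF that(1), of v] by (intro mult_mono) (auto simp: dist1_def)
   have "\<bar>v\<bar> * \<bar>1 / sqrt (q \<theta> v) - 1 / sqrt (q \<theta>' v)\<bar> <= \<bar>v\<bar> * (dist1 \<theta> \<theta>' / c / sqrt (q \<theta>' v))"
    using inv[OF that] by (intro mult_left_mono) auto
   also have "\<dots> = dist1 \<theta> \<theta>' / c * (\<bar>v\<bar> / sqrt (q \<theta>' v))" by simp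
   also have "\<dots> <= dist1 \<theta> \<theta>' / c * (1 / sqrt c)" using vq[OF that(2), of v] c by (intro mult_left_mono) auto
   finally have "\<bar>v\<bar> * \<bar>1 / sqrt (q \<theta> v) - 1 / sqrt (q \<theta>' v)\<bar> <= dist1 \<theta> \<theta>' / c * (1 / sqrt c)" .
   from mult_mono[OF phi(1)[OF that(2)] this]
   show "\<bar>\<phi>\<^sub>0 - fst \<theta>'\<bar> * (\<bar>v\<bar> * \<bar>1 / sqrt (q \<theta> v) - 1 / sqrt (q \<theta>' v)\<bar>) <= (2 * C) * (dist1 \<theta> \<theta>' / c * (1 / sqrt c))"
    using C by simp
  qed
  also have "\<dots> = (1 / sqrt c + 2 * C / (c * sqrt c)) * dist1 \<theta> \<theta>'" by (simp add: distrib_right)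
  finally show ?thesis .
 qed
 have sqrt_lip: "\<bar>sqrt (fst (snd \<theta>)) - sqrt (fst (snd \<theta>'))\<bar> <= 1 / sqrt c * dist1 \<theta> \<theta>'"
  if "\<theta> \<in> param_box c C" "\<theta>' \<in> param_box c C" for \<theta> \<theta>'
 proof -
  define a a' where "a = fst (snd \<theta>)" and "a' = fst (snd \<theta>')"
  have a: "c <= a" "c <= a'" using that by (auto simp: a_def a'_def param_box_def)
  have sa: "sqrt c <= sqrt a" "0 <= sqrt a'" using a c by auto
  have "\<bar>sqrt a - sqrt a'\<bar> * sqrt c <= \<bar>sqrt a - sqrt a'\<bar> * (sqrt a + sqrt a')"
   by (rule mult_left_mono) (use sa in linarith, simp)
  also have "\<dots> = \<bar>(sqrt a - sqrt a') * (sqrt a + sqrt a')\<bar>" using sa sc unfolding abs_mult by simp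
  also have "(sqrt a - sqrt a') * (sqrt a + sqrt a') = a - a'" using a c by (simp add: algebra_simps)
  also have "\<bar>a - a'\<bar> <= dist1 \<theta> \<theta>'" by (simp add: dist1_def a_def a'_def)
  finally show ?thesis using sc by (simp add: a_def a'_def field_simps)
 qed
 have scale: "x <= H * d" if "x <= k * d" "k <= H" "d >= 0" for x k d
  using that mult_right_mono[of k H d] by linarith
 show ?thesis
 proof (rule that[OF H1(1)])
  fix \<theta> v assume \<theta>: "\<theta> \<in> param_box c C"
  have "1 / H <= 1 / r" using r H1 by (intro divide_left_mono) auto
  then show "1 / H <= rho \<theta> v \<and> rho \<theta> v <= H \<and> \<bar>loc \<theta> v\<bar> <= H"
   using rho_ge[OF \<theta>, of v] rho_le(1)[OF \<theta>, of v] loc_le[OF \<theta>, of v] H1 by linarith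
 next
  fix \<theta> assume \<theta>: "\<theta> \<in> param_box c C"
  have "1 / H <= sqrt c" using H1(1,4) sc by (simp add: field_simps)
  moreover have "sqrt c <= sqrt (fst (snd \<theta>))" "sqrt (fst (snd \<theta>)) <= sqrt C" using \<theta> by (auto simp: param_box_def)
  ultimately show "1 / H <= sqrt (fst (snd \<theta>)) \<and> sqrt (fst (snd \<theta>)) <= H \<and> \<bar>fst \<theta>\<bar> <= H"
   using H1 phi(2)[OF \<theta>] by linarith
 next
  fix \<theta> \<theta>' v assume \<theta>: "\<theta> \<in> param_box c C" "\<theta>' \<in> param_box c C"
  show "\<bar>rho \<theta> v - rho \<theta>' v\<bar> <= H * dist1 \<theta> \<theta>' \<and> \<bar>loc \<theta> v - loc \<theta>' v\<bar> <= H * dist1 \<theta> \<theta>'"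
   using scale[OF rho_lip[OF \<theta>]] scale[OF loc_lip[OF \<theta>]] H1 by simp
 next
  fix \<theta> \<theta>' assume \<theta>: "\<theta> \<in> param_box c C" "\<theta>' \<in> param_box c C"
  show "\<bar>sqrt (fst (snd \<theta>)) - sqrt (fst (snd \<theta>'))\<bar> <= H * dist1 \<theta> \<theta>'"
   using scale[OF sqrt_lip[OF \<theta>]] H1 by simp
 qed
qed

end

section \<open>Consistency\<close>

context dar_model
begin

lemma \<mu>_pos:
 assumes "S \<in> sets borel" "emeasure lborel S \<noteq> 0"
 shows "measure \<mu> S > 0"
proof (rule ccontr)
 assume "\<not> measure \<mu> S > 0"
 then have "emeasure \<mu> S = 0" by (simp add: \<mu>.emeasure_eq_measure not_less measure_le_0_iff)
 then have "(\<integral>\<^sup>+ u. ennreal (f u) * indicator S u \<partial>lborel) = 0"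
  using assms(1) by (simp add: \<mu>_def emeasure_density)
 then have "AE u in lborel. ennreal (f u) * indicator S u = 0"
  using assms(1) by (subst (asm) nn_integral_0_iff_AE) auto
 then have "AE u in lborel. u \<notin> S"
  using f_pos by eventually_elim (auto simp: indicator_def split: if_splits)
 then have "emeasure lborel S = 0" using assms(1) by (subst (asm) AE_iff_measurable[of S]) auto
 then show False using assms(2) by simp
qed

lemma integral_\<mu>: "g \<in> borel_measurable borel ==> (\<integral>u. g u \<partial>\<mu>) = (\<integral>u. f u * g u \<partial>lborel)" for g :: "real => real"
 unfolding \<mu>_def using f_nonneg by (subst integral_density) auto

lemma integral_\<mu>_minus:
 fixes g :: "real => real"
 assumes [measurable]: "g \<in> borel_measurable borel"
 shows "(\<integral>u. g (- u) \<partial>\<mu>) = (\<integral>u. g u \<partial>\<mu>)"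
 using lborel_integral_real_affine[of "-1" "\<lambda>u. f u * g u" 0] f_sym by (simp add: integral_\<mu>)

text \<open>The loss at \<open>\<theta>\<close> minus the loss at \<open>\<theta>\<^sub>0\<close>.
  Each loss grows with the previous value; the difference has linear growth in \<open>u\<close>
  uniformly in \<open>v\<close>, as the laws of large numbers require.\<close>

definition excess :: "real \<times> real \<times> real => real => real => real" where
 "excess \<theta> u v = - ln (rho \<theta> v) + \<bar>loc \<theta> v + rho \<theta> v * u\<bar> - \<bar>u\<bar>"

lemma excess_measurable: "case_prod (excess \<theta>) \<in> borel_measurable (borel \<Otimes>\<^sub>M borel)"
 unfolding excess_def[abs_def] by measurable

lemma qml_loss_path:
 assumes t: "t >= 1" "t <= n" and \<theta>: "\<theta> \<in> param_box c C" "0 < c"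
 shows "qml_loss (sample y n x) t \<theta> = ln (\<omega>\<^sub>0 + \<alpha>\<^sub>0 * (y (t - 1) x)\<^sup>2) / 2 + \<bar>U t x\<bar> + excess \<theta> (U t x) (y (t - 1) x)"
proof -
 obtain \<phi> \<alpha> \<omega> where \<theta>': "\<theta> = (\<phi>, \<alpha>, \<omega>)" by (cases \<theta>) auto
 define v where "v = y (t - 1) x"
 have s: "sample y n x (t - 1) = v" using t by (auto simp: sample_def v_def)
 have q: "\<omega> + \<alpha> * v\<^sup>2 > 0" "\<omega>\<^sub>0 + \<alpha>\<^sub>0 * v\<^sup>2 > 0"
  using \<theta> pos by (auto simp: \<theta>' param_box_def intro!: add_pos_nonneg)
 have "qml_loss (sample y n x) t \<theta> = ln (\<omega> + \<alpha> * v\<^sup>2) / 2 + \<bar>resid \<theta> (sample y n x) t\<bar>"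
  using q by (simp add: \<theta>' s[simplified] abs_divide)
 moreover have "ln (rho \<theta> v) = ln (\<omega>\<^sub>0 + \<alpha>\<^sub>0 * v\<^sup>2) / 2 - ln (\<omega> + \<alpha> * v\<^sup>2) / 2"
  using q by (simp add: rho_def \<theta>' ln_div ln_sqrt)
 ultimately show ?thesis unfolding resid_path[OF t] excess_def v_def[symmetric] by simp
qed

lemma excess_true: "excess \<theta>\<^sub>0 u v = 0"
proof -
 have "\<omega>\<^sub>0 + \<alpha>\<^sub>0 * v\<^sup>2 > 0" using pos by (simp add: add_pos_nonneg)
 then show ?thesis by (simp add: excess_def rho_def loc_def)
qed

text \<open>With \<open>x = s * s\<close>, the inequality \<open>ln s <= s - 1\<close> gives the
  lower bound \<open>(s - 1)\<^sup>2\<close>, and \<open>x - 1\<close> is \<open>s - 1\<close> times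
  the bounded factor \<open>s + 1\<close>.\<close>

lemma log_excess_ge:
 fixes x H \<zeta> :: real
 assumes "0 < x" "x <= H" "1 <= H"
 shows "x - 1 - ln x >= 0" "\<bar>x - 1\<bar> >= \<zeta> ==> \<zeta> > 0 ==> x - 1 - ln x >= (\<zeta> / (H + 1))\<^sup>2"
proof -
 define s where "s = sqrt x"
 have s: "s > 0" "s * s = x" using assms by (auto simp: s_def)
 have "ln x = 2 * ln s" using assms by (simp add: s_def ln_sqrt)
 also have "\<dots> <= 2 * (s - 1)" using ln_le_minus_one[OF s(1)] by simp
 finally have 1: "x - 1 - ln x >= (s - 1)\<^sup>2" using s(2) by (simp add: power2_eq_square algebra_simps)
 moreover have "(s - 1)\<^sup>2 >= 0" by simp
 ultimately show "x - 1 - ln x >= 0" by linarith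
 assume \<zeta>: "\<bar>x - 1\<bar> >= \<zeta>" "\<zeta> > 0"
 have "sqrt x <= sqrt (H * H)" using assms mult_mono[of x H 1 H] by (intro real_sqrt_le_mono) auto
 then have "s <= H" using assms by (simp add: s_def)
 have "x - 1 = (s - 1) * (s + 1)" by (simp add: s(2)[symmetric] algebra_simps)
 then have "\<bar>x - 1\<bar> = \<bar>s - 1\<bar> * (s + 1)" using s(1) by (simp only: abs_mult)
 then have "\<zeta> <= \<bar>s - 1\<bar> * (H + 1)" using \<zeta> \<open>s <= H\<close> mult_left_mono[of "s + 1" "H + 1" "\<bar>s - 1\<bar>"] by simp
 then have "\<zeta> / (H + 1) <= \<bar>s - 1\<bar>" using assms by (simp add: field_simps)
 then have "(\<zeta> / (H + 1))\<^sup>2 <= \<bar>s - 1\<bar>\<^sup>2" using \<zeta> assms by (intro power_mono) auto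
 then show "x - 1 - ln x >= (\<zeta> / (H + 1))\<^sup>2" using 1 by simp
qed

text \<open>A lower bound for the mean excess as soon as slope or intercept is off by
  \<open>\<zeta>\<close>: the first term answers for \<open>rho\<close>, the second for
  \<open>loc\<close>.\<close>

definition gap :: "real => real => real" where
 "gap H \<zeta> = min ((\<zeta> / (H + 1))\<^sup>2) (\<integral>u. max 0 (\<zeta> - H * \<bar>u\<bar>) \<partial>\<mu>)"

lemma gap_integrable: "integrable \<mu> (\<lambda>u. max 0 (\<zeta> - H * \<bar>u\<bar>))"
proof (rule Bochner_Integration.integrable_bound)
 show "integrable \<mu> (\<lambda>u. \<bar>\<zeta>\<bar> + \<bar>H\<bar> * \<bar>u\<bar>)" by simp
 have "max 0 (\<zeta> - H * \<bar>u\<bar>) <= \<bar>\<zeta>\<bar> + \<bar>H\<bar> * \<bar>u\<bar>" for u :: real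
  using abs_ge_minus_self[of "H * \<bar>u\<bar>"] by (simp add: abs_mult)
 then show "AE u in \<mu>. norm (max 0 (\<zeta> - H * \<bar>u\<bar>)) <= norm (\<bar>\<zeta>\<bar> + \<bar>H\<bar> * \<bar>u\<bar>)" by (intro AE_I2) simp
qed simp

lemma gap_pos:
 assumes "H >= 1" "\<zeta> > 0"
 shows "gap H \<zeta> > 0"
proof -
 define S where "S = {- (\<zeta> / (2 * H))..\<zeta> / (2 * H)}"
 have S: "measure \<mu> S > 0" unfolding S_def using assms by (intro \<mu>_pos) auto
 have "(\<integral>u. \<zeta> / 2 * indicator S u \<partial>\<mu>) <= (\<integral>u. max 0 (\<zeta> - H * \<bar>u\<bar>) \<partial>\<mu>)"
 proof (rule integral_mono)
  show "integrable \<mu> (\<lambda>u. \<zeta> / 2 * indicator S u)" by (simp add: S_def \<mu>.emeasure_eq_measure)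
  fix u show "\<zeta> / 2 * indicator S u <= max 0 (\<zeta> - H * \<bar>u\<bar>)"
  proof (cases "u \<in> S")
   case True
   then have "\<bar>u\<bar> <= \<zeta> / (2 * H)" by (auto simp: S_def)
   then have "H * \<bar>u\<bar> <= H * (\<zeta> / (2 * H))" using assms by (intro mult_left_mono) auto
   then show ?thesis using True assms by simp
  qed (use assms in simp)
 qed (rule gap_integrable)
 moreover have "(\<integral>u. \<zeta> / 2 * indicator S u \<partial>\<mu>) = \<zeta> / 2 * measure \<mu> S" by (simp add: S_def)
 moreover have "\<zeta> / 2 * measure \<mu> S > 0" using S assms by simp
 ultimately have "(\<integral>u. max 0 (\<zeta> - H * \<bar>u\<bar>) \<partial>\<mu>) > 0" by linarith
 then show ?thesis using assms by (simp add: gap_def)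
qed

text \<open>Symmetry replaces the modulus by the mean of \<open>\<bar>l + r * u\<bar>\<close> and
  \<open>\<bar>l - r * u\<bar>\<close>, which is \<open>r * \<bar>u\<bar>\<close> plus the positive
  part of \<open>\<bar>l\<bar> - r * \<bar>u\<bar>\<close>. Since the modulus of the innovation has
  mean 1, the mean excess is at least \<open>r - 1 - ln r\<close> plus a term for \<open>l\<close>,
  both nonnegative.\<close>

lemma cmean_excess:
 assumes H: "1 / H <= rho \<theta> v" "rho \<theta> v <= H" "H >= 1"
 shows "cmean (excess \<theta>) v >= 0"
  "\<bar>rho \<theta> v - 1\<bar> >= \<zeta> \<or> \<bar>loc \<theta> v\<bar> >= \<zeta> ==> \<zeta> > 0 ==> cmean (excess \<theta>) v >= gap H \<zeta>"
proof -
 define r l where "r = rho \<theta> v" and "l = loc \<theta> v"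
 have r: "r > 0" "r <= H" using H by (auto simp: r_def intro: less_le_trans[of 0 "1 / H"])
 have int: "integrable \<mu> (\<lambda>u. \<bar>l + r * u\<bar>)" "integrable \<mu> (\<lambda>u. \<bar>l + r * - u\<bar>)" by simp_all
 have "(\<integral>u. \<bar>l + r * - u\<bar> \<partial>\<mu>) = (\<integral>u. \<bar>l + r * u\<bar> \<partial>\<mu>)"
  using integral_\<mu>_minus[of "\<lambda>u. \<bar>l + r * u\<bar>"] by simp
 then have "2 * (\<integral>u. \<bar>l + r * u\<bar> \<partial>\<mu>) = (\<integral>u. \<bar>l + r * u\<bar> + \<bar>l + r * - u\<bar> \<partial>\<mu>)"
  using int by simp
 also have "\<dots> >= (\<integral>u. 2 * (r * \<bar>u\<bar> + max 0 (\<bar>l\<bar> - r * \<bar>u\<bar>)) \<partial>\<mu>)"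
 proof (rule integral_mono)
  fix u :: real
  have "\<bar>r * u\<bar> = r * \<bar>u\<bar>" using r by (simp add: abs_mult)
  then show "2 * (r * \<bar>u\<bar> + max 0 (\<bar>l\<bar> - r * \<bar>u\<bar>)) <= \<bar>l + r * u\<bar> + \<bar>l + r * - u\<bar>" by (simp add: max_def) arith
 qed (use gap_integrable int in simp_all)
 also have "(\<integral>u. 2 * (r * \<bar>u\<bar> + max 0 (\<bar>l\<bar> - r * \<bar>u\<bar>)) \<partial>\<mu>) = 2 * (r + (\<integral>u. max 0 (\<bar>l\<bar> - r * \<bar>u\<bar>) \<partial>\<mu>))"
  using gap_integrable[of "\<bar>l\<bar>" r] integral_\<mu>_abs by simp
 finally have 1: "(\<integral>u. \<bar>l + r * u\<bar> \<partial>\<mu>) >= r + (\<integral>u. max 0 (\<bar>l\<bar> - r * \<bar>u\<bar>) \<partial>\<mu>)" by simp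
 have "cmean (excess \<theta>) v = - ln r + (\<integral>u. \<bar>l + r * u\<bar> \<partial>\<mu>) - 1"
  using int(1) integral_\<mu>_abs \<mu>.prob_space by (simp add: cmean_def excess_def r_def[symmetric] l_def[symmetric])
 then have 2: "cmean (excess \<theta>) v >= (r - 1 - ln r) + (\<integral>u. max 0 (\<bar>l\<bar> - r * \<bar>u\<bar>) \<partial>\<mu>)" using 1 by linarith
 have 3: "(\<integral>u. max 0 (\<bar>l\<bar> - r * \<bar>u\<bar>) \<partial>\<mu>) >= 0" by (intro Bochner_Integration.integral_nonneg) auto
 have 4: "r - 1 - ln r >= 0" by (rule log_excess_ge(1)[OF r H(3)])
 show "cmean (excess \<theta>) v >= 0" using 2 3 4 by linarith
 assume \<zeta>: "\<bar>rho \<theta> v - 1\<bar> >= \<zeta> \<or> \<bar>loc \<theta> v\<bar> >= \<zeta>" "\<zeta> > 0"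
 show "cmean (excess \<theta>) v >= gap H \<zeta>"
 proof (cases "\<bar>r - 1\<bar> >= \<zeta>")
  case True
  from log_excess_ge(2)[OF r H(3) this \<zeta>(2)] show ?thesis using 2 3
   unfolding gap_def by (intro min.coboundedI1) linarith
 next
  case False
  then have l: "\<bar>l\<bar> >= \<zeta>" using \<zeta>(1) by (simp add: r_def l_def)
  have "(\<integral>u. max 0 (\<zeta> - H * \<bar>u\<bar>) \<partial>\<mu>) <= (\<integral>u. max 0 (\<bar>l\<bar> - r * \<bar>u\<bar>) \<partial>\<mu>)"
  proof (intro integral_mono gap_integrable)
   fix u :: real
   have "r * \<bar>u\<bar> <= H * \<bar>u\<bar>" using r by (intro mult_right_mono) auto
   then show "max 0 (\<zeta> - H * \<bar>u\<bar>) <= max 0 (\<bar>l\<bar> - r * \<bar>u\<bar>)" using l by (intro max.mono) auto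
  qed
  then show ?thesis using 2 4 unfolding gap_def by (intro min.coboundedI2) linarith
 qed
qed

text \<open>Volatility is at least \<open>sqrt c * sqrt (1 + v\<^sup>2)\<close> and the drift at
  most \<open>C * sqrt (1 + v\<^sup>2)\<close> in modulus, so one large innovation leads above
  \<open>R\<close> from any previous value. This is how large values recur in every regime.\<close>

lemma large_innovation:
 assumes c: "0 < c" "c <= C" and \<theta>0: "\<theta>\<^sub>0 \<in> param_box c C" and R: "R > 0"
  and U: "U t x >= (C + R) / sqrt c"
 shows "y t x >= R"
proof -
 have sc: "sqrt c > 0" using c by simp
 have C: "C > 0" using c by simp
 define Kc where "Kc = (C + R) / sqrt c"
 define v where "v = y (t - 1) x"
 have "sqrt (c * (1 + v\<^sup>2)) <= sqrt (\<omega>\<^sub>0 + \<alpha>\<^sub>0 * v\<^sup>2)"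
  using box_scale(1)[OF \<theta>0 c(1), of v] by (intro real_sqrt_le_mono) simp
 then have sq: "sqrt c * sqrt (1 + v\<^sup>2) <= sqrt (\<omega>\<^sub>0 + \<alpha>\<^sub>0 * v\<^sup>2)" by (simp add: real_sqrt_mult)
 have "sqrt (1 + v\<^sup>2) >= sqrt (v\<^sup>2)" "sqrt (1 + v\<^sup>2) >= sqrt 1" by (intro real_sqrt_le_mono; simp)+
 then have v: "sqrt (1 + v\<^sup>2) >= \<bar>v\<bar>" "sqrt (1 + v\<^sup>2) >= 1" by auto
 have Kc0: "Kc >= 0" using C R sc by (simp add: Kc_def)
 have "(C + R) * sqrt (1 + v\<^sup>2) = Kc * (sqrt c * sqrt (1 + v\<^sup>2))" using sc by (simp add: Kc_def)
 also have "\<dots> <= U t x * sqrt (\<omega>\<^sub>0 + \<alpha>\<^sub>0 * v\<^sup>2)" using U[folded Kc_def] Kc0 sq sc by (intro mult_mono) auto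
 finally have 1: "(C + R) * sqrt (1 + v\<^sup>2) <= U t x * sqrt (\<omega>\<^sub>0 + \<alpha>\<^sub>0 * v\<^sup>2)" .
 have "\<bar>\<phi>\<^sub>0 * v\<bar> <= C * sqrt (1 + v\<^sup>2)" unfolding abs_mult using \<theta>0 v C by (intro mult_mono) (auto simp: param_box_def)
 moreover have "R * 1 <= R * sqrt (1 + v\<^sup>2)" using v R by (intro mult_left_mono) auto
 ultimately show ?thesis using 1 y_rec[of t x] unfolding v_def[symmetric] by (simp add: algebra_simps abs_le_iff)
qed

text \<open>Call an index bad if slope or intercept of its residual is off. Each bad index adds at
  least a fixed amount to the summed mean excess, which the law of large numbers makes small; so bad
  indices are rare, rarer even than large values. Hence some good index follows a large value, and
  there slope and intercept determine \<open>\<phi>\<close> and \<open>\<alpha>\<close>, the share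
  of \<open>\<omega>\<close> being negligible.\<close>

lemma consistency:
 fixes \<kappa> :: real
 assumes c: "0 < c" "c <= C" and \<theta>0: "\<theta>\<^sub>0 \<in> param_box c C" and \<kappa>: "\<kappa> > 0"
 obtains K n0 where "\<And>n W. weights M \<eta> y f \<phi>\<^sub>0 \<alpha>\<^sub>0 \<omega>\<^sub>0 n W ==> n >= n0 ==>
   \<exists>N\<in>events. prob N <= K / real n \<and> (\<forall>x\<in>space M - N. \<forall>\<theta>\<in>param_box c C.
    no_worse n W x \<theta> -->
    \<bar>fst \<theta> - \<phi>\<^sub>0\<bar> <= \<kappa> \<and> \<bar>fst (snd \<theta>) - \<alpha>\<^sub>0\<bar> <= \<kappa> \<and>
    card {t\<in>{1..n}. \<bar>rho \<theta> (y (t - 1) x) - 1\<bar> >= \<kappa> \<or> \<bar>loc \<theta> (y (t - 1) x)\<bar> >= \<kappa>} <= \<kappa> * real n)"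
proof -
 obtain H where H: "H >= 1"
  "\<And>\<theta> v. \<theta> \<in> param_box c C ==> 1 / H <= rho \<theta> v \<and> rho \<theta> v <= H \<and> \<bar>loc \<theta> v\<bar> <= H"
  "\<And>\<theta>. \<theta> \<in> param_box c C ==> 1 / H <= sqrt (fst (snd \<theta>)) \<and> sqrt (fst (snd \<theta>)) <= H \<and> \<bar>fst \<theta>\<bar> <= H"
  "\<And>\<theta> \<theta>' v. \<theta> \<in> param_box c C ==> \<theta>' \<in> param_box c C ==>
    \<bar>rho \<theta> v - rho \<theta>' v\<bar> <= H * dist1 \<theta> \<theta>' \<and> \<bar>loc \<theta> v - loc \<theta>' v\<bar> <= H * dist1 \<theta> \<theta>'"
  by (rule param_box_bounds[OF c \<theta>0]) blast
 have C: "C > 0" using c by simp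
 \<comment> \<open>The last two terms are the accuracies needed to read \<open>\<phi>\<close> and
   \<open>\<alpha>\<close> off one large value. \<open>R\<close> below makes
   \<open>C / R\<^sup>2\<close>, the part of the error in \<open>\<alpha>\<close> that is due to
   \<open>\<omega>\<close>, at most \<open>\<kappa> / 2\<close>.\<close>
 define \<zeta> where "\<zeta> = min (min 1 \<kappa>) (min (\<kappa> / (2 * C + 1)) (\<kappa> / (12 * C)))"
 have \<zeta>: "\<zeta> > 0" "\<zeta> <= 1" "\<zeta> <= \<kappa>" "\<zeta> * (2 * C + 1) <= \<kappa>" "6 * C * \<zeta> <= \<kappa> / 2"
 proof -
  show "\<zeta> > 0" using \<kappa> C by (simp add: \<zeta>_def)
  show "\<zeta> <= 1" "\<zeta> <= \<kappa>" by (auto simp: \<zeta>_def)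
  have "\<zeta> <= \<kappa> / (2 * C + 1)" "\<zeta> <= \<kappa> / (12 * C)" by (auto simp: \<zeta>_def)
  then show "\<zeta> * (2 * C + 1) <= \<kappa>" "6 * C * \<zeta> <= \<kappa> / 2" using C by (auto simp: field_simps)
 qed
 define R where "R = 1 + 2 * C / \<kappa>"
 have R: "R >= 1" "C / R\<^sup>2 <= \<kappa> / 2"
 proof -
  show "R >= 1" using C \<kappa> by (simp add: R_def)
  then have "R <= R\<^sup>2" by (simp add: power2_eq_square mult_left_le)
  then have "2 * C / \<kappa> <= R\<^sup>2" by (simp add: R_def)
  then show "C / R\<^sup>2 <= \<kappa> / 2" using \<kappa> C \<open>R >= 1\<close> by (simp add: field_simps)
 qed
 define Kc where "Kc = (C + R) / sqrt c"
 have sc: "sqrt c > 0" using c by simp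
 have large: "y t x >= R" if "U t x >= Kc" for t x
  by (rule large_innovation[OF c \<theta>0]) (use that R in \<open>simp_all add: Kc_def\<close>)
 define p where "p = measure \<mu> {Kc..}"
 have p: "p > 0" unfolding p_def
 proof (rule \<mu>_pos)
  have "emeasure lborel {Kc..Kc + 1} <= emeasure lborel {Kc..}" by (intro emeasure_mono) auto
  then show "emeasure lborel {Kc..} \<noteq> 0" by auto
 qed simp
 \<comment> \<open>The bad fraction is kept at or below an eighth of the probability
   \<open>p\<close> of a large innovation.\<close>
 define \<kappa>' where "\<kappa>' = min \<kappa> (p / 8)"
 define d where "d = gap H \<zeta>"
 have d: "d > 0" unfolding d_def by (rule gap_pos[OF H(1) \<zeta>(1)])
 have \<kappa>': "\<kappa>' > 0" "\<kappa>' <= \<kappa>" "\<kappa>' <= p / 8" using \<kappa> p by (auto simp: \<kappa>'_def)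
 define \<epsilon> where "\<epsilon> = \<kappa>' * d / 2"
 have \<epsilon>: "\<epsilon> > 0" using \<kappa>' d by (simp add: \<epsilon>_def)
 define \<Lambda> where "\<Lambda> = 2 * H\<^sup>2"
 obtain m :: nat where m0: "20 * C * \<Lambda> / \<epsilon> <= m" using real_arch_simple by blast
 define m1 where "m1 = Suc m"
 have m: "m1 >= 1" "20 * C * \<Lambda> <= \<epsilon> * m1"
 proof -
  have "20 * C * \<Lambda> / \<epsilon> <= m1" using m0 by (simp add: m1_def)
  then show "20 * C * \<Lambda> <= \<epsilon> * m1" using \<epsilon> by (simp add: field_simps)
 qed (simp add: m1_def)
 define K where "K = ((real m1 + 1) ^ 3 * (3 * H)\<^sup>2 / \<epsilon>\<^sup>2 + 1) * (20 * K0) + 4 * 1\<^sup>2 * K0 / (p / 4)\<^sup>2"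
 obtain n0 :: nat where n0: "2 / p < n0" using reals_Archimedean2 by blast
 have ln_rho: "\<bar>ln (rho \<theta> v)\<bar> <= H" if "\<theta> \<in> param_box c C" for \<theta> v
 proof -
  note b = H(2)[OF that, of v]
  have "rho \<theta> v > 0" using b H(1) by (auto intro: less_le_trans[of 0 "1 / H"])
  then have "ln (rho \<theta> v) <= rho \<theta> v - 1" "ln (1 / rho \<theta> v) <= 1 / rho \<theta> v - 1"
   using ln_le_minus_one[of "rho \<theta> v"] ln_le_minus_one[of "1 / rho \<theta> v"] by simp_all
  moreover have "1 / rho \<theta> v <= H" using b H(1) \<open>rho \<theta> v > 0\<close> by (simp add: field_simps)
  ultimately have "ln (rho \<theta> v) <= rho \<theta> v - 1" "ln (1 / rho \<theta> v) <= 1 / rho \<theta> v - 1" "1 / rho \<theta> v <= H"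
   by blast+
  then show ?thesis using b \<open>rho \<theta> v > 0\<close> by (auto simp: ln_div abs_le_iff)
 qed
 have bd: "\<bar>excess \<theta> u v\<bar> <= (3 * H) * (1 + \<bar>u\<bar>)" if "\<theta> \<in> param_box c C" for \<theta> u v
 proof -
  note b = H(2)[OF that, of v]
  have "rho \<theta> v > 0" using b H(1) by (auto intro: less_le_trans[of 0 "1 / H"])
  then have "\<bar>rho \<theta> v * u\<bar> <= H * \<bar>u\<bar>" unfolding abs_mult using b by (intro mult_right_mono) auto
  moreover have "\<bar>u\<bar> <= H * \<bar>u\<bar>" using mult_right_mono[OF H(1), of "\<bar>u\<bar>"] by simp
  ultimately have "\<bar>excess \<theta> u v\<bar> <= H + H + H * \<bar>u\<bar> + H * \<bar>u\<bar>"
   using b ln_rho[OF that, of v] unfolding excess_def by linarith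
  also have "\<dots> <= (3 * H) * (1 + \<bar>u\<bar>)" using H(1) mult_right_mono[OF H(1), of "\<bar>u\<bar>"] by (simp add: algebra_simps)
  finally show ?thesis .
 qed
 have lip: "\<bar>excess \<theta> u v - excess \<theta>' u v\<bar> <= \<Lambda> * dist1 \<theta> \<theta>' * (1 + \<bar>u\<bar>)"
  if \<theta>: "\<theta> \<in> param_box c C" "\<theta>' \<in> param_box c C" for \<theta> \<theta>' u v
 proof -
  define r r' where "r = rho \<theta> v" and "r' = rho \<theta>' v"
  define D where "D = H * dist1 \<theta> \<theta>'"
  have D: "D >= 0" "D <= H * D" using H(1) mult_right_mono[OF H(1), of D] by (auto simp: D_def)
  have b: "1 / H <= r" "1 / H <= r'" using H(2)[OF \<theta>(1), of v] H(2)[OF \<theta>(2), of v] by (auto simp: r_def r'_def)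
  have "1 / H > 0" using H(1) by simp
  then have rp: "r > 0" "r' > 0" using b by linarith+
  have dr: "\<bar>r - r'\<bar> <= D" "\<bar>loc \<theta> v - loc \<theta>' v\<bar> <= D" using H(4)[OF \<theta>] by (auto simp: r_def r'_def D_def)
  have "ln r - ln r' <= H * D" if "r > 0" "1 / H <= r'" "\<bar>r - r'\<bar> <= D" "r' > 0" for r r' :: real
  proof -
   have "ln r - ln r' = ln (r / r')" using that by (simp add: ln_div)
   also have "\<dots> <= r / r' - 1" using that by (intro ln_le_minus_one) simp
   also have "\<dots> = (r - r') * (1 / r')" using that by (simp add: field_simps)
   also have "\<dots> <= D * H"
   proof -
    have "1 / r' <= H" using that H(1) by (simp add: field_simps)
    then have "\<bar>r - r'\<bar> * (1 / r') <= D * H" using that D by (intro mult_mono) auto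
    moreover have "(r - r') * (1 / r') <= \<bar>r - r'\<bar> * (1 / r')" using that by (intro mult_right_mono) auto
    ultimately show ?thesis by linarith
   qed
   finally show ?thesis by (simp add: mult.commute)
  qed
  from this[of r r'] this[of r' r] have ln: "\<bar>ln r - ln r'\<bar> <= H * D" using rp b dr by (simp add: abs_le_iff abs_minus_commute)
  have "\<bar>(r - r') * u\<bar> <= D * \<bar>u\<bar>" unfolding abs_mult using dr by (intro mult_right_mono) auto
  moreover have "(loc \<theta> v + r * u) - (loc \<theta>' v + r' * u) = (loc \<theta> v - loc \<theta>' v) + (r - r') * u" by (simp add: algebra_simps)
  ultimately have "\<bar>\<bar>loc \<theta> v + r * u\<bar> - \<bar>loc \<theta>' v + r' * u\<bar>\<bar> <= D + D * \<bar>u\<bar>" using dr(2) by linarith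
  then have "\<bar>excess \<theta> u v - excess \<theta>' u v\<bar> <= H * D + D + D * \<bar>u\<bar>"
   using ln unfolding excess_def r_def[symmetric] r'_def[symmetric] by linarith
  also have "\<dots> <= (2 * (H * D)) * (1 + \<bar>u\<bar>)"
  proof -
   have "D * \<bar>u\<bar> <= (2 * (H * D)) * \<bar>u\<bar>" using D by (intro mult_right_mono) auto
   then show ?thesis using D unfolding distrib_left mult_1_right by linarith
  qed
  also have "2 * (H * D) = \<Lambda> * dist1 \<theta> \<theta>'" by (simp add: \<Lambda>_def D_def power2_eq_square)
  finally show ?thesis .
 qed
 define ind where "ind u v = (indicator {Kc..} u :: real)" for u v :: real
 have ind: "case_prod ind \<in> borel_measurable (borel \<Otimes>\<^sub>M borel)" "\<And>u v. \<bar>ind u v\<bar> <= 1 * (1 + \<bar>u\<bar>)"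
  unfolding ind_def[abs_def] by (measurable, auto simp: indicator_def)
 have cmean_ind: "cmean ind v = p" for v by (simp add: cmean_def ind_def p_def)
 show ?thesis
 proof (rule that[of n0 K])
  fix n W assume wt: "weights M \<eta> y f \<phi>\<^sub>0 \<alpha>\<^sub>0 \<omega>\<^sub>0 n W" and n: "n >= n0"
  interpret weights M \<eta> y f \<phi>\<^sub>0 \<alpha>\<^sub>0 \<omega>\<^sub>0 n W by (rule wt)
  obtain N1 where N1: "N1 \<in> events" "prob N1 <= ((real m1 + 1) ^ 3 * (3 * H)\<^sup>2 / \<epsilon>\<^sup>2 + 1) * (20 * K0) / n"
   "\<And>x \<theta>. x \<in> space M - N1 ==> \<theta> \<in> param_box c C ==>
    \<bar>\<Sum>t=1..n. W t x * excess \<theta> (U t x) (y (t - 1) x) - cmean (excess \<theta>) (y (t - 1) x)\<bar> <= 2 * \<epsilon> * n"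
   by (rule uniform_lln[where \<psi> = excess and K = "3 * H" and \<Lambda> = \<Lambda>, OF c excess_measurable _ bd _ lip \<epsilon> m])
     (use H(1) in \<open>simp_all add: \<Lambda>_def\<close>)
  define N2 where "N2 = {x \<in> space M. \<bar>\<Sum>t=1..n. centred ind t x\<bar> >= p / 4 * n}"
  have N2: "N2 \<in> events"
  proof -
   have "(\<lambda>x. \<Sum>t=1..n. centred ind t x) \<in> borel_measurable M"
    by (intro borel_measurable_sum centred_measurable[OF ind(1) _ ind(2)]) simp
   then show ?thesis unfolding N2_def by measurable
  qed
  have "prob N2 <= 4 * 1\<^sup>2 * K0 / ((p / 4)\<^sup>2 * n)"
   unfolding N2_def by (rule lln_centred[OF ind(1) _ ind(2)]) (use n_pos p in auto)
  then have "prob N1 + prob N2 <= K / n" using N1(2) by (simp add: K_def add_divide_distrib)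
  then have "prob (N1 \<union> N2) <= K / n" using measure_Un_le[OF N1(1) N2] by linarith
  moreover have "N1 \<union> N2 \<in> events" using N1(1) N2 by (rule sets.Un)
  moreover have "\<bar>fst \<theta> - \<phi>\<^sub>0\<bar> <= \<kappa> \<and> \<bar>fst (snd \<theta>) - \<alpha>\<^sub>0\<bar> <= \<kappa> \<and>
    card {t\<in>{1..n}. \<bar>rho \<theta> (y (t - 1) x) - 1\<bar> >= \<kappa> \<or> \<bar>loc \<theta> (y (t - 1) x)\<bar> >= \<kappa>} <= \<kappa> * real n"
   if x: "x \<in> space M - (N1 \<union> N2)" and \<theta>: "\<theta> \<in> param_box c C"
    and min: "no_worse n W x \<theta>"
   for x \<theta>
  proof -
   define bad where "bad = {t\<in>{1..n}. \<bar>rho \<theta> (y (t - 1) x) - 1\<bar> >= \<zeta> \<or> \<bar>loc \<theta> (y (t - 1) x)\<bar> >= \<zeta>}"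
   have "(\<Sum>t=1..n. W t x * qml_loss (sample y n x) t \<theta>) - (\<Sum>t=1..n. W t x * qml_loss (sample y n x) t \<theta>\<^sub>0)
     = (\<Sum>t=1..n. W t x * excess \<theta> (U t x) (y (t - 1) x))"
    unfolding sum_subtractf[symmetric]
   proof (intro sum.cong refl)
    fix t assume "t \<in> {1..n}"
    then have t: "t >= 1" "t <= n" by auto
    show "W t x * qml_loss (sample y n x) t \<theta> - W t x * qml_loss (sample y n x) t \<theta>\<^sub>0
      = W t x * excess \<theta> (U t x) (y (t - 1) x)"
     unfolding qml_loss_path[OF t \<theta> c(1)] qml_loss_path[OF t \<theta>0 c(1)] excess_true by (simp add: algebra_simps)
   qed
   then have "(\<Sum>t=1..n. cmean (excess \<theta>) (y (t - 1) x)) <= 2 * \<epsilon> * n"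
    using min N1(3)[of x \<theta>] x \<theta> by (simp add: sum_subtractf abs_le_iff)
   moreover have "card bad * d <= (\<Sum>t=1..n. cmean (excess \<theta>) (y (t - 1) x))"
   proof -
    have "card bad * d = (\<Sum>t\<in>bad. d)" by simp
    also have "\<dots> <= (\<Sum>t\<in>bad. cmean (excess \<theta>) (y (t - 1) x))"
     unfolding d_def using H(1) H(2)[OF \<theta>] \<zeta>(1) by (intro sum_mono cmean_excess(2)) (auto simp: bad_def)
    also have "\<dots> <= (\<Sum>t\<in>{1..n}. cmean (excess \<theta>) (y (t - 1) x))"
     using H(1) H(2)[OF \<theta>] by (intro sum_mono2 cmean_excess(1)) (auto simp: bad_def)
    finally show ?thesis .
   qed
   ultimately have "card bad * d <= \<kappa>' * n * d" by (simp add: \<epsilon>_def algebra_simps)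
   then have card_bad: "card bad <= \<kappa>' * n" using d by simp
   have card_\<kappa>: "card {t\<in>{1..n}. \<bar>rho \<theta> (y (t - 1) x) - 1\<bar> >= \<kappa> \<or> \<bar>loc \<theta> (y (t - 1) x)\<bar> >= \<kappa>} <= \<kappa> * real n"
   proof -
    have "{t\<in>{1..n}. \<bar>rho \<theta> (y (t - 1) x) - 1\<bar> >= \<kappa> \<or> \<bar>loc \<theta> (y (t - 1) x)\<bar> >= \<kappa>} \<subseteq> bad"
     using \<zeta>(3) by (auto simp: bad_def)
    then have "card {t\<in>{1..n}. \<bar>rho \<theta> (y (t - 1) x) - 1\<bar> >= \<kappa> \<or> \<bar>loc \<theta> (y (t - 1) x)\<bar> >= \<kappa>} <= card bad"
     by (intro card_mono) (auto simp: bad_def)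
    moreover have "\<kappa>' * n <= \<kappa> * n" using \<kappa>' by (intro mult_right_mono) auto
    ultimately show ?thesis using card_bad by linarith
   qed
   define S where "S = {t\<in>{1..n}. U t x >= Kc}"
   have "(\<Sum>t=1..n. centred ind t x) = (\<Sum>t=1..n. indicator {Kc..} (U t x)) - n * p"
    by (simp add: centred_def[OF ind(1) _ ind(2)] sum_subtractf cmean_ind) (simp add: ind_def)
   moreover have "(\<Sum>t=1..n. indicator {Kc..} (U t x)) = real (card S)"
   proof -
    have "(\<Sum>t=1..n. indicator {Kc..} (U t x) :: real) = (\<Sum>t\<in>{1..n}. if t \<in> S then 1 else 0)"
     by (intro sum.cong) (auto simp: S_def indicator_def)
    also have "\<dots> = real (card ({1..n} \<inter> S))" by (subst sum.inter_restrict[symmetric]) auto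
    also have "{1..n} \<inter> S = S" by (auto simp: S_def)
    finally show ?thesis .
   qed
   moreover have "\<bar>\<Sum>t=1..n. centred ind t x\<bar> < p / 4 * n" using x by (auto simp: N2_def)
   ultimately have card_S: "real (card S) >= 3 / 4 * p * n" by (simp add: algebra_simps abs_less_iff)
   \<comment> \<open>The value \<open>y t\<close> enters the residual with index
     \<open>Suc t\<close>; \<open>n\<close> is removed so that this index still belongs to the
     sample.\<close>
   have "\<exists>t\<in>S - {n}. Suc t \<notin> bad"
   proof (rule ccontr)
    assume "\<not> (\<exists>t\<in>S - {n}. Suc t \<notin> bad)"
    then have "Suc ` (S - {n}) \<subseteq> bad" by blast
    then have "card (Suc ` (S - {n})) <= card bad" by (intro card_mono) (auto simp: bad_def)
    then have "card (S - {n}) <= card bad" by (simp add: card_image)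
    moreover have "card S <= card (S - {n}) + 1" by (metis card_Diff_singleton_if diff_le_self le_diff_conv add.commute Suc_eq_plus1 card_Diff1_le diff_Suc_1 le_SucI Suc_pred' add_diff_cancel_right' le_add1 nat_le_linear)
    ultimately have "real (card S) <= \<kappa>' * n + 1" using card_bad by linarith
    then have "3 / 4 * p * n <= p / 8 * n + 1" using card_S mult_right_mono[OF \<kappa>'(3), of "real n"] by linarith
    moreover have "2 < p * n"
    proof -
     have "2 / p < n" using n0 n by linarith
     then show ?thesis using p by (simp add: field_simps)
    qed
    ultimately show False by linarith
   qed
   then obtain t where t: "t \<in> S" "t \<noteq> n" "Suc t \<notin> bad" by blast
   define v where "v = y t x"
   have "Suc t \<in> {1..n}" using t by (auto simp: S_def)
   then have small: "\<bar>rho \<theta> v - 1\<bar> < \<zeta>" "\<bar>loc \<theta> v\<bar> < \<zeta>" using t(3) by (auto simp: bad_def v_def)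
   have v: "v >= R" unfolding v_def by (rule large) (use t in \<open>simp add: S_def\<close>)
   then have v1: "v >= 1" "v > 0" using R by auto
   then have "1 <= v\<^sup>2" by (simp add: one_le_power)
   define q where "q = snd (snd \<theta>) + fst (snd \<theta>) * v\<^sup>2"
   define q0 where "q0 = \<omega>\<^sub>0 + \<alpha>\<^sub>0 * v\<^sup>2"
   have q: "q <= 2 * C * v\<^sup>2" "q > 0"
   proof -
    have "C * (1 + v\<^sup>2) <= C * (2 * v\<^sup>2)" using C \<open>1 <= v\<^sup>2\<close> by (intro mult_left_mono) auto
    then show "q <= 2 * C * v\<^sup>2" using box_scale(2)[OF \<theta> c(1), of v] by (simp add: q_def)
    have "c * (1 + v\<^sup>2) > 0" using c by (simp add: add_pos_nonneg)
    then show "q > 0" using box_scale(1)[OF \<theta> c(1), of v] by (simp add: q_def)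
   qed
   have "q0 > 0" using pos by (simp add: q0_def add_pos_nonneg)
   have phi: "\<bar>fst \<theta> - \<phi>\<^sub>0\<bar> <= \<kappa>"
   proof -
    have "sqrt q <= sqrt ((2 * C + 1)\<^sup>2 * v\<^sup>2)"
    proof (rule real_sqrt_le_mono)
     have "2 * C <= (2 * C + 1)\<^sup>2" using C by (simp add: power2_eq_square algebra_simps)
     then have "2 * C * v\<^sup>2 <= (2 * C + 1)\<^sup>2 * v\<^sup>2" by (intro mult_right_mono) auto
     then show "q <= (2 * C + 1)\<^sup>2 * v\<^sup>2" using q by linarith
    qed
    then have sq: "sqrt q <= (2 * C + 1) * v" using C v1 by (simp add: real_sqrt_mult)
    have "loc \<theta> v * sqrt q = (\<phi>\<^sub>0 - fst \<theta>) * v" using q(2) by (simp add: loc_def q_def)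
    then have "\<bar>fst \<theta> - \<phi>\<^sub>0\<bar> * v = \<bar>loc \<theta> v\<bar> * sqrt q" using v1 q(2) by (metis abs_minus_commute abs_mult abs_of_pos real_sqrt_gt_zero)
    also have "\<dots> <= \<zeta> * ((2 * C + 1) * v)" using small sq q(2) by (intro mult_mono) auto
    finally have "\<bar>fst \<theta> - \<phi>\<^sub>0\<bar> * v <= (\<zeta> * (2 * C + 1)) * v" by simp
    then have "\<bar>fst \<theta> - \<phi>\<^sub>0\<bar> <= \<zeta> * (2 * C + 1)" using v1 by simp
    then show ?thesis using \<zeta>(4) by linarith
   qed
   \<comment> \<open>A slope close to 1 makes \<open>q0 - q\<close> of the order
     \<open>\<zeta> * v\<^sup>2\<close>; after division by \<open>v\<^sup>2\<close> only this and
     the share of \<open>\<omega>\<close> remain.\<close>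
   have alpha: "\<bar>fst (snd \<theta>) - \<alpha>\<^sub>0\<bar> <= \<kappa>"
   proof -
    define r where "r = rho \<theta> v"
    have "r * r = q0 / q" using q(2) \<open>q0 > 0\<close> by (simp add: r_def rho_def q_def[symmetric] q0_def[symmetric])
    then have "q0 - q = (r - 1) * (r + 1) * q" using q(2) by (simp add: field_simps)
    then have "\<bar>q0 - q\<bar> = \<bar>r - 1\<bar> * \<bar>r + 1\<bar> * q" using q(2) by (simp add: abs_mult)
    also have "\<dots> <= \<zeta> * 3 * (2 * C * v\<^sup>2)"
     using small \<zeta> q by (intro mult_mono) (auto simp: r_def)
    finally have 1: "\<bar>q0 - q\<bar> <= 6 * C * \<zeta> * v\<^sup>2" by (simp add: algebra_simps)
    have w: "\<bar>snd (snd \<theta>) - \<omega>\<^sub>0\<bar> <= C" using \<theta> \<theta>0 c by (auto simp: param_box_def)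
    have "(fst (snd \<theta>) - \<alpha>\<^sub>0) * v\<^sup>2 = (q - q0) - (snd (snd \<theta>) - \<omega>\<^sub>0)" by (simp add: q_def q0_def algebra_simps)
    then have "\<bar>(fst (snd \<theta>) - \<alpha>\<^sub>0) * v\<^sup>2\<bar> <= 6 * C * \<zeta> * v\<^sup>2 + C" using 1 w by linarith
    then have "\<bar>fst (snd \<theta>) - \<alpha>\<^sub>0\<bar> * v\<^sup>2 <= 6 * C * \<zeta> * v\<^sup>2 + C" by (simp add: abs_mult)
    moreover have "C <= \<kappa> / 2 * v\<^sup>2"
    proof -
     have "C / v\<^sup>2 <= C / R\<^sup>2" using v R C by (intro divide_left_mono power_mono) auto
     then have "C / v\<^sup>2 <= \<kappa> / 2" using R(2) by linarith
     then show ?thesis using v1 by (simp add: field_simps)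
    qed
    ultimately have "\<bar>fst (snd \<theta>) - \<alpha>\<^sub>0\<bar> * v\<^sup>2 <= (6 * C * \<zeta> + \<kappa> / 2) * v\<^sup>2" by (simp add: algebra_simps)
    then have "\<bar>fst (snd \<theta>) - \<alpha>\<^sub>0\<bar> <= 6 * C * \<zeta> + \<kappa> / 2" using v1 by simp
    then show ?thesis using \<zeta>(5) by linarith
   qed
   show ?thesis using phi alpha card_\<kappa> by blast
  qed
  ultimately show "\<exists>N\<in>events. prob N <= K / real n \<and> (\<forall>x\<in>space M - N. \<forall>\<theta>\<in>param_box c C.
    no_worse n W x \<theta> -->
    \<bar>fst \<theta> - \<phi>\<^sub>0\<bar> <= \<kappa> \<and> \<bar>fst (snd \<theta>) - \<alpha>\<^sub>0\<bar> <= \<kappa> \<and>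
    card {t\<in>{1..n}. \<bar>rho \<theta> (y (t - 1) x) - 1\<bar> >= \<kappa> \<or> \<bar>loc \<theta> (y (t - 1) x)\<bar> >= \<kappa>} <= \<kappa> * real n)"
   by blast
 qed
qed

end

section \<open>Truncated logarithms\<close>

definition logmax :: "real => real => real" where
 "logmax \<delta> x = ln (max \<bar>x\<bar> \<delta>)"

text \<open>A Lipschitz majorant of the indicator of \<open>\<bar>x\<bar> <= \<delta>\<close>, so
  that the uniform law of large numbers can count small arguments.\<close>

definition tent :: "real => real => real" where
 "tent \<delta> x = max 0 (min 1 (2 - \<bar>x\<bar> / \<delta>))"

text \<open>What truncation at \<open>\<delta>\<close> adds to the logarithm. At 0 it is 0, by the
  conventions for division by zero and for \<open>ln 0\<close>; the separate term in
  \<open>logmax_diff\<close> accounts for this point.\<close>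

definition logdef :: "real => real => real" where
 "logdef \<delta> x = (if \<bar>x\<bar> < \<delta> then ln (\<delta> / \<bar>x\<bar>) else 0)"

lemma logmax_measurable [measurable]: "logmax \<delta> \<in> borel_measurable borel"
 and tent_measurable [measurable]: "tent \<delta> \<in> borel_measurable borel"
 and logdef_measurable [measurable]: "logdef \<delta> \<in> borel_measurable borel"
 unfolding logmax_def[abs_def] tent_def[abs_def] logdef_def[abs_def] by measurable

lemma ln_lipschitz:
 fixes a b \<delta> :: real
 assumes "\<delta> > 0" "a >= \<delta>" "b >= \<delta>"
 shows "\<bar>ln a - ln b\<bar> <= \<bar>a - b\<bar> / \<delta>"
proof -
 have *: "ln a - ln b <= \<bar>a - b\<bar> / \<delta>" if "a >= \<delta>" "b >= \<delta>" for a b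
 proof -
  have "ln a - ln b = ln (a / b)" using that assms by (simp add: ln_div)
  also have "\<dots> <= a / b - 1" using that assms by (intro ln_le_minus_one) simp
  also have "\<dots> = (a - b) / b" using that assms by (simp add: diff_divide_distrib)
  also have "\<dots> <= \<bar>a - b\<bar> / \<delta>" using that assms by (intro frac_le) auto
  finally show ?thesis .
 qed
 show ?thesis using *[OF assms(2,3)] *[OF assms(3,2)] by (simp add: abs_le_iff abs_minus_commute)
qed

lemma logmax_lipschitz:
 assumes "\<delta> > 0"
 shows "\<bar>logmax \<delta> x - logmax \<delta> x'\<bar> <= \<bar>x - x'\<bar> / \<delta>"
proof -
 have "\<bar>logmax \<delta> x - logmax \<delta> x'\<bar> <= \<bar>max \<bar>x\<bar> \<delta> - max \<bar>x'\<bar> \<delta>\<bar> / \<delta>"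
  unfolding logmax_def using assms by (intro ln_lipschitz) auto
 also have "\<dots> <= \<bar>x - x'\<bar> / \<delta>" using assms by (intro divide_right_mono) auto
 finally show ?thesis .
qed

lemma logmax_bound:
 assumes "0 < \<delta>" "\<delta> <= 1"
 shows "\<bar>logmax \<delta> x\<bar> <= - ln \<delta> + \<bar>x\<bar>"
proof -
 have "ln \<delta> <= logmax \<delta> x" unfolding logmax_def using assms by simp
 moreover have "logmax \<delta> x <= \<bar>x\<bar>"
 proof (cases "\<bar>x\<bar> >= 1")
  case True
  then have "max \<bar>x\<bar> \<delta> = \<bar>x\<bar>" "0 < \<bar>x\<bar>" using assms by linarith+
  then have "ln \<bar>x\<bar> <= \<bar>x\<bar> - 1" by (intro ln_le_minus_one)
  then show ?thesis using \<open>max \<bar>x\<bar> \<delta> = \<bar>x\<bar>\<close> by (simp add: logmax_def)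
 next
  case False
  then have "logmax \<delta> x <= 0" unfolding logmax_def using assms by (simp add: max_def)
  then show ?thesis by linarith
 qed
 moreover have "ln \<delta> <= 0" using assms by simp
 ultimately show ?thesis by linarith
qed

lemma logmax_one: "0 <= logmax 1 x \<and> logmax 1 x <= \<bar>x\<bar>"
 using logmax_bound[of 1 x] by (simp add: logmax_def abs_le_iff)

lemma logmax_diff:
 assumes "0 < \<delta>" "\<delta> <= \<delta>'"
 shows "\<bar>logmax \<delta>' x - logmax \<delta> x\<bar> <= logdef \<delta>' x + (if x = 0 then ln \<delta>' - ln \<delta> else 0)"
proof (cases "x = 0")
 case True
 then show ?thesis using assms by (simp add: logmax_def logdef_def)
next
 case False
 have "ln (max \<bar>x\<bar> \<delta>) <= ln (max \<bar>x\<bar> \<delta>')" using assms by (intro ln_mono) (auto simp: less_max_iff_disj)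
 moreover have "ln \<bar>x\<bar> <= ln (max \<bar>x\<bar> \<delta>)" using False by simp
 ultimately show ?thesis using False assms by (auto simp: logmax_def logdef_def max_def ln_div)
qed

lemma logmax_ln_diff:
 assumes "0 < \<delta>" "x \<noteq> 0"
 shows "\<bar>logmax \<delta> x - ln \<bar>x\<bar>\<bar> <= logdef \<delta> x"
 using assms by (auto simp: logmax_def logdef_def max_def ln_div)

lemma logdef_nonneg: "\<delta> > 0 ==> logdef \<delta> x >= 0"
 by (cases "x = 0") (auto simp: logdef_def)

lemma tent_bounds: "0 <= tent \<delta> x" "tent \<delta> x <= 1"
 by (auto simp: tent_def)

lemma tent_one: "\<delta> > 0 ==> \<bar>x\<bar> <= \<delta> ==> tent \<delta> x = 1"
 by (simp add: tent_def)

lemma tent_lipschitz: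
 assumes "\<delta> > 0"
 shows "\<bar>tent \<delta> x - tent \<delta> x'\<bar> <= \<bar>x - x'\<bar> / \<delta>"
proof -
 have "\<bar>max 0 (min 1 (2 - a)) - max 0 (min 1 (2 - b))\<bar> <= \<bar>a - b\<bar>" for a b :: real
  by (simp add: max_def min_def abs_if)
 then have "\<bar>tent \<delta> x - tent \<delta> x'\<bar> <= \<bar>\<bar>x\<bar> / \<delta> - \<bar>x'\<bar> / \<delta>\<bar>" unfolding tent_def .
 also have "\<dots> = \<bar>\<bar>x\<bar> - \<bar>x'\<bar>\<bar> / \<delta>" using assms by (simp add: diff_divide_distrib[symmetric])
 also have "\<dots> <= \<bar>x - x'\<bar> / \<delta>" using assms by (intro divide_right_mono) auto
 finally show ?thesis .
qed

text \<open>Dyadic decomposition of the logarithmic singularity.\<close>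

lemma nn_integral_logdef:
 assumes "\<delta> > 0"
 shows "(\<integral>\<^sup>+ x. ennreal (logdef \<delta> x) \<partial>lborel) <= ennreal (4 * \<delta>)"
proof -
 define I where "I k = {- (\<delta> / 2 ^ k)..\<delta> / 2 ^ k}" for k :: nat
 have le: "ennreal (logdef \<delta> x) <= (\<Sum>k. ennreal (ln 2) * indicator (I k) x)" for x
 proof (cases "0 < \<bar>x\<bar> \<and> \<bar>x\<bar> < \<delta>")
  case True
  obtain k0 where "\<delta> / \<bar>x\<bar> < 2 ^ k0" using real_arch_pow[of 2 "\<delta> / \<bar>x\<bar>"] by auto
  \<comment> \<open>The first scale with \<open>\<delta> / 2 ^ k < \<bar>x\<bar>\<close>:
    \<open>x\<close> lies in all \<open>I j\<close> before it, and each of them contributes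
    \<open>ln 2\<close>.\<close>
  define k where "k = (LEAST k. \<delta> / \<bar>x\<bar> < 2 ^ k)"
  have k: "\<delta> / \<bar>x\<bar> < 2 ^ k" unfolding k_def by (rule LeastI) fact
  have j: "x \<in> I j" if "j < k" for j
  proof -
   have "\<not> \<delta> / \<bar>x\<bar> < 2 ^ j" using that unfolding k_def by (rule not_less_Least)
   then have "2 ^ j * \<bar>x\<bar> <= \<delta>" using True by (simp add: field_simps)
   then have "\<bar>x\<bar> <= \<delta> / 2 ^ j" by (simp add: field_simps)
   then show ?thesis by (auto simp: I_def)
  qed
  have "logdef \<delta> x = ln (\<delta> / \<bar>x\<bar>)" using True by (simp add: logdef_def)
  also have "\<dots> <= ln (2 ^ k)" using k True assms by (intro ln_mono) auto
  also have "\<dots> = k * ln 2" by (simp add: ln_realpow)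
  finally have "ennreal (logdef \<delta> x) <= ennreal (k * ln 2)" by (rule ennreal_leI)
  also have "\<dots> = (\<Sum>j<k. ennreal (ln 2) * indicator (I j) x)"
   using j by (simp add: ennreal_mult ennreal_of_nat_eq_real_of_nat)
  also have "\<dots> <= (\<Sum>j. ennreal (ln 2) * indicator (I j) x)" by (rule sum_le_suminf) auto
  finally show ?thesis .
 next
  case False
  then have "logdef \<delta> x = 0" by (auto simp: logdef_def)
  then show ?thesis by simp
 qed
 have "(\<integral>\<^sup>+ x. ennreal (logdef \<delta> x) \<partial>lborel) <= (\<integral>\<^sup>+ x. (\<Sum>k. ennreal (ln 2) * indicator (I k) x) \<partial>lborel)"
  by (intro nn_integral_mono le)
 also have "\<dots> = (\<Sum>k. \<integral>\<^sup>+ x. ennreal (ln 2) * indicator (I k) x \<partial>lborel)"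
  by (rule nn_integral_suminf) (simp add: I_def)
 also have "\<dots> = (\<Sum>k. ennreal (ln 2 * (2 * \<delta>) * (1 / 2) ^ k))"
 proof (intro suminf_cong)
  fix k
  have "(\<integral>\<^sup>+ x. ennreal (ln 2) * indicator (I k) x \<partial>lborel) = ennreal (ln 2) * emeasure lborel (I k)"
   by (rule nn_integral_cmult_indicator) (simp add: I_def)
  also have "emeasure lborel (I k) = ennreal (2 * (\<delta> / 2 ^ k))" unfolding I_def using assms by simp
  also have "ennreal (ln 2) * ennreal (2 * (\<delta> / 2 ^ k)) = ennreal (ln 2 * (2 * (\<delta> / 2 ^ k)))"
   by (rule ennreal_mult[symmetric]) (use assms in simp_all)
  also have "ln 2 * (2 * (\<delta> / 2 ^ k)) = ln 2 * (2 * \<delta>) * (1 / 2) ^ k"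
   by (simp add: power_divide)
  finally show "(\<integral>\<^sup>+ x. ennreal (ln 2) * indicator (I k) x \<partial>lborel) = ennreal (ln 2 * (2 * \<delta>) * (1 / 2) ^ k)" .
 qed
 also have "\<dots> = ennreal (\<Sum>k. ln 2 * (2 * \<delta>) * (1 / 2) ^ k)"
  using assms by (intro suminf_ennreal2 summable_mult summable_geometric) auto
 also have "(\<Sum>k. ln 2 * (2 * \<delta>) * (1 / 2) ^ k) = ln 2 * (2 * \<delta>) * 2"
  using suminf_mult[OF summable_geometric[of "1/2::real"], of "ln 2 * (2 * \<delta>)"] suminf_geometric[of "1/2::real"] by simp
 also have "ennreal (ln 2 * (2 * \<delta>) * 2) <= ennreal (4 * \<delta>)"
 proof (rule ennreal_leI)
  have "ln 2 * \<delta> <= 1 * \<delta>" using assms ln_le_minus_one[of 2] by (intro mult_right_mono) auto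
  then show "ln 2 * (2 * \<delta>) * 2 <= 4 * \<delta>" by simp
 qed
 finally show ?thesis .
qed

lemma nn_integral_tent:
 assumes "\<delta> > 0"
 shows "(\<integral>\<^sup>+ x. ennreal (tent \<delta> x) \<partial>lborel) <= ennreal (4 * \<delta>)"
proof -
 have "ennreal (tent \<delta> x) <= indicator {- 2 * \<delta>..2 * \<delta>} x" for x
 proof (cases "\<bar>x\<bar> <= 2 * \<delta>")
  case True
  then have "x \<in> {- 2 * \<delta>..2 * \<delta>}" by auto
  then show ?thesis using tent_bounds(2)[of \<delta> x] by simp
 next
  case False
  then have "2 - \<bar>x\<bar> / \<delta> <= 0" using assms by (simp add: field_simps)
  then show ?thesis by (simp add: tent_def max_def min_def)
 qed
 then have "(\<integral>\<^sup>+ x. ennreal (tent \<delta> x) \<partial>lborel) <= (\<integral>\<^sup>+ x. indicator {- 2 * \<delta>..2 * \<delta>} x \<partial>lborel)"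
  by (intro nn_integral_mono)
 also have "\<dots> = ennreal (4 * \<delta>)" using assms by simp
 finally show ?thesis .
qed

section \<open>Means of truncated logarithms under the innovation law\<close>

context dar_model
begin

definition fmax :: real where "fmax = (SUP u. f u)"

lemma f_le: "f u <= fmax"
 unfolding fmax_def using f_bdd by (intro cSUP_upper bounded_imp_bdd_above) auto

lemma fmax_nonneg: "fmax >= 0"
 using f_nonneg[of 0] f_le[of 0] by linarith

text \<open>A change of variables and the bounded density; the bound is free of the intercept
  \<open>p\<close> and depends on the slope only through \<open>G\<close>. For \<open>logdef\<close>
  and \<open>tent\<close> it makes the vicinity of the singularity negligible uniformly in previous
  value and parameter.\<close>

lemma affine_integral_le:
 fixes h :: "real => real"
 assumes [measurable]: "h \<in> borel_measurable borel" and h: "\<And>x. h x >= 0"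
  and I: "(\<integral>\<^sup>+ x. ennreal (h x) \<partial>lborel) <= ennreal (4 * \<delta>)" and q: "q >= 1 / G" "G > 0" and "\<delta> > 0"
 shows "integrable \<mu> (\<lambda>u. h (p + q * u))" "(\<integral>u. h (p + q * u) \<partial>\<mu>) <= 4 * fmax * G * \<delta>"
proof -
 have "q > 0" using q by (auto intro: less_le_trans[of 0 "1 / G"])
 have "(\<integral>\<^sup>+ u. ennreal (h (p + q * u)) \<partial>\<mu>) = (\<integral>\<^sup>+ u. ennreal (f u) * ennreal (h (p + q * u)) \<partial>lborel)"
  unfolding \<mu>_def by (subst nn_integral_density) auto
 also have "\<dots> <= (\<integral>\<^sup>+ u. ennreal fmax * ennreal (h (p + q * u)) \<partial>lborel)"
  by (intro nn_integral_mono mult_right_mono ennreal_leI f_le) auto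
 also have "\<dots> = ennreal fmax * (\<integral>\<^sup>+ u. ennreal (h (p + q * u)) \<partial>lborel)" by (rule nn_integral_cmult) simp
 also have "(\<integral>\<^sup>+ u. ennreal (h (p + q * u)) \<partial>lborel) = ennreal (1 / q) * (\<integral>\<^sup>+ x. ennreal (h x) \<partial>lborel)"
  using nn_integral_real_affine[of "\<lambda>x. ennreal (h x)" q p] \<open>q > 0\<close>
  by (simp add: mult.assoc[symmetric] ennreal_mult[symmetric])
 also have "\<dots> <= ennreal G * ennreal (4 * \<delta>)"
 proof (intro mult_mono ennreal_leI I)
  show "1 / q <= G" using q \<open>q > 0\<close> by (simp add: field_simps)
 qed auto
 finally have "(\<integral>\<^sup>+ u. ennreal (h (p + q * u)) \<partial>\<mu>) <= ennreal fmax * (ennreal G * ennreal (4 * \<delta>))"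
  by (simp add: mult_left_mono)
 also have "\<dots> = ennreal (4 * fmax * G * \<delta>)"
  using fmax_nonneg q \<open>\<delta> > 0\<close> by (simp add: ennreal_mult[symmetric] mult_ac)
 finally have le: "(\<integral>\<^sup>+ u. ennreal (h (p + q * u)) \<partial>\<mu>) <= ennreal (4 * fmax * G * \<delta>)" .
 show int: "integrable \<mu> (\<lambda>u. h (p + q * u))"
  by (rule integrableI_nonneg) (use h le in \<open>auto intro: le_less_trans\<close>)
 have "ennreal (\<integral>u. h (p + q * u) \<partial>\<mu>) = (\<integral>\<^sup>+ u. ennreal (h (p + q * u)) \<partial>\<mu>)"
  using int h by (intro nn_integral_eq_integral[symmetric]) auto
 then have "ennreal (\<integral>u. h (p + q * u) \<partial>\<mu>) <= ennreal (4 * fmax * G * \<delta>)" using le by simp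
 then show "(\<integral>u. h (p + q * u) \<partial>\<mu>) <= 4 * fmax * G * \<delta>"
  using fmax_nonneg q \<open>\<delta> > 0\<close> by (subst (asm) ennreal_le_iff) auto
qed

lemma AE_affine_nonzero:
 assumes "q > 0"
 shows "AE u in \<mu>. p + q * u \<noteq> 0"
proof -
 have "AE u in lborel. u \<noteq> - p / q" by (rule AE_lborel_singleton)
 then have "AE u in lborel. ennreal (f u) > 0 --> p + q * u \<noteq> 0"
  by eventually_elim (use assms in \<open>auto simp: field_simps\<close>)
 then show ?thesis unfolding \<mu>_def by (subst AE_density) auto
qed

definition J :: "real => real => real => real" where "J \<delta> p q = (\<integral>u. logmax \<delta> (p + q * u) \<partial>\<mu>)"

lemma logmax_integrable:
 assumes "0 < \<delta>" "\<delta> <= 1"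
 shows "integrable \<mu> (\<lambda>u. logmax \<delta> (p + q * u))"
proof (rule Bochner_Integration.integrable_bound)
 show "integrable \<mu> (\<lambda>u. - ln \<delta> + \<bar>p + q * u\<bar>)" by simp
 have "ln \<delta> <= 0" using assms by simp
 then show "AE u in \<mu>. norm (logmax \<delta> (p + q * u)) <= norm (- ln \<delta> + \<bar>p + q * u\<bar>)"
  using logmax_bound[OF assms] by (intro AE_I2) (simp add: order.trans[OF _ abs_ge_self])
qed simp

text \<open>Allows the truncation level that shrinks with \<open>n\<close> to be exchanged for a
  fixed one, at which \<open>J_lipschitz\<close> has a fixed constant.\<close>

lemma J_diff:
 assumes "0 < \<delta>" "\<delta> <= \<delta>'" "\<delta>' <= 1" "q >= 1 / G" "G > 0"
 shows "\<bar>J \<delta> p q - J \<delta>' p q\<bar> <= 4 * fmax * G * \<delta>'"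
proof -
 have "q > 0" using assms by (auto intro: less_le_trans[of 0 "1 / G"])
 have i: "integrable \<mu> (\<lambda>u. logmax \<delta> (p + q * u))" "integrable \<mu> (\<lambda>u. logmax \<delta>' (p + q * u))"
  using assms by (auto intro!: logmax_integrable)
 have d: "integrable \<mu> (\<lambda>u. logdef \<delta>' (p + q * u))" "(\<integral>u. logdef \<delta>' (p + q * u) \<partial>\<mu>) <= 4 * fmax * G * \<delta>'"
  using assms by (auto intro!: affine_integral_le[of "logdef \<delta>'"] logdef_nonneg nn_integral_logdef)
 have "\<bar>J \<delta> p q - J \<delta>' p q\<bar> = \<bar>\<integral>u. logmax \<delta>' (p + q * u) - logmax \<delta> (p + q * u) \<partial>\<mu>\<bar>"
  unfolding J_def using i by (simp add: abs_minus_commute)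
 also have "\<dots> <= (\<integral>u. \<bar>logmax \<delta>' (p + q * u) - logmax \<delta> (p + q * u)\<bar> \<partial>\<mu>)" by (rule integral_abs_bound)
 also have "\<dots> <= (\<integral>u. logdef \<delta>' (p + q * u) \<partial>\<mu>)"
 proof (rule integral_mono_AE)
  show "AE u in \<mu>. \<bar>logmax \<delta>' (p + q * u) - logmax \<delta> (p + q * u)\<bar> <= logdef \<delta>' (p + q * u)"
   using AE_affine_nonzero[OF \<open>q > 0\<close>, of p]
  proof eventually_elim
   case (elim u)
   then show ?case using logmax_diff[OF assms(1,2), of "p + q * u"] by simp
  qed
 qed (use i d in auto)
 finally show ?thesis using d(2) by linarith
qed

lemma J_ln_diff:
 assumes "0 < \<delta>" "\<delta> <= 1" "q >= 1 / G" "G > 0"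
 shows "\<bar>J \<delta> p q - (\<integral>u. ln \<bar>p + q * u\<bar> \<partial>\<mu>)\<bar> <= 4 * fmax * G * \<delta>"
proof -
 have "q > 0" using assms by (auto intro: less_le_trans[of 0 "1 / G"])
 have i: "integrable \<mu> (\<lambda>u. logmax \<delta> (p + q * u))" by (rule logmax_integrable[OF assms(1,2)])
 have d: "integrable \<mu> (\<lambda>u. logdef \<delta> (p + q * u))" "(\<integral>u. logdef \<delta> (p + q * u) \<partial>\<mu>) <= 4 * fmax * G * \<delta>"
  using assms by (auto intro!: affine_integral_le[of "logdef \<delta>"] logdef_nonneg nn_integral_logdef)
 have AE: "AE u in \<mu>. \<bar>logmax \<delta> (p + q * u) - ln \<bar>p + q * u\<bar>\<bar> <= logdef \<delta> (p + q * u)"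
  using AE_affine_nonzero[OF \<open>q > 0\<close>, of p]
 proof eventually_elim
  case (elim u)
  then show ?case by (rule logmax_ln_diff[OF assms(1)])
 qed
 have i2: "integrable \<mu> (\<lambda>u. logmax \<delta> (p + q * u) - ln \<bar>p + q * u\<bar>)"
 proof (rule Bochner_Integration.integrable_bound[OF d(1)])
  show "AE u in \<mu>. norm (logmax \<delta> (p + q * u) - ln \<bar>p + q * u\<bar>) <= norm (logdef \<delta> (p + q * u))"
   using AE by eventually_elim simp
 qed simp
 \<comment> \<open>The logarithm itself is integrable, as a difference of two integrable
   functions.\<close>
 have i3: "integrable \<mu> (\<lambda>u. ln \<bar>p + q * u\<bar>)"
  using Bochner_Integration.integrable_diff[OF i i2] by simp
 have "\<bar>J \<delta> p q - (\<integral>u. ln \<bar>p + q * u\<bar> \<partial>\<mu>)\<bar> = \<bar>\<integral>u. logmax \<delta> (p + q * u) - ln \<bar>p + q * u\<bar> \<partial>\<mu>\<bar>"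
  unfolding J_def using i i3 by simp
 also have "\<dots> <= (\<integral>u. \<bar>logmax \<delta> (p + q * u) - ln \<bar>p + q * u\<bar>\<bar> \<partial>\<mu>)" by (rule integral_abs_bound)
 also have "\<dots> <= (\<integral>u. logdef \<delta> (p + q * u) \<partial>\<mu>)"
  using AE i2 d by (intro integral_mono_AE) auto
 finally show ?thesis using d(2) by linarith
qed

lemma J_lipschitz:
 assumes "0 < \<delta>" "\<delta> <= 1"
 shows "\<bar>J \<delta> p q - J \<delta> p' q'\<bar> <= (\<bar>p - p'\<bar> + \<bar>q - q'\<bar>) / \<delta>"
proof -
 have i: "integrable \<mu> (\<lambda>u. logmax \<delta> (p + q * u))" for p q by (rule logmax_integrable[OF assms])
 have "\<bar>J \<delta> p q - J \<delta> p' q'\<bar> = \<bar>\<integral>u. logmax \<delta> (p + q * u) - logmax \<delta> (p' + q' * u) \<partial>\<mu>\<bar>"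
  unfolding J_def using i by simp
 also have "\<dots> <= (\<integral>u. \<bar>logmax \<delta> (p + q * u) - logmax \<delta> (p' + q' * u)\<bar> \<partial>\<mu>)" by (rule integral_abs_bound)
 also have "\<dots> <= (\<integral>u. (\<bar>p - p'\<bar> + \<bar>q - q'\<bar> * \<bar>u\<bar>) / \<delta> \<partial>\<mu>)"
 proof (rule integral_mono)
  fix u
  have "\<bar>(p + q * u) - (p' + q' * u)\<bar> <= \<bar>p - p'\<bar> + \<bar>q - q'\<bar> * \<bar>u\<bar>"
   unfolding abs_mult[symmetric] by (simp add: algebra_simps)
  then have "\<bar>(p + q * u) - (p' + q' * u)\<bar> / \<delta> <= (\<bar>p - p'\<bar> + \<bar>q - q'\<bar> * \<bar>u\<bar>) / \<delta>"
   using assms by (intro divide_right_mono) auto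
  then show "\<bar>logmax \<delta> (p + q * u) - logmax \<delta> (p' + q' * u)\<bar> <= (\<bar>p - p'\<bar> + \<bar>q - q'\<bar> * \<bar>u\<bar>) / \<delta>"
   using logmax_lipschitz[OF assms(1)] by (rule order.trans[rotated])
 qed (use i in auto)
 also have "\<dots> = (\<bar>p - p'\<bar> + \<bar>q - q'\<bar>) / \<delta>"
  using integral_\<mu>_abs \<mu>.prob_space by simp
 finally show ?thesis .
qed

text \<open>Level 1 serves as reference: there the truncated logarithm lies between 0 and the
  modulus. The bound does not depend on \<open>\<delta>\<close>.\<close>

lemma J_bound:
 assumes "0 < \<delta>" "\<delta> <= 1" "q >= 1 / G" "G > 0" "\<bar>p\<bar> <= G" "q <= G"
 shows "\<bar>J \<delta> p q\<bar> <= 2 * G + 4 * fmax * G"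
proof -
 have "q > 0" using assms by (auto intro: less_le_trans[of 0 "1 / G"])
 have i: "integrable \<mu> (\<lambda>u. logmax 1 (p + q * u))" by (rule logmax_integrable) auto
 have "0 <= J 1 p q" unfolding J_def using logmax_one by (intro Bochner_Integration.integral_nonneg) auto
 moreover have "J 1 p q <= (\<integral>u. G * (1 + \<bar>u\<bar>) \<partial>\<mu>)"
  unfolding J_def
 proof (rule integral_mono[OF i])
  fix u
  have "\<bar>q * u\<bar> <= G * \<bar>u\<bar>" unfolding abs_mult using \<open>q > 0\<close> assms by (intro mult_right_mono) auto
  then have "\<bar>p + q * u\<bar> <= G * (1 + \<bar>u\<bar>)" using assms by (simp add: distrib_left)
  then show "logmax 1 (p + q * u) <= G * (1 + \<bar>u\<bar>)" using logmax_one[of "p + q * u"] by linarith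
 qed simp
 moreover have "(\<integral>u. G * (1 + \<bar>u\<bar>) \<partial>\<mu>) = 2 * G" using integral_\<mu>_abs \<mu>.prob_space by simp
 ultimately show ?thesis using J_diff[OF assms(1,2) _ assms(3,4), of p] by (auto simp: abs_le_iff)
qed

lemma lyapunov_eq: "lyapunov M \<phi>\<^sub>0 \<alpha>\<^sub>0 (\<eta> 1) = (\<integral>u. ln \<bar>\<phi>\<^sub>0 + sqrt \<alpha>\<^sub>0 * u\<bar> \<partial>\<mu>)"
proof -
 have "(\<integral>u. ln \<bar>\<phi>\<^sub>0 + u * sqrt \<alpha>\<^sub>0\<bar> \<partial>distr M borel (\<eta> 1)) = lyapunov M \<phi>\<^sub>0 \<alpha>\<^sub>0 (\<eta> 1)"
  unfolding lyapunov_def by (rule integral_distr) measurable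
 then show ?thesis using distr_\<eta>[of 1] by (simp only: mult.commute[of _ "sqrt \<alpha>\<^sub>0"] order.refl)
qed

text \<open>Symmetry of the innovations: both signs of \<open>\<phi>\<^sub>0\<close> give the same
  exponent, so both halves of the estimates have the same limit.\<close>

lemma lyapunov_eq_minus: "lyapunov M \<phi>\<^sub>0 \<alpha>\<^sub>0 (\<eta> 1) = (\<integral>u. ln \<bar>- ((- 1) ^ k * \<phi>\<^sub>0) + sqrt \<alpha>\<^sub>0 * u\<bar> \<partial>\<mu>)"
proof (cases "even k")
 case True
 have *: "\<bar>\<phi>\<^sub>0 + sqrt \<alpha>\<^sub>0 * (- u)\<bar> = \<bar>- \<phi>\<^sub>0 + sqrt \<alpha>\<^sub>0 * u\<bar>" for u by (simp add: abs_if)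
 have "(\<lambda>u. ln \<bar>\<phi>\<^sub>0 + sqrt \<alpha>\<^sub>0 * u\<bar>) \<in> borel_measurable borel" by measurable
 from integral_\<mu>_minus[OF this]
 have "(\<integral>u. ln \<bar>- \<phi>\<^sub>0 + sqrt \<alpha>\<^sub>0 * u\<bar> \<partial>\<mu>) = (\<integral>u. ln \<bar>\<phi>\<^sub>0 + sqrt \<alpha>\<^sub>0 * u\<bar> \<partial>\<mu>)" unfolding * .
 then show ?thesis unfolding lyapunov_eq using True by simp
next
 case False
 then show ?thesis unfolding lyapunov_eq by simp
qed

end

text \<open>The cubic factor counts the points of the parameter grid in the uniform law of large numbers.\<close>

lemma exceptional_rate:
 fixes a b d :: real
 assumes "a > 0" "b > 0" "d > 0"
 shows "eventually (\<lambda>n. ((a * (ln (real n) + 1) * real n powr (1/8) + 3) ^ 3 * (ln (real n) + b)\<^sup>2 * d + d) / real n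
   <= real n powr (- (1/2))) at_top"
 using assms by real_asymp

lemma three_step_bound:
 fixes A B D g u e :: real
 assumes "\<bar>A - B\<bar> <= 2 * (e / 12 + u)" "\<bar>B - D\<bar> <= e / 12" "\<bar>D - g\<bar> <= e / 2" "u <= e / 16" "0 < e"
 shows "\<bar>A - g\<bar> <= e"
 using assms by argo

lemma log_times_delta: "(\<lambda>n. ln (real n) * real n powr (- (1/8))) \<longlonglongrightarrow> 0"
 by real_asymp

text \<open>The two truncations differ only where \<open>\<bar>X\<bar> < \<delta>\<close>, and there
  by at most \<open>2 * ln n\<close>, the modulus of the logarithm at the inner cut-off. The second
  claim serves to bound the total weight of the kept indices from below.\<close>

lemma log_trunc_difference:
 fixes X L \<delta> :: real and n :: nat
 assumes n: "n >= 1" and X: "\<bar>X\<bar> <= (real n)\<^sup>2" and \<delta>: "1 / (real n)\<^sup>2 <= \<delta>" "\<delta> <= 1" and L: "L = ln (real n)"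
 shows "\<bar>(if X \<in> trunc n then ln \<bar>X\<bar> else 0) - logmax \<delta> X\<bar> <= 2 * L * tent \<delta> X"
  "1 - tent \<delta> X <= (if X \<in> trunc n then 1 else 0)"
proof -
 have n2: "1 / (real n)\<^sup>2 > 0" using n by simp
 then have \<delta>0: "\<delta> > 0" using \<delta> by linarith
 have mem: "X \<in> trunc n \<longleftrightarrow> 1 / (real n)\<^sup>2 <= \<bar>X\<bar>" using X n2 by (auto simp: trunc_def abs_if)
 have ln_n2: "ln (1 / (real n)\<^sup>2) = - (2 * L)" using n by (simp add: L ln_div ln_realpow)
 have L0: "L >= 0" using n by (simp add: L)
 have ln\<delta>: "- (2 * L) <= ln \<delta>" "ln \<delta> <= 0" using \<delta> n2 \<delta>0 ln_n2 ln_mono[of "1 / (real n)\<^sup>2" \<delta>] by auto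
 show "\<bar>(if X \<in> trunc n then ln \<bar>X\<bar> else 0) - logmax \<delta> X\<bar> <= 2 * L * tent \<delta> X"
 proof (cases "\<bar>X\<bar> >= \<delta>")
  case True
  then have "X \<in> trunc n" using \<delta> by (simp add: mem)
  then show ?thesis using True L0 tent_bounds(1)[of \<delta> X] by (simp add: logmax_def max_def)
 next
  case False
  then have t: "tent \<delta> X = 1" and lm: "logmax \<delta> X = ln \<delta>" using \<delta>0 by (auto intro!: tent_one simp: logmax_def max_def)
  show ?thesis
  proof (cases "X \<in> trunc n")
   case True
   then have "1 / (real n)\<^sup>2 <= \<bar>X\<bar>" by (simp add: mem)
   then have "- (2 * L) <= ln \<bar>X\<bar>" using n2 ln_mono[of "1 / (real n)\<^sup>2" "\<bar>X\<bar>"] ln_n2 by auto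
   moreover have "0 < \<bar>X\<bar>" "\<bar>X\<bar> <= 1" using False \<delta> \<open>1 / (real n)\<^sup>2 <= \<bar>X\<bar>\<close> n2 by linarith+
   then have "ln \<bar>X\<bar> <= 0" using ln_mono[of "\<bar>X\<bar>" 1] by simp
   ultimately show ?thesis using True ln\<delta> by (simp add: t lm)
  next
   case F: False
   then show ?thesis using ln\<delta> by (simp add: t lm)
  qed
 qed
 show "1 - tent \<delta> X <= (if X \<in> trunc n then 1 else 0)"
 proof (cases "X \<in> trunc n")
  case False
  then have "\<bar>X\<bar> <= \<delta>" using \<delta> by (simp add: mem)
  then show ?thesis using tent_one[OF \<delta>0] False by simp
 qed (use tent_bounds(1)[of \<delta> X] in simp)
qed

section \<open>Consistency of the weighted log means\<close>

context dar_model
begin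

definition root_loc :: "nat => real \<times> real \<times> real => real => real" where
 "root_loc k \<theta> v = sqrt (fst (snd \<theta>)) * loc \<theta> v - (- 1) ^ k * fst \<theta>"

definition root_scale :: "real \<times> real \<times> real => real => real" where
 "root_scale \<theta> v = sqrt (fst (snd \<theta>)) * rho \<theta> v"

definition root_val :: "nat => real \<times> real \<times> real => real => real => real" where
 "root_val k \<theta> u v = root_loc k \<theta> v + root_scale \<theta> v * u"

lemma root_val_measurable [measurable]: "case_prod (root_val k \<theta>) \<in> borel_measurable (borel \<Otimes>\<^sub>M borel)"
 unfolding root_val_def[abs_def] root_loc_def root_scale_def by measurable

lemma root_arg_path:
 assumes "t >= 1" "t <= n"
 shows "root_arg k (sample y n x) t \<theta> = root_val k \<theta> (U t x) (y (t - 1) x)"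
 unfolding root_arg_def resid_path[OF assms] root_val_def root_loc_def root_scale_def by (simp add: algebra_simps)

text \<open>Chebyshev's inequality and a union bound. Off this event all arguments of the logarithms
  are at most \<open>n\<^sup>2\<close> in modulus for large \<open>n\<close>, so the outer
  truncation never acts.\<close>

lemma U_max:
 fixes n :: nat
 assumes "n >= 1"
 obtains N where "N \<in> events" "prob N <= K0 / n"
  "\<And>x t. x \<in> space M - N ==> t \<in> {1..n} ==> 1 + \<bar>U t x\<bar> <= n"
proof -
 define A where "A t = {x \<in> space M. (real n)\<^sup>2 <= (1 + \<bar>U t x\<bar>)\<^sup>2}" for t
 have A: "A t \<in> events" for t unfolding A_def by measurable
 have "prob (A t) <= K0 / (real n)\<^sup>2" if "t \<in> {1..n}" for t
 proof -
  have "t >= 1" using that by simp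
  have "prob (A t) <= expectation (\<lambda>x. (1 + \<bar>U t x\<bar>)\<^sup>2) / (real n)\<^sup>2"
   unfolding A_def using U_sq(1)[OF \<open>t >= 1\<close>] assms by (intro integral_Markov_inequality_measure[where A = "{}"]) auto
  also have "\<dots> <= K0 / (real n)\<^sup>2" using U_sq(2)[OF \<open>t >= 1\<close>] by (intro divide_right_mono) auto
  finally show ?thesis .
 qed
 then have "prob (\<Union>t\<in>{1..n}. A t) <= (\<Sum>t\<in>{1..n}. K0 / (real n)\<^sup>2)"
  using A by (intro order.trans[OF finite_measure_subadditive_finite] sum_mono) auto
 also have "\<dots> = K0 / n" using assms by (simp add: power2_eq_square)
 finally have "prob (\<Union>t\<in>{1..n}. A t) <= K0 / n" .
 moreover have "1 + \<bar>U t x\<bar> <= n" if "x \<in> space M - (\<Union>t\<in>{1..n}. A t)" "t \<in> {1..n}" for x t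
 proof -
  have "\<not> (real n)\<^sup>2 <= (1 + \<bar>U t x\<bar>)\<^sup>2" using that by (auto simp: A_def)
  then have "\<not> real n <= 1 + \<bar>U t x\<bar>" using power_mono[of "real n" "1 + \<bar>U t x\<bar>" 2] by auto
  then show ?thesis by simp
 qed
 ultimately show ?thesis using A by (intro that[of "\<Union>t\<in>{1..n}. A t"]) auto
qed

text \<open>The discontinuous truncated logarithm is replaced by the Lipschitz function
  \<open>logmax \<delta>\<close>, with \<open>\<delta>\<close> shrinking in \<open>n\<close>, at a
  cost of at most \<open>2 * ln n\<close> times a \<open>tent\<close>. Both functions obey the
  uniform law. The conditional means are then compared with the exponent, by continuity at indices
  where slope and intercept are nearly the true ones, and by a uniform bound at the few
  others.\<close>

lemma log_mean_consistency:
 fixes \<epsilon>0 :: real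
 assumes c: "0 < c" "c <= C" and \<theta>0: "\<theta>\<^sub>0 \<in> param_box c C" and \<epsilon>0: "\<epsilon>0 > 0"
 obtains n0 where "\<And>n W. weights M \<eta> y f \<phi>\<^sub>0 \<alpha>\<^sub>0 \<omega>\<^sub>0 n W ==> n >= n0 ==>
   \<exists>N\<in>events. prob N <= real n powr (- (1/2)) \<and> (\<forall>x\<in>space M - N. \<forall>\<theta>\<in>param_box c C.
    no_worse n W x \<theta> -->
    (\<forall>k\<in>{1,2}. \<bar>(\<Sum>t\<in>kept k n (sample y n x) \<theta>. W t x * ln \<bar>root_arg k (sample y n x) t \<theta>\<bar>) / n - lyapunov M \<phi>\<^sub>0 \<alpha>\<^sub>0 (\<eta> 1)\<bar> <= \<epsilon>0
     \<and> \<bar>(\<Sum>t\<in>kept k n (sample y n x) \<theta>. W t x) / n - 1\<bar> <= \<epsilon>0))"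
proof -
 obtain H where H: "H >= 1"
  "\<And>\<theta> v. \<theta> \<in> param_box c C ==> 1 / H <= rho \<theta> v \<and> rho \<theta> v <= H \<and> \<bar>loc \<theta> v\<bar> <= H"
  "\<And>\<theta>. \<theta> \<in> param_box c C ==> 1 / H <= sqrt (fst (snd \<theta>)) \<and> sqrt (fst (snd \<theta>)) <= H \<and> \<bar>fst \<theta>\<bar> <= H"
  "\<And>\<theta> \<theta>' v. \<theta> \<in> param_box c C ==> \<theta>' \<in> param_box c C ==>
    \<bar>rho \<theta> v - rho \<theta>' v\<bar> <= H * dist1 \<theta> \<theta>' \<and> \<bar>loc \<theta> v - loc \<theta>' v\<bar> <= H * dist1 \<theta> \<theta>'"
  "\<And>\<theta> \<theta>'. \<theta> \<in> param_box c C ==> \<theta>' \<in> param_box c C ==>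
    \<bar>sqrt (fst (snd \<theta>)) - sqrt (fst (snd \<theta>'))\<bar> <= H * dist1 \<theta> \<theta>'"
  by (rule param_box_bounds[OF c \<theta>0]) blast
 define G where "G = 3 * H\<^sup>2"
 have H2: "H <= H\<^sup>2" "1 <= H\<^sup>2" using H(1) by (auto simp: power2_eq_square mult_left_le intro: order.trans[OF _ mult_mono[of 1 H 1 H]])
 have G: "G >= 1" "G > 0" using H2 by (auto simp: G_def)
 have C: "C > 0" using c by simp
 have scale_b: "1 / G <= root_scale \<theta> v \<and> root_scale \<theta> v <= G" if "\<theta> \<in> param_box c C" for \<theta> v
 proof -
  note b = H(2)[OF that, of v] H(3)[OF that]
  have "1 / H > 0" using H(1) by simp
  have "1 / G <= 1 / H * (1 / H)" using H2 H(1) by (simp add: G_def power2_eq_square field_simps)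
  also have "\<dots> <= root_scale \<theta> v" unfolding root_scale_def using b \<open>1 / H > 0\<close> by (intro mult_mono) linarith+
  finally have "1 / G <= root_scale \<theta> v" .
  moreover have "root_scale \<theta> v <= H * H" unfolding root_scale_def using b \<open>1 / H > 0\<close> H(1) by (intro mult_mono) linarith+
  ultimately show ?thesis by (simp add: G_def power2_eq_square) (use H2 in \<open>simp add: power2_eq_square\<close>)
 qed
 have loc_b: "\<bar>root_loc k \<theta> v\<bar> <= G" if "\<theta> \<in> param_box c C" for k \<theta> v
 proof -
  note b = H(2)[OF that, of v] H(3)[OF that]
  have "1 / H > 0" using H(1) by simp
  have "\<bar>sqrt (fst (snd \<theta>)) * loc \<theta> v\<bar> <= H * H" unfolding abs_mult using b H(1) \<open>1 / H > 0\<close> by (intro mult_mono) linarith+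
  moreover have "\<bar>(- 1) ^ k * fst \<theta>\<bar> <= H" using b by (simp add: abs_mult)
  ultimately show ?thesis using H2 unfolding root_loc_def G_def power2_eq_square by linarith
 qed
 have val_b: "\<bar>root_val k \<theta> u v\<bar> <= G * (1 + \<bar>u\<bar>)" if "\<theta> \<in> param_box c C" for k \<theta> u v
 proof -
  have "0 < 1 / G" using G by simp
  then have "\<bar>root_scale \<theta> v * u\<bar> <= G * \<bar>u\<bar>" unfolding abs_mult using scale_b[OF that, of v] by (intro mult_right_mono) linarith+
  then show ?thesis using loc_b[OF that, of k v] unfolding root_val_def by (simp add: distrib_left)
 qed
 have val_lip: "\<bar>root_val k \<theta> u v - root_val k \<theta>' u v\<bar> <= G * dist1 \<theta> \<theta>' * (1 + \<bar>u\<bar>)"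
  if \<theta>: "\<theta> \<in> param_box c C" "\<theta>' \<in> param_box c C" for k \<theta> \<theta>' u v
 proof -
  define d s s' where "d = dist1 \<theta> \<theta>'" and "s = sqrt (fst (snd \<theta>))" and "s' = sqrt (fst (snd \<theta>'))"
  have d0: "d >= 0" "H * d >= 0" using H(1) by (auto simp: d_def)
  note b = H(2)[OF \<theta>(1), of v] H(3)[OF \<theta>(2), folded s'_def] H(4)[OF \<theta>, of v, folded d_def] H(5)[OF \<theta>, folded d_def s_def s'_def]
  have "1 / H > 0" using H(1) by simp
  have prod: "\<bar>s * g - s' * g'\<bar> <= 2 * H\<^sup>2 * d" if "\<bar>g\<bar> <= H" "\<bar>g - g'\<bar> <= H * d" for g g'
  proof -
   have "s * g - s' * g' = (s - s') * g + s' * (g - g')" by (simp add: algebra_simps)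
   moreover have "\<bar>(s - s') * g\<bar> <= (H * d) * H" unfolding abs_mult using b that H(1) d0 by (intro mult_mono) auto
   moreover have "\<bar>s' * (g - g')\<bar> <= H * (H * d)" unfolding abs_mult using b that H(1) d0 \<open>1 / H > 0\<close> by (intro mult_mono) linarith+
   ultimately have "\<bar>s * g - s' * g'\<bar> <= H * d * H + H * (H * d)" by linarith
   then show ?thesis by (simp add: power2_eq_square algebra_simps)
  qed
  have "\<bar>root_scale \<theta> v - root_scale \<theta>' v\<bar> <= 2 * H\<^sup>2 * d"
   unfolding root_scale_def s_def[symmetric] s'_def[symmetric] using b \<open>1 / H > 0\<close> by (intro prod) linarith+
  also have "\<dots> <= G * d" unfolding G_def using d0 by (intro mult_right_mono) auto
  finally have 1: "\<bar>root_scale \<theta> v - root_scale \<theta>' v\<bar> <= G * d" .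
  have "\<bar>s * loc \<theta> v - s' * loc \<theta>' v\<bar> <= 2 * H\<^sup>2 * d" using b by (intro prod) auto
  moreover have "\<bar>(- 1) ^ k * fst \<theta> - (- 1) ^ k * fst \<theta>'\<bar> <= d"
   unfolding right_diff_distrib[symmetric] by (simp add: abs_mult d_def dist1_def)
  moreover have "1 * d <= H\<^sup>2 * d" using H2 d0 by (intro mult_right_mono) auto
  ultimately have 2: "\<bar>root_loc k \<theta> v - root_loc k \<theta>' v\<bar> <= G * d"
   unfolding root_loc_def s_def[symmetric] s'_def[symmetric] G_def by linarith
  have "\<bar>(root_scale \<theta> v - root_scale \<theta>' v) * u\<bar> <= G * d * \<bar>u\<bar>" unfolding abs_mult using 1 by (intro mult_right_mono) auto
  moreover have "root_val k \<theta> u v - root_val k \<theta>' u v = (root_loc k \<theta> v - root_loc k \<theta>' v) + (root_scale \<theta> v - root_scale \<theta>' v) * u"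
   by (simp add: root_val_def algebra_simps)
  ultimately show ?thesis using 2 unfolding d_def[symmetric] by (simp add: distrib_left)
 qed
 define \<gamma> where "\<gamma> = lyapunov M \<phi>\<^sub>0 \<alpha>\<^sub>0 (\<eta> 1)"
 define F where "F = fmax * G"
 have F: "F >= 0" using fmax_nonneg G by (simp add: F_def)
 \<comment> \<open>A fixed level at which truncation is harmless. \<open>\<kappa>\<close> is then
   small enough for the continuity of \<open>J \<delta>'\<close> at good indices and for the total
   effect \<open>\<kappa> * C1\<close> of the bad ones.\<close>
 define \<delta>' where "\<delta>' = min 1 (\<epsilon>0 / (64 * F + 1))"
 have \<delta>': "\<delta>' > 0" "\<delta>' <= 1" "8 * F * \<delta>' <= \<epsilon>0 / 8"
 proof -
  show "\<delta>' > 0" "\<delta>' <= 1" using \<epsilon>0 F by (auto simp: \<delta>'_def)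
  have "8 * F * \<delta>' <= 8 * F * (\<epsilon>0 / (64 * F + 1))" using F by (intro mult_left_mono) (auto simp: \<delta>'_def)
  also have "\<dots> <= \<epsilon>0 / 8" using F \<epsilon>0 by (simp add: field_simps)
  finally show "8 * F * \<delta>' <= \<epsilon>0 / 8" .
 qed
 define C1 where "C1 = 4 * G + 8 * F"
 have C1: "C1 > 0" using F G by (simp add: C1_def add_pos_nonneg)
 define \<kappa> where "\<kappa> = min (\<epsilon>0 * \<delta>' / (32 * H)) (\<epsilon>0 / (8 * C1))"
 have \<kappa>: "\<kappa> > 0" "4 * H * \<kappa> / \<delta>' <= \<epsilon>0 / 8" "\<kappa> * C1 <= \<epsilon>0 / 8"
 proof -
  show "\<kappa> > 0" using \<epsilon>0 \<delta>' H(1) C1 by (simp add: \<kappa>_def)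
  have k: "\<kappa> <= \<epsilon>0 * \<delta>' / (32 * H)" "\<kappa> <= \<epsilon>0 / (8 * C1)" by (auto simp: \<kappa>_def)
  show "4 * H * \<kappa> / \<delta>' <= \<epsilon>0 / 8" using k(1) H(1) \<delta>' by (simp add: field_simps)
  show "\<kappa> * C1 <= \<epsilon>0 / 8" using k(2) C1 by (simp add: field_simps)
 qed
 define \<epsilon> where "\<epsilon> = \<epsilon>0 / 24"
 have \<epsilon>: "\<epsilon> > 0" using \<epsilon>0 by (simp add: \<epsilon>_def)
 obtain Kc nc where cons: "\<And>n W. weights M \<eta> y f \<phi>\<^sub>0 \<alpha>\<^sub>0 \<omega>\<^sub>0 n W ==> n >= nc ==>
   \<exists>N\<in>events. prob N <= Kc / real n \<and> (\<forall>x\<in>space M - N. \<forall>\<theta>\<in>param_box c C.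
    no_worse n W x \<theta> -->
    \<bar>fst \<theta> - \<phi>\<^sub>0\<bar> <= \<kappa> \<and> \<bar>fst (snd \<theta>) - \<alpha>\<^sub>0\<bar> <= \<kappa> \<and>
    card {t\<in>{1..n}. \<bar>rho \<theta> (y (t - 1) x) - 1\<bar> >= \<kappa> \<or> \<bar>loc \<theta> (y (t - 1) x)\<bar> >= \<kappa>} <= \<kappa> * real n)"
  by (rule consistency[OF c \<theta>0 \<kappa>(1)], rule that)
 define a where "a = 20 * C * G / \<epsilon>"
 have a: "a > 0" using C G \<epsilon> by (simp add: a_def)
 \<comment> \<open>Collects the constants of all exceptional events, for the comparison with
   \<open>exceptional_rate\<close>.\<close>
 define d where "d = 100 * K0 / \<epsilon>\<^sup>2 + 200 * K0 + \<bar>Kc\<bar>"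
 have d: "d > 0" using K0_bound(3) \<epsilon> by (simp add: d_def add_pos_nonneg)
 have "eventually (\<lambda>n. ((a * (ln (real n) + 1) * real n powr (1/8) + 3) ^ 3 * (ln (real n) + G)\<^sup>2 * d + d) / real n
   <= real n powr (- (1/2))) at_top" by (rule exceptional_rate[OF a G(2) d])
 moreover have "eventually (\<lambda>n. ln (real n) * real n powr (- (1/8)) < \<epsilon>0 / (64 * F + 1)) sequentially"
  using F \<epsilon>0 by (intro order_tendstoD(2)[OF log_times_delta]) simp
 moreover have "eventually (\<lambda>n. real n powr (- (1/8)) <= \<delta>' \<and> ln (real n) >= 1 \<and> 1 / (real n)\<^sup>2 <= real n powr (- (1/8))) sequentially"
 proof (intro eventually_conj)
  have "(\<lambda>n. real n powr (- (1/8))) \<longlonglongrightarrow> 0" by real_asymp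
  from order_tendstoD(2)[OF this \<delta>'(1)] show "eventually (\<lambda>n. real n powr (- (1/8)) <= \<delta>') sequentially"
   by eventually_elim simp
 qed real_asymp+
 ultimately have "eventually (\<lambda>n. ((a * (ln (real n) + 1) * real n powr (1/8) + 3) ^ 3 * (ln (real n) + G)\<^sup>2 * d + d) / real n
   <= real n powr (- (1/2)) \<and> ln (real n) * real n powr (- (1/8)) < \<epsilon>0 / (64 * F + 1) \<and>
   real n powr (- (1/8)) <= \<delta>' \<and> ln (real n) >= 1 \<and> 1 / (real n)\<^sup>2 <= real n powr (- (1/8))) sequentially"
  by eventually_elim blast
 then obtain n1 where n1: "\<And>n. n >= n1 ==> ((a * (ln (real n) + 1) * real n powr (1/8) + 3) ^ 3 * (ln (real n) + G)\<^sup>2 * d + d) / real n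
   <= real n powr (- (1/2)) \<and> ln (real n) * real n powr (- (1/8)) < \<epsilon>0 / (64 * F + 1) \<and>
   real n powr (- (1/8)) <= \<delta>' \<and> ln (real n) >= 1 \<and> 1 / (real n)\<^sup>2 <= real n powr (- (1/8))"
  unfolding eventually_sequentially by blast
 obtain n2 :: nat where n2: "G <= n2" using real_arch_simple by blast
 show ?thesis
 proof (rule that[of "max nc (max n1 n2)"])
  fix n W assume wt: "weights M \<eta> y f \<phi>\<^sub>0 \<alpha>\<^sub>0 \<omega>\<^sub>0 n W" and n: "n >= max nc (max n1 n2)"
  interpret weights M \<eta> y f \<phi>\<^sub>0 \<alpha>\<^sub>0 \<omega>\<^sub>0 n W by (rule wt)
  define L where "L = ln (real n)"
  \<comment> \<open>The exponent 1/8 balances two demands: \<open>ln n * \<delta>\<close> must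
    vanish, and the grid, with about \<open>(ln n / \<delta>) ^ 3\<close> points, must be small
    against \<open>n\<close>. The exceptional probability is then of the order
    \<open>n powr (- (5/8))\<close> up to powers of \<open>ln n\<close>, within the bound that is
    claimed.\<close>
  define \<delta> where "\<delta> = real n powr (- (1/8))"
  have n': "G <= n" using n n2 by simp
  note big = n1[of n, folded L_def \<delta>_def]
  have rate: "((a * (L + 1) * real n powr (1/8) + 3) ^ 3 * (L + G)\<^sup>2 * d + d) / real n <= real n powr (- (1/2))"
   and L\<delta>: "L * \<delta> < \<epsilon>0 / (64 * F + 1)" and \<delta>: "\<delta> <= \<delta>'" "1 / (real n)\<^sup>2 <= \<delta>" and L: "L >= 1"
   using big n by auto
  have \<delta>0: "\<delta> > 0" "\<delta> <= 1" using n_pos \<delta> \<delta>' by (auto simp: \<delta>_def)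
  have inv\<delta>: "1 / \<delta> = real n powr (1/8)" using n_pos by (simp add: \<delta>_def powr_minus_divide)
  have ln\<delta>: "- ln \<delta> <= L" using n_pos L by (simp add: \<delta>_def L_def ln_powr)
  have FL: "8 * L * F * \<delta> <= \<epsilon>0 / 8"
  proof -
   have "8 * F * (L * \<delta>) <= 8 * F * (\<epsilon>0 / (64 * F + 1))" using F L\<delta> by (intro mult_left_mono) auto
   also have "\<dots> <= \<epsilon>0 / 8" using F \<epsilon>0 by (simp add: field_simps)
   finally show ?thesis by (simp add: mult_ac)
  qed
  \<comment> \<open>Fine enough for the larger of the two Lipschitz constants,
    \<open>L * G / \<delta>\<close>.\<close>
  define m where "m = nat \<lceil>a * (L + 1) / \<delta>\<rceil> + 1"
  have am: "a * (L + 1) / \<delta> >= 0" using a L \<delta>0 by simp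
  have m: "m >= 1" "a * (L + 1) / \<delta> <= m" "real m <= a * (L + 1) / \<delta> + 2"
   using am unfolding m_def by (linarith, linarith, linarith)
  have m_lip: "20 * C * (L * G / \<delta>) <= \<epsilon> * m" "20 * C * (G / \<delta>) <= \<epsilon> * m"
  proof -
   have e: "\<epsilon> * (a * (L + 1) / \<delta>) = 20 * C * G * (L + 1) / \<delta>" using \<epsilon> by (simp add: a_def)
   have "\<epsilon> * (a * (L + 1) / \<delta>) <= \<epsilon> * m" using m \<epsilon> by (intro mult_left_mono) auto
   then have le: "20 * C * G * (L + 1) / \<delta> <= \<epsilon> * m" unfolding e .
   have "20 * C * (L * G / \<delta>) <= 20 * C * G * (L + 1) / \<delta>" "20 * C * (G / \<delta>) <= 20 * C * G * (L + 1) / \<delta>"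
    using C G L \<delta>0 by (auto simp: field_simps)
   then show "20 * C * (L * G / \<delta>) <= \<epsilon> * m" "20 * C * (G / \<delta>) <= \<epsilon> * m" using le by linarith+
  qed
  define p where "p = ((real m + 1) ^ 3 * (L + G)\<^sup>2 / \<epsilon>\<^sup>2 + 1) * (20 * K0) / n"
  define \<psi>1 where "\<psi>1 k \<theta> u v = logmax \<delta> (root_val k \<theta> u v)" for k \<theta> u v
  \<comment> \<open>Scaled by \<open>L\<close>, because each index with a small argument may cost up
    to \<open>2 * L\<close>.\<close>
  define \<psi>2 where "\<psi>2 k \<theta> u v = L * tent \<delta> (root_val k \<theta> u v)" for k \<theta> u v
  have \<psi>1_meas: "case_prod (\<psi>1 k \<theta>) \<in> borel_measurable (borel \<Otimes>\<^sub>M borel)"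
   and \<psi>2_meas: "case_prod (\<psi>2 k \<theta>) \<in> borel_measurable (borel \<Otimes>\<^sub>M borel)" for k \<theta>
   unfolding \<psi>1_def[abs_def] \<psi>2_def[abs_def] by measurable
  have \<psi>1_b: "\<bar>\<psi>1 k \<theta> u v\<bar> <= (L + G) * (1 + \<bar>u\<bar>)" if "\<theta> \<in> param_box c C" for k \<theta> u v
  proof -
   have "\<bar>\<psi>1 k \<theta> u v\<bar> <= L + G * (1 + \<bar>u\<bar>)"
    using logmax_bound[OF \<delta>0, of "root_val k \<theta> u v"] val_b[OF that, of k u v] ln\<delta> unfolding \<psi>1_def by linarith
   also have "\<dots> <= (L + G) * (1 + \<bar>u\<bar>)" using L by (simp add: distrib_right distrib_left)
   finally show ?thesis .
  qed
  have \<psi>2_b: "\<bar>\<psi>2 k \<theta> u v\<bar> <= (L + G) * (1 + \<bar>u\<bar>)" for k \<theta> u v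
  proof -
   have "\<bar>\<psi>2 k \<theta> u v\<bar> <= L * 1" unfolding \<psi>2_def abs_mult using L tent_bounds[of \<delta> "root_val k \<theta> u v"] by (intro mult_mono) auto
   also have "\<dots> <= (L + G) * (1 + \<bar>u\<bar>)" using L G by (intro mult_mono) auto
   finally show ?thesis .
  qed
  have \<psi>1_lip: "\<bar>\<psi>1 k \<theta> u v - \<psi>1 k \<theta>' u v\<bar> <= G / \<delta> * dist1 \<theta> \<theta>' * (1 + \<bar>u\<bar>)"
   if "\<theta> \<in> param_box c C" "\<theta>' \<in> param_box c C" for k \<theta> \<theta>' u v
  proof -
   have "\<bar>\<psi>1 k \<theta> u v - \<psi>1 k \<theta>' u v\<bar> <= \<bar>root_val k \<theta> u v - root_val k \<theta>' u v\<bar> / \<delta>"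
    unfolding \<psi>1_def by (rule logmax_lipschitz[OF \<delta>0(1)])
   also have "\<dots> <= (G * dist1 \<theta> \<theta>' * (1 + \<bar>u\<bar>)) / \<delta>" using val_lip[OF that] \<delta>0 by (intro divide_right_mono) auto
   finally show ?thesis by (simp add: mult_ac)
  qed
  have \<psi>2_lip: "\<bar>\<psi>2 k \<theta> u v - \<psi>2 k \<theta>' u v\<bar> <= L * G / \<delta> * dist1 \<theta> \<theta>' * (1 + \<bar>u\<bar>)"
   if "\<theta> \<in> param_box c C" "\<theta>' \<in> param_box c C" for k \<theta> \<theta>' u v
  proof -
   have "\<bar>\<psi>2 k \<theta> u v - \<psi>2 k \<theta>' u v\<bar> = L * \<bar>tent \<delta> (root_val k \<theta> u v) - tent \<delta> (root_val k \<theta>' u v)\<bar>"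
    unfolding \<psi>2_def right_diff_distrib[symmetric] abs_mult using L by simp
   also have "\<dots> <= L * (\<bar>root_val k \<theta> u v - root_val k \<theta>' u v\<bar> / \<delta>)"
    using L by (intro mult_left_mono tent_lipschitz[OF \<delta>0(1)]) auto
   also have "\<dots> <= L * ((G * dist1 \<theta> \<theta>' * (1 + \<bar>u\<bar>)) / \<delta>)"
    using val_lip[OF that] \<delta>0 L by (intro mult_left_mono divide_right_mono) auto
   finally show ?thesis by (simp add: mult_ac)
  qed
  have ex1: "\<exists>N. N \<in> events \<and> prob N <= p \<and> (\<forall>x\<in>space M - N. \<forall>\<theta>\<in>param_box c C.
   \<bar>\<Sum>t=1..n. W t x * \<psi>1 k \<theta> (U t x) (y (t - 1) x) - cmean (\<psi>1 k \<theta>) (y (t - 1) x)\<bar> <= 2 * \<epsilon> * n)" for k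
  proof -
   obtain N where N: "N \<in> events" "prob N <= p" "\<And>x \<theta>. x \<in> space M - N ==> \<theta> \<in> param_box c C ==>
    \<bar>\<Sum>t=1..n. W t x * \<psi>1 k \<theta> (U t x) (y (t - 1) x) - cmean (\<psi>1 k \<theta>) (y (t - 1) x)\<bar> <= 2 * \<epsilon> * n"
    unfolding p_def
    by (rule uniform_lln[where \<psi> = "\<psi>1 k" and K = "L + G" and \<Lambda> = "G / \<delta>", OF c \<psi>1_meas _ \<psi>1_b _ \<psi>1_lip \<epsilon> m(1) m_lip(2)])
      (use L G \<delta>0 in simp_all)
   show ?thesis using N(1,2) by (intro exI[of _ N] conjI ballI N(3))
  qed
  have ex2: "\<exists>N. N \<in> events \<and> prob N <= p \<and> (\<forall>x\<in>space M - N. \<forall>\<theta>\<in>param_box c C.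
   \<bar>\<Sum>t=1..n. W t x * \<psi>2 k \<theta> (U t x) (y (t - 1) x) - cmean (\<psi>2 k \<theta>) (y (t - 1) x)\<bar> <= 2 * \<epsilon> * n)" for k
  proof -
   obtain N where N: "N \<in> events" "prob N <= p" "\<And>x \<theta>. x \<in> space M - N ==> \<theta> \<in> param_box c C ==>
    \<bar>\<Sum>t=1..n. W t x * \<psi>2 k \<theta> (U t x) (y (t - 1) x) - cmean (\<psi>2 k \<theta>) (y (t - 1) x)\<bar> <= 2 * \<epsilon> * n"
    unfolding p_def
    by (rule uniform_lln[where \<psi> = "\<psi>2 k" and K = "L + G" and \<Lambda> = "L * G / \<delta>", OF c \<psi>2_meas _ \<psi>2_b _ \<psi>2_lip \<epsilon> m(1) m_lip(1)])
      (use L G \<delta>0 in simp_all)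
   show ?thesis using N(1,2) by (intro exI[of _ N] conjI ballI N(3))
  qed
  obtain N1 where N1': "\<forall>k. N1 k \<in> events \<and> prob (N1 k) <= p \<and> (\<forall>x\<in>space M - N1 k. \<forall>\<theta>\<in>param_box c C.
    \<bar>\<Sum>t=1..n. W t x * \<psi>1 k \<theta> (U t x) (y (t - 1) x) - cmean (\<psi>1 k \<theta>) (y (t - 1) x)\<bar> <= 2 * \<epsilon> * n)"
   by (rule exE[OF choice[OF allI[OF ex1]]], rule that)
  note N1 = N1'[rule_format, THEN conjunct1] N1'[rule_format, THEN conjunct2, THEN conjunct1]
   N1'[rule_format, THEN conjunct2, THEN conjunct2, rule_format]
  obtain N2 where N2': "\<forall>k. N2 k \<in> events \<and> prob (N2 k) <= p \<and> (\<forall>x\<in>space M - N2 k. \<forall>\<theta>\<in>param_box c C.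
    \<bar>\<Sum>t=1..n. W t x * \<psi>2 k \<theta> (U t x) (y (t - 1) x) - cmean (\<psi>2 k \<theta>) (y (t - 1) x)\<bar> <= 2 * \<epsilon> * n)"
   by (rule exE[OF choice[OF allI[OF ex2]]], rule that)
  note N2 = N2'[rule_format, THEN conjunct1] N2'[rule_format, THEN conjunct2, THEN conjunct1]
   N2'[rule_format, THEN conjunct2, THEN conjunct2, rule_format]
  obtain N3 where N3: "N3 \<in> events" "prob N3 <= 20 * K0 * 1\<^sup>2 / (\<epsilon>\<^sup>2 * n)"
   "\<And>x. x \<in> space M - N3 ==> \<bar>\<Sum>t=1..n. W t x * 1 - cmean (\<lambda>u v. 1) (y (t - 1) x)\<bar> <= \<epsilon> * n"
   by (rule lln_single[of "\<lambda>u v. 1" 1 \<epsilon>]) (use \<epsilon> in auto)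
  obtain N4 where N4: "N4 \<in> events" "prob N4 <= K0 / n" "\<And>x t. x \<in> space M - N4 ==> t \<in> {1..n} ==> 1 + \<bar>U t x\<bar> <= n"
   by (rule U_max[OF n_pos], rule that)
  obtain N5 where N5: "N5 \<in> events" "prob N5 <= Kc / real n" "\<And>x \<theta>. x \<in> space M - N5 ==> \<theta> \<in> param_box c C ==>
    no_worse n W x \<theta> ==>
    \<bar>fst \<theta> - \<phi>\<^sub>0\<bar> <= \<kappa> \<and> \<bar>fst (snd \<theta>) - \<alpha>\<^sub>0\<bar> <= \<kappa> \<and>
    card {t\<in>{1..n}. \<bar>rho \<theta> (y (t - 1) x) - 1\<bar> >= \<kappa> \<or> \<bar>loc \<theta> (y (t - 1) x)\<bar> >= \<kappa>} <= \<kappa> * real n"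
   using cons[OF wt] n by auto
  obtain N0 where N0: "{x \<in> space M. \<not> (\<forall>t\<in>{1..n}. W t x >= 0)} \<subseteq> N0" "emeasure M N0 = 0" "N0 \<in> events"
   by (rule AE_E[OF W_nonneg])
  define N where "N = ((N1 1 \<union> N1 2) \<union> (N2 1 \<union> N2 2)) \<union> ((N3 \<union> N4) \<union> (N5 \<union> N0))"
  have N_ev: "N \<in> events" unfolding N_def using N1(1) N2(1) N3(1) N4(1) N5(1) N0(3) by (intro sets.Un)
  have prob_N: "prob N <= real n powr (- (1/2))"
  proof -
   have Un: "prob (A \<union> B) <= a + b" if "A \<in> events" "B \<in> events" "prob A <= a" "prob B <= b" for A B a b
    using measure_Un_le[OF that(1,2)] that by linarith
   have "prob N <= ((p + p) + (p + p)) + ((20 * K0 * 1\<^sup>2 / (\<epsilon>\<^sup>2 * n) + K0 / n) + (Kc / n + 0))"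
    unfolding N_def using N1(1,2) N2(1,2) N3(1,2) N4(1,2) N5(1,2) N0(2,3)
    by (intro Un sets.Un) (auto simp: measure_def)
   also have "\<dots> <= ((real m + 1) ^ 3 * (L + G)\<^sup>2 * d + d) / n"
   proof -
    define q where "q = (real m + 1) ^ 3 * (L + G)\<^sup>2"
    have q: "q >= 1"
    proof -
     have "1 * 1 <= q" unfolding q_def using L G by (intro mult_mono one_le_power) auto
     then show ?thesis by simp
    qed
    have K0: "K0 >= 2" by (rule K0_bound(3))
    define E where "E = 1 / \<epsilon>\<^sup>2"
    have E: "E > 0" using \<epsilon> by (simp add: E_def)
    have "((p + p) + (p + p)) + ((20 * K0 * 1\<^sup>2 / (\<epsilon>\<^sup>2 * n) + K0 / n) + (Kc / n + 0))
      = (80 * K0 * E * q + 80 * K0 + 20 * K0 * E + K0 + Kc) / n"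
     unfolding p_def q_def[symmetric] E_def using n_pos \<epsilon> by (simp add: field_simps)
    also have "\<dots> <= (q * d + d) / n"
    proof (rule divide_right_mono)
     have d: "d = 100 * K0 * E + 200 * K0 + \<bar>Kc\<bar>" by (simp add: d_def E_def)
     have "80 * K0 * E * q <= q * d"
     proof -
      have "80 * K0 * E <= d" using K0 E unfolding d by (simp add: mult_right_mono)
      then show ?thesis using mult_left_mono[of "80 * K0 * E" d q] q by (simp add: mult_ac)
     qed
     moreover have "20 * K0 * E <= 100 * K0 * E" using K0 E by (intro mult_right_mono) auto
     ultimately show "80 * K0 * E * q + 80 * K0 + 20 * K0 * E + K0 + Kc <= q * d + d" using K0 unfolding d by linarith
    qed simp
    finally show ?thesis by (simp add: q_def)
   qed
   also have "\<dots> <= ((a * (L + 1) * real n powr (1/8) + 3) ^ 3 * (L + G)\<^sup>2 * d + d) / n"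
   proof -
    have "real m + 1 <= a * (L + 1) * real n powr (1/8) + 3" using m(3) by (simp flip: inv\<delta>)
    moreover have "d >= 0" using K0_bound(3) by (simp add: d_def)
    ultimately show ?thesis by (intro divide_right_mono add_right_mono mult_right_mono power_mono) auto
   qed
   also have "\<dots> <= real n powr (- (1/2))" by (rule rate)
   finally show ?thesis .
  qed
  have "\<bar>(\<Sum>t\<in>kept k n (sample y n x) \<theta>. W t x * ln \<bar>root_arg k (sample y n x) t \<theta>\<bar>) / n - \<gamma>\<bar> <= \<epsilon>0
     \<and> \<bar>(\<Sum>t\<in>kept k n (sample y n x) \<theta>. W t x) / n - 1\<bar> <= \<epsilon>0"
   if x: "x \<in> space M - N" and \<theta>: "\<theta> \<in> param_box c C" and k: "k \<in> {1, 2}"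
    and min: "no_worse n W x \<theta>"
   for x \<theta> k
  proof -
   define X where "X t = root_val k \<theta> (U t x) (y (t - 1) x)" for t
   have X: "root_arg k (sample y n x) t \<theta> = X t" if "t \<in> {1..n}" for t
    unfolding X_def using that by (intro root_arg_path) auto
   have W0: "W t x >= 0" if "t \<in> {1..n}" for t using x N0(1) that unfolding N_def by blast
   have Xn: "\<bar>X t\<bar> <= (real n)\<^sup>2" if "t \<in> {1..n}" for t
   proof -
    have "1 + \<bar>U t x\<bar> <= n" using x that by (intro N4(3)) (auto simp: N_def)
    have "\<bar>X t\<bar> <= G * (1 + \<bar>U t x\<bar>)" unfolding X_def by (rule val_b[OF \<theta>])
    also have "\<dots> <= real n * real n" using \<open>1 + \<bar>U t x\<bar> <= n\<close> n' G by (intro mult_mono) auto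
    finally show ?thesis by (simp add: power2_eq_square)
   qed
   have x1: "x \<in> space M - N1 k" "x \<in> space M - N2 k" "x \<in> space M - N3" "x \<in> space M - N5"
    using x k by (auto simp: N_def)
   have S1: "\<bar>(\<Sum>t=1..n. W t x * logmax \<delta> (X t)) - (\<Sum>t=1..n. cmean (\<psi>1 k \<theta>) (y (t - 1) x))\<bar> <= 2 * \<epsilon> * n"
    using N1(3)[OF x1(1) \<theta>] by (simp add: \<psi>1_def[of k \<theta>] X_def sum_subtractf)
   have cm2: "cmean (\<psi>2 k \<theta>) v <= 4 * L * F * \<delta>" for v
   proof -
    have "(\<integral>u. tent \<delta> (root_loc k \<theta> v + root_scale \<theta> v * u) \<partial>\<mu>) <= 4 * fmax * G * \<delta>"
     using scale_b[OF \<theta>, of v] G \<delta>0 by (intro affine_integral_le nn_integral_tent tent_bounds) auto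
    then have "L * (\<integral>u. tent \<delta> (root_loc k \<theta> v + root_scale \<theta> v * u) \<partial>\<mu>) <= L * (4 * fmax * G * \<delta>)"
     using L by (intro mult_left_mono) auto
    then show ?thesis by (simp add: cmean_def \<psi>2_def root_val_def F_def mult_ac)
   qed
   have S2: "(\<Sum>t=1..n. W t x * (L * tent \<delta> (X t))) <= (2 * \<epsilon> + 4 * L * F * \<delta>) * n"
   proof -
    have "(\<Sum>t=1..n. W t x * (L * tent \<delta> (X t))) - (\<Sum>t=1..n. cmean (\<psi>2 k \<theta>) (y (t - 1) x)) <= 2 * \<epsilon> * n"
     using N2(3)[OF x1(2) \<theta>] by (simp add: \<psi>2_def[of k \<theta>] X_def sum_subtractf abs_le_iff)
    moreover have "(\<Sum>t=1..n. cmean (\<psi>2 k \<theta>) (y (t - 1) x)) <= (\<Sum>t=1..n. 4 * L * F * \<delta>)" by (intro sum_mono cm2)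
    ultimately show ?thesis by (simp add: algebra_simps)
   qed
   have S3: "\<bar>(\<Sum>t=1..n. W t x) - n\<bar> <= \<epsilon> * n"
    using N3(3)[OF x1(3)] \<mu>.prob_space by (simp add: cmean_def sum_subtractf)
   have d1: "\<bar>(\<Sum>t\<in>kept k n (sample y n x) \<theta>. W t x * ln \<bar>root_arg k (sample y n x) t \<theta>\<bar>) - (\<Sum>t=1..n. W t x * logmax \<delta> (X t))\<bar>
     <= 2 * ((2 * \<epsilon> + 4 * L * F * \<delta>) * n)"
   proof -
    have "(\<Sum>t\<in>kept k n (sample y n x) \<theta>. W t x * ln \<bar>root_arg k (sample y n x) t \<theta>\<bar>)
      = (\<Sum>t=1..n. W t x * (if X t \<in> trunc n then ln \<bar>X t\<bar> else 0))"
     unfolding sum_kept by (intro sum.cong) (auto simp: X)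
    then have "\<bar>(\<Sum>t\<in>kept k n (sample y n x) \<theta>. W t x * ln \<bar>root_arg k (sample y n x) t \<theta>\<bar>) - (\<Sum>t=1..n. W t x * logmax \<delta> (X t))\<bar>
      <= (\<Sum>t=1..n. \<bar>W t x * ((if X t \<in> trunc n then ln \<bar>X t\<bar> else 0) - logmax \<delta> (X t))\<bar>)"
     by (simp only: sum_subtractf[symmetric] right_diff_distrib[symmetric] sum_abs)
    also have "\<dots> <= (\<Sum>t=1..n. W t x * (2 * L * tent \<delta> (X t)))"
     unfolding abs_mult using W0 log_trunc_difference(1)[OF n_pos Xn \<delta>(2) \<delta>0(2) L_def]
     by (intro sum_mono mult_mono) auto
    also have "\<dots> = 2 * (\<Sum>t=1..n. W t x * (L * tent \<delta> (X t)))" by (simp add: sum_distrib_left mult_ac)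
    finally show ?thesis using S2 by linarith
   qed
   note cns = N5(3)[OF x1(4) \<theta> min]
   define bad where "bad = {t\<in>{1..n}. \<bar>rho \<theta> (y (t - 1) x) - 1\<bar> >= \<kappa> \<or> \<bar>loc \<theta> (y (t - 1) x)\<bar> >= \<kappa>}"
   have J_eq: "cmean (\<psi>1 k \<theta>) v = J \<delta> (root_loc k \<theta> v) (root_scale \<theta> v)" for v
    by (simp add: cmean_def \<psi>1_def root_val_def J_def)
   define P0 where "P0 = - ((- 1) ^ k * \<phi>\<^sub>0)"
   have \<gamma>_J: "\<bar>J \<delta>' P0 (sqrt \<alpha>\<^sub>0) - \<gamma>\<bar> <= 4 * F * \<delta>'"
   proof -
    have "1 / G <= 1 / H" using H2 H(1) by (intro divide_left_mono) (auto simp: G_def)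
    then have "1 / G <= sqrt \<alpha>\<^sub>0" using H(3)[OF \<theta>0] by simp
    from J_ln_diff[OF \<delta>'(1,2) this G(2), of P0] show ?thesis
     unfolding \<gamma>_def lyapunov_eq_minus[of k] P0_def F_def by (simp add: mult_ac)
   qed
   \<comment> \<open>Three comparisons: the level \<open>\<delta>\<close> with
     \<open>\<delta>'\<close>, the coefficients with the true ones, and the level
     \<open>\<delta>'\<close> with no truncation.\<close>
   have good: "\<bar>J \<delta> (root_loc k \<theta> v) (root_scale \<theta> v) - \<gamma>\<bar> <= \<epsilon>0 / 4"
    if v: "\<bar>rho \<theta> v - 1\<bar> < \<kappa>" "\<bar>loc \<theta> v\<bar> < \<kappa>" for v
   proof -
    define s where "s = sqrt (fst (snd \<theta>))"
    have s: "1 / H <= s" "s <= H" using H(3)[OF \<theta>] by (auto simp: s_def)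
    have "1 / H > 0" using H(1) by simp
    then have "s > 0" using s by linarith
    have s0: "1 / H <= sqrt \<alpha>\<^sub>0" using H(3)[OF \<theta>0] by simp
    have ds: "\<bar>s - sqrt \<alpha>\<^sub>0\<bar> <= H * \<kappa>"
    proof -
     have "fst (snd \<theta>) > 0" using \<open>s > 0\<close> by (simp add: s_def)
     then have "(s - sqrt \<alpha>\<^sub>0) * (s + sqrt \<alpha>\<^sub>0) = fst (snd \<theta>) - \<alpha>\<^sub>0" using pos by (simp add: s_def algebra_simps)
     then have "\<bar>(s - sqrt \<alpha>\<^sub>0) * (s + sqrt \<alpha>\<^sub>0)\<bar> <= \<kappa>" using cns by simp
     moreover have "s + sqrt \<alpha>\<^sub>0 > 0" using \<open>s > 0\<close> pos by (simp add: add_pos_nonneg)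
     ultimately have "\<bar>s - sqrt \<alpha>\<^sub>0\<bar> * (s + sqrt \<alpha>\<^sub>0) <= \<kappa>" by (simp add: abs_mult)
     moreover have "\<bar>s - sqrt \<alpha>\<^sub>0\<bar> * (1 / H) <= \<bar>s - sqrt \<alpha>\<^sub>0\<bar> * (s + sqrt \<alpha>\<^sub>0)" using s0 \<open>s > 0\<close> by (intro mult_left_mono) auto
     ultimately have "\<bar>s - sqrt \<alpha>\<^sub>0\<bar> * (1 / H) <= \<kappa>" by linarith
     then show ?thesis using H(1) by (simp add: field_simps)
    qed
    have "\<bar>root_loc k \<theta> v - P0\<bar> <= 2 * (H * \<kappa>)"
    proof -
     have "root_loc k \<theta> v - P0 = s * loc \<theta> v - (- 1) ^ k * (fst \<theta> - \<phi>\<^sub>0)" by (simp add: root_loc_def P0_def s_def algebra_simps)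
     moreover have "\<bar>s * loc \<theta> v\<bar> <= H * \<kappa>" unfolding abs_mult using s v \<open>s > 0\<close> H(1) by (intro mult_mono) auto
     moreover have "\<bar>(- 1) ^ k * (fst \<theta> - \<phi>\<^sub>0)\<bar> <= \<kappa>" using cns by (simp add: abs_mult)
     moreover have "\<kappa> <= H * \<kappa>" using mult_right_mono[OF H(1), of \<kappa>] \<kappa>(1) by simp
     ultimately show ?thesis by linarith
    qed
    moreover have "\<bar>root_scale \<theta> v - sqrt \<alpha>\<^sub>0\<bar> <= 2 * (H * \<kappa>)"
    proof -
     have "root_scale \<theta> v - sqrt \<alpha>\<^sub>0 = s * (rho \<theta> v - 1) + (s - sqrt \<alpha>\<^sub>0)" by (simp add: root_scale_def s_def algebra_simps)
     moreover have "\<bar>s * (rho \<theta> v - 1)\<bar> <= H * \<kappa>" unfolding abs_mult using s v \<open>s > 0\<close> H(1) by (intro mult_mono) auto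
     ultimately show ?thesis using ds by linarith
    qed
    ultimately have "(\<bar>root_loc k \<theta> v - P0\<bar> + \<bar>root_scale \<theta> v - sqrt \<alpha>\<^sub>0\<bar>) / \<delta>' <= (4 * H * \<kappa>) / \<delta>'"
     using \<delta>' by (intro divide_right_mono) auto
    then have "\<bar>J \<delta>' (root_loc k \<theta> v) (root_scale \<theta> v) - J \<delta>' P0 (sqrt \<alpha>\<^sub>0)\<bar> <= \<epsilon>0 / 8"
     using J_lipschitz[OF \<delta>'(1,2), of "root_loc k \<theta> v" "root_scale \<theta> v" P0 "sqrt \<alpha>\<^sub>0"] \<kappa>(2) by linarith
    moreover have "\<bar>J \<delta> (root_loc k \<theta> v) (root_scale \<theta> v) - J \<delta>' (root_loc k \<theta> v) (root_scale \<theta> v)\<bar> <= 4 * F * \<delta>'"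
     using J_diff[OF \<delta>0(1) \<delta>(1) \<delta>'(2) _ G(2), of "root_scale \<theta> v" "root_loc k \<theta> v"] scale_b[OF \<theta>, of v] by (simp add: F_def mult_ac)
    ultimately show ?thesis using \<gamma>_J \<delta>'(3) by linarith
   qed
   have any: "\<bar>J \<delta> (root_loc k \<theta> v) (root_scale \<theta> v) - \<gamma>\<bar> <= C1 + \<epsilon>0 / 16" for v
   proof -
    have "\<bar>J \<delta> (root_loc k \<theta> v) (root_scale \<theta> v)\<bar> <= 2 * G + 4 * F"
     using J_bound[OF \<delta>0 _ G(2), of "root_scale \<theta> v" "root_loc k \<theta> v"] scale_b[OF \<theta>, of v] loc_b[OF \<theta>, of k v] by (simp add: F_def mult_ac)
    moreover have "\<bar>J \<delta>' P0 (sqrt \<alpha>\<^sub>0)\<bar> <= 2 * G + 4 * F"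
    proof -
     \<comment> \<open>The limiting coefficients are those at \<open>\<theta>\<^sub>0\<close>, so
       the bounds for the box apply to them as well.\<close>
     have "root_loc k \<theta>\<^sub>0 0 = P0" "root_scale \<theta>\<^sub>0 0 = sqrt \<alpha>\<^sub>0"
      using pos by (auto simp: root_loc_def root_scale_def P0_def loc_def rho_def)
     then show ?thesis
      using J_bound[OF \<delta>'(1,2) _ G(2), of "sqrt \<alpha>\<^sub>0" P0] scale_b[OF \<theta>0, of 0] loc_b[OF \<theta>0, of k 0] by (simp add: F_def mult_ac)
    qed
    ultimately show ?thesis using \<gamma>_J \<delta>'(3) unfolding C1_def by linarith
   qed
   have S4: "\<bar>(\<Sum>t=1..n. cmean (\<psi>1 k \<theta>) (y (t - 1) x)) - n * \<gamma>\<bar> <= (\<epsilon>0 / 2) * n"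
   proof -
    have "\<bar>(\<Sum>t=1..n. cmean (\<psi>1 k \<theta>) (y (t - 1) x)) - n * \<gamma>\<bar> = \<bar>\<Sum>t=1..n. J \<delta> (root_loc k \<theta> (y (t - 1) x)) (root_scale \<theta> (y (t - 1) x)) - \<gamma>\<bar>"
     by (simp add: J_eq sum_subtractf)
    also have "\<dots> <= (\<Sum>t=1..n. \<bar>J \<delta> (root_loc k \<theta> (y (t - 1) x)) (root_scale \<theta> (y (t - 1) x)) - \<gamma>\<bar>)" by (rule sum_abs)
    also have "\<dots> <= (\<Sum>t=1..n. (\<epsilon>0 / 4 + \<epsilon>0 / 16) + (if t \<in> bad then C1 else 0))"
    proof (rule sum_mono)
     fix t assume t: "t \<in> {1..n}"
     show "\<bar>J \<delta> (root_loc k \<theta> (y (t - 1) x)) (root_scale \<theta> (y (t - 1) x)) - \<gamma>\<bar> <= (\<epsilon>0 / 4 + \<epsilon>0 / 16) + (if t \<in> bad then C1 else 0)"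
     proof (cases "t \<in> bad")
      case True
      then show ?thesis using any[of "y (t - 1) x"] \<epsilon>0 by simp
     next
      case False
      then have "\<bar>rho \<theta> (y (t - 1) x) - 1\<bar> < \<kappa>" "\<bar>loc \<theta> (y (t - 1) x)\<bar> < \<kappa>" using t by (auto simp: bad_def)
      from good[OF this] show ?thesis using False \<epsilon>0 by simp
     qed
    qed
    also have "\<dots> = (\<epsilon>0 / 4 + \<epsilon>0 / 16) * n + card bad * C1"
    proof -
     have "(\<Sum>t=1..n. if t \<in> bad then C1 else 0) = card ({1..n} \<inter> bad) * C1"
      by (subst sum.inter_restrict[symmetric]) auto
     also have "{1..n} \<inter> bad = bad" by (auto simp: bad_def)
     finally show ?thesis by (simp add: sum.distrib algebra_simps)
    qed
    also have "card bad * C1 <= (\<epsilon>0 / 8) * n"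
    proof -
     have "card bad * C1 <= (\<kappa> * n) * C1" using cns C1 by (intro mult_right_mono) (auto simp: bad_def)
     also have "\<dots> = (\<kappa> * C1) * n" by simp
     also have "\<dots> <= (\<epsilon>0 / 8) * n" using \<kappa>(3) by (intro mult_right_mono) auto
     finally show ?thesis .
    qed
    also have "(\<epsilon>0 / 4 + \<epsilon>0 / 16) * n + (\<epsilon>0 / 8) * n <= (\<epsilon>0 / 2) * n"
     using \<epsilon>0 by (simp add: algebra_simps)
    finally show ?thesis by simp
   qed
   have np: "real n > 0" using n_pos by simp
   have FLn: "4 * L * F * \<delta> * n <= (\<epsilon>0 * n) / 16" using mult_right_mono[OF FL, of n] by simp
   have \<epsilon>n: "2 * \<epsilon> * n = (\<epsilon>0 * n) / 12" "\<epsilon> * n = (\<epsilon>0 * n) / 24" by (simp_all add: \<epsilon>_def)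
   have half: "(\<epsilon>0 / 2) * n = (\<epsilon>0 * n) / 2" by simp
   have "\<bar>(\<Sum>t\<in>kept k n (sample y n x) \<theta>. W t x * ln \<bar>root_arg k (sample y n x) t \<theta>\<bar>) - n * \<gamma>\<bar> <= \<epsilon>0 * n"
    by (rule three_step_bound[OF d1[unfolded distrib_right \<epsilon>n] S1[unfolded \<epsilon>n] S4[unfolded half] FLn mult_pos_pos[OF \<epsilon>0 np]])
   then have 1: "\<bar>(\<Sum>t\<in>kept k n (sample y n x) \<theta>. W t x * ln \<bar>root_arg k (sample y n x) t \<theta>\<bar>) / n - \<gamma>\<bar> <= \<epsilon>0"
    using np by (simp add: field_simps abs_le_iff)
   \<comment> \<open>Since \<open>L >= 1\<close>, the weight lost by truncation is dominated by the
     scaled tent, whose sum is already bounded in \<open>S2\<close>.\<close>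
   have low: "(\<Sum>t=1..n. W t x) - (2 * \<epsilon> + 4 * L * F * \<delta>) * n <= (\<Sum>t\<in>kept k n (sample y n x) \<theta>. W t x)"
   proof -
    have "(\<Sum>t=1..n. W t x) - (\<Sum>t=1..n. W t x * (L * tent \<delta> (X t))) = (\<Sum>t=1..n. W t x * (1 - L * tent \<delta> (X t)))"
     by (simp add: sum_subtractf right_diff_distrib)
    also have "\<dots> <= (\<Sum>t=1..n. W t x * (if X t \<in> trunc n then 1 else 0))"
    proof (intro sum_mono mult_left_mono W0)
     fix t assume t: "t \<in> {1..n}"
     have "1 * tent \<delta> (X t) <= L * tent \<delta> (X t)" using L tent_bounds[of \<delta> "X t"] by (intro mult_right_mono) auto
     then show "1 - L * tent \<delta> (X t) <= (if X t \<in> trunc n then 1 else 0)"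
      using log_trunc_difference(2)[OF n_pos Xn[OF t] \<delta>(2) \<delta>0(2) L_def] by linarith
    qed
    also have "\<dots> = (\<Sum>t\<in>kept k n (sample y n x) \<theta>. W t x)"
     unfolding sum_kept by (intro sum.cong) (auto simp: X)
    finally show ?thesis using S2 by linarith
   qed
   have up: "(\<Sum>t\<in>kept k n (sample y n x) \<theta>. W t x) <= (\<Sum>t=1..n. W t x)"
    using W0 kept_subset by (intro sum_mono2) auto
   have "\<bar>(\<Sum>t\<in>kept k n (sample y n x) \<theta>. W t x) - n\<bar> <= \<epsilon>0 * n"
    using low up S3 FLn mult_pos_pos[OF \<epsilon>0 np] unfolding distrib_right \<epsilon>n by linarith
   then have 2: "\<bar>(\<Sum>t\<in>kept k n (sample y n x) \<theta>. W t x) / n - 1\<bar> <= \<epsilon>0"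
    using np by (simp add: field_simps abs_le_iff)
   show ?thesis using 1 2 by blast
  qed
  then show "\<exists>N\<in>events. prob N <= real n powr (- (1/2)) \<and> (\<forall>x\<in>space M - N. \<forall>\<theta>\<in>param_box c C.
    no_worse n W x \<theta> -->
    (\<forall>k\<in>{1,2}. \<bar>(\<Sum>t\<in>kept k n (sample y n x) \<theta>. W t x * ln \<bar>root_arg k (sample y n x) t \<theta>\<bar>) / n - lyapunov M \<phi>\<^sub>0 \<alpha>\<^sub>0 (\<eta> 1)\<bar> <= \<epsilon>0
     \<and> \<bar>(\<Sum>t\<in>kept k n (sample y n x) \<theta>. W t x) / n - 1\<bar> <= \<epsilon>0))"
   using N_ev prob_N unfolding \<gamma>_def by blast
 qed
qed

end

section \<open>Visits of the path\<close>

context dar_model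
begin

lemma path_tight:
 fixes m :: nat and \<tau> :: real
 assumes "\<tau> > 0"
 obtains K :: real and N where "N \<in> events" "prob N <= \<tau>" "\<And>x t. x \<in> space M - N ==> t < m ==> \<bar>y t x\<bar> <= K"
proof -
 define Z where "Z x = (\<Sum>t<m. \<bar>y t x\<bar>)" for x
 define A where "A k = {x \<in> space M. real k < Z x}" for k :: nat
 have [measurable]: "Z \<in> borel_measurable M" unfolding Z_def[abs_def] by measurable
 have A: "A k \<in> events" for k unfolding A_def by measurable
 have "decseq A" by (rule decseq_SucI) (auto simp: A_def)
 then have "(\<lambda>k. prob (A k)) \<longlonglongrightarrow> prob (\<Inter>k. A k)" using A by (intro finite_Lim_measure_decseq) auto
 moreover have "(\<Inter>k. A k) = {}"
 proof -
  have "x \<notin> (\<Inter>k. A k)" for x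
  proof -
   obtain k where "Z x < real k" using reals_Archimedean2 by blast
   then have "x \<notin> A k" by (simp add: A_def)
   then show ?thesis by (intro notI) (drule INT_D[OF _ UNIV_I, of _ _ k], simp)
  qed
  then show ?thesis by blast
 qed
 ultimately have "(\<lambda>k. prob (A k)) \<longlonglongrightarrow> 0" by simp
 from order_tendstoD(2)[OF this assms] obtain k where k: "prob (A k) < \<tau>"
  by (rule eventually_happens'[OF sequentially_bot, THEN exE])
 show ?thesis
 proof (rule that[of "A k" k])
  fix x t assume x: "x \<in> space M - A k" and t: "t < m"
  have "\<bar>y t x\<bar> <= Z x" unfolding Z_def by (rule member_le_sum) (use t in auto)
  then show "\<bar>y t x\<bar> <= k" using x by (auto simp: A_def not_less)
 qed (use A k in auto)
qed

text \<open>Two laws of large numbers. Large innovations have probability \<open>p\<close> and force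
  large values; after a large value the next innovation falls into \<open>S\<close> with conditional
  probability \<open>q\<close>. Without any such visit the second law would make large values rarer
  than the first one allows.\<close>

lemma path_visits:
 fixes \<tau> :: real
 assumes c: "0 < c" "c <= C" and \<theta>0: "\<theta>\<^sub>0 \<in> param_box c C" and R: "R > 0"
  and S: "S \<in> sets borel" "emeasure lborel S \<noteq> 0" and \<tau>: "\<tau> > 0"
 obtains n0 where "\<And>n. n >= n0 ==> \<exists>N\<in>events. prob N <= \<tau> \<and> (\<forall>x\<in>space M - N. \<exists>t\<in>{1..n}. y (t - 1) x >= R \<and> U t x \<in> S)"
proof -
 define Kc where "Kc = (C + R) / sqrt c"
 define p where "p = measure \<mu> {Kc..}"
 define q where "q = measure \<mu> S"
 have p: "p > 0" unfolding p_def
 proof (rule \<mu>_pos)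
  have "emeasure lborel {Kc..Kc + 1} <= emeasure lborel {Kc..}" by (rule emeasure_mono) auto
  then show "emeasure lborel {Kc..} \<noteq> 0" by auto
 qed simp
 have q: "q > 0" unfolding q_def by (rule \<mu>_pos[OF S])
 have q1: "q <= 1" unfolding q_def by (rule \<mu>.prob_le_1)
 \<comment> \<open>A quarter of \<open>q * p\<close> leaves room for the errors of both laws and for
   the shift of the index.\<close>
 define \<epsilon> where "\<epsilon> = q * p / 4"
 have \<epsilon>: "\<epsilon> > 0" using p q by (simp add: \<epsilon>_def)
 define \<psi>1 \<psi>2 :: "real => real => real"
  where "\<psi>1 u v = indicator {Kc..} u" and "\<psi>2 u v = indicator S u * indicator {R..} v" for u v
 have meas: "case_prod \<psi>1 \<in> borel_measurable (borel \<Otimes>\<^sub>M borel)" "case_prod \<psi>2 \<in> borel_measurable (borel \<Otimes>\<^sub>M borel)"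
  unfolding \<psi>1_def \<psi>2_def using S by measurable
 have b: "\<bar>\<psi>1 u v\<bar> <= 1 * (1 + \<bar>u\<bar>)" "\<bar>\<psi>2 u v\<bar> <= 1 * (1 + \<bar>u\<bar>)" for u v
  by (auto simp: \<psi>1_def \<psi>2_def indicator_def)
 have cm1: "cmean \<psi>1 v = p" for v unfolding cmean_def \<psi>1_def p_def by simp
 have cm2: "cmean \<psi>2 v = q * indicator {R..} v" for v unfolding cmean_def \<psi>2_def q_def using S by simp
 obtain n0 :: nat where n0: "8 * K0 / (\<epsilon>\<^sup>2 * \<tau>) + 4 / (q * p) + 1 <= n0" using real_arch_simple by blast
 have pos0: "8 * K0 / (\<epsilon>\<^sup>2 * \<tau>) >= 0" "4 / (q * p) > 0" using K0_bound(3) \<tau> p q by auto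
 show ?thesis
 proof (rule that[of n0])
  fix n :: nat assume "n >= n0"
  then have n: "8 * K0 / (\<epsilon>\<^sup>2 * \<tau>) <= n" "4 / (q * p) <= n" "n >= 1" using n0 pos0 by linarith+
  define N1 where "N1 = {x \<in> space M. \<bar>\<Sum>t=1..n. centred \<psi>1 t x\<bar> >= \<epsilon> * n}"
  define N2 where "N2 = {x \<in> space M. \<bar>\<Sum>t=1..n. centred \<psi>2 t x\<bar> >= \<epsilon> * n}"
  note [measurable] = centred_measurable[OF meas(1) _ b(1)] centred_measurable[OF meas(2) _ b(2)]
  have N: "N1 \<in> events" "N2 \<in> events" unfolding N1_def N2_def by measurable
  have "prob N1 <= 4 * 1\<^sup>2 * K0 / (\<epsilon>\<^sup>2 * n)" unfolding N1_def by (rule lln_centred[OF meas(1) _ b(1) n(3) \<epsilon>]) simp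
  moreover have "prob N2 <= 4 * 1\<^sup>2 * K0 / (\<epsilon>\<^sup>2 * n)" unfolding N2_def by (rule lln_centred[OF meas(2) _ b(2) n(3) \<epsilon>]) simp
  moreover have "4 * 1\<^sup>2 * K0 / (\<epsilon>\<^sup>2 * n) <= \<tau> / 2" using n \<epsilon> \<tau> by (simp add: field_simps)
  ultimately have pN: "prob (N1 \<union> N2) <= \<tau>" using measure_Un_le[OF N] by simp
  have "\<exists>t\<in>{1..n}. y (t - 1) x >= R \<and> U t x \<in> S" if x: "x \<in> space M - (N1 \<union> N2)" for x
  proof (rule ccontr)
   assume no: "\<not> ?thesis"
   define a :: "nat => real" where "a t = indicator {R..} (y t x)" for t
   have "(\<Sum>t=1..n. \<psi>2 (U t x) (y (t - 1) x)) = 0" using no by (intro sum.neutral ballI) (auto simp: \<psi>2_def indicator_def)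
   moreover have "(\<Sum>t=1..n. centred \<psi>2 t x) = (\<Sum>t=1..n. \<psi>2 (U t x) (y (t - 1) x)) - (\<Sum>t=1..n. q * a (t - 1))"
    unfolding centred_def[OF meas(2) zero_le_one b(2)] cm2 sum_subtractf a_def by (rule refl)
   moreover have "\<bar>\<Sum>t=1..n. centred \<psi>2 t x\<bar> < \<epsilon> * n" using x by (auto simp: N2_def not_le)
   ultimately have 1: "q * (\<Sum>t=1..n. a (t - 1)) < \<epsilon> * n" unfolding sum_distrib_left by linarith
   have "(\<Sum>t=1..n. centred \<psi>1 t x) = (\<Sum>t=1..n. \<psi>1 (U t x) (y (t - 1) x)) - p * n"
    unfolding centred_def[OF meas(1) zero_le_one b(1)] cm1 sum_subtractf by simp
   moreover have "\<bar>\<Sum>t=1..n. centred \<psi>1 t x\<bar> < \<epsilon> * n" using x by (auto simp: N1_def not_le)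
   ultimately have "p * n - \<epsilon> * n < (\<Sum>t=1..n. \<psi>1 (U t x) (y (t - 1) x))" by linarith
   also have "\<dots> <= (\<Sum>t=1..n. a t)"
   proof (rule sum_mono)
    fix t show "\<psi>1 (U t x) (y (t - 1) x) <= a t"
     using large_innovation[OF c \<theta>0 R, of t x] by (auto simp: \<psi>1_def a_def indicator_def Kc_def)
   qed
   \<comment> \<open>Passing from \<open>y t\<close> to the previous value \<open>y (t - 1)\<close>
     changes only the end terms of the sum.\<close>
   also have "\<dots> <= (\<Sum>t=1..n. a (t - 1)) + 1"
   proof -
    have "(\<Sum>t=1..m. a t) = (\<Sum>t=1..m. a (t - 1)) + a m - a 0" for m by (induction m) auto
    then show ?thesis by (simp add: a_def indicator_def)
   qed
   finally have "q * (p * n - \<epsilon> * n - 1) <= q * (\<Sum>t=1..n. a (t - 1))" using q by (intro mult_left_mono) auto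
   then have "q * (p * n) - q * (\<epsilon> * n) - q < \<epsilon> * n" using 1 by (simp add: right_diff_distrib)
   moreover have "q * (\<epsilon> * n) <= 1 * (\<epsilon> * n)" using q1 \<epsilon> by (intro mult_right_mono) auto
   moreover have "q * (p * n) = 4 * (\<epsilon> * n)" by (simp add: \<epsilon>_def)
   moreover have "4 <= q * (p * n)" using n(2) p q by (simp add: field_simps)
   ultimately show False using q1 by linarith
  qed
  then show "\<exists>N\<in>events. prob N <= \<tau> \<and> (\<forall>x\<in>space M - N. \<exists>t\<in>{1..n}. y (t - 1) x >= R \<and> U t x \<in> S)"
   using N pN by (intro bexI[of _ "N1 \<union> N2"]) auto
 qed
qed

end

section \<open>Bootstrap replicates\<close>

lemma PiM_density_lborel:
 fixes g :: "real => ennreal"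
 assumes I: "finite I" and g [measurable]: "g \<in> borel_measurable borel" and sf: "sigma_finite_measure (density lborel g)"
 shows "PiM I (\<lambda>_. density lborel g) = density (PiM I (\<lambda>_. lborel)) (\<lambda>x. \<Prod>i\<in>I. g (x i))"
proof -
 interpret D: product_sigma_finite "\<lambda>_. density lborel g" by (rule product_sigma_finite.intro) (rule sf)
 interpret L: product_sigma_finite "\<lambda>_. lborel :: real measure" by standard
 show ?thesis
 proof (rule D.PiM_eqI[symmetric, OF I])
  show "sets (density (PiM I (\<lambda>_. lborel)) (\<lambda>x. \<Prod>i\<in>I. g (x i))) = sets (PiM I (\<lambda>_. density lborel g))"
   by (simp cong: sets_PiM_cong)
  fix A assume "\<And>i. i \<in> I ==> A i \<in> sets (density lborel g)"
  then have A: "\<And>i. i \<in> I ==> A i \<in> sets borel" by simp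
  have meas: "(\<lambda>x. \<Prod>i\<in>I. g (x i)) \<in> borel_measurable (PiM I (\<lambda>_. lborel))" by measurable
  have "emeasure (density (PiM I (\<lambda>_. lborel)) (\<lambda>x. \<Prod>i\<in>I. g (x i))) (Pi\<^sub>E I A)
    = (\<integral>\<^sup>+ x. (\<Prod>i\<in>I. g (x i)) * indicator (Pi\<^sub>E I A) x \<partial>PiM I (\<lambda>_. lborel))"
   by (rule emeasure_density[OF meas]) (use A I in \<open>auto intro!: sets_PiM_I_finite\<close>)
  also have "\<dots> = (\<integral>\<^sup>+ x. (\<Prod>i\<in>I. g (x i) * indicator (A i) (x i)) \<partial>PiM I (\<lambda>_. lborel))"
  proof (rule nn_integral_cong)
   fix x :: "_ => real" assume "x \<in> space (PiM I (\<lambda>_. lborel))"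
   then have ext: "x \<in> extensional I" by (simp add: space_PiM PiE_def)
   have "indicator (Pi\<^sub>E I A) x = (\<Prod>i\<in>I. indicator (A i) (x i) :: ennreal)"
   proof (cases "x \<in> Pi\<^sub>E I A")
    case False
    then obtain i where i: "i \<in> I" "x i \<notin> A i" using ext by (auto simp: PiE_def)
    then have "(\<Prod>i\<in>I. indicator (A i) (x i) :: ennreal) = 0" using I by (intro prod_zero) (auto intro!: bexI[of _ i])
    then show ?thesis using False by simp
   qed (simp add: PiE_mem)
   then show "(\<Prod>i\<in>I. g (x i)) * indicator (Pi\<^sub>E I A) x = (\<Prod>i\<in>I. g (x i) * indicator (A i) (x i))"
    unfolding prod.distrib by simp
  qed
  also have "\<dots> = (\<Prod>i\<in>I. \<integral>\<^sup>+ x. g x * indicator (A i) x \<partial>lborel)"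
  proof (rule L.product_nn_integral_prod[OF I])
   fix i assume "i \<in> I"
   then have [measurable]: "A i \<in> sets borel" by (rule A)
   show "(\<lambda>x. g x * indicator (A i) x) \<in> borel_measurable lborel" by measurable
  qed
  also have "\<dots> = (\<Prod>i\<in>I. emeasure (density lborel g) (A i))"
   using A by (intro prod.cong refl) (simp add: emeasure_density)
  finally show "emeasure (density (PiM I (\<lambda>_. lborel)) (\<lambda>x. \<Prod>i\<in>I. g (x i))) (Pi\<^sub>E I A)
    = (\<Prod>i\<in>I. emeasure (density lborel g) (A i))" .
 qed
qed

text \<open>Absolute continuity: it turns Lebesgue null level sets into null events for the weight
  vector.\<close>

lemma AE_PiM_density:
 fixes g :: "real => ennreal"
 assumes I: "finite I" and g [measurable]: "g \<in> borel_measurable borel" and sf: "sigma_finite_measure (density lborel g)"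
  and N: "N \<in> null_sets (PiM I (\<lambda>_. lborel))"
 shows "AE x in PiM I (\<lambda>_. density lborel g). x \<notin> N"
proof -
 have "AE x in PiM I (\<lambda>_. lborel). x \<notin> N" by (rule AE_not_in[OF N])
 then have *: "AE x in PiM I (\<lambda>_. lborel). 0 < (\<Prod>i\<in>I. g (x i)) --> x \<notin> N" by eventually_elim simp
 have "(\<lambda>x. \<Prod>i\<in>I. g (x i)) \<in> borel_measurable (PiM I (\<lambda>_. lborel))" by measurable
 then show ?thesis unfolding PiM_density_lborel[OF I g sf] using * by (simp add: AE_density)
qed

lemma (in prob_space) indep_rv_compose_right:
 assumes ind: "indep_rv M N X N' X'" and g: "g \<in> measurable N' N''"
 shows "indep_rv M N X N'' (\<lambda>x. g (X' x))"
proof -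
 have X: "X \<in> measurable M N" and X': "X' \<in> measurable M N'"
  and i: "indep_set {X -` A \<inter> space M |A. A \<in> sets N} {X' -` A \<inter> space M |A. A \<in> sets N'}"
  using ind by (auto simp: indep_rv_def)
 have sub: "{(\<lambda>x. g (X' x)) -` A \<inter> space M |A. A \<in> sets N''} \<subseteq> {X' -` A \<inter> space M |A. A \<in> sets N'}"
 proof
  fix S assume "S \<in> {(\<lambda>x. g (X' x)) -` A \<inter> space M |A. A \<in> sets N''}"
  then obtain A where A: "A \<in> sets N''" "S = (\<lambda>x. g (X' x)) -` A \<inter> space M" by auto
  have "S = X' -` (g -` A \<inter> space N') \<inter> space M" using A(2) measurable_space[OF X'] by auto
  then show "S \<in> {X' -` A \<inter> space M |A. A \<in> sets N'}" using measurable_sets[OF g A(1)] by blast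
 qed
 have "indep_set {X -` A \<inter> space M |A. A \<in> sets N} {(\<lambda>x. g (X' x)) -` A \<inter> space M |A. A \<in> sets N''}"
  using i sub unfolding indep_sets2_eq by (meson subset_eq subset_trans)
 then show ?thesis using X measurable_compose[OF X' g] by (simp add: indep_rv_def)
qed

section \<open>Estimates as weighted means; admissible weights\<close>

text \<open>A weighted mean of logarithms whose arguments lie in the truncation range. If the total
  weight is zero, the quotient is 0 by convention.\<close>

lemma gamma_star_bound:
 assumes n: "n >= 1" and w: "\<And>t. t \<in> {1..n} ==> w t >= 0"
 shows "\<bar>gamma_star n w Y \<theta>\<bar> <= 2 * ln (real n)"
proof -
 have part: "\<bar>gamma_star_part k n w Y \<theta>\<bar> <= 2 * ln (real n)" for k
 proof -
  define A where "A = kept k n Y \<theta>"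
  have wA: "w t >= 0" if "t \<in> A" for t using w kept_subset[of k n Y \<theta>] that by (auto simp: A_def)
  have l: "\<bar>ln \<bar>root_arg k Y t \<theta>\<bar>\<bar> <= 2 * ln (real n)" if "t \<in> A" for t
  proof -
   define X where "X = \<bar>root_arg k Y t \<theta>\<bar>"
   have "1 / (real n)\<^sup>2 > 0" using n by simp
   define N2 where "N2 = (real n)\<^sup>2"
   have "root_arg k Y t \<theta> \<in> {- N2 .. - (1 / N2)} \<union> {1 / N2 .. N2}" using that by (simp add: A_def kept_def trunc_def N2_def)
   then have "- N2 <= root_arg k Y t \<theta> \<and> root_arg k Y t \<theta> <= - (1 / N2) \<or> 1 / N2 <= root_arg k Y t \<theta> \<and> root_arg k Y t \<theta> <= N2" by auto
   with \<open>1 / (real n)\<^sup>2 > 0\<close> have X: "1 / (real n)\<^sup>2 <= X" "X <= (real n)\<^sup>2" "X > 0"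
    unfolding X_def N2_def[symmetric] by linarith+
   have "ln X <= ln ((real n)\<^sup>2)" using X by (intro ln_mono)
   moreover have "ln (1 / (real n)\<^sup>2) <= ln X" using X \<open>1 / (real n)\<^sup>2 > 0\<close> by (intro ln_mono)
   ultimately show ?thesis using n by (simp add: X_def[symmetric] ln_div ln_realpow)
  qed
  have "\<bar>\<Sum>t\<in>A. w t * ln \<bar>root_arg k Y t \<theta>\<bar>\<bar> <= (\<Sum>t\<in>A. \<bar>w t * ln \<bar>root_arg k Y t \<theta>\<bar>\<bar>)" by (rule sum_abs)
  also have "\<dots> <= (\<Sum>t\<in>A. w t * (2 * ln (real n)))"
   unfolding abs_mult using wA l by (intro sum_mono mult_mono) auto
  also have "\<dots> = 2 * ln (real n) * (\<Sum>t\<in>A. w t)" by (simp add: sum_distrib_right[symmetric])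
  finally have 1: "\<bar>\<Sum>t\<in>A. w t * ln \<bar>root_arg k Y t \<theta>\<bar>\<bar> <= 2 * ln (real n) * (\<Sum>t\<in>A. w t)" .
  have "(\<Sum>t\<in>A. w t) >= 0" using wA by (rule sum_nonneg)
  then show ?thesis unfolding gamma_star_part_eq weighted_mean_def A_def[symmetric] abs_divide
   using 1 n by (cases "(\<Sum>t\<in>A. w t) = 0") (auto simp: field_simps)
 qed
 show ?thesis using part[of 1] part[of 2] unfolding gamma_star_def by (simp add: abs_le_iff)
qed

lemma trunc_minus: "- X \<in> trunc n \<longleftrightarrow> X \<in> trunc n"
 by (auto simp: trunc_def)

lemma gamma_hat_eq:
 "gamma_hat n Y \<theta> = ((\<Sum>t\<in>kept 1 n Y \<theta>. ln \<bar>root_arg 1 Y t \<theta>\<bar>) + (\<Sum>t\<in>kept 2 n Y \<theta>. ln \<bar>root_arg 2 Y t \<theta>\<bar>)) / (2 * real n)"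
proof -
 obtain \<phi> \<alpha> \<omega> where \<theta>: "\<theta> = (\<phi>, \<alpha>, \<omega>)" by (cases \<theta>) auto
 define e where "e = resid (\<phi>, \<alpha>, \<omega>) Y"
 have 1: "root_arg 1 Y t \<theta> = \<phi> + e t * sqrt \<alpha>" and 2: "root_arg 2 Y t \<theta> = - (\<phi> - e t * sqrt \<alpha>)" for t
  by (simp_all add: root_arg_def \<theta> e_def)
 show ?thesis unfolding kept_def 1 2 trunc_minus abs_minus_cancel
  unfolding \<theta> gamma_hat.simps Let_def e_def by (rule refl)
qed

text \<open>At accuracy \<open>1 / 2\<close> or better the denominator is at least
  \<open>1 / 2\<close>, whence the factor 2.\<close>

lemma ratio_close:
 fixes S V g \<epsilon> :: real
 assumes "\<bar>S - g\<bar> <= \<epsilon>" "\<bar>V - 1\<bar> <= \<epsilon>" "\<epsilon> <= 1 / 2"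
 shows "\<bar>S / V - g\<bar> <= 2 * (1 + \<bar>g\<bar>) * \<epsilon>"
proof -
 have V: "V >= 1 / 2" using assms by linarith
 have "\<bar>S - g * V\<bar> <= \<bar>S - g\<bar> + \<bar>g * (V - 1)\<bar>" by (simp add: right_diff_distrib)
 also have "\<dots> <= \<epsilon> + \<bar>g\<bar> * \<epsilon>" unfolding abs_mult using assms by (intro add_mono mult_left_mono) auto
 finally have "\<bar>S - g * V\<bar> <= (1 + \<bar>g\<bar>) * \<epsilon>" by (simp add: distrib_right)
 moreover have "(1 + \<bar>g\<bar>) * \<epsilon> * 1 <= (1 + \<bar>g\<bar>) * \<epsilon> * (2 * V)" using V assms by (intro mult_left_mono) auto
 ultimately have "\<bar>S - g * V\<bar> <= 2 * (1 + \<bar>g\<bar>) * \<epsilon> * V" by (simp add: mult_ac)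
 moreover have "S / V - g = (S - g * V) / V" using V by (simp add: field_simps)
 ultimately show ?thesis using V by (simp add: abs_divide divide_le_eq)
qed

context dar_model
begin

text \<open>Makes \<open>gamma_hat\<close> a case of \<open>log_mean_consistency\<close>. A constant
  is independent of everything, as its preimages are trivial.\<close>

lemma weights_one:
 assumes "n >= 1"
 shows "weights M \<eta> y f \<phi>\<^sub>0 \<alpha>\<^sub>0 \<omega>\<^sub>0 n (\<lambda>_ _. 1)"
proof unfold_locales
 have s: "sample y n \<in> measurable M (PiM {0..n} (\<lambda>_. borel))" unfolding sample_def[abs_def] by measurable
 have c: "(\<lambda>x. \<lambda>t\<in>{1..n}. 1 :: real) \<in> measurable M (PiM {1..n} (\<lambda>_. borel))" by measurable
 define k where "k = (\<lambda>x :: 'a. \<lambda>t\<in>{1..n}. 1 :: real)"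
 have c: "k \<in> measurable M (PiM {1..n} (\<lambda>_. borel))" using c by (simp only: k_def)
 have "indep_set {sample y n -` A \<inter> space M |A. A \<in> sets (PiM {0..n} (\<lambda>_. borel))}
   {k -` A \<inter> space M |A. A \<in> sets (PiM {1..n} (\<lambda>_. borel))}"
 proof (rule indep_setI)
  fix a b assume a: "a \<in> {sample y n -` A \<inter> space M |A. A \<in> sets (PiM {0..n} (\<lambda>_. borel))}"
   and "b \<in> {k -` A \<inter> space M |A. A \<in> sets (PiM {1..n} (\<lambda>_. borel))}"
  then obtain A where "b = k -` A \<inter> space M" by blast
  then have b: "b = space M \<or> b = {}" unfolding k_def by (cases "(\<lambda>t\<in>{1..n}. 1 :: real) \<in> A") simp_all
  have "a \<in> events" using a measurable_sets[OF s] by blast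
  then have "a \<inter> space M = a" using sets.sets_into_space by blast
  then show "prob (a \<inter> b) = prob a * prob b" using b prob_space by auto
 next
  show "{sample y n -` A \<inter> space M |A. A \<in> sets (PiM {0..n} (\<lambda>_. borel))} \<subseteq> events"
   using measurable_sets[OF s] by blast
  show "{k -` A \<inter> space M |A. A \<in> sets (PiM {1..n} (\<lambda>_. borel))} \<subseteq> events"
   using measurable_sets[OF c] by blast
 qed
 then show "indep_rv M (PiM {0..n} (\<lambda>_. borel)) (sample y n) (PiM {1..n} (\<lambda>_. borel)) (\<lambda>x. \<lambda>t\<in>{1..n}. 1 :: real)"
  using s c unfolding indep_rv_def k_def by blast
qed (use assms prob_space in auto)

context
 fixes n B :: nat and W :: "nat => nat => 'a => real"
 assumes W: "bootstrap_weights M n B y W"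
begin

lemma weight_law: "b \<in> {1..B} ==> t \<in> {1..n} ==> distributed M lborel (W b t) (exponential_density 1)"
 using W by (simp add: bootstrap_weights_def)

lemma weight_measurable: "b \<in> {1..B} ==> t \<in> {1..n} ==> W b t \<in> borel_measurable M"
 using distributed_measurable[OF weight_law] by simp

lemma weight_vec_measurable: 
 assumes "b \<in> {1..B}"
 shows "(\<lambda>x. weight_vec W n x b) \<in> measurable M (PiM {1..n} (\<lambda>_. borel))"
 unfolding weight_vec_def by (intro measurable_restrict weight_measurable assms)

lemma AE_weight_pos: "AE x in M. \<forall>b\<in>{1..B}. \<forall>t\<in>{1..n}. W b t x > 0"
proof -
 have "AE x in M. W b t x > 0" if bt: "b \<in> {1..B}" "t \<in> {1..n}" for b t
 proof -
  have "AE u in lborel. u \<noteq> (0::real)" by (rule AE_lborel_singleton)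
  then have "AE u in lborel. 0 < ennreal (exponential_density 1 u) --> u > 0"
   by eventually_elim (auto simp: exponential_density_def split: if_splits)
  then show ?thesis by (subst distributed_AE2[OF weight_law[OF bt]]) auto
 qed
 then show ?thesis by (intro AE_finite_allI) auto
qed

lemma weights_bootstrap:
 assumes n: "n >= 1" and b: "b \<in> {1..B}"
 shows "weights M \<eta> y f \<phi>\<^sub>0 \<alpha>\<^sub>0 \<omega>\<^sub>0 n (W b)"
proof unfold_locales
 have ind: "indep_rv M (PiM {0..n} (\<lambda>_. borel)) (sample y n)
    (PiM ({1..B} \<times> {1..n}) (\<lambda>_. borel)) (\<lambda>x. \<lambda>(b, t)\<in>{1..B} \<times> {1..n}. W b t x)"
  and iv: "indep_vars (\<lambda>_. borel) (\<lambda>(b, t). W b t) ({1..B} \<times> {1..n})"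
  using W by (auto simp: bootstrap_weights_def)
 define pr where "pr z = (\<lambda>t\<in>{1..n}. z (b, t))" for z :: "nat \<times> nat => real"
 have "pr \<in> measurable (PiM ({1..B} \<times> {1..n}) (\<lambda>_. borel)) (PiM {1..n} (\<lambda>_. borel))"
  unfolding pr_def[abs_def] by (intro measurable_restrict measurable_component_singleton) (use b in auto)
 from indep_rv_compose_right[OF ind this]
 show "indep_rv M (PiM {0..n} (\<lambda>_. borel)) (sample y n) (PiM {1..n} (\<lambda>_. borel)) (\<lambda>x. \<lambda>t\<in>{1..n}. W b t x)"
 proof -
  have "pr (\<lambda>(b, t)\<in>{1..B} \<times> {1..n}. W b t x) = (\<lambda>t\<in>{1..n}. W b t x)" for x
   unfolding pr_def using b by (intro restrict_ext) auto
  with \<open>indep_rv M _ _ _ (\<lambda>x. pr _)\<close> show ?thesis by simp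
 qed
 show "AE x in M. \<forall>t\<in>{1..n}. W b t x >= 0"
  using AE_weight_pos by eventually_elim (use b in \<open>auto intro: less_imp_le\<close>)
 have m: "integrable M (\<lambda>x. W b t x ^ i)" "expectation (\<lambda>x. W b t x ^ i) = fact i" if "t \<in> {1..n}" for t i
  using erlang_ith_moment_integrable[OF _ weight_law[OF b that]] erlang_ith_moment[OF _ weight_law[OF b that]] by auto
 show "integrable M (\<lambda>x. (W b t x)\<^sup>2)" "expectation (W b t) = 1" "expectation (\<lambda>x. (W b t x)\<^sup>2) <= 2"
  if "t \<in> {1..n}" for t using m[OF that, of 2] m[OF that, of 1] by (auto simp: fact_numeral)
 show "expectation (\<lambda>x. W b s x * W b t x) = 1" if st: "s \<in> {1..n}" "t \<in> {1..n}" "s < t" for s t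
 proof -
  have "indep_var (PiM {(b, s)} (\<lambda>_. borel)) (\<lambda>x. \<lambda>i\<in>{(b, s)}. (case i of (b, t) => W b t) x)
    (PiM {(b, t)} (\<lambda>_. borel)) (\<lambda>x. \<lambda>i\<in>{(b, t)}. (case i of (b, t) => W b t) x)"
   by (rule indep_var_restrict[OF iv]) (use b st in auto)
  from indep_var_compose[OF this measurable_component_singleton measurable_component_singleton, of "(b, s)" "(b, t)"]
  have "indep_var borel (W b s) borel (W b t)" by (simp add: comp_def)
  from indep_var_lebesgue_integral[OF this] show ?thesis
   using m[OF st(1), of 1] m[OF st(2), of 1] by simp
 qed
qed (use n b weight_measurable in auto)

end

end

section \<open>Empirical variance and good configurations\<close>

definition boot_gamma :: "((nat => real) => (nat => real) => real \<times> real \<times> real) => nat => (nat => real) => (nat => nat => real) => nat => real" where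
 "boot_gamma est n Y w b = gamma_star n (w b) Y (est (w b) Y)"

definition configuration :: "real => real => real => real => real => real => nat => (nat => real) => (nat => nat) => bool" where
 "configuration c C E0 E1 R6 R n Y t \<longleftrightarrow> (\<forall>i\<in>{1..6}. t i \<in> {1..n}) \<and> (\<forall>i\<in>{1..5}. Y (t i - 1) >= R) \<and> \<bar>Y (t 6 - 1)\<bar> <= R6 \<and>
   (\<forall>\<theta>\<in>param_box c C. E0 <= resid \<theta> Y (t 1) \<and> resid \<theta> Y (t 1) + 1 <= resid \<theta> Y (t 2) \<and>
     resid \<theta> Y (t 2) + 1 <= resid \<theta> Y (t 3) \<and> resid \<theta> Y (t 3) + 1 <= resid \<theta> Y (t 4) \<and> resid \<theta> Y (t 4) <= E1 \<and>
     - E1 <= resid \<theta> Y (t 5) \<and> resid \<theta> Y (t 5) <= - E0 \<and> E0 <= resid \<theta> Y (t 6) \<and> resid \<theta> Y (t 6) <= E1)"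

lemma sum_squares_about:
 fixes g :: "nat => real"
 assumes "B >= 1"
 shows "(\<Sum>b=1..B. (g b - (\<Sum>b=1..B. g b) / B)\<^sup>2) <= (\<Sum>b=1..B. (g b - a)\<^sup>2)"
proof -
 define m where "m = (\<Sum>b=1..B. g b) / B"
 have B0: "real B \<noteq> 0" using assms by simp
 have m: "(\<Sum>b=1..B. g b) = B * m" unfolding m_def times_divide_eq_right nonzero_mult_div_cancel_left[OF B0] ..
 have "(\<Sum>b=1..B. (g b - a)\<^sup>2) = (\<Sum>b=1..B. (g b - m)\<^sup>2 + 2 * (m - a) * (g b - m) + (m - a)\<^sup>2)"
  by (intro sum.cong refl) (simp add: power2_eq_square algebra_simps)
 also have "\<dots> = (\<Sum>b=1..B. (g b - m)\<^sup>2) + 2 * (m - a) * (\<Sum>b=1..B. g b - m) + B * (m - a)\<^sup>2"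
  by (simp add: sum.distrib sum_distrib_left)
 also have "(\<Sum>b=1..B. g b - m) = 0" unfolding sum_subtractf m by simp
 finally show ?thesis unfolding m_def[symmetric] by simp
qed

text \<open>The empirical mean minimizes the sum of squares, so it may be replaced by any centre
  \<open>a\<close>, here later the true exponent; the factor 2 absorbs
  \<open>B / (B - 1)\<close>.\<close>

lemma sigma2_hat_le:
 assumes "n >= 1" "B >= 2"
 shows "sigma2_hat n B g / n <= 2 / B * (\<Sum>b=1..B. (g b - a)\<^sup>2)"
proof -
 have "sigma2_hat n B g / n = (\<Sum>b=1..B. (g b - (\<Sum>b=1..B. g b) / B)\<^sup>2) / (real B - 1)"
  using assms by (simp add: sigma2_hat_def Let_def)
 also have "\<dots> <= (\<Sum>b=1..B. (g b - a)\<^sup>2) / (real B - 1)"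
  using assms sum_squares_about[of B g a] by (intro divide_right_mono) auto
 also have "\<dots> <= (\<Sum>b=1..B. (g b - a)\<^sup>2) / (real B / 2)"
  using assms by (intro divide_left_mono sum_nonneg) auto
 finally show ?thesis by (simp add: mult_ac)
qed

lemma sigma2_hat_nonneg: "sigma2_hat n B g >= 0" if "B >= 1"
 using that by (auto simp: sigma2_hat_def Let_def intro!: mult_nonneg_nonneg divide_nonneg_nonneg sum_nonneg)

lemma sigma2_hat_zero:
 assumes "n >= 1" "B >= 2" "sigma2_hat n B g = 0"
 shows "g 1 = g 2"
proof -
 define m where "m = (\<Sum>b=1..B. g b) / B"
 have "(\<Sum>b=1..B. (g b - m)\<^sup>2) = 0" using assms by (auto simp: sigma2_hat_def Let_def m_def)
 then have "\<forall>b\<in>{1..B}. (g b - m)\<^sup>2 = 0" by (subst (asm) sum_nonneg_eq_0_iff) auto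
 then have "(g 1 - m)\<^sup>2 = 0" "(g 2 - m)\<^sup>2 = 0" using assms by auto
 then show ?thesis by simp
qed

context dar_model
begin

text \<open>The quantifiers follow the dependence of the constants: \<open>E0\<close> and
  \<open>E1\<close> belong to the box, \<open>R6\<close> depends on the probability, and
  \<open>R\<close> comes afterwards, as in \<open>gamma_star_level_null\<close>. Indices 1 to 5 come
  from \<open>path_visits\<close> with threshold \<open>R\<close>. Index 6 comes from the first
  \<open>n6\<close> steps, where tightness bounds the previous value even for an explosive
  path.\<close>

lemma good_configuration:
 assumes c: "0 < c" "c <= C" and \<theta>0: "\<theta>\<^sub>0 \<in> param_box c C"
 obtains E0 E1 :: real where "2 <= E0" "C + 1 <= sqrt c * E0" "E0 <= E1"
  "\<And>\<tau>. \<tau> > 0 ==> \<exists>R6. \<forall>R>0. \<exists>n0. \<forall>n\<ge>n0. \<exists>N\<in>events. prob N <= \<tau> \<and>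
    (\<forall>x\<in>space M - N. \<exists>t. configuration c C E0 E1 R6 R n (sample y n x) t)"
proof -
 obtain H where H: "H >= 1"
  "\<And>\<theta> v. \<theta> \<in> param_box c C ==> 1 / H <= rho \<theta> v \<and> rho \<theta> v <= H \<and> \<bar>loc \<theta> v\<bar> <= H"
  by (rule param_box_bounds[OF c \<theta>0]) blast
 have H0: "1 / H > 0" using H(1) by simp
 \<comment> \<open>The range of the residuals over the box for innovations in
   \<open>{j..j + 1}\<close>: the slope lies between \<open>1 / H\<close> and \<open>H\<close>, and
   the intercept is at most \<open>H\<close> in modulus. \<open>nxt\<close> solves
   \<open>lo (nxt j) = hi j + 1\<close>, the separation by 1 that a configuration demands.\<close>
 define lo hi where "lo j = j / H - H" and "hi j = H * (j + 2)" for j :: real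
 define nxt where "nxt j = H * (hi j + 1 + H)" for j
 have sc: "sqrt c > 0" using c by simp
 define E0 where "E0 = max 2 ((C + 1) / sqrt c)"
 have E0: "2 <= E0" "C + 1 <= sqrt c * E0"
 proof -
  have "(C + 1) / sqrt c <= E0" by (simp add: E0_def)
  then show "C + 1 <= sqrt c * E0" using sc by (simp add: field_simps)
 qed (simp add: E0_def)
 define j1 where "j1 = H * (E0 + H)"
 define j2 where "j2 = nxt j1"
 define j3 where "j3 = nxt j2"
 define j4 where "j4 = nxt j3"
 define E1 where "E1 = hi j4"
 have lo_nxt: "lo (nxt j) = hi j + 1" for j using H(1) by (simp add: lo_def nxt_def)
 have lo1: "lo j1 = E0" using H(1) by (simp add: lo_def j1_def)
 have hi_ge: "j + 2 <= hi j" if "j >= 0" for j using mult_right_mono[OF H(1), of "j + 2"] that by (simp add: hi_def)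
 have nxt_ge: "j <= nxt j" if "j >= 0" for j
 proof -
  have "0 <= hi j + 1 + H" using hi_ge[OF that] that H(1) by linarith
  have "j <= 1 * (hi j + 1 + H)" unfolding mult_1_left using hi_ge[OF that] H(1) by linarith
  also have "\<dots> <= nxt j" unfolding nxt_def by (rule mult_right_mono[OF H(1) \<open>0 <= hi j + 1 + H\<close>])
  finally show ?thesis .
 qed
 have hi_mono: "hi j <= hi k" if "j <= k" for j k using H(1) that by (simp add: hi_def mult_left_mono)
 have "0 * 0 <= H * (E0 + H)" using H(1) E0 by (intro mult_mono) auto
 then have j: "0 <= j1" "j1 <= j2" "j2 <= j3" "j3 <= j4"
  using nxt_ge[of j1] nxt_ge[of j2] nxt_ge[of j3] unfolding j2_def[symmetric] j3_def[symmetric] j4_def[symmetric] by (auto simp: j1_def)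
 have hE: "hi j1 <= E1" unfolding E1_def by (rule hi_mono) (use j in linarith)
 have j1E: "E0 <= hi j1"
 proof -
  have "j1 / H <= H * j1" using H(1) j(1) mult_right_mono[of 1 "H * H" j1] mult_mono[of 1 H 1 H] by (simp add: field_simps)
  then show ?thesis using lo1 H(1) unfolding lo_def hi_def by (simp add: distrib_left)
 qed
 have pos_res: "lo j <= resid \<theta> (sample y n x) t \<and> resid \<theta> (sample y n x) t <= hi j"
  if "\<theta> \<in> param_box c C" "t \<in> {1..n}" "U t x \<in> {j..j + 1}" "j >= 0" for \<theta> n x t j
 proof -
  have r: "resid \<theta> (sample y n x) t = loc \<theta> (y (t - 1) x) + rho \<theta> (y (t - 1) x) * U t x"
   using that by (intro resid_path) auto
  note b = H(2)[OF that(1), of "y (t - 1) x"]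
  have "rho \<theta> (y (t - 1) x) >= 0" using b H0 by linarith
  note b = b this
  have u: "j <= U t x" "U t x <= j + 1" using that(3) by auto
  have "1 / H * j <= rho \<theta> (y (t - 1) x) * U t x" using b u that(4) H0 H(1) by (intro mult_mono) linarith+
  moreover have "rho \<theta> (y (t - 1) x) * U t x <= H * (j + 1)" using b u that(4) H(1) by (intro mult_mono) linarith+
  ultimately show ?thesis unfolding r lo_def hi_def using b by (simp add: distrib_left abs_le_iff)
 qed
 have neg_res: "- hi j <= resid \<theta> (sample y n x) t \<and> resid \<theta> (sample y n x) t <= - lo j"
  if "\<theta> \<in> param_box c C" "t \<in> {1..n}" "U t x \<in> {- j - 1..- j}" "j >= 0" for \<theta> n x t j
 proof -
  have r: "resid \<theta> (sample y n x) t = loc \<theta> (y (t - 1) x) - rho \<theta> (y (t - 1) x) * (- U t x)"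
   using that resid_path[of t n \<theta> x] by auto
  note b = H(2)[OF that(1), of "y (t - 1) x"]
  have "rho \<theta> (y (t - 1) x) >= 0" using b H0 by linarith
  note b = b this
  have u: "- j - 1 <= U t x" "U t x <= - j" using that(3) by auto
  have "1 / H * j <= rho \<theta> (y (t - 1) x) * (- U t x)" using b u that(4) H0 H(1) by (intro mult_mono) linarith+
  moreover have "rho \<theta> (y (t - 1) x) * (- U t x) <= H * (j + 1)" using b u that(4) H(1) by (intro mult_mono) linarith+
  ultimately show ?thesis unfolding r lo_def hi_def using b by (simp add: distrib_left abs_le_iff)
 qed
 \<comment> \<open>Left ends of the windows for the innovations; index 5 gets the mirror image of
   the first window.\<close>
 define a where "a i = (if i = 1 then j1 else if i = 2 then j2 else if i = 3 then j3 else if i = 4 then j4 else - j1 - 1)" for i :: nat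
 show ?thesis
 proof (rule that[of E0 E1])
  show "E0 <= E1" using hE j1E by linarith
  fix \<tau> :: real assume \<tau>: "\<tau> > 0"
  then have \<tau>4: "\<tau> / 4 > 0" "\<tau> / 10 > 0" by auto
  have S: "{s..s + 1} \<in> sets borel" "emeasure lborel {s..s + 1} \<noteq> 0" for s :: real by auto
  \<comment> \<open>For index 6 only the innovation matters here: the visit yields one in the first
    window within a fixed number of steps.\<close>
  obtain n6 where n6: "\<And>n. n >= n6 ==> \<exists>N\<in>events. prob N <= \<tau> / 4 \<and> (\<forall>x\<in>space M - N. \<exists>t\<in>{1..n}. y (t - 1) x >= 1 \<and> U t x \<in> {j1..j1 + 1})"
   by (rule path_visits[OF c \<theta>0 zero_less_one S[of j1] \<tau>4(1)], rule that)
  obtain N6 where N6: "N6 \<in> events" "prob N6 <= \<tau> / 4" "\<forall>x\<in>space M - N6. \<exists>t\<in>{1..n6}. y (t - 1) x >= 1 \<and> U t x \<in> {j1..j1 + 1}"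
   using n6[OF order.refl] by (elim bexE conjE) (rule that)
  obtain R6 N7 where N7: "N7 \<in> events" "prob N7 <= \<tau> / 4" "\<And>x t. x \<in> space M - N7 ==> t < n6 ==> \<bar>y t x\<bar> <= R6"
   by (rule path_tight[OF \<tau>4(1), of n6], rule that)
  show "\<exists>R6. \<forall>R>0. \<exists>n0. \<forall>n\<ge>n0. \<exists>N\<in>events. prob N <= \<tau> \<and> (\<forall>x\<in>space M - N. \<exists>t. configuration c C E0 E1 R6 R n (sample y n x) t)"
  proof (intro exI[of _ R6] allI impI)
   fix R :: real assume R: "R > 0"
   define Q where "Q n i N \<longleftrightarrow> N \<in> events \<and> prob N <= \<tau> / 10 \<and> (\<forall>x\<in>space M - N. \<exists>t\<in>{1..n}. y (t - 1) x >= R \<and> U t x \<in> {a i..a i + 1})"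
    for n :: nat and i :: nat and N
   have "\<forall>i. \<exists>m. \<forall>n\<ge>m. \<exists>N. Q n i N"
   proof
    fix i
    obtain m where m: "\<And>n. n >= m ==> \<exists>N\<in>events. prob N <= \<tau> / 10 \<and> (\<forall>x\<in>space M - N. \<exists>t\<in>{1..n}. y (t - 1) x >= R \<and> U t x \<in> {a i..a i + 1})"
     by (rule path_visits[OF c \<theta>0 R S[of "a i"] \<tau>4(2)], rule that)
    show "\<exists>m. \<forall>n\<ge>m. \<exists>N. Q n i N"
    proof (intro exI[of _ m] allI impI)
     fix n assume "n >= m"
     from m[OF this] show "\<exists>N. Q n i N" unfolding Q_def Bex_def .
    qed
   qed
   from choice[OF this] obtain m where m: "\<forall>i. \<forall>n\<ge>m i. \<exists>N. Q n i N" ..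
   show "\<exists>n0. \<forall>n\<ge>n0. \<exists>N\<in>events. prob N <= \<tau> \<and> (\<forall>x\<in>space M - N. \<exists>t. configuration c C E0 E1 R6 R n (sample y n x) t)"
   proof (intro exI[of _ "n6 + (\<Sum>i\<in>{1..5}. m i)"] allI impI)
    fix n assume n: "n >= n6 + (\<Sum>i\<in>{1..5}. m i)"
    have "\<forall>i\<in>{1..5}. \<exists>N. Q n i N"
    proof
     fix i :: nat assume "i \<in> {1..5}"
     then have "m i <= (\<Sum>i\<in>{1..5}. m i)" by (intro member_le_sum) auto
     then show "\<exists>N. Q n i N" using m n by simp
    qed
    from bchoice[OF this] obtain N where N: "\<forall>i\<in>{1..5}. Q n i (N i)" ..
    define NN where "NN = (\<Union>i\<in>{1..5}. N i) \<union> (N6 \<union> N7)"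
    have ev: "(\<Union>i\<in>{1..5}. N i) \<in> events" "N6 \<union> N7 \<in> events" using N N6 N7 by (auto simp: Q_def)
    have "prob (\<Union>i\<in>{1..5}. N i) <= (\<Sum>i\<in>{1..5::nat}. \<tau> / 10)"
     using N by (intro order.trans[OF finite_measure_subadditive_finite] sum_mono) (auto simp: Q_def)
    moreover have "prob (N6 \<union> N7) <= \<tau> / 4 + \<tau> / 4" using measure_Un_le[OF N6(1) N7(1)] N6 N7 by linarith
    ultimately have pr: "prob NN <= \<tau>" using measure_Un_le[OF ev] unfolding NN_def by simp
    have "\<exists>t. configuration c C E0 E1 R6 R n (sample y n x) t" if x: "x \<in> space M - NN" for x
    proof -
     have "\<forall>i\<in>{1..5}. \<exists>t. t \<in> {1..n} \<and> y (t - 1) x >= R \<and> U t x \<in> {a i..a i + 1}"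
     proof
      fix i :: nat assume i: "i \<in> {1..5}"
      then have "x \<in> space M - N i" using x by (auto simp: NN_def)
      then show "\<exists>t. t \<in> {1..n} \<and> y (t - 1) x >= R \<and> U t x \<in> {a i..a i + 1}" using N i unfolding Q_def by blast
     qed
     from bchoice[OF this] obtain t where t: "\<forall>i\<in>{1..5}. t i \<in> {1..n} \<and> y (t i - 1) x >= R \<and> U (t i) x \<in> {a i..a i + 1}" ..
     have "x \<in> space M - N6" using x by (simp add: NN_def)
     then obtain s where s: "s \<in> {1..n6}" "U s x \<in> {j1..j1 + 1}" using N6(3) by blast
     have "x \<in> space M - N7" using x by (simp add: NN_def)
     then have s6: "\<bar>y (s - 1) x\<bar> <= R6" using s by (intro N7(3)) auto
     define t' where "t' = t(6 := s)"
     have t't: "t' i = t i" if "i \<in> {1..5}" for i using that by (auto simp: t'_def)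
     have t'6: "t' 6 = s" by (simp add: t'_def)
     have sn: "s \<in> {1..n}" using s n by auto
     have sam: "sample y n x (r - 1) = y (r - 1) x" if "r \<in> {1..n}" for r using that by (auto simp: sample_def)
     have ti: "t i \<in> {1..n}" "y (t i - 1) x >= R" "U (t i) x \<in> {a i..a i + 1}" if "i \<in> {1..5}" for i using t that by blast+
     have "configuration c C E0 E1 R6 R n (sample y n x) t'"
      unfolding configuration_def
     proof (intro conjI ballI)
      show "t' i \<in> {1..n}" if "i \<in> {1..6}" for i
      proof (cases "i = 6")
       case False
       then have "i \<in> {1..5}" using that by auto
       then show ?thesis using ti(1) t't by simp
      qed (use sn t'6 in simp)
      show "R <= sample y n x (t' i - 1)" if "i \<in> {1..5}" for i
       using ti[OF that] by (simp only: t't[OF that] sam[OF ti(1)[OF that]])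
      show "\<bar>sample y n x (t' 6 - 1)\<bar> <= R6" using s6 by (simp only: t'6 sam[OF sn])
      fix \<theta> assume \<theta>: "\<theta> \<in> param_box c C"
      have i5: "1 \<in> {1..5::nat}" "2 \<in> {1..5::nat}" "3 \<in> {1..5::nat}" "4 \<in> {1..5::nat}" "5 \<in> {1..5::nat}" by auto
      have av: "a 1 = j1" "a 2 = j2" "a 3 = j3" "a 4 = j4" "a 5 = - j1 - 1" by (simp_all add: a_def)
      have j0: "0 <= j2" "0 <= j3" "0 <= j4" using j by linarith+
      note r1 = pos_res[OF \<theta> ti(1)[OF i5(1)] ti(3)[OF i5(1), unfolded av] j(1), folded t't[OF i5(1)]]
      note r2 = pos_res[OF \<theta> ti(1)[OF i5(2)] ti(3)[OF i5(2), unfolded av] j0(1), folded t't[OF i5(2)]]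
      note r3 = pos_res[OF \<theta> ti(1)[OF i5(3)] ti(3)[OF i5(3), unfolded av] j0(2), folded t't[OF i5(3)]]
      note r4 = pos_res[OF \<theta> ti(1)[OF i5(4)] ti(3)[OF i5(4), unfolded av] j0(3), folded t't[OF i5(4)]]
      have "U (t 5) x \<in> {- j1 - 1..- j1}" using ti(3)[OF i5(5), unfolded av] by simp
      note r5 = neg_res[OF \<theta> ti(1)[OF i5(5)] this j(1), folded t't[OF i5(5)]]
      note r6 = pos_res[OF \<theta> sn s(2) j(1), folded t'6]
      note l = lo_nxt[of j1, folded j2_def] lo_nxt[of j2, folded j3_def] lo_nxt[of j3, folded j4_def]
      show "E0 <= resid \<theta> (sample y n x) (t' 1)" using r1 lo1 by linarith
      show "resid \<theta> (sample y n x) (t' 1) + 1 <= resid \<theta> (sample y n x) (t' 2)" using r1 r2 l by linarith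
      show "resid \<theta> (sample y n x) (t' 2) + 1 <= resid \<theta> (sample y n x) (t' 3)" using r2 r3 l by linarith
      show "resid \<theta> (sample y n x) (t' 3) + 1 <= resid \<theta> (sample y n x) (t' 4)" using r3 r4 l by linarith
      show "resid \<theta> (sample y n x) (t' 4) <= E1" using r4 by (simp add: E1_def)
      show "- E1 <= resid \<theta> (sample y n x) (t' 5)" using r5 hE by linarith
      show "resid \<theta> (sample y n x) (t' 5) <= - E0" using r5 lo1 by linarith
      show "E0 <= resid \<theta> (sample y n x) (t' 6)" using r6 lo1 by linarith
      show "resid \<theta> (sample y n x) (t' 6) <= E1" using r6 hE by linarith
     qed
     then show ?thesis by (rule exI[of _ t'])
    qed
    then show "\<exists>N\<in>events. prob N <= \<tau> \<and> (\<forall>x\<in>space M - N. \<exists>t. configuration c C E0 E1 R6 R n (sample y n x) t)"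
     using pr ev by (intro bexI[of _ NN] conjI ballI) (auto simp: NN_def)
   qed
  qed
 qed (rule E0)+
qed

lemma sample_space: "x \<in> space M ==> sample y n x \<in> space (PiM {0..n} (\<lambda>_. borel))"
 by (auto simp: sample_def space_PiM)

lemma weight_vec_space: "weight_vec W n x b \<in> space (PiM {1..n} (\<lambda>_. borel))"
 by (auto simp: weight_vec_def space_PiM)

section \<open>Concentration of the estimates and of the bootstrap spread\<close>

lemma gamma_hat_concentration:
 fixes \<epsilon> :: real
 assumes c: "0 < c" "c <= C" and \<Theta>: "\<Theta> \<subseteq> param_box c C" "\<theta>\<^sub>0 \<in> \<Theta>"
  and est: "\<And>n. qml_estimator \<Theta> n (est n)" and \<epsilon>: "\<epsilon> > 0"
 obtains n0 where "\<And>n. n >= n0 ==> \<exists>N\<in>events. prob N <= real n powr (- (1/2)) \<and>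
  (\<forall>x\<in>space M - N. \<bar>gamma_hat n (sample y n x) (est n (sample y n x)) - lyapunov M \<phi>\<^sub>0 \<alpha>\<^sub>0 (\<eta> 1)\<bar> <= \<epsilon>)"
proof -
 have \<theta>0: "\<theta>\<^sub>0 \<in> param_box c C" using \<Theta> by blast
 define \<gamma> where "\<gamma> = lyapunov M \<phi>\<^sub>0 \<alpha>\<^sub>0 (\<eta> 1)"
 obtain n0 where n0: "\<And>n W. weights M \<eta> y f \<phi>\<^sub>0 \<alpha>\<^sub>0 \<omega>\<^sub>0 n W ==> n >= n0 ==>
   \<exists>N\<in>events. prob N <= real n powr (- (1/2)) \<and> (\<forall>x\<in>space M - N. \<forall>\<theta>\<in>param_box c C.
    no_worse n W x \<theta> -->
    (\<forall>k\<in>{1,2}. \<bar>(\<Sum>t\<in>kept k n (sample y n x) \<theta>. W t x * ln \<bar>root_arg k (sample y n x) t \<theta>\<bar>) / n - \<gamma>\<bar> <= \<epsilon>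
     \<and> \<bar>(\<Sum>t\<in>kept k n (sample y n x) \<theta>. W t x) / n - 1\<bar> <= \<epsilon>))"
  by (rule log_mean_consistency[OF c \<theta>0 \<epsilon>, folded \<gamma>_def], rule that)
 show ?thesis
 proof (rule that[of "max 1 n0"], fold \<gamma>_def)
  fix n assume n: "n >= max 1 n0"
  then have n1: "n >= 1" "n >= n0" by auto
  obtain N where N: "N \<in> events" "prob N <= real n powr (- (1/2))" "\<forall>x\<in>space M - N. \<forall>\<theta>\<in>param_box c C.
    (\<Sum>t=1..n. 1 * qml_loss (sample y n x) t \<theta>) <= (\<Sum>t=1..n. 1 * qml_loss (sample y n x) t \<theta>\<^sub>0) -->
    (\<forall>k\<in>{1,2}. \<bar>(\<Sum>t\<in>kept k n (sample y n x) \<theta>. 1 * ln \<bar>root_arg k (sample y n x) t \<theta>\<bar>) / n - \<gamma>\<bar> <= \<epsilon>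
     \<and> \<bar>(\<Sum>t\<in>kept k n (sample y n x) \<theta>. 1) / n - 1\<bar> <= \<epsilon>)"
   using n0[OF weights_one[OF n1(1)] n1(2)] by (elim bexE conjE) (rule that)
  have "\<bar>gamma_hat n (sample y n x) (est n (sample y n x)) - \<gamma>\<bar> <= \<epsilon>" if x: "x \<in> space M - N" for x
  proof -
   define Y where "Y = sample y n x"
   define \<theta> where "\<theta> = est n Y"
   have "Y \<in> space (PiM {0..n} (\<lambda>_. borel))" unfolding Y_def using x by (intro sample_space) simp
   then have "is_arg_min (L n Y) (\<lambda>\<theta>. \<theta> \<in> \<Theta>) \<theta>" using est[of n] unfolding qml_estimator_def \<theta>_def by blast
   then have \<theta>: "\<theta> \<in> \<Theta>" "L n Y \<theta> <= L n Y \<theta>\<^sub>0"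
    using \<Theta>(2) unfolding is_arg_min_linorder by blast+
   have k: "\<forall>k\<in>{1,2}. \<bar>(\<Sum>t\<in>kept k n Y \<theta>. 1 * ln \<bar>root_arg k Y t \<theta>\<bar>) / n - \<gamma>\<bar> <= \<epsilon>
     \<and> \<bar>(\<Sum>t\<in>kept k n Y \<theta>. 1) / n - 1\<bar> <= \<epsilon>"
    using N(3) x \<theta> \<Theta>(1) unfolding Y_def L_def by (simp only: mult_1_left) blast
   define S where "S k = (\<Sum>t\<in>kept k n Y \<theta>. ln \<bar>root_arg k Y t \<theta>\<bar>)" for k
   have "\<bar>S 1 / n - \<gamma>\<bar> <= \<epsilon>" "\<bar>S 2 / n - \<gamma>\<bar> <= \<epsilon>" using k by (auto simp: S_def)
   moreover have "gamma_hat n Y \<theta> = (S 1 / n + S 2 / n) / 2" unfolding gamma_hat_eq S_def[symmetric] by (simp add: add_divide_distrib)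
   ultimately show ?thesis unfolding Y_def[symmetric] \<theta>_def[symmetric] by (simp add: abs_le_iff field_simps)
  qed
  then show "\<exists>N\<in>events. prob N <= real n powr (- (1/2)) \<and> (\<forall>x\<in>space M - N. \<bar>gamma_hat n (sample y n x) (est n (sample y n x)) - \<gamma>\<bar> <= \<epsilon>)"
   using N by blast
 qed
qed

lemma gamma_star_concentration:
 fixes \<epsilon> :: real
 assumes c: "0 < c" "c <= C" and \<Theta>: "\<Theta> \<subseteq> param_box c C" "\<theta>\<^sub>0 \<in> \<Theta>"
  and est: "\<And>n. bootstrap_estimator \<Theta> n (est n)" and \<epsilon>: "\<epsilon> > 0"
 obtains n0 where "\<And>n B W b. n >= n0 ==> bootstrap_weights M n B y W ==> b \<in> {1..B} ==>
  \<exists>N\<in>events. prob N <= real n powr (- (1/2)) \<and>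
  (\<forall>x\<in>space M - N. \<bar>boot_gamma (est n) n (sample y n x) (weight_vec W n x) b - lyapunov M \<phi>\<^sub>0 \<alpha>\<^sub>0 (\<eta> 1)\<bar> <= \<epsilon>)"
proof -
 have \<theta>0: "\<theta>\<^sub>0 \<in> param_box c C" using \<Theta> by blast
 define \<gamma> where "\<gamma> = lyapunov M \<phi>\<^sub>0 \<alpha>\<^sub>0 (\<eta> 1)"
 \<comment> \<open>The accuracy of numerator and denominator for which \<open>ratio_close\<close>
   gives accuracy \<open>\<epsilon>\<close> of the quotient.\<close>
 define e where "e = min (1 / 2) (\<epsilon> / (2 * (1 + \<bar>\<gamma>\<bar>)))"
 have e: "e > 0" "e <= 1 / 2"
  unfolding e_def using \<epsilon> by (simp add: add_pos_nonneg, intro min.cobounded1)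
 have e\<epsilon>: "2 * (1 + \<bar>\<gamma>\<bar>) * e <= \<epsilon>"
 proof -
  have g: "2 * (1 + \<bar>\<gamma>\<bar>) > 0" by (simp add: add_pos_nonneg)
  then have "2 * (1 + \<bar>\<gamma>\<bar>) * e <= 2 * (1 + \<bar>\<gamma>\<bar>) * (\<epsilon> / (2 * (1 + \<bar>\<gamma>\<bar>)))" by (intro mult_left_mono) (auto simp: e_def)
  also have "\<dots> = \<epsilon>" using g by simp
  finally show ?thesis .
 qed
 obtain n0 where n0: "\<And>n W. weights M \<eta> y f \<phi>\<^sub>0 \<alpha>\<^sub>0 \<omega>\<^sub>0 n W ==> n >= n0 ==>
   \<exists>N\<in>events. prob N <= real n powr (- (1/2)) \<and> (\<forall>x\<in>space M - N. \<forall>\<theta>\<in>param_box c C.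
    no_worse n W x \<theta> -->
    (\<forall>k\<in>{1,2}. \<bar>(\<Sum>t\<in>kept k n (sample y n x) \<theta>. W t x * ln \<bar>root_arg k (sample y n x) t \<theta>\<bar>) / n - \<gamma>\<bar> <= e
     \<and> \<bar>(\<Sum>t\<in>kept k n (sample y n x) \<theta>. W t x) / n - 1\<bar> <= e))"
  by (rule log_mean_consistency[OF c \<theta>0 e(1), folded \<gamma>_def], rule that)
 show ?thesis
 proof (rule that[of "max 1 n0"], fold \<gamma>_def)
  fix n B W b assume n: "n >= max 1 n0" and W: "bootstrap_weights M n B y W" and b: "b \<in> {1..B}"
  then have n1: "n >= 1" "n >= n0" by auto
  obtain N where N: "N \<in> events" "prob N <= real n powr (- (1/2))" "\<forall>x\<in>space M - N. \<forall>\<theta>\<in>param_box c C.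
    no_worse n (W b) x \<theta> -->
    (\<forall>k\<in>{1,2}. \<bar>(\<Sum>t\<in>kept k n (sample y n x) \<theta>. W b t x * ln \<bar>root_arg k (sample y n x) t \<theta>\<bar>) / n - \<gamma>\<bar> <= e
     \<and> \<bar>(\<Sum>t\<in>kept k n (sample y n x) \<theta>. W b t x) / n - 1\<bar> <= e)"
   using n0[OF weights_bootstrap[OF W n1(1) b] n1(2)] by (elim bexE conjE) (rule that)
  have "\<bar>boot_gamma (est n) n (sample y n x) (weight_vec W n x) b - \<gamma>\<bar> <= \<epsilon>" if x: "x \<in> space M - N" for x
  proof -
   define Y where "Y = sample y n x"
   define w where "w = weight_vec W n x b"
   define \<theta> where "\<theta> = est n w Y"
   have w: "W b t x = w t" if "t \<in> {1..n}" for t using that by (simp add: w_def weight_vec_def)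
   have "Y \<in> space (PiM {0..n} (\<lambda>_. borel))" unfolding Y_def using x by (intro sample_space) simp
   moreover have "w \<in> space (PiM {1..n} (\<lambda>_. borel))" unfolding w_def by (rule weight_vec_space)
   ultimately have "is_arg_min (L_star n w Y) (\<lambda>\<theta>. \<theta> \<in> \<Theta>) \<theta>" using est[of n] unfolding bootstrap_estimator_def \<theta>_def by blast
   then have \<theta>: "\<theta> \<in> \<Theta>" "L_star n w Y \<theta> <= L_star n w Y \<theta>\<^sub>0"
    using \<Theta>(2) unfolding is_arg_min_linorder by blast+
   have Le: "(\<Sum>t=1..n. W b t x * qml_loss Y t \<theta>) = L_star n w Y \<theta>" for \<theta> unfolding L_star_def using w by simp
   have S: "(\<Sum>t\<in>kept k n Y \<theta>. W b t x * h t) = (\<Sum>t\<in>kept k n Y \<theta>. w t * h t)" "(\<Sum>t\<in>kept k n Y \<theta>. W b t x) = (\<Sum>t\<in>kept k n Y \<theta>. w t)" for k h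
    using w kept_subset[of k n Y \<theta>] by (auto intro!: sum.cong)
   have "\<forall>k\<in>{1,2}. \<bar>(\<Sum>t\<in>kept k n Y \<theta>. W b t x * ln \<bar>root_arg k Y t \<theta>\<bar>) / n - \<gamma>\<bar> <= e \<and> \<bar>(\<Sum>t\<in>kept k n Y \<theta>. W b t x) / n - 1\<bar> <= e"
    using N(3)[folded Y_def, rule_format, OF x] N(3) x \<theta> \<Theta>(1) unfolding Y_def[symmetric] Le
    using N(3)[rule_format, OF x, folded Y_def, unfolded Le] by blast
   then have k: "\<bar>(\<Sum>t\<in>kept k n Y \<theta>. w t * ln \<bar>root_arg k Y t \<theta>\<bar>) / n - \<gamma>\<bar> <= e \<and> \<bar>(\<Sum>t\<in>kept k n Y \<theta>. w t) / n - 1\<bar> <= e"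
    if "k \<in> {1, 2}" for k unfolding S using that by blast
   have part: "\<bar>gamma_star_part k n w Y \<theta> - \<gamma>\<bar> <= \<epsilon>" if "k \<in> {1, 2}" for k
   proof -
    have "gamma_star_part k n w Y \<theta> = ((\<Sum>t\<in>kept k n Y \<theta>. w t * ln \<bar>root_arg k Y t \<theta>\<bar>) / n) / ((\<Sum>t\<in>kept k n Y \<theta>. w t) / n)"
     unfolding gamma_star_part_eq weighted_mean_def using n1(1) by simp
    then show ?thesis using ratio_close[OF conjunct1[OF k[OF that]] conjunct2[OF k[OF that]] e(2)] e\<epsilon> by linarith
   qed
   have "boot_gamma (est n) n Y (weight_vec W n x) b = (gamma_star_part 1 n w Y \<theta> + gamma_star_part 2 n w Y \<theta>) / 2"
    unfolding boot_gamma_def gamma_star_def w_def[symmetric] \<theta>_def by (rule refl)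
   then show ?thesis using part[of 1] part[of 2] unfolding Y_def[symmetric] by (simp add: abs_le_iff field_simps)
  qed
  then show "\<exists>N\<in>events. prob N <= real n powr (- (1/2)) \<and> (\<forall>x\<in>space M - N. \<bar>boot_gamma (est n) n (sample y n x) (weight_vec W n x) b - \<gamma>\<bar> <= \<epsilon>)"
   using N by blast
 qed
qed

end

lemma log_square_rate: "(\<lambda>n. 2 * (2 * ln (real n) + g)\<^sup>2 * real n powr (- (1/2))) \<longlonglongrightarrow> 0" for g :: real
 by real_asymp

context dar_model
begin

lemma sample_measurable: "sample y n \<in> measurable M (PiM {0..n} (\<lambda>_. borel))"
 unfolding sample_def[abs_def] by measurable

lemma boot_gamma_measurable:
 assumes W: "bootstrap_weights M n B y W" and est: "bootstrap_estimator \<Theta> n est" and b: "b \<in> {1..B}"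
 shows "(\<lambda>x. boot_gamma est n (sample y n x) (weight_vec W n x) b) \<in> borel_measurable M"
proof -
 have m: "case_prod est \<in> borel_measurable (PiM {1..n} (\<lambda>_. borel) \<Otimes>\<^sub>M PiM {0..n} (\<lambda>_. borel))"
  using est by (simp add: bootstrap_estimator_def)
 have w: "(\<lambda>x. weight_vec W n x b) \<in> measurable M (PiM {1..n} (\<lambda>_. borel))" by (rule weight_vec_measurable[OF W b])
 have "(\<lambda>x. case_prod est (weight_vec W n x b, sample y n x)) \<in> borel_measurable M"
  by (rule measurable_compose[OF measurable_Pair[OF w sample_measurable] m])
 then have g: "(\<lambda>x. est (weight_vec W n x b) (sample y n x)) \<in> borel_measurable M" by simp
 show ?thesis unfolding boot_gamma_def by (rule measurable_gamma_star[OF sample_measurable g w])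
qed

lemma boot_gamma_bound:
 assumes W: "bootstrap_weights M n B y W" and n: "n >= 1" and b: "b \<in> {1..B}"
 shows "AE x in M. \<bar>boot_gamma est n (sample y n x) (weight_vec W n x) b\<bar> <= 2 * ln (real n)"
 using AE_weight_pos[OF W]
proof eventually_elim
 case (elim x)
 show ?case unfolding boot_gamma_def
  by (rule gamma_star_bound[OF n]) (use elim b in \<open>auto simp: weight_vec_def intro: less_imp_le\<close>)
qed

text \<open>Each replicate has a small second moment about \<open>\<gamma>\<close>: the squared
  accuracy off its exceptional event, and on it a multiple of a squared logarithm times the
  probability. By linearity of expectation no joint control of the replicates is required, so the
  bound is uniform in \<open>B\<close>.\<close>

lemma bootstrap_spread:
 fixes \<sigma> \<tau> :: real
 assumes c: "0 < c" "c <= C" and \<Theta>: "\<Theta> \<subseteq> param_box c C" "\<theta>\<^sub>0 \<in> \<Theta>"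
  and est: "\<And>n. bootstrap_estimator \<Theta> n (est n)" and \<sigma>: "\<sigma> > 0" and \<tau>: "\<tau> > 0"
 obtains n0 where "\<And>n B W. n >= n0 ==> B >= 2 ==> bootstrap_weights M n B y W ==>
  \<exists>N\<in>events. prob N <= \<tau> \<and> (\<forall>x\<in>space M - N. sigma2_hat n B (boot_gamma (est n) n (sample y n x) (weight_vec W n x)) / n < \<sigma>)"
proof -
 define \<gamma> where "\<gamma> = lyapunov M \<phi>\<^sub>0 \<alpha>\<^sub>0 (\<eta> 1)"
 \<comment> \<open>Makes \<open>2 * \<epsilon>\<^sup>2\<close> half of
   \<open>\<sigma> * \<tau>\<close>, the bound on the mean of \<open>Z\<close> from which Markov's
   inequality gives probability \<open>\<tau>\<close>.\<close>
 define \<epsilon> where "\<epsilon> = sqrt (\<sigma> * \<tau>) / 2"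
 have \<epsilon>: "\<epsilon> > 0" "2 * \<epsilon>\<^sup>2 = \<sigma> * \<tau> / 2" using \<sigma> \<tau> by (auto simp: \<epsilon>_def power_divide)
 obtain n1 where n1: "\<And>n B W b. n >= n1 ==> bootstrap_weights M n B y W ==> b \<in> {1..B} ==>
  \<exists>N\<in>events. prob N <= real n powr (- (1/2)) \<and>
  (\<forall>x\<in>space M - N. \<bar>boot_gamma (est n) n (sample y n x) (weight_vec W n x) b - \<gamma>\<bar> <= \<epsilon>)"
  by (rule gamma_star_concentration[OF c \<Theta> est \<epsilon>(1), folded \<gamma>_def], rule that)
 have "\<sigma> * \<tau> / 2 > 0" using \<sigma> \<tau> by simp
 from order_tendstoD(2)[OF log_square_rate[of "\<bar>\<gamma>\<bar>"] this]
 obtain n2 where n2: "\<forall>n\<ge>n2. 2 * (2 * ln (real n) + \<bar>\<gamma>\<bar>)\<^sup>2 * real n powr (- (1/2)) < \<sigma> * \<tau> / 2"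
  unfolding eventually_sequentially ..
 show ?thesis
 proof (rule that[of "max 1 (max n1 n2)"])
  fix n B :: nat and W assume n: "n >= max 1 (max n1 n2)" and B: "B >= 2" and W: "bootstrap_weights M n B y W"
  then have n': "n >= 1" "n >= n1" "n >= n2" by auto
  define g where "g x b = boot_gamma (est n) n (sample y n x) (weight_vec W n x) b" for x b
  define K where "K = (2 * ln (real n) + \<bar>\<gamma>\<bar>)\<^sup>2"
  have g_meas: "(\<lambda>x. g x b) \<in> borel_measurable M" if "b \<in> {1..B}" for b
   unfolding g_def by (rule boot_gamma_measurable[OF W est that])
  have K: "AE x in M. (g x b - \<gamma>)\<^sup>2 <= K" if "b \<in> {1..B}" for b
   using boot_gamma_bound[OF W n'(1) that, of "est n"]
  proof eventually_elim
   case (elim x)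
   then have "\<bar>g x b - \<gamma>\<bar> <= 2 * ln (real n) + \<bar>\<gamma>\<bar>" unfolding g_def by linarith
   then show ?case unfolding K_def by (metis abs_ge_zero power2_abs power_mono)
  qed
  have sq_meas: "(\<lambda>x. (g x b - \<gamma>)\<^sup>2) \<in> borel_measurable M" if "b \<in> {1..B}" for b
   using g_meas[OF that] by simp
  have int: "integrable M (\<lambda>x. (g x b - \<gamma>)\<^sup>2)" if "b \<in> {1..B}" for b
   by (rule integrable_const_bound[of _ K]) (use K[OF that] sq_meas[OF that] in simp_all)
  have E: "expectation (\<lambda>x. (g x b - \<gamma>)\<^sup>2) <= \<epsilon>\<^sup>2 + K * real n powr (- (1/2))" if b: "b \<in> {1..B}" for b
  proof -
   obtain N where N: "N \<in> events" "prob N <= real n powr (- (1/2))" "\<forall>x\<in>space M - N. \<bar>g x b - \<gamma>\<bar> <= \<epsilon>"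
    using n1[OF n'(2) W b, folded g_def] by (elim bexE conjE) (rule that)
   have K0: "K >= 0" by (simp add: K_def)
   have intN: "integrable M (\<lambda>x. K * indicator N x)" using N(1) by (simp add: emeasure_eq_measure)
   have "expectation (\<lambda>x. (g x b - \<gamma>)\<^sup>2) <= expectation (\<lambda>x. \<epsilon>\<^sup>2 + K * indicator N x)"
   proof (rule integral_mono_AE)
    show "AE x in M. (g x b - \<gamma>)\<^sup>2 <= \<epsilon>\<^sup>2 + K * indicator N x"
     using K[OF b] AE_space
    proof eventually_elim
     case (elim x)
     show ?case
     proof (cases "x \<in> N")
      case False
      then have "\<bar>g x b - \<gamma>\<bar> <= \<epsilon>" using N(3) elim by blast
      then have "\<bar>g x b - \<gamma>\<bar>\<^sup>2 <= \<epsilon>\<^sup>2" by (intro power_mono) auto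
      then show ?thesis using False by simp
     qed (use elim in \<open>simp add: add_increasing\<close>)
    qed
   qed (use int[OF b] intN in simp_all)
   also have "\<dots> = \<epsilon>\<^sup>2 + K * prob N" using N(1) intN prob_space by simp
   also have "\<dots> <= \<epsilon>\<^sup>2 + K * real n powr (- (1/2))" using N(2) K0 by (intro add_left_mono mult_left_mono)
   finally show ?thesis .
  qed
  define Z where "Z x = 2 / B * (\<Sum>b=1..B. (g x b - \<gamma>)\<^sup>2)" for x
  have intZ: "integrable M Z" unfolding Z_def[abs_def] using int by (intro integrable_mult_right Bochner_Integration.integrable_sum) auto
  have Z0: "Z x >= 0" for x unfolding Z_def by (intro mult_nonneg_nonneg sum_nonneg) auto
  have "expectation Z = 2 / B * (\<Sum>b=1..B. expectation (\<lambda>x. (g x b - \<gamma>)\<^sup>2))"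
   unfolding Z_def using int by (subst Bochner_Integration.integral_mult_right_zero, subst Bochner_Integration.integral_sum) auto
  also have "\<dots> <= 2 / B * (\<Sum>b=1..B. \<epsilon>\<^sup>2 + K * real n powr (- (1/2)))" using E by (intro mult_left_mono sum_mono) auto
  also have "\<dots> = 2 * \<epsilon>\<^sup>2 + 2 * K * real n powr (- (1/2))" using B by (simp add: algebra_simps)
  also have "\<dots> <= \<sigma> * \<tau> / 2 + \<sigma> * \<tau> / 2" using n2 n'(3) \<epsilon>(2) unfolding K_def by (intro add_mono) (auto intro: less_imp_le)
  finally have EZ: "expectation Z <= \<sigma> * \<tau>" by simp
  define N where "N = {x \<in> space M. \<sigma> <= Z x}"
  have N: "N \<in> events" unfolding N_def using borel_measurable_integrable[OF intZ] by measurable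
  have "prob N <= expectation Z / \<sigma>" unfolding N_def
   by (rule integral_Markov_inequality_measure[where A = "{}"]) (use intZ Z0 \<sigma> in auto)
  also have "\<dots> <= \<tau>" using EZ \<sigma> by (simp add: divide_le_eq mult.commute)
  finally have "prob N <= \<tau>" .
  moreover have "sigma2_hat n B (g x) / n < \<sigma>" if "x \<in> space M - N" for x
  proof -
   have "Z x < \<sigma>" using that by (auto simp: N_def not_le)
   then show ?thesis using sigma2_hat_le[OF n'(1) B, of "g x" \<gamma>] unfolding Z_def by linarith
  qed
  ultimately show "\<exists>N\<in>events. prob N <= \<tau> \<and> (\<forall>x\<in>space M - N. sigma2_hat n B (boot_gamma (est n) n (sample y n x) (weight_vec W n x)) / n < \<sigma>)"
   using N unfolding g_def by (intro bexI[of _ N] conjI ballI) (auto simp: g_def[abs_def] eta_contract_eq)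
 qed
qed

section \<open>Distinct replicates\<close>

lemma weight_vec_law:
 assumes W: "bootstrap_weights M n B y W" and n: "n >= 1" and b: "b \<in> {1..B}"
 shows "distr M (PiM {1..n} (\<lambda>_. borel)) (\<lambda>x. weight_vec W n x b)
  = PiM {1..n} (\<lambda>_. density lborel (\<lambda>u. ennreal (exponential_density 1 u)))"
proof -
 define I where "I = {1..B} \<times> {1..n}"
 define P where "P = density lborel (\<lambda>u. ennreal (exponential_density 1 u))"
 define X where "X i = (case i of (b, t) => W b t)" for i
 have I: "I \<noteq> {}" using n b by (auto simp: I_def)
 have iv: "indep_vars (\<lambda>_. borel) X I" using W unfolding bootstrap_weights_def I_def X_def[abs_def] by blast
 have X: "X i \<in> borel_measurable M" if "i \<in> I" for i using that weight_measurable[OF W] by (auto simp: X_def I_def)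
 have law: "distr M borel (X i) = P" if "i \<in> I" for i
  using that distributed_distr_eq_density[OF weight_law[OF W]] by (auto simp: X_def I_def P_def cong: distr_cong)
 have pP: "prob_space P" unfolding law[symmetric, of "(b, 1)"] using prob_space_exponential_density[of 1] by (simp add: P_def)
 have Pi: "distr M (PiM I (\<lambda>_. borel)) (\<lambda>x. \<lambda>i\<in>I. X i x) = PiM I (\<lambda>_. P)"
 proof -
  have "distr M (PiM I (\<lambda>_. borel)) (\<lambda>x. \<lambda>i\<in>I. X i x) = PiM I (\<lambda>i. distr M borel (X i))"
   by (rule iffD1[OF indep_vars_iff_distr_eq_PiM'[where M' = "\<lambda>_. borel", OF I X] iv])
  also have "\<dots> = PiM I (\<lambda>_. P)" by (intro PiM_cong refl law)
  finally show ?thesis .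
 qed
 define pr where "pr z = (\<lambda>t\<in>{1..n}. z (b, t))" for z :: "nat \<times> nat => real"
 have bt: "(b, t) \<in> I" if "t \<in> {1..n}" for t using that b by (auto simp: I_def)
 have pr: "pr \<in> measurable (PiM I (\<lambda>_. borel)) (PiM {1..n} (\<lambda>_. borel))"
  unfolding pr_def[abs_def] by (intro measurable_restrict measurable_component_singleton bt)
 have "distr M (PiM {1..n} (\<lambda>_. borel)) (\<lambda>x. weight_vec W n x b)
   = distr M (PiM {1..n} (\<lambda>_. borel)) (\<lambda>x. pr (\<lambda>i\<in>I. X i x))"
 proof -
  have "weight_vec W n x b = pr (\<lambda>i\<in>I. X i x)" for x
   unfolding weight_vec_def pr_def by (intro restrict_ext) (use bt in \<open>auto simp: X_def\<close>)
  then show ?thesis by simp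
 qed
 also have "\<dots> = distr (distr M (PiM I (\<lambda>_. borel)) (\<lambda>x. \<lambda>i\<in>I. X i x)) (PiM {1..n} (\<lambda>_. borel)) pr"
  using X by (subst distr_distr[OF pr]) (auto simp: comp_def intro!: measurable_restrict)
 also have "\<dots> = distr (PiM I (\<lambda>_. P)) (PiM {1..n} (\<lambda>_. P)) pr"
  unfolding Pi by (rule distr_cong) (auto intro!: sets_PiM_cong simp: P_def)
 also have "\<dots> = PiM {1..n} (\<lambda>_. P)"
  unfolding pr_def[abs_def] by (rule distr_PiM_reindex[of I "\<lambda>_. P" "\<lambda>t. (b, t)"]) (use pP bt in \<open>auto simp: inj_on_def\<close>)
 finally show ?thesis unfolding P_def .
qed

text \<open>Replicate 2 stands first in the pair because it is held fixed while replicate 1 is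
  integrated over.\<close>

lemma weight_vec_pair:
 assumes W: "bootstrap_weights M n B y W" and B: "2 <= B"
 defines "P \<equiv> PiM {1..n} (\<lambda>_. borel :: real measure)"
 shows "distr M (P \<Otimes>\<^sub>M P) (\<lambda>x. (weight_vec W n x 2, weight_vec W n x 1))
   = distr M P (\<lambda>x. weight_vec W n x 2) \<Otimes>\<^sub>M distr M P (\<lambda>x. weight_vec W n x 1)" (is ?pair)
  and "indep_rv M (PiM {0..n} (\<lambda>_. borel)) (sample y n) (P \<Otimes>\<^sub>M P) (\<lambda>x. (weight_vec W n x 2, weight_vec W n x 1))" (is ?ind)
proof -
 define I where "I = {1..B} \<times> {1..n}"
 define X where "X i = (case i of (b, t) => W b t)" for i
 define J where "J b = {b} \<times> {1..n}" for b :: nat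
 define pr where "pr b z = (\<lambda>t\<in>{1..n}. z (b, t))" for b and z :: "nat \<times> nat => real"
 have iv: "indep_vars (\<lambda>_. borel) X I" using W unfolding bootstrap_weights_def I_def X_def[abs_def] by blast
 have pr: "pr b \<in> measurable (PiM S (\<lambda>_. borel)) P" if "J b \<subseteq> S" for b S
  unfolding pr_def[abs_def] P_def by (intro measurable_restrict measurable_component_singleton) (use that in \<open>auto simp: J_def\<close>)
 have w: "pr b (\<lambda>i\<in>S. X i x) = weight_vec W n x b" if "J b \<subseteq> S" for b S x
 proof -
  have "(b, t) \<in> S" if "t \<in> {1..n}" for t
   using \<open>J b \<subseteq> S\<close> that by (intro subsetD[of "J b" S]) (auto simp: J_def)
  then show ?thesis unfolding weight_vec_def pr_def by (intro restrict_ext) (simp add: X_def)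
 qed
 have JI: "J 1 \<subseteq> I" "J 2 \<subseteq> I" using B by (auto simp: J_def I_def)
 have "indep_var (PiM (J 2) (\<lambda>_. borel)) (\<lambda>x. \<lambda>i\<in>J 2. X i x) (PiM (J 1) (\<lambda>_. borel)) (\<lambda>x. \<lambda>i\<in>J 1. X i x)"
  by (rule indep_var_restrict[OF iv]) (use JI in \<open>auto simp: J_def\<close>)
 from indep_var_compose[OF this pr[OF order.refl] pr[OF order.refl]]
 have "indep_var P (\<lambda>x. weight_vec W n x 2) P (\<lambda>x. weight_vec W n x 1)" unfolding comp_def w[OF order.refl] .
 then show ?pair unfolding indep_var_distribution_eq by simp
 have ind: "indep_rv M (PiM {0..n} (\<lambda>_. borel)) (sample y n) (PiM I (\<lambda>_. borel)) (\<lambda>x. \<lambda>i\<in>I. X i x)"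
 proof -
  have "(\<lambda>(b, t)\<in>I. W b t x) = (\<lambda>i\<in>I. X i x)" for x by (intro restrict_ext) (auto simp: X_def)
  then show ?thesis using W by (simp add: bootstrap_weights_def I_def)
 qed
 have "(\<lambda>z. (pr 2 z, pr 1 z)) \<in> measurable (PiM I (\<lambda>_. borel)) (P \<Otimes>\<^sub>M P)"
  by (rule measurable_Pair[OF pr[OF JI(2)] pr[OF JI(1)]])
 from indep_rv_compose_right[OF ind this] show ?ind unfolding w[OF JI(1)] w[OF JI(2)] .
qed

text \<open>Fubini: given data and replicate 2, a tie places replicate 1 in the level set of one
  fixed value, which the premise declares null.\<close>

lemma replicates_differ_AE:
 assumes W: "bootstrap_weights M n B y W" and B: "2 <= B" and n: "n >= 1" and est: "bootstrap_estimator \<Theta> n est"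
 shows "AE x in M. (\<forall>\<gamma>. {w \<in> space (PiM {1..n} (\<lambda>_. borel)). (\<forall>t\<in>{1..n}. w t > 0) \<and> gamma_star n w (sample y n x) (est w (sample y n x)) = \<gamma>}
    \<in> null_sets (PiM {1..n} (\<lambda>_. lborel))) -->
   boot_gamma est n (sample y n x) (weight_vec W n x) 1 \<noteq> boot_gamma est n (sample y n x) (weight_vec W n x) 2"
proof -
 define P where "P = PiM {1..n} (\<lambda>_. borel :: real measure)"
 define P0 where "P0 = PiM {0..n} (\<lambda>_. borel :: real measure)"
 define v where "v b x = weight_vec W n x b" for b x
 define D where "D b = distr M P (v b)" for b
 define D2 where "D2 = D 2 \<Otimes>\<^sub>M D 1"
 define G where "G Y w = gamma_star n w Y (est w Y)" for Y w
 define E where "E = density lborel (\<lambda>u. ennreal (exponential_density 1 u))"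
 have b12: "1 \<in> {1..B}" "2 \<in> {1..B}" using B by auto
 have v: "v 1 \<in> measurable M P" "v 2 \<in> measurable M P"
  unfolding v_def[abs_def] P_def by (rule weight_vec_measurable[OF W b12(1)], rule weight_vec_measurable[OF W b12(2)])
 have D1: "D 1 = PiM {1..n} (\<lambda>_. E)"
  unfolding D_def P_def v_def[abs_def] E_def by (rule weight_vec_law[OF W n b12(1)])
 have pD: "prob_space (D 1)" "prob_space (D 2)" unfolding D_def by (rule prob_space_distr[OF v(1)], rule prob_space_distr[OF v(2)])
 interpret D1: prob_space "D 1" by (rule pD)
 interpret D2: prob_space "D 2" by (rule pD)
 interpret DD: pair_prob_space "D 2" "D 1" by standard
 have setsD: "sets (D b) = sets P" for b by (simp add: D_def)
 have setsD2: "sets D2 = sets (P \<Otimes>\<^sub>M P)" unfolding D2_def by (intro sets_pair_measure_cong setsD)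
 have pD2: "prob_space D2" unfolding D2_def by (rule DD.P.prob_space_axioms)
 have estm: "case_prod est \<in> borel_measurable (P \<Otimes>\<^sub>M P0)" using est by (simp add: bootstrap_estimator_def P_def P0_def)
 have Gm: "(\<lambda>z. G (f z) (h z)) \<in> borel_measurable N" if f: "f \<in> measurable N P0" and h: "h \<in> measurable N P" for f h and N :: "'z measure"
 proof -
  have "(\<lambda>z. case_prod est (h z, f z)) \<in> borel_measurable N" by (rule measurable_compose[OF measurable_Pair[OF h f] estm])
  then have "(\<lambda>z. est (h z) (f z)) \<in> borel_measurable N" by simp
  from measurable_gamma_star[OF f[unfolded P0_def] this h[unfolded P_def]] show ?thesis unfolding G_def .
 qed
 have sE: "sigma_finite_measure E"
 proof -
  interpret e: prob_space E unfolding E_def by (rule prob_space_exponential_density) simp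
  show ?thesis by standard
 qed
 have AE_null: "AE w in D 1. w \<notin> N" if "N \<in> null_sets (PiM {1..n} (\<lambda>_. lborel))" for N
  unfolding D1 E_def by (rule AE_PiM_density[OF _ _ _ that]) (use sE[unfolded E_def] in auto)
 have pos: "AE w in D 1. \<forall>t\<in>{1..n}. w t > 0"
 proof -
  have "{w \<in> space P. \<forall>t\<in>{1..n}. w t > 0} \<in> sets P" unfolding P_def by measurable
  moreover have "AE x in M. \<forall>t\<in>{1..n}. v 1 x t > 0"
   using AE_weight_pos[OF W] by eventually_elim (use b12 in \<open>auto simp: v_def weight_vec_def\<close>)
  ultimately show ?thesis unfolding D_def by (subst AE_distr_iff[OF v(1)]) auto
 qed
 \<comment> \<open>This condition on the data is not known to be measurable. It enters only through
   \<open>slice\<close>: it makes the section of the tie event \<open>Q\<close> null, and the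
   measure of that section is measurable in the data.\<close>
 define good where "good Y \<longleftrightarrow> (\<forall>\<gamma>. {w \<in> space P. (\<forall>t\<in>{1..n}. w t > 0) \<and> G Y w = \<gamma>} \<in> null_sets (PiM {1..n} (\<lambda>_. lborel)))" for Y
 define Q where "Q = {z \<in> space (P0 \<Otimes>\<^sub>M (P \<Otimes>\<^sub>M P)). G (fst z) (fst (snd z)) = G (fst z) (snd (snd z))}"
 have ms: "fst \<in> measurable (P0 \<Otimes>\<^sub>M (P \<Otimes>\<^sub>M P)) P0" "(\<lambda>z. fst (snd z)) \<in> measurable (P0 \<Otimes>\<^sub>M (P \<Otimes>\<^sub>M P)) P"
  "(\<lambda>z. snd (snd z)) \<in> measurable (P0 \<Otimes>\<^sub>M (P \<Otimes>\<^sub>M P)) P" by measurable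
 note [measurable] = Gm[OF ms(1,2)] Gm[OF ms(1,3)]
 have Q: "Q \<in> sets (P0 \<Otimes>\<^sub>M (P \<Otimes>\<^sub>M P))" unfolding Q_def by measurable
 have slice: "emeasure D2 (Pair Y -` Q) = 0" if Y: "Y \<in> space P0" "good Y" for Y
 proof -
  have Qs: "Pair Y -` Q \<in> sets D2" unfolding setsD2 by (rule sets_Pair1[OF Q])
  have "AE p in D 2 \<Otimes>\<^sub>M D 1. p \<notin> Pair Y -` Q"
  proof (rule DD.AE_pair_measure)
   have "space (D 2 \<Otimes>\<^sub>M D 1) - Pair Y -` Q \<in> sets (D 2 \<Otimes>\<^sub>M D 1)" using Qs unfolding D2_def by blast
   then show "{p \<in> space (D 2 \<Otimes>\<^sub>M D 1). p \<notin> Pair Y -` Q} \<in> sets (D 2 \<Otimes>\<^sub>M D 1)" by (simp add: set_diff_eq)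
   show "AE w2 in D 2. AE w1 in D 1. (w2, w1) \<notin> Pair Y -` Q"
   proof (rule AE_I2)
    fix w2
    have "{w \<in> space P. (\<forall>t\<in>{1..n}. w t > 0) \<and> G Y w = G Y w2} \<in> null_sets (PiM {1..n} (\<lambda>_. lborel))"
     using Y(2) by (simp add: good_def)
    from AE_null[OF this] pos AE_space show "AE w1 in D 1. (w2, w1) \<notin> Pair Y -` Q"
    proof eventually_elim
     case (elim w1)
     then have "w1 \<in> space P" by (simp add: D_def)
     then show ?case using elim by (auto simp: Q_def)
    qed
   qed
  qed
  then show ?thesis using Qs AE_iff_null_sets[of "Pair Y -` Q" D2] unfolding D2_def by auto
 qed
 interpret PD2: prob_space D2 by (rule pD2)
 define DY where "DY = distr M P0 (sample y n)"
 have Ym: "sample y n \<in> measurable M P0" unfolding P0_def by (rule sample_measurable)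
 interpret DY: prob_space DY unfolding DY_def by (rule prob_space_distr[OF Ym])
 interpret YD: pair_prob_space DY D2 by standard
 have setsYD: "sets (DY \<Otimes>\<^sub>M D2) = sets (P0 \<Otimes>\<^sub>M (P \<Otimes>\<^sub>M P))" by (intro sets_pair_measure_cong setsD2) (simp add: DY_def)
 have spYD: "space (DY \<Otimes>\<^sub>M D2) = space (P0 \<Otimes>\<^sub>M (P \<Otimes>\<^sub>M P))" by (rule sets_eq_imp_space_eq[OF setsYD])
 have hm: "(\<lambda>Y. emeasure D2 (Pair Y -` Q)) \<in> borel_measurable DY"
  by (rule PD2.measurable_emeasure_Pair) (use Q in \<open>simp add: setsYD\<close>)
 have aeYD: "AE z in DY \<Otimes>\<^sub>M D2. emeasure D2 (Pair (fst z) -` Q) = 0 --> z \<notin> Q"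
 proof (rule YD.AE_pair_measure)
  have "(\<lambda>z. emeasure D2 (Pair (fst z) -` Q)) \<in> borel_measurable (DY \<Otimes>\<^sub>M D2)" by (rule measurable_compose[OF measurable_fst hm])
  then have "{z \<in> space (DY \<Otimes>\<^sub>M D2). emeasure D2 (Pair (fst z) -` Q) = 0} \<in> sets (DY \<Otimes>\<^sub>M D2)" by measurable
  then have "space (DY \<Otimes>\<^sub>M D2) - ({z \<in> space (DY \<Otimes>\<^sub>M D2). emeasure D2 (Pair (fst z) -` Q) = 0} \<inter> Q) \<in> sets (DY \<Otimes>\<^sub>M D2)"
   using Q[folded setsYD] by (intro sets.Diff sets.top sets.Int)
  moreover have "{z \<in> space (DY \<Otimes>\<^sub>M D2). emeasure D2 (Pair (fst z) -` Q) = 0 --> z \<notin> Q}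
    = space (DY \<Otimes>\<^sub>M D2) - ({z \<in> space (DY \<Otimes>\<^sub>M D2). emeasure D2 (Pair (fst z) -` Q) = 0} \<inter> Q)" by blast
  ultimately show "{z \<in> space (DY \<Otimes>\<^sub>M D2). emeasure D2 (Pair (fst z) -` Q) = 0 --> z \<notin> Q} \<in> sets (DY \<Otimes>\<^sub>M D2)" by simp
  show "AE Y in DY. AE p in D2. emeasure D2 (Pair (fst (Y, p)) -` Q) = 0 --> (Y, p) \<notin> Q"
  proof (rule AE_I2)
   fix Y
   show "AE p in D2. emeasure D2 (Pair (fst (Y, p)) -` Q) = 0 --> (Y, p) \<notin> Q"
   proof (cases "emeasure D2 (Pair Y -` Q) = 0")
    case True
    have "Pair Y -` Q \<in> sets D2" unfolding setsD2 by (rule sets_Pair1[OF Q])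
    then have "AE p in D2. p \<notin> Pair Y -` Q" using True by (intro AE_not_in null_setsI)
    then show ?thesis by eventually_elim simp
   qed simp
  qed
 qed
 have lawYD: "DY \<Otimes>\<^sub>M D2 = distr M (P0 \<Otimes>\<^sub>M (P \<Otimes>\<^sub>M P)) (\<lambda>x. (sample y n x, (v 2 x, v 1 x)))"
  unfolding DY_def D2_def D_def v_def P_def P0_def weight_vec_pair(1)[OF W B, symmetric]
  by (rule distr_indep_rv[OF weight_vec_pair(2)[OF W B], symmetric])
 have "AE z in distr M (P0 \<Otimes>\<^sub>M (P \<Otimes>\<^sub>M P)) (\<lambda>x. (sample y n x, (v 2 x, v 1 x))). emeasure D2 (Pair (fst z) -` Q) = 0 --> z \<notin> Q"
  using aeYD unfolding lawYD .
 from AE_distrD[OF measurable_Pair[OF Ym measurable_Pair[OF v(2) v(1)]] this] AE_space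
 show ?thesis
 proof eventually_elim
  case (elim x)
  have Y: "sample y n x \<in> space P0" using elim(2) unfolding P0_def by (rule sample_space)
  have "boot_gamma est n (sample y n x) (weight_vec W n x) 1 \<noteq> boot_gamma est n (sample y n x) (weight_vec W n x) 2" if "good (sample y n x)"
  proof -
   have "(sample y n x, (v 2 x, v 1 x)) \<notin> Q" using elim(1) slice[OF Y that] by simp
   moreover have "(sample y n x, (v 2 x, v 1 x)) \<in> space (P0 \<Otimes>\<^sub>M (P \<Otimes>\<^sub>M P))"
    using Y weight_vec_space by (auto simp: space_pair_measure v_def P_def)
   ultimately have "G (sample y n x) (v 2 x) \<noteq> G (sample y n x) (v 1 x)" by (simp add: Q_def)
   then show ?thesis unfolding boot_gamma_def G_def v_def by metis
  qed
  then show ?case unfolding good_def P_def G_def by blast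
 qed
qed

end

section \<open>Compact parameter sets and measurability of the statistic\<close>

lemma compact_in_param_box:
 assumes sub: "\<Theta> \<subseteq> UNIV \<times> {0<..} \<times> {0<..}" and cpt: "compact \<Theta>" and ne: "\<Theta> \<noteq> {}"
 obtains c C where "0 < c" "c <= C" "\<Theta> \<subseteq> param_box c C"
proof -
 have cont: "continuous_on \<Theta> (\<lambda>\<theta> :: real \<times> real \<times> real. fst (snd \<theta>))" "continuous_on \<Theta> (\<lambda>\<theta> :: real \<times> real \<times> real. snd (snd \<theta>))"
  by (intro continuous_intros)+
 obtain p where p: "p \<in> \<Theta>" "\<forall>\<theta>\<in>\<Theta>. fst (snd p) <= fst (snd \<theta>)" using continuous_attains_inf[OF cpt ne cont(1)] by blast
 obtain q where q: "q \<in> \<Theta>" "\<forall>\<theta>\<in>\<Theta>. snd (snd q) <= snd (snd \<theta>)" using continuous_attains_inf[OF cpt ne cont(2)] by blast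
 obtain C where C: "\<forall>\<theta>\<in>\<Theta>. norm \<theta> <= C" using compact_imp_bounded[OF cpt] unfolding bounded_iff by blast
 define c where "c = min (fst (snd p)) (snd (snd q))"
 have comp: "\<bar>fst \<theta>\<bar> <= C \<and> fst (snd \<theta>) <= C \<and> snd (snd \<theta>) <= C" if "\<theta> \<in> \<Theta>" for \<theta>
 proof -
  obtain a b d where \<theta>: "\<theta> = (a, b, d)" by (cases \<theta>) auto
  have "norm a <= norm \<theta>" "norm (b, d) <= norm \<theta>" "norm b <= norm (b, d)" "norm d <= norm (b, d)"
   unfolding \<theta> by (rule norm_fst_le norm_snd_le)+
  then show ?thesis using C that by (auto simp: \<theta>)
 qed
 have "c <= C" unfolding c_def using comp[OF p(1)] by (intro min.coboundedI1) blast
 moreover have "0 < c" using p(1) q(1) sub by (auto simp: c_def)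
 moreover have "\<Theta> \<subseteq> param_box c C" using comp p(2) q(2) by (fastforce simp: param_box_def c_def)
 ultimately show ?thesis by (intro that[of c C])
qed

lemma configuration_level_null:
 fixes c C E0 E1 R6 :: real
 assumes "0 < c" "c <= C" "2 <= E0" "C + 1 <= sqrt c * E0" "E0 <= E1"
 obtains R where "R > 0"
  "\<And>\<Theta> n est Y t \<gamma>. \<Theta> \<subseteq> param_box c C ==> n >= 1 ==> sqrt C * E1 + C <= (real n)\<^sup>2 ==> bootstrap_estimator \<Theta> n est ==>
   Y \<in> space (PiM {0..n} (\<lambda>_. borel)) ==> configuration c C E0 E1 R6 R n Y t ==>
   {w \<in> space (PiM {1..n} (\<lambda>_. borel)). (\<forall>t\<in>{1..n}. w t > 0) \<and> gamma_star n w Y (est w Y) = \<gamma>} \<in> null_sets (PiM {1..n} (\<lambda>_. lborel))"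
proof (rule gamma_star_level_null[OF assms, of R6], goal_cases)
 case (1 R)
 show ?case
 proof (rule 1(1)[OF 1(2)])
  fix \<Theta> n est Y t \<gamma>
  assume A: "\<Theta> \<subseteq> param_box c C" "n >= 1" "sqrt C * E1 + C <= (real n)\<^sup>2" "bootstrap_estimator \<Theta> n est"
   "Y \<in> space (PiM {0..n} (\<lambda>_. borel))" and conf: "configuration c C E0 E1 R6 R n Y t"
  show "{w \<in> space (PiM {1..n} (\<lambda>_. borel)). (\<forall>t\<in>{1..n}. w t > 0) \<and> gamma_star n w Y (est w Y) = \<gamma>} \<in> null_sets (PiM {1..n} (\<lambda>_. lborel))"
  proof (rule 1(3)[where \<Theta> = \<Theta> and t = t])
   fix \<phi> \<alpha> \<omega> assume "(\<phi>, \<alpha>, \<omega>) \<in> \<Theta>"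
   then have "(\<phi>, \<alpha>, \<omega>) \<in> param_box c C" using A(1) by blast
   then show "\<bar>\<phi>\<bar> <= C \<and> c <= \<alpha> \<and> \<alpha> <= C \<and> c <= \<omega> \<and> \<omega> <= C" by (simp add: param_box_def)
  next
   fix i :: nat assume "i \<in> {1..6}" then show "t i \<in> {1..n}" using conf unfolding configuration_def by blast
  next
   fix i :: nat assume "i \<in> {1..5}" then show "R <= Y (t i - 1)" using conf unfolding configuration_def by blast
  next
   show "\<bar>Y (t 6 - 1)\<bar> <= R6" using conf unfolding configuration_def by blast
  next
   fix \<theta> assume "\<theta> \<in> \<Theta>"
   then have "\<theta> \<in> param_box c C" using A(1) by blast
   then show "E0 <= resid \<theta> Y (t 1) \<and> resid \<theta> Y (t 1) + 1 <= resid \<theta> Y (t 2) \<and>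
     resid \<theta> Y (t 2) + 1 <= resid \<theta> Y (t 3) \<and> resid \<theta> Y (t 3) + 1 <= resid \<theta> Y (t 4) \<and> resid \<theta> Y (t 4) <= E1 \<and>
     - E1 <= resid \<theta> Y (t 5) \<and> resid \<theta> Y (t 5) <= - E0 \<and> E0 <= resid \<theta> Y (t 6) \<and> resid \<theta> Y (t 6) <= E1"
    using conf unfolding configuration_def by blast
  qed (use A in blast)+
 qed
qed

lemma gamma_hat_measurable:
 assumes f: "f \<in> measurable N (PiM {0..n} (\<lambda>_. borel))" and g: "g \<in> borel_measurable N"
 shows "(\<lambda>x. gamma_hat n (f x) (g x)) \<in> borel_measurable N"
proof -
 have "(\<lambda>x. if root_arg k (f x) t (g x) \<in> trunc n then ln \<bar>root_arg k (f x) t (g x)\<bar> else 0) \<in> borel_measurable N" if "t \<in> {1..n}" for k t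
 proof -
  note [measurable] = measurable_root_arg[OF f g that]
  show ?thesis by measurable
 qed
 then show ?thesis unfolding gamma_hat_eq sum_kept
  by (intro borel_measurable_divide borel_measurable_add borel_measurable_sum borel_measurable_const)
qed

lemma sigma2_hat_measurable:
 assumes "\<And>b. b \<in> {1..B} ==> (\<lambda>x. g x b) \<in> borel_measurable N"
 shows "(\<lambda>x. sigma2_hat n B (g x)) \<in> borel_measurable N"
 unfolding sigma2_hat_def Let_def using assms
 by (intro borel_measurable_times borel_measurable_const borel_measurable_sum borel_measurable_power borel_measurable_diff borel_measurable_divide) auto

lemma T_stat_eq: "T_stat est est_star n B Y w = sqrt (real n) * gamma_hat n Y (est Y) / sqrt (sigma2_hat n B (boot_gamma est_star n Y w))"
 by (simp add: T_stat_def boot_gamma_def[abs_def])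

context dar_model
begin

lemma T_stat_measurable:
 assumes "bootstrap_weights M n B y W" "qml_estimator \<Theta> n est" "bootstrap_estimator \<Theta> n est_star"
 shows "(\<lambda>x. T_stat est est_star n B (sample y n x) (weight_vec W n x)) \<in> borel_measurable M"
proof -
 have "(\<lambda>x. est (sample y n x)) \<in> borel_measurable M"
  using assms(2) by (intro measurable_compose[OF sample_measurable]) (simp add: qml_estimator_def)
 note [measurable] = gamma_hat_measurable[OF sample_measurable this]
  sigma2_hat_measurable[OF boot_gamma_measurable[OF assms(1,3)]]
 show ?thesis unfolding T_stat_eq by measurable
qed

lemma replicates_differ:
 fixes \<tau> :: real
 assumes c: "0 < c" "c <= C" and \<Theta>: "\<Theta> \<subseteq> param_box c C" "\<theta>\<^sub>0 \<in> \<Theta>"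
  and est: "\<And>n. bootstrap_estimator \<Theta> n (est n)" and \<tau>: "\<tau> > 0"
 obtains n0 where "\<And>n B W. n >= n0 ==> B >= 2 ==> bootstrap_weights M n B y W ==>
  \<exists>N\<in>events. prob N <= \<tau> \<and> (\<forall>x\<in>space M - N.
   boot_gamma (est n) n (sample y n x) (weight_vec W n x) 1 \<noteq> boot_gamma (est n) n (sample y n x) (weight_vec W n x) 2)"
proof -
 have \<theta>0: "\<theta>\<^sub>0 \<in> param_box c C" using \<Theta> by blast
 obtain E0 E1 :: real where E: "2 <= E0" "C + 1 <= sqrt c * E0" "E0 <= E1"
  and conf: "\<And>\<tau>. \<tau> > 0 ==> \<exists>R6. \<forall>R>0. \<exists>n0. \<forall>n\<ge>n0. \<exists>N\<in>events. prob N <= \<tau> \<and>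
    (\<forall>x\<in>space M - N. \<exists>t. configuration c C E0 E1 R6 R n (sample y n x) t)"
  by (rule good_configuration[OF c \<theta>0], rule that)
 from conf[OF \<tau>] obtain R6 where R6: "\<forall>R>0. \<exists>n0. \<forall>n\<ge>n0. \<exists>N\<in>events. prob N <= \<tau> \<and>
    (\<forall>x\<in>space M - N. \<exists>t. configuration c C E0 E1 R6 R n (sample y n x) t)" ..
 obtain R where R: "R > 0" and null: "\<And>\<Theta> n est Y t \<gamma>. \<Theta> \<subseteq> param_box c C ==> n >= 1 ==> sqrt C * E1 + C <= (real n)\<^sup>2 ==> bootstrap_estimator \<Theta> n est ==>
   Y \<in> space (PiM {0..n} (\<lambda>_. borel)) ==> configuration c C E0 E1 R6 R n Y t ==>
   {w \<in> space (PiM {1..n} (\<lambda>_. borel)). (\<forall>t\<in>{1..n}. w t > 0) \<and> gamma_star n w Y (est w Y) = \<gamma>} \<in> null_sets (PiM {1..n} (\<lambda>_. lborel))"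
  by (rule configuration_level_null[OF c E, of R6], rule that)
 from R6[rule_format, OF R] obtain n1 where n1: "\<forall>n\<ge>n1. \<exists>N\<in>events. prob N <= \<tau> \<and>
    (\<forall>x\<in>space M - N. \<exists>t. configuration c C E0 E1 R6 R n (sample y n x) t)" ..
 obtain n2 :: nat where n2: "sqrt C * E1 + C <= n2" using real_arch_simple by blast
 show ?thesis
 proof (rule that[of "max 1 (max n1 n2)"])
  fix n B :: nat and W assume n: "n >= max 1 (max n1 n2)" and B: "B >= 2" and W: "bootstrap_weights M n B y W"
  then have n': "n >= 1" "n >= n1" "n >= n2" by auto
  have "1 * real n <= real n * real n" using n'(1) by (intro mult_right_mono) auto
  then have big: "sqrt C * E1 + C <= (real n)\<^sup>2" using n2 n'(3) unfolding power2_eq_square by linarith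
  obtain N1 where N1: "N1 \<in> events" "prob N1 <= \<tau>" "\<forall>x\<in>space M - N1. \<exists>t. configuration c C E0 E1 R6 R n (sample y n x) t"
   using n1 n'(2) by blast
  define differ where "differ x \<longleftrightarrow> boot_gamma (est n) n (sample y n x) (weight_vec W n x) 1 \<noteq> boot_gamma (est n) n (sample y n x) (weight_vec W n x) 2" for x
  define P where "P x \<longleftrightarrow> (\<forall>\<gamma>. {w \<in> space (PiM {1..n} (\<lambda>_. borel)). (\<forall>t\<in>{1..n}. w t > 0) \<and> gamma_star n w (sample y n x) (est n w (sample y n x)) = \<gamma>}
    \<in> null_sets (PiM {1..n} (\<lambda>_. lborel)))" for x
  have "AE x in M. P x --> differ x" unfolding P_def differ_def by (rule replicates_differ_AE[OF W B n'(1) est])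
  from AE_E[OF this] obtain N2 where N2: "{x \<in> space M. \<not> (P x --> differ x)} \<subseteq> N2" "emeasure M N2 = 0" "N2 \<in> events" .
  have "differ x" if x: "x \<in> space M - (N1 \<union> N2)" for x
  proof -
   obtain t where t: "configuration c C E0 E1 R6 R n (sample y n x) t" using N1(3) x by blast
   have "P x" unfolding P_def
    by (intro allI null[OF \<Theta>(1) n'(1) big est _ t] sample_space) (use x in simp)
   then show ?thesis using N2(1) x by blast
  qed
  moreover have "prob (N1 \<union> N2) <= \<tau>" using measure_Un_le[OF N1(1) N2(3)] N1(2) N2(2) by (simp add: measure_def)
  ultimately show "\<exists>N\<in>events. prob N <= \<tau> \<and> (\<forall>x\<in>space M - N.
   boot_gamma (est n) n (sample y n x) (weight_vec W n x) 1 \<noteq> boot_gamma (est n) n (sample y n x) (weight_vec W n x) 2)"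
   using N1(1) N2(3) unfolding differ_def by (intro bexI[of _ "N1 \<union> N2"] conjI ballI sets.Un)
 qed
qed

section \<open>Divergence of the test statistic\<close>

text \<open>The factor \<open>sgn \<gamma>\<close> reflects the statistic, so that one statement
  covers both signs of the exponent.\<close>

lemma T_stat_separation:
 fixes K :: real
 defines "\<gamma> \<equiv> lyapunov M \<phi>\<^sub>0 \<alpha>\<^sub>0 (\<eta> 1)"
 assumes c: "0 < c" "c <= C" and \<Theta>: "\<Theta> \<subseteq> param_box c C" "\<theta>\<^sub>0 \<in> \<Theta>"
  and est: "\<And>n. qml_estimator \<Theta> n (est n)" and est_star: "\<And>n. bootstrap_estimator \<Theta> n (est_star n)"
  and W: "\<And>n. bootstrap_weights M n (B n) y (W n)" and B: "filterlim B at_top sequentially" and \<gamma>: "\<gamma> \<noteq> 0"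
 shows "(\<lambda>n. prob {x \<in> space M. K < sgn \<gamma> * T_stat (est n) (est_star n) n (B n) (sample y n x) (weight_vec (W n) n x)}) \<longlonglongrightarrow> 1"
proof (rule LIMSEQ_I)
 fix r :: real assume "r > 0"
 \<comment> \<open>Three exceptional events of probability at most \<open>\<tau>\<close> add up to
   at most \<open>r / 2\<close>.\<close>
 define \<tau> where "\<tau> = r / 6"
 have \<tau>: "\<tau> > 0" using \<open>r > 0\<close> by (simp add: \<tau>_def)
 define T where "T n x = T_stat (est n) (est_star n) n (B n) (sample y n x) (weight_vec (W n) n x)" for n x
 \<comment> \<open>If the spread is below \<open>s\<close> and the estimate within half of
   \<open>\<bar>\<gamma>\<bar>\<close>, the reflected statistic exceeds
   \<open>\<bar>K\<bar> + 1\<close>.\<close>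
 define s where "s = \<bar>\<gamma>\<bar> / (2 * (\<bar>K\<bar> + 1))"
 have "\<bar>K\<bar> + 1 > 0" by simp
 have s: "s > 0" using \<gamma> by (simp add: s_def)
 have sK: "s * (\<bar>K\<bar> + 1) = \<bar>\<gamma>\<bar> / 2" using \<open>\<bar>K\<bar> + 1 > 0\<close> by (simp add: s_def field_simps)
 have \<gamma>2: "\<bar>\<gamma>\<bar> / 2 > 0" "s\<^sup>2 > 0" using \<gamma> s by auto
 obtain n1 where n1: "\<And>n. n >= n1 ==> \<exists>N\<in>events. prob N <= real n powr (- (1/2)) \<and>
  (\<forall>x\<in>space M - N. \<bar>gamma_hat n (sample y n x) (est n (sample y n x)) - \<gamma>\<bar> <= \<bar>\<gamma>\<bar> / 2)"
  by (rule gamma_hat_concentration[OF c \<Theta> est \<gamma>2(1), folded \<gamma>_def], rule that)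
 obtain n2 where n2: "\<And>n B W. n >= n2 ==> B >= 2 ==> bootstrap_weights M n B y W ==>
  \<exists>N\<in>events. prob N <= \<tau> \<and> (\<forall>x\<in>space M - N. sigma2_hat n B (boot_gamma (est_star n) n (sample y n x) (weight_vec W n x)) / n < s\<^sup>2)"
  by (rule bootstrap_spread[OF c \<Theta> est_star \<gamma>2(2) \<tau>], rule that)
 obtain n3 where n3: "\<And>n B W. n >= n3 ==> B >= 2 ==> bootstrap_weights M n B y W ==>
  \<exists>N\<in>events. prob N <= \<tau> \<and> (\<forall>x\<in>space M - N.
   boot_gamma (est_star n) n (sample y n x) (weight_vec W n x) 1 \<noteq> boot_gamma (est_star n) n (sample y n x) (weight_vec W n x) 2)"
  by (rule replicates_differ[OF c \<Theta> est_star \<tau>], rule that)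
 have "(\<lambda>n. real n powr (- (1/2))) \<longlonglongrightarrow> 0" by real_asymp
 from order_tendstoD(2)[OF this \<tau>] obtain n4 where n4: "\<forall>n\<ge>n4. real n powr (- (1/2)) < \<tau>"
  unfolding eventually_sequentially ..
 have "eventually (\<lambda>n. B n >= 2) sequentially" using B by (simp add: filterlim_at_top)
 then obtain n5 where n5: "\<forall>n\<ge>n5. B n >= 2" unfolding eventually_sequentially ..
 show "\<exists>n0. \<forall>n\<ge>n0. norm (prob {x \<in> space M. K < sgn \<gamma> * T_stat (est n) (est_star n) n (B n) (sample y n x) (weight_vec (W n) n x)} - 1) < r"
 proof (intro exI[of _ "n1 + n2 + n3 + n4 + n5 + 1"] allI impI)
  fix n assume "n >= n1 + n2 + n3 + n4 + n5 + 1"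
  then have n: "n >= n1" "n >= n2" "n >= n3" "n >= n4" "n >= n5" "n >= 1" by linarith+
  have Bn: "B n >= 2" using n5 n(5) by blast
  define g where "g x = boot_gamma (est_star n) n (sample y n x) (weight_vec (W n) n x)" for x
  define h where "h x = gamma_hat n (sample y n x) (est n (sample y n x))" for x
  obtain N1 where N1: "N1 \<in> events" "prob N1 <= real n powr (- (1/2))" "\<forall>x\<in>space M - N1. \<bar>h x - \<gamma>\<bar> <= \<bar>\<gamma>\<bar> / 2"
   using n1[OF n(1), folded h_def] by (elim bexE conjE) (rule that)
  obtain N2 where N2: "N2 \<in> events" "prob N2 <= \<tau>" "\<forall>x\<in>space M - N2. sigma2_hat n (B n) (g x) / n < s\<^sup>2"
   using n2[OF n(2) Bn W, folded g_def] by (elim bexE conjE) (rule that)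
  obtain N3 where N3: "N3 \<in> events" "prob N3 <= \<tau>" "\<forall>x\<in>space M - N3. g x 1 \<noteq> g x 2"
   using n3[OF n(3) Bn W, folded g_def] by (elim bexE conjE) (rule that)
  define N where "N = N1 \<union> (N2 \<union> N3)"
  have N: "N \<in> events" unfolding N_def using N1(1) N2(1) N3(1) by (intro sets.Un)
  have "prob (N2 \<union> N3) <= \<tau> + \<tau>" using measure_Un_le[OF N2(1) N3(1)] N2(2) N3(2) by linarith
  moreover have "prob N1 <= \<tau>" using N1(2) n4 n(4) by (meson less_imp_le order.trans)
  moreover have "prob N <= prob N1 + prob (N2 \<union> N3)" unfolding N_def by (rule measure_Un_le[OF N1(1) sets.Un[OF N2(1) N3(1)]])
  ultimately have pN: "prob N < r" using \<open>r > 0\<close> unfolding \<tau>_def by linarith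
  define A where "A = {x \<in> space M. K < sgn \<gamma> * T n x}"
  have [measurable]: "T n \<in> borel_measurable M" unfolding T_def[abs_def] by (rule T_stat_measurable[OF W est est_star])
  have A: "A \<in> events" unfolding A_def by measurable
  have "space M - N \<subseteq> A"
  proof
   fix x assume x: "x \<in> space M - N"
   then have h: "\<bar>h x - \<gamma>\<bar> <= \<bar>\<gamma>\<bar> / 2" using N1(3) by (simp add: N_def)
   define v where "v = sigma2_hat n (B n) (g x) / n"
   have "v < s\<^sup>2" using N2(3) x by (simp add: N_def v_def)
   have "g x 1 \<noteq> g x 2" using N3(3) x by (simp add: N_def)
   then have "sigma2_hat n (B n) (g x) \<noteq> 0" using sigma2_hat_zero[OF n(6) Bn, of "g x"] by blast
   moreover have "sigma2_hat n (B n) (g x) >= 0" using Bn by (intro sigma2_hat_nonneg) simp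
   ultimately have v: "v > 0" using n(6) by (simp add: v_def)
   have sv: "sqrt v < s" using \<open>v < s\<^sup>2\<close> s by (intro real_less_lsqrt) (use v in auto)
   have "T n x = sqrt n * h x / sqrt (n * v)"
    unfolding T_def T_stat_eq g_def[symmetric] h_def v_def using n(6) by simp
   also have "\<dots> = h x / sqrt v" using n(6) by (simp add: real_sqrt_mult)
   finally have T: "T n x = h x / sqrt v" .
   have "\<gamma> - \<bar>\<gamma>\<bar> / 2 <= h x" "h x <= \<gamma> + \<bar>\<gamma>\<bar> / 2" using h by linarith+
   then have "sgn \<gamma> * h x >= \<bar>\<gamma>\<bar> / 2" using \<gamma> by (cases "\<gamma> > 0") (auto simp: sgn_if)
   moreover have "sqrt v * (\<bar>K\<bar> + 1) < s * (\<bar>K\<bar> + 1)" using sv by (intro mult_strict_right_mono) auto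
   ultimately have "sqrt v * (\<bar>K\<bar> + 1) < sgn \<gamma> * h x" unfolding sK by linarith
   then have "\<bar>K\<bar> + 1 < sgn \<gamma> * h x / sqrt v" using v by (simp add: less_divide_eq mult.commute)
   then show "x \<in> A" using x by (simp add: A_def T)
  qed
  then have "prob (space M - N) <= prob A" using A by (rule finite_measure_mono)
  then have "1 - prob N <= prob A" using prob_compl[OF N] by simp
  then have "norm (prob A - 1) < r" using pN prob_le_1[of A] unfolding real_norm_def by linarith
  then show "norm (prob {x \<in> space M. K < sgn \<gamma> * T_stat (est n) (est_star n) n (B n) (sample y n x) (weight_vec (W n) n x)} - 1) < r"
   by (simp only: A_def T_def)
 qed
qed

end

text \<open>The event \<open>E n\<close> lies in the complement of \<open>F n\<close>, so its
  probability tends to 0, below every positive level.\<close>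

lemma (in prob_space) limsup_prob_le:
 fixes a :: real
 assumes E: "\<And>n. E n \<in> events" and F: "\<And>n. F n \<in> events" and disj: "\<And>n. E n \<inter> F n = {}"
  and lim: "(\<lambda>n. prob (F n)) \<longlonglongrightarrow> 1" and a: "0 < a"
 shows "limsup (\<lambda>n. ereal (prob (E n))) <= ereal a"
proof -
 have le: "prob (E n) <= 1 - prob (F n)" for n
  using finite_measure_Union[OF E F disj, of n] prob_le_1[of "E n \<union> F n"] by linarith
 have lim0: "(\<lambda>n. 1 - prob (F n)) \<longlonglongrightarrow> 0" using tendsto_diff[OF tendsto_const lim, of 1] by simp
 have "(\<lambda>n. prob (E n)) \<longlonglongrightarrow> 0"
  by (rule tendsto_sandwich[OF always_eventually always_eventually tendsto_const lim0]) (simp_all add: le)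
 then have "(\<lambda>n. ereal (prob (E n))) \<longlonglongrightarrow> ereal 0" by (rule tendsto_ereal)
 then have "limsup (\<lambda>n. ereal (prob (E n))) = ereal 0" by (intro lim_imp_Limsup) simp_all
 then show ?thesis using a by simp
qed

theorem theorem3p3:
  fixes M :: "'a measure"
    and \<eta> y :: "nat \<Rightarrow> 'a \<Rightarrow> real"
    and f :: "real \<Rightarrow> real"
    and \<phi>\<^sub>0 \<alpha>\<^sub>0 \<omega>\<^sub>0 a :: real
    and \<Theta> :: "(real \<times> real \<times> real) set"
    and B :: "nat \<Rightarrow> nat"
    and W :: "nat \<Rightarrow> nat \<Rightarrow> nat \<Rightarrow> 'a \<Rightarrow> real"
    and est :: "nat \<Rightarrow> (nat \<Rightarrow> real) \<Rightarrow> real \<times> real \<times> real"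
    and est_star :: "nat \<Rightarrow> (nat \<Rightarrow> real) \<Rightarrow> (nat \<Rightarrow> real) \<Rightarrow> real \<times> real \<times> real"
  defines "\<gamma>\<^sub>0 \<equiv> lyapunov M \<phi>\<^sub>0 \<alpha>\<^sub>0 (\<eta> 1)"
    and "T \<equiv> \<lambda>n x. T_stat (est n) (est_star n) n (B n) (sample y n x) (weight_vec (W n) n x)"
  assumes prob: "prob_space M"
    and pos: "\<omega>\<^sub>0 > 0" "\<alpha>\<^sub>0 > 0"
    \<comment> \<open>the data\<close>
    and iid: "prob_space.indep_vars M (\<lambda>_. borel) \<eta> {1..}"
      "\<And>t. t \<ge> 1 \<Longrightarrow> distributed M lborel (\<eta> t) (\<lambda>u. ennreal (f u))"
    and model: "dar1_process M (\<phi>\<^sub>0, \<alpha>\<^sub>0, \<omega>\<^sub>0) \<eta> y"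
    and stat: "\<gamma>\<^sub>0 < 0 \<Longrightarrow> strictly_stationary M y \<and> ergodic M y"
    \<comment> \<open>(1)\<close>
    and moment1: "(LINT x|M. \<bar>\<eta> 1 x\<bar>) = 1"
    and moment2: "integrable M (\<lambda>x. (\<eta> 1 x)\<^sup>2)"
    \<comment> \<open>(2)\<close>
    and f_nonneg: "\<And>u. f u \<ge> 0"
    and f_sym: "\<And>u. f (- u) = f u"
    and f_bdd: "bounded (range f)"
    and f_cont: "continuous_on UNIV f"
    and f_zero: "f 0 > 0"
    \<comment> \<open>(3)\<close>
    and Theta: "\<Theta> \<subseteq> UNIV \<times> {0<..} \<times> {0<..}" "compact \<Theta>" "(\<phi>\<^sub>0, \<alpha>\<^sub>0, \<omega>\<^sub>0) \<in> interior \<Theta>"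
    \<comment> \<open>(4)\<close>
    and f_pos_diff: "AE u in lborel. f u > 0 \<and> f differentiable (at u)"
    and f_sup: "bdd_above (range f)"
    and f_int: "integrable lborel (\<lambda>u. ln \<bar>\<phi>\<^sub>0 + u * sqrt \<alpha>\<^sub>0\<bar> * (f u + \<bar>u * deriv f u\<bar>))"
    \<comment> \<open>estimators and resampling\<close>
    and est: "\<And>n. qml_estimator \<Theta> n (est n)"
    and est_star: "\<And>n. bootstrap_estimator \<Theta> n (est_star n)"
    and weights: "\<And>n. bootstrap_weights M n (B n) y (W n)"
    and B_top: "filterlim B at_top sequentially"
    and B_O: "(\<lambda>n. real (B n)) \<in> O(\<lambda>n. real n)"
    and level: "0 < a" "a < 1"
  shows
    \<comment> \<open>the tests of (i) and of (ii)\<close>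
    "((\<gamma>\<^sub>0 < 0 \<longrightarrow>
        limsup (\<lambda>n. ereal (measure M {x \<in> space M. T n x > std_normal_quantile (1 - a)})) \<le> ereal a) \<and>
      (\<gamma>\<^sub>0 > 0 \<longrightarrow>
        (\<lambda>n. measure M {x \<in> space M. T n x > std_normal_quantile (1 - a)}) \<longlonglongrightarrow> 1)) \<and>
     ((\<gamma>\<^sub>0 > 0 \<longrightarrow>
        limsup (\<lambda>n. ereal (measure M {x \<in> space M. T n x < std_normal_quantile a})) \<le> ereal a) \<and>
      (\<gamma>\<^sub>0 < 0 \<longrightarrow>
        (\<lambda>n. measure M {x \<in> space M. T n x < std_normal_quantile a}) \<longlonglongrightarrow> 1))"
proof -
 have \<theta>0: "(\<phi>\<^sub>0, \<alpha>\<^sub>0, \<omega>\<^sub>0) \<in> \<Theta>" using Theta(3) interior_subset by blast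
 interpret dar_model M \<eta> y f \<phi>\<^sub>0 \<alpha>\<^sub>0 \<omega>\<^sub>0
 proof (intro dar_model.intro dar_model_axioms.intro)
  show "AE u in lborel. f u > 0" using f_pos_diff by eventually_elim simp
 qed (fact prob pos iid(2) model moment1 moment2 f_nonneg f_sym f_bdd)+
 obtain c C where c: "0 < c" "c <= C" and box: "\<Theta> \<subseteq> param_box c C"
  by (rule compact_in_param_box[OF Theta(1,2)]) (use \<theta>0 in blast)+
 have T_meas [measurable]: "T n \<in> borel_measurable M" for n
  unfolding T_def by (rule T_stat_measurable[OF weights est est_star])
 \<comment> \<open>Valid for every real threshold, in particular for both normal quantiles and their
   negatives.\<close>
 have sep: "(\<lambda>n. measure M {x \<in> space M. K < sgn \<gamma>\<^sub>0 * T n x}) \<longlonglongrightarrow> 1" if "\<gamma>\<^sub>0 \<noteq> 0" for K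
  using T_stat_separation[OF c box \<theta>0 est est_star weights B_top that[unfolded \<gamma>\<^sub>0_def], of K]
  unfolding \<gamma>\<^sub>0_def T_def .
 have up: "(\<lambda>n. measure M {x \<in> space M. T n x > q}) \<longlonglongrightarrow> 1" if "\<gamma>\<^sub>0 > 0" for q
  using sep[of q] that by simp
 have down: "(\<lambda>n. measure M {x \<in> space M. T n x < q}) \<longlonglongrightarrow> 1" if "\<gamma>\<^sub>0 < 0" for q
  using sep[of "- q"] that by simp
 have ev: "{x \<in> space M. T n x > q} \<in> sets M" "{x \<in> space M. T n x < q} \<in> sets M" for n q by measurable
 have disj: "{x \<in> space M. T n x > q} \<inter> {x \<in> space M. T n x < q} = {}" "{x \<in> space M. T n x < q} \<inter> {x \<in> space M. T n x > q} = {}" for n q by auto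
 \<comment> \<open>The size bound of each test is the divergence in the opposite direction at the
   same quantile, because the two regions are disjoint.\<close>
 show ?thesis
  by (intro conjI impI up down limsup_prob_le[OF ev(1) ev(2) disj(1) down level(1)] limsup_prob_le[OF ev(2) ev(1) disj(2) up level(1)])
qed

end
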